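(* Let $n\ge 2$ and fix exponents $p_0,\dots,p_n\in(1,\infty)$. Suppose that for every standard smooth symbol $m$ on $\mathbb{R}^n$ there is a constant $c_m<\infty$ such that \[ |\Lambda_m(F_0,\dots,F_n)|\le c_m\prod_{j=0}^n\|F_j\|_{L^{p_j}(\mathbb{R}^n)} \] for all Schwartz functions $F_0,\dots,F_n$ on $\mathbb{R}^n$. Then there is a constant $c<\infty$ such that \[ |\Lambda^{(n)}(F_0,\dots,F_n)|\le c\prod_{j=0}^n\|F_j\|_{L^{p_j}(\mathbb{R}^n)} \] for all Schwartz functions $F_0,\dots,F_n$ on $\mathbb{R}^n$.
   Context: A standard smooth symbol is a bounded function $m\in C^\infty(\mathbb{R}^n\setminus\{0\})$ such that for every multi-index $\beta\in\mathbb{N}_0^n$ there is $c_\beta<\infty$ with $|\partial^\beta m(\xi)|\le c_\beta|\xi|^{-|\beta|}$ for all $\xi\ne0$. For bounded $m$ on $\mathbb{R}^n\setminus\{0\}$, \[ \Lambda_m(F_0,\dots,F_n)=\int_{(\mathbb{R}^n)^n}\widehat{F_0}(-(\tau_1+\cdots+\tau_n))\Big(\prod_{j=1}^n\widehat{F_j}(\tau_j)\Big)m(\tau_{11},\tau_{22},\dots,\tau_{nn})\,d\tau, \] where $\tau=(\tau_1,\dots,\tau_n)\in(\mathbb{R}^n)^n$, $\tau_j=(\tau_{j1},\dots,\tau_{jn})\in\mathbb{R}^n$, and $\widehat{F}(\xi)=\int_{\mathbb{R}^n}F(x)e^{-2\pi i x\cdot\xi}dx$. Also \[ \Lambda^{(n)}(F_0,\dots,F_n)=\int_{\mathbb{R}^{n}}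 \mathrm{p.v.}\!\int_\mathbb{R} \int_{[0,1]^{n-1}} F_0(x)\Big( \prod_{j=1}^{n-1} F_j(x+t\alpha_j e_j) \Big) F_n(x+te_n)\, d\alpha\, \frac{dt}{t}\, dx, \] with $e_1,\dots,e_n$ the standard unit vectors of $\mathbb{R}^n$. *)

theory Defs
  imports "HOL-Analysis.Analysis"
begin

text \<open>Functions on R^n are modelled on the type real^'n, where the finite index type 'n
  stands for the coordinate set {1..n}; the linear order on 'n fixes which coordinate is
  the last one (the coordinate n of the paper).\<close>

definition unit_vec :: "'n::finite \<Rightarrow> real^'n" where
  "unit_vec j = axis j 1"

definition partial :: "'n::finite \<Rightarrow> (real^'n \<Rightarrow> complex) \<Rightarrow> real^'n \<Rightarrow> complex" where
  "partial j f x = vector_derivative (\<lambda>s. f (x + s *\<^sub>R unit_vec j)) (at 0)"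

text \<open>Iterated partial derivative; a list of indices encodes a multi-index, its length
  is the order.\<close>
fun pderivs :: "'n::finite list \<Rightarrow> (real^'n \<Rightarrow> complex) \<Rightarrow> real^'n \<Rightarrow> complex" where
  "pderivs [] f = f"
| "pderivs (j # js) f = partial j (pderivs js f)"

definition schwartz :: "(real^'n::finite \<Rightarrow> complex) \<Rightarrow> bool" where
  "schwartz f \<longleftrightarrow>
     (\<forall>js x. pderivs js f differentiable at x) \<and>
     (\<forall>js (N::nat). \<exists>C. \<forall>x. (1 + norm x) ^ N * norm (pderivs js f x) \<le> C)"

definition standard_symbol :: "(real^'n::finite \<Rightarrow> complex) \<Rightarrow> bool" where
  "standard_symbol m \<longleftrightarrow>
     (\<exists>B. \<forall>\<xi>. \<xi> \<noteq> 0 \<longrightarrow> norm (m \<xi>) \<le> B) \<and>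
     (\<forall>js \<xi>. \<xi> \<noteq> 0 \<longrightarrow> pderivs js m differentiable at \<xi>) \<and>
     (\<forall>js. \<exists>c. \<forall>\<xi>. \<xi> \<noteq> 0 \<longrightarrow> norm (pderivs js m \<xi>) \<le> c / norm \<xi> ^ length js)"

definition fourier :: "(real^'n::finite \<Rightarrow> complex) \<Rightarrow> real^'n \<Rightarrow> complex" where
  "fourier f \<xi> = (LINT x|lborel. f x * exp (- 2 * pi * \<i> * complex_of_real (x \<bullet> \<xi>)))"

definition Lp_norm :: "real \<Rightarrow> (real^'n::finite \<Rightarrow> complex) \<Rightarrow> real" where
  "Lp_norm p f = (LINT x|lborel. norm (f x) powr p) powr (1 / p)"

text \<open>The multiplier form Lambda_m. Here tau :: real^'n^'n, tau $ j = tau_j,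
  tau $ j $ k = tau_jk, and F j plays the role of F_j for j = 1..n.\<close>
definition Lambda_m :: "(real^'n::finite \<Rightarrow> complex) \<Rightarrow> (real^'n \<Rightarrow> complex)
    \<Rightarrow> ('n \<Rightarrow> real^'n \<Rightarrow> complex) \<Rightarrow> complex" where
  "Lambda_m m F0 F = (LINT \<tau>|lborel.
      fourier F0 (- (\<Sum>j\<in>UNIV. \<tau> $ j)) * (\<Prod>j\<in>UNIV. fourier (F j) (\<tau> $ j))
      * m (\<chi> j. \<tau> $ j $ j))"

definition last_idx :: "'n::{finite,linorder}" where
  "last_idx = Max UNIV"

definition Lambda_n :: "(real^('n::{finite,linorder}) \<Rightarrow> complex)
    \<Rightarrow> ('n::{finite,linorder} \<Rightarrow> real^('n::{finite,linorder}) \<Rightarrow> complex) \<Rightarrow> complex" where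
  "Lambda_n F0 F = (LINT x|lborel.
      Lim (at_right 0) (\<lambda>\<epsilon>::real.
        LINT t:{t::real. \<epsilon> < \<bar>t\<bar>}|lborel.
          (LINT \<alpha>:(PiE (UNIV - {last_idx}) (\<lambda>_. {0..1::real}))|PiM (UNIV - {last_idx}) (\<lambda>_. lborel).
             F0 x * (\<Prod>j\<in>UNIV - {last_idx}. F j (x + (t * \<alpha> j) *\<^sub>R unit_vec j))
               * F last_idx (x + t *\<^sub>R unit_vec last_idx))
          / complex_of_real t))"

end

theory Submission
  imports Defs "HOL-Probability.Probability" "HOL-Computational_Algebra.Polynomial"
begin

text \<open>On the Fourier side \<open>\<Lambda>\<^sup>(\<^sup>n\<^sup>)\<close> is \<open>\<Lambda>\<^sub>M\<close> for the multiplier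
  \<open>M(\<xi>) = \<pi>\<i> \<integral> sgn(\<xi>\<^sub>n + \<Sum>\<^sub>j \<alpha>\<^sub>j \<xi>\<^sub>j) d\<alpha>\<close>, which is not a standard symbol, so \<open>M\<close> is built from
  standard ones by operations preserving the boundedness of \<open>\<Lambda>\<^sub>m\<close>: anisotropic dilations (the exponents
  satisfy the scaling identity because \<open>m = 1\<close> is bounded), pointwise limits and averages.
  Where one frequency dominates the others, the average of the sign is constant and agrees with a
  cone multiplier. Where two frequencies \<open>\<xi>\<^sub>i\<close>, \<open>\<xi>\<^sub>j\<close> are comparable, a dyadic decomposition in both
  turns the average over the slope into an average of frequency-localised translates
  \<open>m(\<xi> + a 2\<^sup>k e\<^sub>j)\<close>, which are modulations of \<open>F\<^sub>i\<close> and \<open>F\<^sub>j\<close>; they are summed by randomising signs, and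
  the Littlewood--Paley bounds needed for \<open>F\<^sub>i\<close> and \<open>F\<^sub>j\<close> follow by duality from the boundedness of the
  standard symbols that depend on one variable only. Induction on the number of averages does the rest.\<close>

text \<open>The hypothesis yields one unquantified constant per symbol; nothing bounds it by
  finitely many derivatives. Uniformity over random signs therefore has to come from a single
  symbol, whose sign sequence contains every finite pattern: a dyadic dilation moves the pattern
  into place without changing the constant, and a limit discards the rest. Functions of one
  frequency are likewise limits of a cone symbol, with the other coordinates scaled to 0. Averages
  over [0,1] are sums of dilates of averages over [1/2,1], because slopes near 0 would suppress a
  dominating frequency. For two comparable averaged frequencies the inner average is written through
  an antiderivative; this leaves one average fewer, evaluated at \<xi> + \<alpha> \<xi>_i e_j. That
  shift depends on \<xi>, but substituting a = \<alpha> 2^(-k) \<xi>_i in the band |\<xi>_i| ~ 2^k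
  makes it a 2^k, constant in \<xi>, so that only jump cutoffs in \<xi>_i remain.\<close>

section \<open>Partial derivatives and function classes stable under them\<close>

lemma partial_eq:
  assumes "(h has_derivative D) (at x)"
  shows "partial j h x = D (unit_vec j)"
proof -
  have lin: "bounded_linear D" using assms by (rule has_derivative_bounded_linear)
  have 1: "((%s::real. x + s *\<^sub>R unit_vec j) has_derivative (%s. s *\<^sub>R unit_vec j)) (at 0)"
    by (auto intro!: derivative_eq_intros)
  have "((%s::real. h (x + s *\<^sub>R unit_vec j)) has_derivative (%s. D (s *\<^sub>R unit_vec j))) (at 0)"
    using diff_chain_at[OF 1, of h D] assms by (simp add: o_def)
  then have "((%s::real. h (x + s *\<^sub>R unit_vec j)) has_vector_derivative D (unit_vec j)) (at 0)"
    by (simp add: has_vector_derivative_def linear_simps(5)[OF lin])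
  then show ?thesis unfolding partial_def by (rule vector_derivative_at)
qed

lemma partial_has_vector_derivative:
  assumes "h differentiable (at (x + s *\<^sub>R unit_vec j))"
  shows "((%s. h (x + s *\<^sub>R unit_vec j)) has_vector_derivative partial j h (x + s *\<^sub>R unit_vec j)) (at s)"
proof -
  obtain D where D: "(h has_derivative D) (at (x + s *\<^sub>R unit_vec j))"
    using assms by (auto simp: differentiable_def)
  have lin: "bounded_linear D" using D by (rule has_derivative_bounded_linear)
  have 1: "((%s::real. x + s *\<^sub>R unit_vec j) has_derivative (%s. s *\<^sub>R unit_vec j)) (at s)"
    by (auto intro!: derivative_eq_intros)
  have "((%s::real. h (x + s *\<^sub>R unit_vec j)) has_derivative (%s. D (s *\<^sub>R unit_vec j))) (at s)"
    using diff_chain_at[OF 1, of h D] D by (simp add: o_def)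
  then show ?thesis
    by (simp add: has_vector_derivative_def linear_simps(5)[OF lin] partial_eq[OF D])
qed

lemma partial_cong_open:
  assumes "open U" "x \<in> U" "\<And>y. y \<in> U ==> f y = g y" "g differentiable (at x)"
  shows "partial j f x = partial j g x" and "f differentiable (at x)"
proof -
  obtain D where D: "(g has_derivative D) (at x)" using assms(4) by (auto simp: differentiable_def)
  have D': "(f has_derivative D) (at x)"
    using has_derivative_transform_within_open[OF D assms(1,2)] assms(3) by simp
  show "partial j f x = partial j g x" using partial_eq[OF D] partial_eq[OF D'] by simp
  show "f differentiable (at x)" using D' by (auto simp: differentiable_def)
qed

lemma partial_add:
  assumes "f differentiable (at x)" "g differentiable (at x)"
  shows "partial j (%x. f x + g x) x = partial j f x + partial j g x"
  using assms unfolding differentiable_def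
  by (auto simp: partial_eq partial_eq[OF has_derivative_add])

lemma partial_mult:
  assumes "f differentiable (at x)" "g differentiable (at x)"
  shows "partial j (%x. f x * g x) x = partial j f x * g x + f x * partial j g x"
proof -
  obtain D E where D: "(f has_derivative D) (at x)" and E: "(g has_derivative E) (at x)"
    using assms by (auto simp: differentiable_def)
  show ?thesis using partial_eq[OF D] partial_eq[OF E] partial_eq[OF has_derivative_mult[OF D E]] by simp
qed

lemma partial_const [simp]: "partial j (%x. c) = (%x. 0)"
  by (rule ext) (rule partial_eq, rule has_derivative_const)

text \<open>One definition covers three classes: rapid decay gives the Schwartz functions,
  polynomial growth their multipliers, and boundedness the functions that later serve as Fourier
  multipliers. The condition is imposed on every iterated partial derivative.\<close>

definition smooth_class :: "((real^'n::finite => complex) => bool) => (real^'n => complex) => bool" where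
  "smooth_class P f \<longleftrightarrow> (\<forall>js. (\<forall>x. pderivs js f differentiable at x) \<and> P (pderivs js f))"

definition rapid :: "(real^'n::finite => complex) => bool" where
  "rapid f \<longleftrightarrow> (\<forall>N::nat. \<exists>C. \<forall>x. (1 + norm x) ^ N * norm (f x) \<le> C)"

definition poly_growth :: "(real^'n::finite => complex) => bool" where
  "poly_growth f \<longleftrightarrow> (\<exists>C N. \<forall>x. norm (f x) \<le> C * (1 + norm x) ^ N)"

definition bounded_fn :: "('a => complex) => bool" where
  "bounded_fn f \<longleftrightarrow> (\<exists>C. \<forall>x. norm (f x) \<le> C)"

abbreviation "slow \<equiv> smooth_class poly_growth"
abbreviation "bsmooth \<equiv> smooth_class bounded_fn"

lemma schwartz_iff: "schwartz f \<longleftrightarrow> smooth_class rapid f"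
  unfolding schwartz_def smooth_class_def rapid_def by blast

lemma pderivs_in_closed:
  assumes "f \<in> X" "\<And>g j. g \<in> X ==> partial j g \<in> X"
  shows "pderivs js f \<in> X"
  using assms by (induction js) auto

text \<open>A coinductive principle: any set closed under first partial derivatives will do,
  provided its members satisfy the condition. The smoothness proofs below supply such a set, which
  avoids closed formulas for higher derivatives.\<close>

lemma smooth_classI:
  assumes "f \<in> X" "\<And>g j. g \<in> X ==> partial j g \<in> X"
    and "\<And>g x. g \<in> X ==> g differentiable at x" "\<And>g. g \<in> X ==> P g"
  shows "smooth_class P f"
  using pderivs_in_closed[of f X] assms unfolding smooth_class_def by metis

lemma pderivs_snoc: "pderivs js (partial j f) = pderivs (js @ [j]) f"
  by (induction js) auto

lemma smooth_class_partial: "smooth_class P f ==> smooth_class P (partial j f)"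
  unfolding smooth_class_def pderivs_snoc by blast

lemma smooth_classD:
  assumes "smooth_class P f"
  shows "P f" "f differentiable at x"
  using assms unfolding smooth_class_def by (metis pderivs.simps(1))+

lemma smooth_class_mono: "smooth_class P f ==> (\<And>g. P g ==> Q g) ==> smooth_class Q f"
  unfolding smooth_class_def by blast

text \<open>By the Leibniz rule a derivative of a product is a sum of two products from the same
  classes, so the span of products is the closed set that \<open>smooth_classI\<close> asks
  for.\<close>

inductive_set product_span :: "(real^'n::finite => complex) set => (real^'n => complex) set => (real^'n => complex) set"
  for U V where
  mult: "u \<in> U ==> v \<in> V ==> (%x. u x * v x) \<in> product_span U V"
| add: "f \<in> product_span U V ==> g \<in> product_span U V ==> (%x. f x + g x) \<in> product_span U V"

lemma smooth_class_mult:
  assumes f: "smooth_class P f" and g: "smooth_class Q g"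
    and PQR: "\<And>u v. P u ==> Q v ==> R (%x. u x * v x)"
    and R: "\<And>u v. R u ==> R v ==> R (%x. u x + v x)"
  shows "smooth_class R (%x. f x * g x)"
proof -
  let ?X = "product_span (Collect (smooth_class P)) (Collect (smooth_class Q))"
  have diff: "h differentiable at x" if "h \<in> ?X" for h x
    using that by induction (auto intro: differentiable_mult differentiable_add smooth_classD(2))
  show ?thesis
  proof (rule smooth_classI[where X = ?X])
    show "(%x. f x * g x) \<in> ?X" using f g by (auto intro: product_span.mult)
    show "partial j h \<in> ?X" if "h \<in> ?X" for h j
      using that
    proof induction
      case (mult u v)
      then have "partial j (%x. u x * v x) = (%x. partial j u x * v x + u x * partial j v x)"
        by (intro ext partial_mult) (auto intro: smooth_classD(2))
      then show ?case using mult smooth_class_partial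
        by (auto intro!: product_span.add product_span.mult)
    next
      case (add h1 h2)
      then have "partial j (%x. h1 x + h2 x) = (%x. partial j h1 x + partial j h2 x)"
        by (intro ext partial_add) (auto intro: diff)
      then show ?case using add by (auto intro!: product_span.add)
    qed
    show "h differentiable at x" if "h \<in> ?X" for h x by (rule diff[OF that])
    show "R h" if "h \<in> ?X" for h
      using that by induction (auto intro!: PQR R dest: smooth_classD(1))
  qed
qed

lemma smooth_class_const: "(\<And>c. P (%x. c)) ==> smooth_class P (%x. c)"
  by (rule smooth_classI[where X = "range (%c x. c)"]) auto

lemma smooth_class_add:
  assumes f: "smooth_class P f" and g: "smooth_class P g"
    and R: "\<And>u v. P u ==> P v ==> P (%x. u x + v x)"
  shows "smooth_class P (%x. f x + g x)"
proof (rule smooth_classI[where X = "{%x. u x + v x | u v. smooth_class P u \<and> smooth_class P v}"])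
  fix h j assume "h \<in> {%x. u x + v x | u v. smooth_class P u \<and> smooth_class P v}"
  then obtain u v where h: "h = (%x. u x + v x)" "smooth_class P u" "smooth_class P v" by auto
  then have "partial j h = (%x. partial j u x + partial j v x)"
    by (auto intro!: ext partial_add smooth_classD(2))
  then show "partial j h \<in> {%x. u x + v x | u v. smooth_class P u \<and> smooth_class P v}"
    using h smooth_class_partial by blast
qed (use f g in \<open>auto intro: differentiable_add smooth_classD(2) R smooth_classD(1)\<close>)

text \<open>Each derivative in direction \<open>j\<close> brings out a factor \<open>l j\<close>.
  The free scalar \<open>c\<close> in the hypothesis absorbs these factors, so the closed set
  consists of scalar multiples of functions composed with one fixed map.\<close>

lemma smooth_class_affine:
  fixes f :: "real^'n::finite => complex"
  assumes f: "smooth_class P f"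
    and P: "\<And>h c. P h ==> Q (%x. c * h (a + (\<chi> j. l j * x $ j)))"
  shows "smooth_class Q (%x. f (a + (\<chi> j. l j * x $ j)))"
proof -
  let ?T = "%x::real^'n. a + (\<chi> j. l j * x $ j)"
  have bl: "bounded_linear (%x::real^'n. (\<chi> j. l j * x $ j))"
    by (intro linear_conv_bounded_linear[THEN iffD1] linearI)
       (auto simp: vec_eq_iff algebra_simps)
  have T: "(?T has_derivative (%x. (\<chi> j. l j * x $ j))) (at x)" for x
    using bl by (auto intro!: derivative_eq_intros bounded_linear_imp_has_derivative)
  have d: "((%x. c * h (?T x)) has_derivative (%y. c * D (\<chi> j. l j * y $ j))) (at x)"
    if "(h has_derivative D) (at (?T x))" for h :: "real^'n => complex" and D c x
    using has_derivative_mult_right[OF diff_chain_at[OF T that], of c] by (simp add: o_def)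
  let ?X = "{%x. c * h (?T x) | c h. smooth_class P h}"
  show ?thesis
  proof (rule smooth_classI[where X = ?X])
    show "(%x. f (?T x)) \<in> ?X" using f by (auto intro!: exI[of _ 1])
    fix g assume "g \<in> ?X"
    then obtain c h where g: "g = (%x. c * h (?T x))" "smooth_class P h" by auto
    have hd: "h differentiable at x" for x using g(2) by (rule smooth_classD)
    show "g differentiable at x" for x
    proof -
      obtain D where D: "(h has_derivative D) (at (?T x))" using hd by (auto simp: differentiable_def)
      show ?thesis unfolding g(1) differentiable_def by (rule exI) (rule d[OF D])
    qed
    show "Q g" unfolding g(1) by (rule P[OF smooth_classD(1)[OF g(2)]])
    fix j
    have "partial j g x = (c * l j) * partial j h (?T x)" for x
    proof -
      obtain D where D: "(h has_derivative D) (at (?T x))" using hd by (auto simp: differentiable_def)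
      have "(\<chi> i. l i * unit_vec j $ i) = l j *\<^sub>R unit_vec j"
        by (auto simp: vec_eq_iff unit_vec_def axis_def)
      then show ?thesis unfolding g(1) partial_eq[OF d[OF D]] partial_eq[OF D]
        using linear_simps(5)[OF has_derivative_bounded_linear[OF D]] by (simp add: scaleR_conv_of_real)
    qed
    then have "partial j g = (%x. (c * l j) * partial j h (?T x))" by auto
    then show "partial j g \<in> ?X" using smooth_class_partial[OF g(2)] by blast
  qed
qed

lemma smooth_class_cnj:
  assumes f: "smooth_class P f" and P: "\<And>h. P h ==> P (%x. cnj (h x))"
  shows "smooth_class P (%x. cnj (f x))"
proof (rule smooth_classI[where X = "{%x. cnj (h x) | h. smooth_class P h}"])
  fix g j assume "g \<in> {%x. cnj (h x) | h. smooth_class P h}"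
  then obtain h where g: "g = (%x. cnj (h x))" "smooth_class P h" by auto
  have d: "(g has_derivative (%y. cnj (D y))) (at x)" if "(h has_derivative D) (at x)" for D x
    using that unfolding g by (rule has_derivative_cnj)
  have hd: "h differentiable at x" for x using g(2) by (rule smooth_classD)
  then show "g differentiable at x" for x using d unfolding differentiable_def by blast
  have "partial j g x = cnj (partial j h x)" for x
  proof -
    obtain D where D: "(h has_derivative D) (at x)" using hd by (auto simp: differentiable_def)
    show ?thesis using partial_eq[OF D] partial_eq[OF d[OF D]] by simp
  qed
  then have "partial j g = (%x. cnj (partial j h x))" by auto
  then show "partial j g \<in> {%x. cnj (h x) | h. smooth_class P h}"
    using smooth_class_partial[OF g(2)] by blast
  show "P g" unfolding g(1) by (rule P[OF smooth_classD(1)[OF g(2)]])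
qed (use f in auto)

lemma bounded_fn_add: "bounded_fn f ==> bounded_fn g ==> bounded_fn (%x. f x + g x)"
  unfolding bounded_fn_def by (meson add_mono norm_triangle_le)

lemma bounded_fn_mult: "bounded_fn f ==> bounded_fn g ==> bounded_fn (%x. f x * g x)"
  unfolding bounded_fn_def norm_mult by (meson mult_mono' norm_ge_zero)

lemma rapid_add: "rapid f ==> rapid g ==> rapid (%x. f x + g x)"
  unfolding rapid_def
proof
  fix N assume "\<forall>N::nat. \<exists>C. \<forall>x. (1 + norm x) ^ N * norm (f x) \<le> C" "\<forall>N::nat. \<exists>C. \<forall>x. (1 + norm x) ^ N * norm (g x) \<le> C"
  then obtain C D where CD: "\<And>x. (1 + norm x) ^ N * norm (f x) \<le> C" "\<And>x. (1 + norm x) ^ N * norm (g x) \<le> D" by meson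
  have "(1 + norm x) ^ N * norm (f x + g x) \<le> C + D" for x
  proof -
    have "(1 + norm x) ^ N * norm (f x + g x) \<le> (1 + norm x) ^ N * (norm (f x) + norm (g x))"
      by (intro mult_left_mono norm_triangle_ineq) auto
    then show ?thesis using CD(1)[of x] CD(2)[of x] by (simp add: algebra_simps)
  qed
  then show "\<exists>C. \<forall>x. (1 + norm x) ^ N * norm (f x + g x) \<le> C" by blast
qed

lemma poly_growth_add: "poly_growth f ==> poly_growth g ==> poly_growth (%x. f x + g x)"
  unfolding poly_growth_def
proof (elim exE)
  fix C D N M assume *: "\<forall>x. norm (f x) \<le> C * (1 + norm x) ^ N" "\<forall>x. norm (g x) \<le> D * (1 + norm x) ^ M"
  have "norm (f x + g x) \<le> (\<bar>C\<bar> + \<bar>D\<bar>) * (1 + norm x) ^ (N + M)" for x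
  proof -
    have "C * (1 + norm x) ^ N \<le> \<bar>C\<bar> * (1 + norm x) ^ (N + M)"
      by (intro mult_mono power_increasing) auto
    moreover have "D * (1 + norm x) ^ M \<le> \<bar>D\<bar> * (1 + norm x) ^ (N + M)"
      by (intro mult_mono power_increasing) auto
    ultimately show ?thesis using *(1)[rule_format, of x] *(2)[rule_format, of x] norm_triangle_ineq[of "f x" "g x"]
      by (simp add: algebra_simps)
  qed
  then show "\<exists>C N. \<forall>x. norm (f x + g x) \<le> C * (1 + norm x) ^ N" by blast
qed

lemma rapid_mult_poly_growth: "rapid f ==> poly_growth g ==> rapid (%x. f x * g x)"
  unfolding rapid_def poly_growth_def
proof (elim exE, intro allI)
  fix D M N assume f: "\<forall>N::nat. \<exists>C. \<forall>x. (1 + norm x) ^ N * norm (f x) \<le> C"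
    and g: "\<forall>x. norm (g x) \<le> D * (1 + norm x) ^ M"
  obtain C where C: "\<And>x. (1 + norm x) ^ (N + M) * norm (f x) \<le> C" using f by meson
  have "(1 + norm x) ^ N * norm (f x * g x) \<le> C * \<bar>D\<bar>" for x
  proof -
    have "norm (g x) \<le> \<bar>D\<bar> * (1 + norm x) ^ M"
      by (rule order_trans[OF g[rule_format]]) (intro mult_right_mono, auto)
    then have "(1 + norm x) ^ N * norm (f x * g x) \<le> (1 + norm x) ^ N * (norm (f x) * (\<bar>D\<bar> * (1 + norm x) ^ M))"
      unfolding norm_mult by (intro mult_left_mono) auto
    also have "\<dots> = ((1 + norm x) ^ (N + M) * norm (f x)) * \<bar>D\<bar>" by (simp add: power_add)
    also have "\<dots> \<le> C * \<bar>D\<bar>" by (intro mult_right_mono C) auto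
    finally show ?thesis .
  qed
  then show "\<exists>C. \<forall>x. (1 + norm x) ^ N * norm (f x * g x) \<le> C" by blast
qed

lemma bounded_fn_poly_growth: "bounded_fn f ==> poly_growth f"
  unfolding bounded_fn_def poly_growth_def by (metis mult.right_neutral power_0)

lemma rapid_bounded_fn: "rapid f ==> bounded_fn f"
  unfolding rapid_def bounded_fn_def by (metis mult_1 power_0)

lemma schwartz_mult_slow: "schwartz f ==> slow g ==> schwartz (%x. f x * g x)"
  unfolding schwartz_iff by (rule smooth_class_mult[OF _ _ rapid_mult_poly_growth rapid_add])

lemma bsmooth_slow: "bsmooth f ==> slow f"
  by (erule smooth_class_mono) (rule bounded_fn_poly_growth)

lemma schwartz_bsmooth: "schwartz f ==> bsmooth f"
  unfolding schwartz_iff by (erule smooth_class_mono) (rule rapid_bounded_fn)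

lemma bsmooth_mult: "bsmooth f ==> bsmooth g ==> bsmooth (%x. f x * g x)"
  by (rule smooth_class_mult[OF _ _ bounded_fn_mult bounded_fn_add])

lemma bsmooth_add: "bsmooth f ==> bsmooth g ==> bsmooth (%x. f x + g x)"
  by (rule smooth_class_add) (auto intro: bounded_fn_add)

lemma bsmooth_const: "bsmooth (%x. c)"
  by (rule smooth_class_const) (auto simp: bounded_fn_def)

lemma schwartz_add: "schwartz f ==> schwartz g ==> schwartz (%x. f x + g x)"
  unfolding schwartz_iff by (rule smooth_class_add) (auto intro: rapid_add)

lemma schwartz_mult_bsmooth: "schwartz f ==> bsmooth g ==> schwartz (%x. f x * g x)"
  by (intro schwartz_mult_slow bsmooth_slow)

lemma schwartz_cmult: "schwartz f ==> schwartz (%x. c * f x)"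
  using schwartz_mult_bsmooth[of f "%x. c", OF _ bsmooth_const] by (simp add: mult.commute)

lemma schwartz_zero: "schwartz (%x. 0)"
  unfolding schwartz_iff
  by (rule smooth_classI[where X = "{%x. 0}"]) (auto simp: rapid_def intro!: exI[of _ 0])

lemma schwartz_sum: "(\<And>k. k \<in> I ==> schwartz (f k)) ==> schwartz (%x. \<Sum>k\<in>I. f k x)"
  by (induction I rule: infinite_finite_induct) (auto intro: schwartz_zero schwartz_add)

lemma schwartz_partial: "schwartz f ==> schwartz (partial j f)"
  unfolding schwartz_iff by (rule smooth_class_partial)

lemma schwartz_differentiable: "schwartz f ==> f differentiable at x"
  unfolding schwartz_iff by (rule smooth_classD)

lemma schwartz_continuous: "schwartz f ==> continuous_on A f"
  by (meson continuous_at_imp_continuous_on differentiable_imp_continuous_within schwartz_differentiable)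

lemma schwartz_measurable [measurable_dest]: "schwartz f ==> f \<in> borel_measurable borel"
  by (intro borel_measurable_continuous_onI schwartz_continuous)

lemma schwartz_bounded:
  assumes "schwartz f"
  obtains C where "\<And>x. norm (f x) \<le> C"
  using smooth_classD(1)[OF schwartz_bsmooth[OF assms]] unfolding bounded_fn_def by blast

text \<open>Decay survives because the map is invertible: each coordinate of \<open>x\<close> is
  recovered from that of the image, so \<open>1 + norm x\<close> is at most a constant times one
  plus the norm of the image. A vanishing \<open>l j\<close> would destroy the decay in that
  direction.\<close>

lemma rapid_affine:
  fixes h :: "real^'n::finite => complex"
  assumes h: "rapid h" and l: "\<And>j. l j \<noteq> 0"
  shows "rapid (%x. c * h (a + (\<chi> j. l j * x $ j)))"
  unfolding rapid_def
proof
  fix N :: nat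
  obtain C where C: "\<And>x. (1 + norm x) ^ N * norm (h x) \<le> C" using h unfolding rapid_def by blast
  define K where "K = (\<Sum>j\<in>UNIV. 1 / \<bar>l j\<bar>)"
  have K: "0 \<le> K" unfolding K_def by (auto intro: sum_nonneg)
  have n: "1 + norm x \<le> (1 + K) * (1 + norm a) * (1 + norm (a + (\<chi> j. l j * x $ j)))" for x :: "real^'n"
  proof -
    let ?y = "\<chi> j. l j * x $ j"
    have "norm x \<le> (\<Sum>j\<in>UNIV. \<bar>x $ j\<bar>)" by (rule norm_le_l1_cart)
    also have "\<dots> \<le> (\<Sum>j\<in>UNIV. 1 / \<bar>l j\<bar> * norm ?y)"
    proof (rule sum_mono)
      fix j have "\<bar>x $ j\<bar> = 1 / \<bar>l j\<bar> * \<bar>?y $ j\<bar>" using l[of j] by (simp add: abs_mult)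
      also have "\<dots> \<le> 1 / \<bar>l j\<bar> * norm ?y" by (intro mult_left_mono component_le_norm_cart) auto
      finally show "\<bar>x $ j\<bar> \<le> 1 / \<bar>l j\<bar> * norm ?y" .
    qed
    also have "\<dots> = K * norm ?y" by (simp add: K_def sum_distrib_right)
    also have "\<dots> \<le> K * (norm a + norm (a + ?y))"
      using K norm_triangle_ineq4[of "a + ?y" a] by (intro mult_left_mono) auto
    finally have 1: "norm x \<le> K * (norm a + norm (a + ?y))" .
    have "norm a + norm (a + ?y) \<le> (1 + norm a) * (1 + norm (a + ?y))" by (simp add: algebra_simps)
    then have "norm x \<le> K * ((1 + norm a) * (1 + norm (a + ?y)))"
      using order_trans[OF 1 mult_left_mono[OF _ K]] by simp
    moreover have "1 \<le> (1 + norm a) * (1 + norm (a + ?y))"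
      using mult_mono[of 1 "1 + norm a" 1 "1 + norm (a + ?y)"] by simp
    ultimately have "1 + norm x \<le> (1 + norm a) * (1 + norm (a + ?y)) + K * ((1 + norm a) * (1 + norm (a + ?y)))"
      by linarith
    moreover have "(1 + K) * A * B = A * B + K * (A * B)" for A B :: real by (simp add: algebra_simps)
    ultimately show ?thesis by simp
  qed
  have "(1 + norm x) ^ N * norm (c * h (a + (\<chi> j. l j * x $ j))) \<le> ((1 + K) * (1 + norm a)) ^ N * norm c * C" for x
  proof -
    let ?z = "a + (\<chi> j. l j * x $ j)"
    have "(1 + norm x) ^ N * norm (c * h ?z) \<le> ((1 + K) * (1 + norm a) * (1 + norm ?z)) ^ N * norm (c * h ?z)"
      by (intro mult_right_mono power_mono n) auto
    also have "\<dots> = ((1 + K) * (1 + norm a)) ^ N * norm c * ((1 + norm ?z) ^ N * norm (h ?z))"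
      by (simp add: power_mult_distrib norm_mult)
    also have "\<dots> \<le> ((1 + K) * (1 + norm a)) ^ N * norm c * C"
      using K by (intro mult_left_mono C) auto
    finally show ?thesis .
  qed
  then show "\<exists>C. \<forall>x. (1 + norm x) ^ N * norm (c * h (a + (\<chi> j. l j * x $ j))) \<le> C" by (intro exI allI)
qed

lemma schwartz_affine:
  fixes f :: "real^'n::finite => complex"
  assumes "schwartz f" and l: "\<And>j. l j \<noteq> 0"
  shows "schwartz (%x. f (a + (\<chi> j. l j * x $ j)))"
proof -
  have "smooth_class rapid f" using assms(1) by (simp only: schwartz_iff)
  from smooth_class_affine[OF this, where Q = rapid, OF rapid_affine[OF _ l]]
  show ?thesis by (simp only: schwartz_iff)
qed

lemma slow_coord: "slow (%x::real^'n::finite. c * complex_of_real (x $ j))"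
proof -
  let ?f = "%x::real^'n. c * complex_of_real (x $ j)"
  let ?X = "insert ?f (range (%(c::complex) (x::real^'n). c))"
  have d: "(?f has_derivative (%y. c * complex_of_real (y $ j))) (at x)" for x
    by (intro has_derivative_mult_right has_derivative_of_real bounded_linear_imp_has_derivative bounded_linear_vec_nth)
  have p: "partial i ?f = (%x. c * of_real (unit_vec i $ j))" for i
    by (rule ext) (rule partial_eq[OF d])
  have pc: "poly_growth (%x::real^'n. c)" for c
    unfolding poly_growth_def by (rule exI[of _ "norm c"], rule exI[of _ 0]) auto
  have "norm (?f x) \<le> norm c * (1 + norm x) ^ 1" for x
    unfolding norm_mult power_one_right
    using component_le_norm_cart[of x j] by (intro mult_left_mono) auto
  then have pg: "poly_growth ?f"
    unfolding poly_growth_def by (intro exI allI)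
  show ?thesis
  proof (rule smooth_classI[where X = ?X])
    fix g assume "g \<in> ?X"
    then consider "g = ?f" | k where "g = (%x. k)" by fast
    note cases = this
    show "partial i g \<in> ?X" for i by (cases rule: cases) (simp_all add: p)
    show "g differentiable at x" for x
      by (cases rule: cases) (use d differentiable_const in \<open>auto simp only: differentiable_def\<close>)
    show "poly_growth g" by (cases rule: cases) (simp_all only: pg pc)
  qed simp
qed

section \<open>Lebesgue measure on powers of a space and changes of variables\<close>

lemma prod_Basis_vec:
  fixes f :: "('a::euclidean_space)^'n::finite => 'b::comm_monoid_mult"
  shows "(\<Prod>b\<in>Basis. f b) = (\<Prod>i\<in>UNIV. \<Prod>u\<in>Basis. f (axis i u))"
proof -
  have inj: "inj_on (%(i, u). axis i u :: 'a^'n) (UNIV \<times> Basis)"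
    by (auto simp: inj_on_def axis_eq_axis)
  have "(Basis :: ('a^'n) set) = (%(i, u). axis i u) ` (UNIV \<times> Basis)"
    by (auto simp: Basis_vec_def)
  then have "(\<Prod>b\<in>Basis. f b) = (\<Prod>(i, u)\<in>UNIV \<times> Basis. f (axis i u))"
    using prod.reindex[OF inj, of f] by (simp add: o_def case_prod_beta')
  then show ?thesis by (simp add: prod.cartesian_product)
qed

lemma vec_lambda_measurable [measurable]:
  "vec_lambda \<in> Pi\<^sub>M (UNIV::'n::finite set) (%_. lborel :: ('a::euclidean_space) measure) \<rightarrow>\<^sub>M borel"
proof (rule borel_measurable_euclidean_space[THEN iffD2], intro ballI)
  fix b :: "'a^'n" assume "b \<in> Basis"
  then obtain i u where b: "b = axis i u" by (auto simp: Basis_vec_def)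
  have "(%x. x i) \<in> Pi\<^sub>M (UNIV::'n set) (%_. lborel :: 'a measure) \<rightarrow>\<^sub>M borel"
    using measurable_component_singleton[of i UNIV "%_. lborel :: 'a measure"] by simp
  then show "(%x. vec_lambda x \<bullet> b) \<in> borel_measurable (Pi\<^sub>M (UNIV::'n set) (%_. lborel))"
    unfolding b by (simp add: inner_axis)
qed

lemma box_vec: "vec_lambda x \<in> box (l :: ('a::euclidean_space)^'n::finite) u \<longleftrightarrow> (\<forall>i. x i \<in> box (l $ i) (u $ i))"
  by (auto simp: mem_box Basis_vec_def inner_axis)

text \<open>Both measures agree on boxes, which determines Lebesgue measure. The entry type is any
  Euclidean space, so one lemma serves both \<open>real^'n\<close> and the space
  \<open>real^'n^'n\<close> of the variable \<tau>.\<close>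

lemma lborel_vec:
  "(lborel :: (('a::euclidean_space)^'n::finite) measure) = distr (Pi\<^sub>M UNIV (%_. lborel)) borel vec_lambda"
proof (rule lborel_eqI)
  fix l u :: "'a^'n" assume le: "\<And>b. b \<in> Basis ==> l \<bullet> b \<le> u \<bullet> b"
  interpret product_sigma_finite "%_::'n. lborel :: 'a measure" ..
  have le': "(l $ i) \<bullet> b \<le> (u $ i) \<bullet> b" if "b \<in> Basis" for i b
    using le[of "axis i b"] that by (auto simp: inner_axis axis_in_Basis_iff)
  have "emeasure (distr (Pi\<^sub>M UNIV (%_. lborel)) borel vec_lambda) (box l u)
      = emeasure (Pi\<^sub>M (UNIV::'n set) (%_. lborel :: 'a measure)) (Pi\<^sub>E UNIV (%i. box (l $ i) (u $ i)))"
    by (subst emeasure_distr) (auto intro!: arg_cong2[where f=emeasure] simp: box_vec space_PiM PiE_iff)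
  also have "\<dots> = (\<Prod>i\<in>UNIV. emeasure lborel (box (l $ i) (u $ i)))"
    by (rule emeasure_PiM) auto
  also have "\<dots> = (\<Prod>i\<in>UNIV. ennreal (\<Prod>b\<in>Basis. ((u $ i) - (l $ i)) \<bullet> b))"
    using le' by (intro prod.cong refl) (auto simp: emeasure_lborel_box)
  also have "\<dots> = ennreal (\<Prod>i\<in>UNIV. \<Prod>b\<in>Basis. ((u $ i) - (l $ i)) \<bullet> b)"
    using le' by (intro prod_ennreal) (auto intro!: prod_nonneg simp: inner_diff_left)
  also have "(\<Prod>i\<in>UNIV. \<Prod>b\<in>Basis. ((u $ i) - (l $ i)) \<bullet> b) = (\<Prod>b\<in>Basis. (u - l) \<bullet> b)"
    unfolding prod_Basis_vec by (simp add: inner_axis)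
  finally show "emeasure (distr (Pi\<^sub>M UNIV (%_. lborel)) borel vec_lambda) (box l u) = ennreal (\<Prod>b\<in>Basis. (u - l) \<bullet> b)" .
qed simp

lemma
  fixes f :: "'n::finite => 'a::euclidean_space => 'b::{real_normed_field,banach,second_countable_topology}"
  assumes f: "\<And>j. integrable lborel (f j)"
  shows integrable_prod_vec: "integrable lborel (%x::'a^'n. \<Prod>j\<in>UNIV. f j (x $ j))"
    and integral_prod_vec: "(LINT x|lborel. (\<Prod>j\<in>UNIV. f j ((x::'a^'n) $ j))) = (\<Prod>j\<in>UNIV. integral\<^sup>L lborel (f j))"
proof -
  interpret product_sigma_finite "%_::'n. lborel :: 'a measure" ..
  have [measurable]: "f j \<in> borel_measurable borel" for j using f[of j] by auto
  have [measurable]: "(%x::'a^'n. x $ j) \<in> borel \<rightarrow>\<^sub>M borel" for j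
    by (intro borel_measurable_continuous_onI continuous_intros)
  have m: "(%x::'a^'n. \<Prod>j\<in>UNIV. f j (x $ j)) \<in> borel_measurable borel" by measurable
  show "integrable lborel (%x::'a^'n. \<Prod>j\<in>UNIV. f j (x $ j))"
    unfolding lborel_vec using product_integrable_prod[of UNIV f] f m
    by (subst integrable_distr_eq) auto
  show "(LINT x|lborel. (\<Prod>j\<in>UNIV. f j ((x::'a^'n) $ j))) = (\<Prod>j\<in>UNIV. integral\<^sup>L lborel (f j))"
    unfolding lborel_vec[where 'a='a] using product_integral_prod[of UNIV f] f m
    by (subst integral_distr) auto
qed

lemma
  fixes f :: "'a::euclidean_space => 'b::{banach, second_countable_topology}"
  assumes T: "\<And>x b. b \<in> Basis ==> T x \<bullet> b = t \<bullet> b + c b * (x \<bullet> b)" and c: "\<And>b. b \<in> Basis ==> c b \<noteq> (0::real)"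
    and f [measurable]: "f \<in> borel_measurable borel"
  shows integral_diagonal: "(LINT x|lborel. f x) = (\<Prod>b\<in>Basis. \<bar>c b\<bar>) *\<^sub>R (LINT x|lborel. f (T x))"
    and integrable_diagonal: "integrable lborel f \<longleftrightarrow> integrable lborel (%x. f (T x))"
proof -
  have T_eq: "T = (%x. t + (\<Sum>j\<in>Basis. (c j * (x \<bullet> j)) *\<^sub>R j))"
    using T by (auto simp: fun_eq_iff euclidean_eq_iff[where 'a='a] inner_simps inner_sum_left_Basis)
  have [measurable]: "T \<in> borel \<rightarrow>\<^sub>M borel" unfolding T_eq by simp
  have pos: "0 < (\<Prod>b\<in>Basis. \<bar>c b\<bar>)" using c by (auto intro!: prod_pos)
  note L = lborel_affine_euclidean[of c t, OF c, simplified, folded T_eq]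
  show "(LINT x|lborel. f x) = (\<Prod>b\<in>Basis. \<bar>c b\<bar>) *\<^sub>R (LINT x|lborel. f (T x))"
    by (subst L) (use pos in \<open>simp add: integral_density integral_distr\<close>)
  show "integrable lborel f \<longleftrightarrow> integrable lborel (%x. f (T x))"
  proof -
    have "integrable lborel f \<longleftrightarrow> integrable lborel (%x. (\<Prod>b\<in>Basis. \<bar>c b\<bar>) *\<^sub>R f (T x))"
      by (subst (1) L) (use pos in \<open>simp add: integrable_density integrable_distr_eq\<close>)
    also have "\<dots> \<longleftrightarrow> integrable lborel (%x. f (T x))"
    proof -
      have "inverse (\<Prod>b\<in>Basis. \<bar>c b\<bar>) * (\<Prod>b\<in>Basis. \<bar>c b\<bar>) = 1" using pos by (intro left_inverse) linarith
      then show ?thesis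
        using integrable_scaleR_right[of "inverse (\<Prod>b\<in>Basis. \<bar>c b\<bar>)" lborel "%x. (\<Prod>b\<in>Basis. \<bar>c b\<bar>) *\<^sub>R f (T x)"]
        by (auto simp only: scaleR_scaleR scaleR_one intro: integrable_scaleR_right)
    qed
    finally show ?thesis .
  qed
qed

lemma
  fixes f :: "real^'n::finite => 'b::{banach, second_countable_topology}"
  assumes l: "\<And>j. l j \<noteq> 0" and f: "f \<in> borel_measurable borel"
  shows integral_diag: "(LINT x|lborel. f x) = (\<Prod>j\<in>UNIV. \<bar>l j\<bar>) *\<^sub>R (LINT x|lborel. f (a + (\<chi> j. l j * x $ j)))"
    and integrable_diag: "integrable lborel f \<longleftrightarrow> integrable lborel (%x. f (a + (\<chi> j. l j * x $ j)))"
proof -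
  define c where "c b = (\<Sum>i\<in>UNIV. l i * b $ i)" for b :: "real^'n"
  have ca: "c (axis i 1) = l i" for i
    unfolding c_def axis_def by (simp add: if_distrib cong: if_cong)
  have T: "(a + (\<chi> j. l j * x $ j)) \<bullet> b = a \<bullet> b + c b * (x \<bullet> b)" if "b \<in> Basis" for b x
    using that by (auto simp: Basis_vec_def inner_add_left inner_axis ca)
  have c: "c b \<noteq> 0" if "b \<in> Basis" for b using that l by (auto simp: Basis_vec_def ca)
  show "(LINT x|lborel. f x) = (\<Prod>j\<in>UNIV. \<bar>l j\<bar>) *\<^sub>R (LINT x|lborel. f (a + (\<chi> j. l j * x $ j)))"
    using integral_diagonal[of "%x. a + (\<chi> j. l j * x $ j)" a c f] T c f by (simp add: prod_Basis_vec ca)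
  show "integrable lborel f \<longleftrightarrow> integrable lborel (%x. f (a + (\<chi> j. l j * x $ j)))"
    by (rule integrable_diagonal) (use T c f in auto)
qed

text \<open>All rows are scaled by the same \<open>l\<close>, so each of the \<open>CARD('n)\<close>
  rows contributes the Jacobian of one dilation.\<close>

lemma integral_diag_matrix:
  fixes f :: "real^'n^'n::finite => 'b::{banach, second_countable_topology}"
  assumes l: "\<And>j. l j \<noteq> 0" and f: "f \<in> borel_measurable borel"
  shows "(LINT x|lborel. f x) = ((\<Prod>j\<in>UNIV. \<bar>l j\<bar>) ^ CARD('n)) *\<^sub>R (LINT x|lborel. f (\<chi> i. \<chi> j. l j * x $ i $ j))"
proof -
  define c where "c b = (\<Sum>i\<in>UNIV. \<Sum>j\<in>UNIV. l j * b $ i $ j)" for b :: "real^'n^'n"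
  have ca: "c (axis i (axis j 1)) = l j" for i j
  proof -
    have "c (axis i (axis j 1)) = (\<Sum>i'\<in>UNIV. \<Sum>j'\<in>UNIV. if i' = i \<and> j' = j then l j else 0)"
      unfolding c_def by (intro sum.cong refl) (auto simp: axis_def)
    also have "\<dots> = (\<Sum>i'\<in>UNIV. if i' = i then l j else 0)"
      by (intro sum.cong refl) auto
    finally show ?thesis by simp
  qed
  have T: "(\<chi> i. \<chi> j. l j * x $ i $ j) \<bullet> b = 0 \<bullet> b + c b * (x \<bullet> b)" if "b \<in> Basis" for b x
    using that by (auto simp: Basis_vec_def inner_axis ca)
  have c: "c b \<noteq> 0" if "b \<in> Basis" for b using that l by (auto simp: Basis_vec_def ca)
  have Bv: "(Basis :: (real^'n) set) = range (%j. axis j 1)" by (auto simp: Basis_vec_def)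
  show ?thesis
    using integral_diagonal[of "%x. \<chi> i. \<chi> j. l j * x $ i $ j" 0 c f] T c f
    by (simp add: prod_Basis_vec ca)
qed

lemma integral_translate:
  fixes f :: "'a::euclidean_space => 'b::{banach, second_countable_topology}"
  assumes [measurable]: "f \<in> borel_measurable borel"
  shows "(LINT x|lborel. f (a + x)) = (LINT x|lborel. f x)"
  by (subst lborel_distr_plus[of a, symmetric], subst integral_distr) auto

lemma integrable_translate:
  fixes f :: "'a::euclidean_space => 'b::{banach, second_countable_topology}"
  assumes [measurable]: "f \<in> borel_measurable borel"
  shows "integrable lborel (%x. f (a + x)) \<longleftrightarrow> integrable lborel f"
  by (subst (2) lborel_distr_plus[of a, symmetric], subst integrable_distr_eq) auto

text \<open>The form in which Fubini is mostly used below: integrable factors in separate variables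
  times a bounded kernel, typically a character or a multiplier. Joint integrability follows from
  the product of the two one-variable norms.\<close>

lemma
  fixes f :: "'a => complex" and g :: "'b => complex"
  assumes M: "sigma_finite_measure M" and N: "sigma_finite_measure N"
    and f: "integrable M f" and g: "integrable N g"
    and h: "case_prod h \<in> borel_measurable (M \<Otimes>\<^sub>M N)" and B: "\<And>x y. norm (h x y) \<le> B"
  shows integrable_pair_mult: "integrable (M \<Otimes>\<^sub>M N) (%(x, y). f x * g y * h x y)"
    and Fubini_mult: "(LINT x|M. LINT y|N. f x * g y * h x y) = (LINT y|N. LINT x|M. f x * g y * h x y)"
proof -
  interpret M: sigma_finite_measure M by fact
  interpret N: sigma_finite_measure N by fact
  interpret P: pair_sigma_finite M N ..
  have [measurable]: "f \<in> borel_measurable M" "g \<in> borel_measurable N" using f g by auto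
  have [measurable]: "(%p. h (fst p) (snd p)) \<in> borel_measurable (M \<Otimes>\<^sub>M N)" using h by (simp add: case_prod_beta')
  have 0: "0 \<le> B" using B[of undefined undefined] norm_ge_zero order_trans by blast
  have 1: "integrable (M \<Otimes>\<^sub>M N) (%(x, y). f x * g y)"
  proof (rule P.Fubini_integrable)
    have "(%x. LINT y|N. norm (case (x, y) of (x, y) => f x * g y)) = (%x. norm (f x) * (LINT y|N. norm (g y)))"
      by (simp add: norm_mult)
    then show "integrable M (%x. LINT y|N. norm (case (x, y) of (x, y) => f x * g y))" using f by simp
    show "AE x in M. integrable N (%y. case (x, y) of (x, y) => f x * g y)" using g by simp
  qed measurable
  show 2: "integrable (M \<Otimes>\<^sub>M N) (%(x, y). f x * g y * h x y)"
  proof (rule Bochner_Integration.integrable_bound[where f = "%p. of_real B * (case p of (x, y) => f x * g y)"])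
    show "integrable (M \<Otimes>\<^sub>M N) (%p. complex_of_real B * (case p of (x, y) => f x * g y))"
      using 1 by (rule integrable_mult_right)
    show "AE p in M \<Otimes>\<^sub>M N. norm (case p of (x, y) => f x * g y * h x y) \<le> norm (complex_of_real B * (case p of (x, y) => f x * g y))"
      using B 0 by (intro AE_I2) (auto simp: norm_mult mult.commute split: prod.split intro!: mult_right_mono)
  qed (simp add: case_prod_beta')
  show "(LINT x|M. LINT y|N. f x * g y * h x y) = (LINT y|N. LINT x|M. f x * g y * h x y)"
    using P.Fubini_integral[OF 2] by simp
qed

lemma integrable_inverse_1_plus_square_UNIV: "integrable lborel (%x::real. inverse (1 + x\<^sup>2))"
  using integrable_inverse_1_plus_square by (simp add: set_integrable_def einterval_eq_UNIV)

lemma integrable_cauchy_vec: "integrable lborel (%x::real^'n::finite. \<Prod>j\<in>UNIV. inverse (1 + (x $ j)\<^sup>2))"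
  by (rule integrable_prod_vec[where f = "%j x. inverse (1 + x\<^sup>2)"]) (rule integrable_inverse_1_plus_square_UNIV)

text \<open>The exponent \<open>2 * CARD('n)\<close> pays for one factor
  \<open>1 + (x $ j)\<^sup>2\<close> per coordinate, each at most
  \<open>(1 + norm x)\<^sup>2\<close>. The product of Cauchy densities is a majorant that the
  product formula shows to be integrable.\<close>

lemma rapid_cauchy_bound:
  fixes f :: "real^'n::finite => complex"
  assumes "rapid f"
  obtains C where "\<And>x. norm (f x) \<le> C * (\<Prod>j\<in>UNIV. inverse (1 + (x $ j)\<^sup>2))"
proof -
  obtain C where C: "\<And>x. (1 + norm x) ^ (2 * CARD('n)) * norm (f x) \<le> C"
    using assms unfolding rapid_def by blast
  have "norm (f x) \<le> C * (\<Prod>j\<in>UNIV. inverse (1 + (x $ j)\<^sup>2))" for x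
  proof -
    have 1: "1 + (x $ j)\<^sup>2 \<le> (1 + norm x)\<^sup>2" for j
    proof -
      have "(x $ j)\<^sup>2 \<le> (norm x)\<^sup>2" using component_le_norm_cart[of x j] by (metis abs_le_square_iff abs_norm_cancel)
      then show ?thesis by (simp add: power2_sum add_increasing2)
    qed
    have pos: "0 < (\<Prod>j\<in>UNIV. 1 + (x $ j)\<^sup>2)" by (intro prod_pos) (auto intro: add_pos_nonneg)
    have "(\<Prod>j\<in>UNIV. 1 + (x $ j)\<^sup>2) \<le> (\<Prod>j\<in>(UNIV::'n set). (1 + norm x)\<^sup>2)"
      by (intro prod_mono) (use 1 in auto)
    also have "\<dots> = (1 + norm x) ^ (2 * CARD('n))" by (simp add: power_mult)
    finally have "(\<Prod>j\<in>UNIV. 1 + (x $ j)\<^sup>2) * norm (f x) \<le> (1 + norm x) ^ (2 * CARD('n)) * norm (f x)"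
      by (intro mult_right_mono) auto
    also have "\<dots> \<le> C" by (rule C)
    finally have "norm (f x) \<le> C / (\<Prod>j\<in>UNIV. 1 + (x $ j)\<^sup>2)" using pos by (simp add: field_simps)
    then show ?thesis using prod_inversef[of "%j. 1 + (x $ j)\<^sup>2" UNIV] by (simp add: divide_inverse o_def)
  qed
  then show ?thesis by (rule that)
qed

lemma schwartz_integrable:
  fixes f :: "real^'n::finite => complex"
  assumes f: "schwartz f" shows "integrable lborel f"
proof -
  obtain C where C: "\<And>x. norm (f x) \<le> C * (\<Prod>j\<in>UNIV. inverse (1 + (x $ j)\<^sup>2))"
    using rapid_cauchy_bound smooth_classD(1) f unfolding schwartz_iff by blast
  show ?thesis
  proof (rule Bochner_Integration.integrable_bound[where f = "%x. C * (\<Prod>j\<in>UNIV. inverse (1 + (x $ j)\<^sup>2))"])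
    show "integrable lborel (%x::real^'n. C * (\<Prod>j\<in>UNIV. inverse (1 + (x $ j)\<^sup>2)))"
      by (intro integrable_mult_right integrable_cauchy_vec)
    show "f \<in> borel_measurable lborel" using f by measurable
    show "AE x in lborel. norm (f x) \<le> norm (C * (\<Prod>j\<in>UNIV. inverse (1 + (x $ j)\<^sup>2)))"
      using C by (intro AE_I2) (smt (verit) real_norm_def)
  qed
qed

lemma schwartz_powr_integrable:
  fixes f :: "real^'n::finite => complex"
  assumes f: "schwartz f" and p: "p \<ge> 1" shows "integrable lborel (%x. norm (f x) powr p)"
proof -
  obtain C where C: "\<And>x. norm (f x) \<le> C" using schwartz_bounded[OF f] by blast
  have [measurable]: "f \<in> borel_measurable borel" using f by measurable
  show ?thesis
  proof (rule Bochner_Integration.integrable_bound[where f = "%x. C powr (p - 1) * norm (f x)"])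
    show "integrable lborel (%x. C powr (p - 1) * norm (f x))"
      using schwartz_integrable[OF f] by simp
    have "norm (f x) powr p \<le> C powr (p - 1) * norm (f x)" for x
    proof (cases "f x = 0")
      case False
      then have "norm (f x) powr p = norm (f x) powr (p - 1) * norm (f x)"
        by (simp add: powr_diff)
      also have "\<dots> \<le> C powr (p - 1) * norm (f x)"
        using p C by (intro mult_right_mono powr_mono2) auto
      finally show ?thesis .
    qed simp
    then show "AE x in lborel. norm (norm (f x) powr p) \<le> norm (C powr (p - 1) * norm (f x))"
      by (intro AE_I2) (smt (verit) norm_ge_zero powr_ge_zero real_norm_def)
  qed simp
qed

section \<open>The Fourier transform on Schwartz functions\<close>

lemma fourier_cis: "fourier f \<xi> = (LINT x|lborel. f x * cis (- 2 * pi * (x \<bullet> \<xi>)))"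
  unfolding fourier_def cis_conv_exp by (simp add: mult_ac)

lemma has_derivative_quadratic:
  fixes g :: "'a::real_normed_vector => 'b::real_normed_vector"
  assumes D: "bounded_linear D" and K: "\<And>v. norm (g (x + v) - g x - D v) \<le> K * norm v ^ 2"
  shows "(g has_derivative D) (at x)"
proof -
  have "((%v. norm (g (x + v) - g x - D v) / norm v) \<longlongrightarrow> 0) (at 0)"
  proof (rule Lim_null_comparison[where g = "%v. K * norm v"])
    have "norm (norm (g (x + v) - g x - D v) / norm v) \<le> K * norm v" if "v \<noteq> 0" for v
      using K[of v] that by (simp add: field_simps power2_eq_square)
    then show "\<forall>\<^sub>F v in at 0. norm (norm (g (x + v) - g x - D v) / norm v) \<le> K * norm v"
      by (auto simp: eventually_at_filter)
    show "((%v::'a. K * norm v) \<longlongrightarrow> 0) (at 0)" by (auto intro!: tendsto_eq_intros)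
  qed
  then show ?thesis using D by (simp add: has_derivative_at)
qed

lemma cis_has_derivative: "(cis has_derivative (%h. h *\<^sub>R (\<i> * cis t))) (at t)"
proof -
  have "cis = (%t. of_real (cos t) + \<i> * of_real (sin t))" by (auto simp: complex_eq_iff)
  then show ?thesis
    by (auto intro!: derivative_eq_intros simp: complex_eq_iff fun_eq_iff)
qed

lemma cis_inner_has_derivative:
  "((%x::real^'n::finite. cis (c * (x \<bullet> v))) has_derivative (%y. (c * (y \<bullet> v)) *\<^sub>R (\<i> * cis (c * (x \<bullet> v))))) (at x)"
proof -
  have "((%x::real^'n. c * (x \<bullet> v)) has_derivative (%y. c * (y \<bullet> v))) (at x)"
    by (auto intro!: derivative_eq_intros)
  from diff_chain_at[OF this cis_has_derivative] show ?thesis by (simp add: o_def)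
qed

lemma bsmooth_cis: "bsmooth (%x::real^'n::finite. cis (c * (x \<bullet> v)))"
proof -
  let ?X = "range (%(k::complex) (x::real^'n). k * cis (c * (x \<bullet> v)))"
  have d: "((%x::real^'n. k * cis (c * (x \<bullet> v))) has_derivative (%y. k * (\<i> * cis (c * (x \<bullet> v)) * of_real (c * (y \<bullet> v))))) (at x)" for k x
    using has_derivative_mult_right[OF cis_inner_has_derivative, of k] by (simp add: scaleR_conv_of_real mult_ac)
  show ?thesis
  proof (rule smooth_classI[where X = ?X])
    show "(%x. cis (c * (x \<bullet> v))) \<in> ?X" by (rule range_eqI[where x = 1]) simp
    fix g assume "g \<in> ?X"
    then obtain k where g: "g = (%x. k * cis (c * (x \<bullet> v)))" by blast
    show "g differentiable at x" for x unfolding g differentiable_def by (rule exI) (rule d)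
    show "bounded_fn g" unfolding g bounded_fn_def by (rule exI[of _ "norm k"]) (simp add: norm_mult)
    fix j
    show "partial j g \<in> ?X"
      by (rule range_eqI[where x = "k * \<i> * of_real (c * (unit_vec j \<bullet> v))"])
         (auto simp: g partial_eq[OF d] mult_ac)
  qed
qed

lemma schwartz_coord_mult: "schwartz f ==> schwartz (%x. c * complex_of_real (x $ j) * f x)"
  using schwartz_mult_slow[OF _ slow_coord[of c j], of f] by (simp add: mult_ac)

lemma schwartz_cis_mult: "schwartz f ==> schwartz (%x. f x * cis (c * (x \<bullet> v)))"
  by (intro schwartz_mult_bsmooth bsmooth_cis)

text \<open>No boundary term at infinity occurs. The increment h(x + e_j) - h(x) is the integral of
  the partial derivative over a unit segment; integrating in x and using translation invariance, the
  increment contributes 0 and the other side becomes the integral of the derivative.\<close>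

lemma integral_partial_zero:
  fixes h :: "real^'n::finite => complex"
  assumes h: "schwartz h"
  shows "(LINT x|lborel. partial j h x) = 0"
proof -
  have hm [measurable]: "h \<in> borel_measurable borel" using h by measurable
  have ph: "schwartz (partial j h)" using h by (rule schwartz_partial)
  have pm [measurable]: "partial j h \<in> borel_measurable borel" using ph by measurable
  let ?I = "indicator {0..1::real} :: real => real"
  have ftc: "(LINT s|lborel. ?I s *\<^sub>R partial j h (x + s *\<^sub>R unit_vec j)) = h (x + unit_vec j) - h x" for x
  proof -
    have "(LINT s|lborel. ?I s *\<^sub>R partial j h (x + s *\<^sub>R unit_vec j)) = h (x + 1 *\<^sub>R unit_vec j) - h (x + 0 *\<^sub>R unit_vec j)"
    proof (rule integral_FTC_Icc)
      show "((%s. h (x + s *\<^sub>R unit_vec j)) has_vector_derivative partial j h (x + s *\<^sub>R unit_vec j)) (at s within {0..1})" for s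
        by (rule has_vector_derivative_at_within) (rule partial_has_vector_derivative[OF schwartz_differentiable[OF h]])
      show "continuous_on {0..1} (%s. partial j h (x + s *\<^sub>R unit_vec j))"
        by (rule continuous_on_compose2[OF schwartz_continuous[OF ph, of UNIV]]) (auto intro!: continuous_intros)
    qed auto
    then show ?thesis by simp
  qed
  have int: "integrable lborel (%x. partial j h (x + s *\<^sub>R unit_vec j))" for s
    using schwartz_integrable[OF ph] integrable_translate[of "partial j h" "s *\<^sub>R unit_vec j"] by (simp add: add.commute)
  have tr: "(LINT x|lborel. f (x + v)) = (LINT x|lborel. f x)" if "f \<in> borel_measurable borel" for f :: "real^'n => 'b::{banach,second_countable_topology}" and v
    using integral_translate[OF that, of v] by (simp add: add.commute)
  have "integrable (lborel \<Otimes>\<^sub>M lborel) (%(s::real, x). ?I s *\<^sub>R partial j h (x + s *\<^sub>R unit_vec j))"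
  proof (rule lborel_pair.Fubini_integrable)
    have "(LINT x|lborel. norm (?I s *\<^sub>R partial j h (x + s *\<^sub>R unit_vec j))) = ?I s * (LINT x|lborel. norm (partial j h x))" for s
      using tr[of "%x. norm (partial j h x)"] by simp
    then have "(%s. LINT x|lborel. norm (case (s, x) of (s, x) => ?I s *\<^sub>R partial j h (x + s *\<^sub>R unit_vec j))) = (%s. ?I s * (LINT x|lborel. norm (partial j h x)))"
      by (simp only: prod.case)
    then show "integrable lborel (%s. LINT x|lborel. norm (case (s, x) of (s, x) => ?I s *\<^sub>R partial j h (x + s *\<^sub>R unit_vec j)))"
      by simp
  qed (use int in auto)
  then have "(LINT x|lborel. LINT s|lborel. ?I s *\<^sub>R partial j h (x + s *\<^sub>R unit_vec j)) = (LINT s|lborel. LINT x|lborel. ?I s *\<^sub>R partial j h (x + s *\<^sub>R unit_vec j))"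
    by (rule lborel_pair.Fubini_integral)
  also have "\<dots> = (LINT s|lborel. ?I s *\<^sub>R (LINT x|lborel. partial j h x))"
    by (simp add: tr)
  also have "\<dots> = (LINT x|lborel. partial j h x)" by simp
  finally have "(LINT x|lborel. h (x + unit_vec j) - h x) = (LINT x|lborel. partial j h x)" unfolding ftc .
  moreover have "(LINT x|lborel. h (x + unit_vec j) - h x) = 0"
    using schwartz_integrable[OF h] integrable_translate[of h "unit_vec j"] tr[of h "unit_vec j"]
    by (subst Bochner_Integration.integral_diff) (auto simp: add.commute)
  ultimately show ?thesis by simp
qed

lemma partial_cis: "partial j (%x::real^'n::finite. cis (c * (x \<bullet> v))) x = \<i> * of_real (c * v $ j) * cis (c * (x \<bullet> v))"
  using partial_eq[OF cis_inner_has_derivative]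
  by (simp add: unit_vec_def inner_axis' scaleR_conv_of_real mult_ac)

lemma fourier_partial:
  fixes f :: "real^'n::finite => complex"
  assumes f: "schwartz f"
  shows "fourier (partial j f) \<xi> = 2 * pi * \<i> * complex_of_real (\<xi> $ j) * fourier f \<xi>"
proof -
  let ?e = "%x. cis (- 2 * pi * (x \<bullet> \<xi>))"
  have e: "bsmooth ?e" by (rule bsmooth_cis)
  have "partial j (%x. f x * ?e x) x = partial j f x * ?e x + f x * (\<i> * of_real (- 2 * pi * \<xi> $ j) * ?e x)" for x
    using partial_mult[OF schwartz_differentiable[OF f] smooth_classD(2)[OF e], of j x] partial_cis[of j "- 2 * pi" \<xi>] by simp
  then have "0 = (LINT x|lborel. partial j f x * ?e x + (\<i> * of_real (- 2 * pi * \<xi> $ j)) * (f x * ?e x))"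
    using integral_partial_zero[OF schwartz_mult_bsmooth[OF f e], of j] by (simp add: mult_ac)
  also have "\<dots> = (LINT x|lborel. partial j f x * ?e x) + (LINT x|lborel. (\<i> * of_real (- 2 * pi * \<xi> $ j)) * (f x * ?e x))"
    by (intro Bochner_Integration.integral_add integrable_mult_right schwartz_integrable schwartz_mult_bsmooth e schwartz_partial f)
  also have "\<dots> = fourier (partial j f) \<xi> + (\<i> * of_real (- 2 * pi * \<xi> $ j)) * fourier f \<xi>"
    by (simp add: fourier_cis)
  finally have "fourier (partial j f) \<xi> = - ((\<i> * of_real (- 2 * pi * \<xi> $ j)) * fourier f \<xi>)"
    by (metis add.commute add.right_inverse add_left_cancel add_right_cancel)
  then show ?thesis by (simp add: algebra_simps)
qed

lemma fourier_norm_le: "norm (fourier f \<xi>) \<le> (LINT x|lborel. norm (f x))"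
  unfolding fourier_cis by (rule order_trans[OF integral_norm_bound]) (simp add: norm_mult)

text \<open>Pure derivatives suffice: at each \<xi> the coordinate of largest modulus is comparable
  to the norm, and the N-th derivative of \<open>f\<close> in that direction bounds the N-th power
  of this coordinate times the transform. Small \<xi> are covered by the L^1 norm of
  \<open>f\<close>.\<close>

lemma fourier_rapid:
  fixes f :: "real^'n::finite => complex"
  assumes f: "schwartz f"
  shows "rapid (fourier f)"
  unfolding rapid_def
proof
  fix N :: nat
  have s: "schwartz ((partial j ^^ N) f)" for j
    by (induction N) (auto intro: schwartz_partial f)
  have e: "fourier ((partial j ^^ N) f) \<xi> = (2 * pi * \<i> * complex_of_real (\<xi> $ j)) ^ N * fourier f \<xi>" for j \<xi>
  proof (induction N)
    case (Suc N)
    have "schwartz ((partial j ^^ N) f)" by (induction N) (auto intro: schwartz_partial f)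
    then show ?case using Suc by (simp add: fourier_partial)
  qed simp
  define B where "B j = (LINT x|lborel. norm ((partial j ^^ N) f x))" for j
  define B0 where "B0 = (LINT x|lborel. norm (f x))"
  have bj: "\<bar>\<xi> $ j\<bar> ^ N * norm (fourier f \<xi>) \<le> B j" for j \<xi>
  proof -
    have "1 \<le> (2 * pi) ^ N" using pi_gt3 by (intro one_le_power) auto
    then have "\<bar>\<xi> $ j\<bar> ^ N * norm (fourier f \<xi>) \<le> (2 * pi) ^ N * (\<bar>\<xi> $ j\<bar> ^ N * norm (fourier f \<xi>))"
      using mult_right_mono[of 1 "(2 * pi) ^ N" "\<bar>\<xi> $ j\<bar> ^ N * norm (fourier f \<xi>)"] by simp
    also have "\<dots> = norm (fourier ((partial j ^^ N) f) \<xi>)"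
      unfolding e by (simp add: norm_mult norm_power power_mult_distrib)
    also have "\<dots> \<le> B j" unfolding B_def by (rule fourier_norm_le)
    finally show ?thesis .
  qed
  let ?n = "real (CARD('n))"
  have "(1 + norm \<xi>) ^ N * norm (fourier f \<xi>) \<le> (1 + ?n) ^ N * (B0 + (\<Sum>j\<in>UNIV. B j))" for \<xi>
  proof -
    define m where "m = Max (range (%j. \<bar>\<xi> $ j\<bar>))"
    have m: "\<bar>\<xi> $ j\<bar> \<le> m" for j unfolding m_def by (rule Max_ge) auto
    have "m \<in> range (%j. \<bar>\<xi> $ j\<bar>)" unfolding m_def by (rule Max_in) auto
    then obtain j where j: "m = \<bar>\<xi> $ j\<bar>" by auto
    have "norm \<xi> \<le> (\<Sum>j\<in>UNIV. \<bar>\<xi> $ j\<bar>)" by (rule norm_le_l1_cart)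
    also have "\<dots> \<le> (\<Sum>j\<in>(UNIV::'n set). max 1 m)" by (intro sum_mono) (use m in \<open>simp add: max.coboundedI2\<close>)
    finally have "1 + norm \<xi> \<le> (1 + ?n) * max 1 m" by (simp add: algebra_simps)
    then have "(1 + norm \<xi>) ^ N * norm (fourier f \<xi>) \<le> ((1 + ?n) * max 1 m) ^ N * norm (fourier f \<xi>)"
      by (intro mult_right_mono power_mono) auto
    also have "\<dots> = (1 + ?n) ^ N * (max 1 m ^ N * norm (fourier f \<xi>))" by (simp add: power_mult_distrib)
    also have "max 1 m ^ N * norm (fourier f \<xi>) \<le> B0 + (\<Sum>j\<in>UNIV. B j)"
    proof -
      have 0: "0 \<le> B j" "0 \<le> B0" for j unfolding B_def B0_def by auto
      have "norm (fourier f \<xi>) \<le> B0" unfolding B0_def by (rule fourier_norm_le)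
      moreover have "B j \<le> (\<Sum>j\<in>UNIV. B j)" using 0 by (intro member_le_sum) auto
      moreover have "0 \<le> (\<Sum>j\<in>UNIV. B j)" using 0 by (intro sum_nonneg) auto
      ultimately show ?thesis using bj[of \<xi> j] 0 j by (cases "m \<le> 1") (auto simp: max_def)
    qed
    finally show ?thesis by (simp add: mult_left_mono)
  qed
  then show "\<exists>C. \<forall>x. (1 + norm x) ^ N * norm (fourier f x) \<le> C" by (intro exI allI)
qed

text \<open>The second-order remainder of \<open>cis\<close> is at most the square of the phase, and
  Schwartz functions have finite second moments. This gives a quadratic error, hence the derivative,
  without interchanging a limit and an integral.\<close>

lemma fourier_has_derivative:
  fixes f :: "real^'n::finite => complex"
  assumes f: "schwartz f"
  shows "(fourier f has_derivative (%v. \<Sum>j\<in>UNIV. (v $ j) *\<^sub>R fourier (%x. (- 2 * pi * \<i>) * complex_of_real (x $ j) * f x) \<xi>)) (at \<xi>)"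
proof (rule has_derivative_quadratic)
  let ?g = "%j x. (- 2 * pi * \<i>) * complex_of_real (x $ j) * f x"
  show "bounded_linear (%v::real^'n. \<Sum>j\<in>UNIV. (v $ j) *\<^sub>R fourier (?g j) \<xi>)"
    by (intro bounded_linear_sum bounded_linear_scaleR_left[THEN bounded_linear_compose] bounded_linear_vec_nth)
  have g: "schwartz (?g j)" for j using f by (rule schwartz_coord_mult)
  have x2: "integrable lborel (%x. norm x ^ 2 * norm (f x))"
  proof -
    have "schwartz (%x. \<Sum>j\<in>UNIV. 1 * complex_of_real (x $ j) * (1 * complex_of_real (x $ j) * f x))"
      by (intro schwartz_sum schwartz_coord_mult f)
    from integrable_norm[OF schwartz_integrable[OF this]]
    have "integrable lborel (%x. norm (\<Sum>j\<in>UNIV. complex_of_real (x $ j) * (complex_of_real (x $ j) * f x)))" by simp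
    moreover have "norm (\<Sum>j\<in>UNIV. complex_of_real (x $ j) * (complex_of_real (x $ j) * f x)) = norm x ^ 2 * norm (f x)" for x
    proof -
      have "(\<Sum>j\<in>UNIV. complex_of_real (x $ j) * (complex_of_real (x $ j) * f x)) = complex_of_real (\<Sum>j\<in>UNIV. x $ j * x $ j) * f x"
        by (simp add: sum_distrib_left mult_ac)
      also have "(\<Sum>j\<in>UNIV. x $ j * x $ j) = norm x ^ 2" by (simp add: power2_norm_eq_inner inner_vec_def)
      finally show ?thesis by (simp add: norm_mult norm_power)
    qed
    ultimately show ?thesis by simp
  qed
  define K where "K = (2 * pi)\<^sup>2 * (LINT x|lborel. norm x ^ 2 * norm (f x))"
  fix v :: "real^'n"
  let ?e = "%\<xi> x. cis (- 2 * pi * (x \<bullet> \<xi>))"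
  have gi: "integrable lborel (%x. (v $ j) *\<^sub>R (?g j x * ?e \<xi> x))" for j
    by (intro integrable_scaleR_right schwartz_integrable schwartz_cis_mult g)
  have "(\<Sum>j\<in>UNIV. (v $ j) *\<^sub>R fourier (?g j) \<xi>) = (LINT x|lborel. (\<Sum>j\<in>UNIV. (v $ j) *\<^sub>R (?g j x * ?e \<xi> x)))"
    unfolding fourier_cis
    by (simp only: Bochner_Integration.integral_sum[OF gi] integral_scaleR_right)
  also have "\<dots> = (LINT x|lborel. f x * ?e \<xi> x * (\<i> * of_real (- 2 * pi * (x \<bullet> v))))"
    by (intro Bochner_Integration.integral_cong refl)
       (auto simp: inner_vec_def sum_distrib_left sum_distrib_right scaleR_conv_of_real sum_negf[symmetric] mult_ac intro!: sum.cong)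
  finally have D: "(\<Sum>j\<in>UNIV. (v $ j) *\<^sub>R fourier (?g j) \<xi>) = (LINT x|lborel. f x * ?e \<xi> x * (\<i> * of_real (- 2 * pi * (x \<bullet> v))))" .
  have i1: "integrable lborel (%x. f x * ?e w x)" for w
    by (intro schwartz_integrable schwartz_cis_mult f)
  have i2: "integrable lborel (%x. f x * ?e \<xi> x * (\<i> * of_real (- 2 * pi * (x \<bullet> v))))"
  proof -
    have "integrable lborel (%x. (\<Sum>j\<in>UNIV. (v $ j) *\<^sub>R (?g j x * ?e \<xi> x)))"
      by (intro Bochner_Integration.integrable_sum gi)
    moreover have "(%x. (\<Sum>j\<in>UNIV. (v $ j) *\<^sub>R (?g j x * ?e \<xi> x))) = (%x. f x * ?e \<xi> x * (\<i> * of_real (- 2 * pi * (x \<bullet> v))))"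
      by (auto simp: fun_eq_iff inner_vec_def sum_distrib_left sum_distrib_right scaleR_conv_of_real sum_negf[symmetric] mult_ac intro!: sum.cong)
    ultimately show ?thesis by simp
  qed
  have E: "fourier f (\<xi> + v) - fourier f \<xi> - (\<Sum>j\<in>UNIV. (v $ j) *\<^sub>R fourier (?g j) \<xi>)
     = (LINT x|lborel. f x * ?e (\<xi> + v) x - f x * ?e \<xi> x - f x * ?e \<xi> x * (\<i> * of_real (- 2 * pi * (x \<bullet> v))))"
    unfolding D unfolding fourier_cis using i1 i2 by simp
  have "norm (LINT x|lborel. f x * ?e (\<xi> + v) x - f x * ?e \<xi> x - f x * ?e \<xi> x * (\<i> * of_real (- 2 * pi * (x \<bullet> v)))) \<le> (LINT x|lborel. (2 * pi)\<^sup>2 * norm v ^ 2 * (norm x ^ 2 * norm (f x)))"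
  proof (rule order_trans[OF integral_norm_bound integral_mono])
    show "integrable lborel (%x. norm (f x * ?e (\<xi> + v) x - f x * ?e \<xi> x - f x * ?e \<xi> x * (\<i> * of_real (- 2 * pi * (x \<bullet> v)))))"
      using i1 i2 by (intro integrable_norm Bochner_Integration.integrable_diff)
    show "integrable lborel (%x. (2 * pi)\<^sup>2 * norm v ^ 2 * (norm x ^ 2 * norm (f x)))"
      using x2 by simp
    fix x :: "real^'n"
    let ?t = "- 2 * pi * (x \<bullet> v)"
    have "?e (\<xi> + v) x = ?e \<xi> x * cis ?t" by (simp add: cis_mult inner_add_right algebra_simps)
    then have *: "norm (f x * ?e (\<xi> + v) x - f x * ?e \<xi> x - f x * ?e \<xi> x * (\<i> * of_real ?t))
       = norm (f x) * norm (cis ?t - 1 - \<i> * of_real ?t)"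
    proof -
      assume a: "?e (\<xi> + v) x = ?e \<xi> x * cis ?t"
      have "f x * ?e (\<xi> + v) x - f x * ?e \<xi> x - f x * ?e \<xi> x * (\<i> * of_real ?t) = f x * ?e \<xi> x * (cis ?t - 1 - \<i> * of_real ?t)"
        unfolding a by (simp add: algebra_simps)
      then show ?thesis by (simp add: norm_mult)
    qed
    have "norm (cis ?t - 1 - \<i> * of_real ?t) \<le> ?t\<^sup>2"
    proof -
      have "norm (cis t - 1 - \<i> * of_real t) \<le> t\<^sup>2" for t
      proof -
        have "norm (cis t - (1 + \<i> * of_real t)) \<le> t\<^sup>2 / 2"
          using iexp_approx1[of t 1] by (simp add: cis_conv_exp power2_eq_square)
        also have "\<dots> \<le> t\<^sup>2" by simp
        finally show ?thesis by (simp add: diff_diff_eq)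
      qed
      then show ?thesis .
    qed
    also have "?t\<^sup>2 \<le> (2 * pi)\<^sup>2 * (norm x ^ 2 * norm v ^ 2)"
    proof -
      have "(x \<bullet> v)\<^sup>2 \<le> (norm x * norm v)\<^sup>2"
        using Cauchy_Schwarz_ineq2[of x v] by (metis abs_ge_zero power2_abs power_mono)
      then show ?thesis by (simp add: power_mult_distrib)
    qed
    finally have "norm (f x) * norm (cis ?t - 1 - \<i> * of_real ?t) \<le> norm (f x) * ((2 * pi)\<^sup>2 * (norm x ^ 2 * norm v ^ 2))"
      by (rule mult_left_mono) simp
    also have "\<dots> = (2 * pi)\<^sup>2 * norm v ^ 2 * (norm x ^ 2 * norm (f x))" by (simp only: mult_ac)
    finally show "norm (f x * ?e (\<xi> + v) x - f x * ?e \<xi> x - f x * ?e \<xi> x * (\<i> * of_real ?t)) \<le> (2 * pi)\<^sup>2 * norm v ^ 2 * (norm x ^ 2 * norm (f x))"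
      unfolding * .
  qed
  also have "\<dots> = K * norm v ^ 2" by (simp add: K_def)
  finally show "norm (fourier f (\<xi> + v) - fourier f \<xi> - (\<Sum>j\<in>UNIV. (v $ j) *\<^sub>R fourier (?g j) \<xi>)) \<le> K * norm v ^ 2" unfolding E .
qed

text \<open>A derivative of a transform is again the transform of a Schwartz function, so the image
  of the Schwartz class is a closed set as required, and its members all decay rapidly.\<close>

lemma schwartz_fourier:
  fixes f :: "real^'n::finite => complex"
  assumes f: "schwartz f"
  shows "schwartz (fourier f)"
  unfolding schwartz_iff
proof (rule smooth_classI[where X = "fourier ` Collect schwartz"])
  show "fourier f \<in> fourier ` Collect schwartz" using f by auto
  fix g :: "real^'n => complex" assume "g \<in> fourier ` Collect schwartz"
  then obtain h where g: "g = fourier h" and h: "schwartz h" by auto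
  show "g differentiable at x" for x unfolding g differentiable_def by (rule exI) (rule fourier_has_derivative[OF h])
  show "rapid g" unfolding g by (rule fourier_rapid[OF h])
  fix j
  have "partial j g = fourier (%x. (- 2 * pi * \<i>) * complex_of_real (x $ j) * h x)"
  proof
    fix \<xi>
    have "partial j g \<xi> = (\<Sum>i\<in>UNIV. (unit_vec j $ i) *\<^sub>R fourier (%x. (- 2 * pi * \<i>) * complex_of_real (x $ i) * h x) \<xi>)"
      unfolding g by (rule partial_eq[OF fourier_has_derivative[OF h]])
    also have "\<dots> = (\<Sum>i\<in>UNIV. if i = j then fourier (%x. (- 2 * pi * \<i>) * complex_of_real (x $ i) * h x) \<xi> else 0)"
      by (intro sum.cong refl) (simp add: unit_vec_def axis_def)
    also have "\<dots> = fourier (%x. (- 2 * pi * \<i>) * complex_of_real (x $ j) * h x) \<xi>" by simp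
    finally show "partial j g \<xi> = fourier (%x. (- 2 * pi * \<i>) * complex_of_real (x $ j) * h x) \<xi>" .
  qed
  then show "partial j g \<in> fourier ` Collect schwartz" using schwartz_coord_mult[OF h] by blast
qed

lemma poly_growth_mult: "poly_growth f ==> poly_growth g ==> poly_growth (%x. f x * g x)"
  unfolding poly_growth_def
proof (elim exE)
  fix C D N M assume *: "\<forall>x. norm (f x) \<le> C * (1 + norm x) ^ N" "\<forall>x. norm (g x) \<le> D * (1 + norm x) ^ M"
  have "norm (f x * g x) \<le> (C * D) * (1 + norm x) ^ (N + M)" for x
  proof -
    have "norm (f x) * norm (g x) \<le> (C * (1 + norm x) ^ N) * (D * (1 + norm x) ^ M)"
      using * by (intro mult_mono) (auto intro: order_trans[OF norm_ge_zero])
    then show ?thesis by (simp add: norm_mult power_add mult_ac)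
  qed
  then show "\<exists>C N. \<forall>x. norm (f x * g x) \<le> C * (1 + norm x) ^ N" by (intro exI allI)
qed

lemma slow_mult: "slow f ==> slow g ==> slow (%x. f x * g x)"
  by (rule smooth_class_mult[OF _ _ poly_growth_mult poly_growth_add])

lemma slow_add: "slow f ==> slow g ==> slow (%x. f x + g x)"
  by (rule smooth_class_add) (auto intro: poly_growth_add)

text \<open>Derivatives stay of the form slowly growing factor times the Gaussian, and the Gaussian
  beats every power of \<open>1 + norm x\<close> after completing a square.\<close>

lemma schwartz_gaussian:
  fixes c :: real assumes c: "c > 0"
  shows "schwartz (%x::real^'n::finite. complex_of_real (exp (- c * (x \<bullet> x))))"
proof -
  let ?G = "%x::real^'n. complex_of_real (exp (- c * (x \<bullet> x)))"
  let ?X = "{%x. p x * ?G x | p. slow p}"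
  have d: "(?G has_derivative (%y. of_real (- 2 * c * (x \<bullet> y)) * ?G x)) (at x)" for x
    by (auto intro!: derivative_eq_intros simp: inner_commute algebra_simps)
  have pG: "partial j ?G x = (- 2 * of_real c) * of_real (x $ j) * ?G x" for j x
    using partial_eq[OF d, of j x] by (simp add: unit_vec_def inner_axis)
  have rG: "rapid ?G"
    unfolding rapid_def
  proof
    fix N :: nat
    have "(1 + norm x) ^ N * norm (?G x) \<le> exp (real N ^ 2 / (4 * c))" for x
    proof -
      have "(1 + norm x) ^ N \<le> exp (norm x) ^ N" by (intro power_mono) (auto simp: add_nonneg_nonneg)
      also have "\<dots> = exp (real N * norm x)" by (simp add: exp_of_nat_mult)
      finally have "(1 + norm x) ^ N * norm (?G x) \<le> exp (real N * norm x) * exp (- c * (x \<bullet> x))"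
        by (simp add: mult_right_mono)
      also have "\<dots> = exp (real N * norm x - c * norm x ^ 2)" by (simp add: mult_exp_exp power2_norm_eq_inner)
      also have "real N * norm x - c * norm x ^ 2 \<le> real N ^ 2 / (4 * c)"
      proof -
        have "0 \<le> (2 * c * norm x - real N)\<^sup>2" by simp
        then show ?thesis using c by (simp add: field_simps power2_eq_square)
      qed
      finally show ?thesis by simp
    qed
    then show "\<exists>C. \<forall>x. (1 + norm x) ^ N * norm (?G x) \<le> C" by (intro exI allI)
  qed
  have c1: "slow (%x. 1)" by (rule bsmooth_slow[OF bsmooth_const])
  show ?thesis
    unfolding schwartz_iff
  proof (rule smooth_classI[where X = ?X])
    show "?G \<in> ?X" using c1 by force
    fix g assume "g \<in> ?X"
    then obtain p where g: "g = (%x. p x * ?G x)" and p: "slow p" by blast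
    have Gd: "?G differentiable at x" for x unfolding differentiable_def by (rule exI) (rule d)
    have pd: "p differentiable at x" for x by (rule smooth_classD(2)[OF p])
    show "g differentiable at x" for x unfolding g by (rule differentiable_mult[OF pd Gd])
    show "rapid g" using rapid_mult_poly_growth[OF rG smooth_classD(1)[OF p]] unfolding g by (simp add: mult.commute)
    fix j
    have "partial j g = (%x. (partial j p x + p x * ((- 2 * of_real c) * of_real (x $ j))) * ?G x)"
    proof
      fix x show "partial j g x = (partial j p x + p x * ((- 2 * of_real c) * of_real (x $ j))) * ?G x"
        unfolding g partial_mult[OF pd Gd] pG by (simp add: algebra_simps)
    qed
    moreover have "slow (%x. partial j p x + p x * ((- 2 * of_real c) * of_real (x $ j)))"
      by (intro slow_add slow_mult p smooth_class_partial slow_coord)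
    ultimately show "partial j g \<in> ?X" unfolding mem_Collect_eq by (intro exI conjI)
  qed
qed

text \<open>A rescaling of the characteristic function of the standard normal law, which is
  available from probability theory.\<close>

lemma gaussian_fourier_1d:
  assumes s: "s > 0"
  shows "integrable lborel (%x. complex_of_real (exp (- (s * x)\<^sup>2 / 2)) * cis (t * x))"
    and "(LINT x|lborel. complex_of_real (exp (- (s * x)\<^sup>2 / 2)) * cis (t * x)) = of_real (sqrt (2 * pi) / s * exp (- (t / s)\<^sup>2 / 2))"
proof -
  let ?f = "%u x. complex_of_real (exp (- x\<^sup>2 / 2)) * cis (u * x)"
  have n: "complex_of_real (exp (- x\<^sup>2 / 2)) * cis (u * x) = sqrt (2 * pi) * (complex_of_real (std_normal_density x) * cis (u * x))" for u x
    by (simp add: std_normal_density_def)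
  have i0: "integrable lborel (%x. complex_of_real (std_normal_density x) * cis (u * x))" for u
  proof (rule Bochner_Integration.integrable_bound[where f = "%x. std_normal_density x"])
    show "integrable lborel std_normal_density" using integrable_std_normal_moment[of 0] by simp
    show "(%x. complex_of_real (std_normal_density x) * cis (u * x)) \<in> borel_measurable lborel"
      unfolding cis_conv_exp by measurable
  qed (simp add: norm_mult)
  have v: "(LINT x|lborel. complex_of_real (std_normal_density x) * cis (u * x)) = of_real (exp (- (u\<^sup>2) / 2))" for u
  proof -
    have "char std_normal_distribution u = (LINT x|lborel. std_normal_density x *\<^sub>R iexp (u * x))"
      unfolding char_def by (subst integral_density) (auto simp: normal_density_nonneg)
    then show ?thesis by (simp add: char_std_normal_distribution scaleR_conv_of_real cis_conv_exp)
  qed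
  have i1: "integrable lborel (?f u)" for u unfolding n by (intro integrable_mult_right i0)
  have v1: "(LINT x|lborel. ?f u x) = sqrt (2 * pi) * of_real (exp (- (u\<^sup>2) / 2))" for u
    unfolding n by (simp add: v)
  have e: "?f (t / s) (0 + s * x) = complex_of_real (exp (- (s * x)\<^sup>2 / 2)) * cis (t * x)" for x
    using s by simp
  show "integrable lborel (%x. complex_of_real (exp (- (s * x)\<^sup>2 / 2)) * cis (t * x))"
    using lborel_integrable_real_affine[OF i1[of "t / s"], of s 0] s unfolding e by simp
  have "(LINT x|lborel. ?f (t / s) x) = \<bar>s\<bar> *\<^sub>R (LINT x|lborel. ?f (t / s) (0 + s * x))"
    by (rule lborel_integral_real_affine) (use s in simp)
  then show "(LINT x|lborel. complex_of_real (exp (- (s * x)\<^sup>2 / 2)) * cis (t * x)) = of_real (sqrt (2 * pi) / s * exp (- (t / s)\<^sup>2 / 2))"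
    unfolding v1 e using s by (simp add: scaleR_conv_of_real field_simps)
qed

lemma cis_sum: "finite A ==> cis (\<Sum>j\<in>A. f j) = (\<Prod>j\<in>A. cis (f j))"
  by (induction A rule: finite_induct) (auto simp: cis_mult[symmetric])

lemma cis_inner: "cis (c * (x \<bullet> (y::real^'n::finite))) = (\<Prod>j\<in>UNIV. cis (c * x $ j * y $ j))"
  unfolding inner_vec_def sum_distrib_left by (simp add: cis_sum mult_ac)

lemma cis_measurable [measurable]: "cis \<in> borel_measurable borel"
  unfolding cis_conv_exp by measurable

lemma vec_nth_measurable [measurable]: "(%x::('a::euclidean_space)^'n::finite. x $ j) \<in> borel \<rightarrow>\<^sub>M borel"
  by (intro borel_measurable_continuous_onI continuous_intros)

text \<open>Inversion at the origin. The integral is regularised by a Gaussian of width 1/s. Fubini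
  moves the transform onto the Gaussian, and rescaling by s/(2 pi) turns the other side into the
  mean of f(s z/(2 pi)) against the standard normal density in z. As s tends to 0 both sides
  converge by domination. Inversion at other points follows by translation.\<close>

lemma fourier_integral_zero:
  fixes f :: "real^'n::finite => complex"
  assumes f: "schwartz f"
  shows "(LINT \<xi>|lborel. fourier f \<xi>) = f 0"
proof -
  let ?G = "%s \<xi>. \<Prod>j\<in>UNIV. complex_of_real (exp (- (s * \<xi> $ j)\<^sup>2 / 2))"
  let ?N = "%z. \<Prod>j\<in>UNIV. std_normal_density (z $ j)"
  have fm [measurable]: "f \<in> borel_measurable borel" using f by measurable
  have Fm [measurable]: "fourier f \<in> borel_measurable borel" using schwartz_fourier[OF f] by measurable
  have Fi: "integrable lborel (fourier f)" by (intro schwartz_integrable schwartz_fourier f)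
  have fi: "integrable lborel f" by (intro schwartz_integrable f)
  obtain B where B: "\<And>x. norm (f x) \<le> B" using schwartz_bounded[OF f] by blast
  have Gi: "integrable lborel (?G s)" if "s > 0" for s
  proof (rule integrable_prod_vec[where f = "%j x. complex_of_real (exp (- (s * x)\<^sup>2 / 2))"])
    show "integrable lborel (%x. complex_of_real (exp (- (s * x)\<^sup>2 / 2)))"
      using gaussian_fourier_1d(1)[OF that, of 0] by simp
  qed
  have ni: "integrable lborel std_normal_density" using integrable_std_normal_moment[of 0] by simp
  have Ni: "integrable lborel (?N :: real^'n => real)" by (rule integrable_prod_vec[OF ni])
  have NI: "(LINT z|lborel. ?N (z::real^'n)) = 1"
    using integral_prod_vec[of "%(j::'n). std_normal_density", OF ni] integral_std_normal_moment_even[of 0] by simp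
  have FG: "(LINT y|lborel. ?G s y * cis (- 2 * pi * (x \<bullet> y))) = (\<Prod>j\<in>UNIV. of_real (sqrt (2 * pi) / s * exp (- (2 * pi * x $ j / s)\<^sup>2 / 2)))"
    if "s > 0" for s and x :: "real^'n"
  proof -
    have "(LINT y|lborel. ?G s y * cis (- 2 * pi * (x \<bullet> y))) = (LINT y|lborel. (\<Prod>j\<in>UNIV. complex_of_real (exp (- (s * y $ j)\<^sup>2 / 2)) * cis ((- 2 * pi * x $ j) * y $ j)))"
      unfolding cis_inner by (simp add: prod.distrib)
    also have "\<dots> = (\<Prod>j\<in>UNIV. LINT y|lborel. complex_of_real (exp (- (s * y)\<^sup>2 / 2)) * cis ((- 2 * pi * x $ j) * y))"
      by (rule integral_prod_vec) (rule gaussian_fourier_1d(1)[OF that])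
    also have "\<dots> = (\<Prod>j\<in>UNIV. of_real (sqrt (2 * pi) / s * exp (- (2 * pi * x $ j / s)\<^sup>2 / 2)))"
      by (intro prod.cong refl, subst gaussian_fourier_1d(2)[OF that]) (simp add: power_divide power_mult_distrib)
    finally show ?thesis .
  qed
  have eq: "(LINT \<xi>|lborel. fourier f \<xi> * ?G s \<xi>) = (LINT z|lborel. f ((s / (2 * pi)) *\<^sub>R z) * of_real (?N z))" if s: "s > 0" for s
  proof -
    have "(LINT \<xi>|lborel. fourier f \<xi> * ?G s \<xi>) = (LINT \<xi>|lborel. LINT x|lborel. ?G s \<xi> * f x * cis (- 2 * pi * (x \<bullet> \<xi>)))"
      unfolding fourier_cis by (simp add: mult_ac flip: integral_mult_left_zero integral_mult_right_zero)
    also have "\<dots> = (LINT x|lborel. LINT \<xi>|lborel. ?G s \<xi> * f x * cis (- 2 * pi * (x \<bullet> \<xi>)))"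
      by (rule Fubini_mult[where B = 1]) (use Gi[OF s] fi in \<open>auto simp: sigma_finite_lborel\<close>)
    also have "\<dots> = (LINT x|lborel. f x * (\<Prod>j\<in>UNIV. of_real (sqrt (2 * pi) / s * exp (- (2 * pi * x $ j / s)\<^sup>2 / 2))))"
    proof -
      have "(LINT \<xi>|lborel. ?G s \<xi> * f x * cis (- 2 * pi * (x \<bullet> \<xi>))) = f x * (LINT \<xi>|lborel. ?G s \<xi> * cis (- 2 * pi * (x \<bullet> \<xi>)))" for x
        by (subst integral_mult_right_zero[symmetric]) (simp only: mult_ac)
      then show ?thesis by (simp only: FG[OF s])
    qed
    also have "\<dots> = (\<Prod>j\<in>(UNIV::'n set). \<bar>s / (2 * pi)\<bar>) *\<^sub>R (LINT z|lborel. f (0 + (\<chi> j. s / (2 * pi) * z $ j)) * (\<Prod>j\<in>UNIV. of_real (sqrt (2 * pi) / s * exp (- (2 * pi * (0 + (\<chi> j. s / (2 * pi) * z $ j)) $ j / s)\<^sup>2 / 2))))"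
      by (rule integral_diag) (use s in \<open>auto\<close>)
    also have "\<dots> = (LINT z|lborel. f ((s / (2 * pi)) *\<^sub>R z) * of_real (?N z))"
    proof -
      have 1: "(\<Prod>j\<in>(UNIV::'n set). \<bar>s / (2 * pi)\<bar>) *\<^sub>R (f (0 + (\<chi> j. s / (2 * pi) * z $ j)) * (\<Prod>j\<in>UNIV. of_real (sqrt (2 * pi) / s * exp (- (2 * pi * (0 + (\<chi> j. s / (2 * pi) * z $ j)) $ j / s)\<^sup>2 / 2))))
        = f ((s / (2 * pi)) *\<^sub>R z) * of_real (?N z)" for z :: "real^'n"
      proof -
        have v: "0 + (\<chi> j. s / (2 * pi) * z $ j) = (s / (2 * pi)) *\<^sub>R z" by (simp add: vec_eq_iff)
        have gen: "P *\<^sub>R (c * complex_of_real Q) = c * complex_of_real (P * Q)" for P Q c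
          by (simp add: scaleR_conv_of_real)
        have "\<bar>s / (2 * pi)\<bar> * (sqrt (2 * pi) / s * exp (- (2 * pi * (s / (2 * pi) * z $ j) / s)\<^sup>2 / 2)) = std_normal_density (z $ j)" for j
        proof -
          have "sqrt (2 * pi) / (2 * pi) = 1 / sqrt (2 * pi)"
            using real_sqrt_mult_self[of "2 * pi"] pi_gt_zero by (simp add: field_simps)
          then show ?thesis using s by (simp add: std_normal_density_def field_simps)
        qed
        then have "(\<Prod>j\<in>(UNIV::'n set). \<bar>s / (2 * pi)\<bar>) * (\<Prod>j\<in>UNIV. (sqrt (2 * pi) / s * exp (- (2 * pi * (s / (2 * pi) * z $ j) / s)\<^sup>2 / 2))) = ?N z"
          by (subst prod.distrib[symmetric], intro prod.cong refl)
        then show ?thesis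
          by (simp only: v vector_scaleR_component real_scaleR_def of_real_prod[symmetric] gen)
      qed
      show ?thesis unfolding integral_scaleR_right[symmetric] 1 ..
    qed
    finally show ?thesis .
  qed
  let ?s = "%k. 1 / real (Suc k)"
  have s0: "?s \<longlonglongrightarrow> 0" by (rule LIMSEQ_Suc[OF lim_1_over_n])
  have "(%k. LINT \<xi>|lborel. fourier f \<xi> * ?G (?s k) \<xi>) \<longlonglongrightarrow> (LINT \<xi>|lborel. fourier f \<xi>)"
  proof (rule integral_dominated_convergence[where w = "%\<xi>. norm (fourier f \<xi>)"])
    show "AE x in lborel. (%k. fourier f x * ?G (?s k) x) \<longlonglongrightarrow> fourier f x"
    proof (rule AE_I2)
      fix x :: "real^'n"
      have "(%k. fourier f x * ?G (?s k) x) \<longlonglongrightarrow> fourier f x * (\<Prod>j\<in>UNIV. complex_of_real (exp (- (0 * x $ j)\<^sup>2 / 2)))"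
        by (intro tendsto_intros s0) auto
      then show "(%k. fourier f x * ?G (?s k) x) \<longlonglongrightarrow> fourier f x" by simp
    qed
    show "AE x in lborel. norm (fourier f x * ?G (?s k) x) \<le> norm (fourier f x)" for k
      by (intro AE_I2) (auto simp: norm_mult prod_norm[symmetric] intro!: mult_left_le prod_le_1)
  qed (use Fi in auto)
  moreover have "(%k. LINT \<xi>|lborel. fourier f \<xi> * ?G (?s k) \<xi>) = (%k. LINT z|lborel. f ((?s k / (2 * pi)) *\<^sub>R z) * of_real (?N z))"
    by (rule ext) (rule eq, simp)
  moreover have "(%k. LINT z|lborel. f ((?s k / (2 * pi)) *\<^sub>R z) * of_real (?N z)) \<longlonglongrightarrow> (LINT z|lborel. f 0 * of_real (?N (z::real^'n)))"
  proof (rule integral_dominated_convergence[where w = "%z::real^'n. B * ?N z"])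
    show "AE x in lborel. (%k. f ((?s k / (2 * pi)) *\<^sub>R x) * of_real (?N x)) \<longlonglongrightarrow> f 0 * of_real (?N x)"
    proof (intro AE_I2 tendsto_intros)
      fix x :: "real^'n"
      have "(%k. (?s k / (2 * pi)) *\<^sub>R x) \<longlonglongrightarrow> (0 / (2 * pi)) *\<^sub>R x" by (intro tendsto_intros s0) auto
      then have "(%k. (?s k / (2 * pi)) *\<^sub>R x) \<longlonglongrightarrow> 0" by simp
      moreover have "isCont f 0" using schwartz_continuous[OF f, of UNIV] by (simp add: continuous_on_eq_continuous_at)
      ultimately show "(%k. f ((?s k / (2 * pi)) *\<^sub>R x)) \<longlonglongrightarrow> f 0" by (rule isCont_tendsto_compose[rotated])
    qed
    show "AE x in lborel. norm (f ((?s k / (2 * pi)) *\<^sub>R x) * of_real (?N x)) \<le> B * ?N x" for k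
    proof (rule AE_I2)
      fix x :: "real^'n"
      have "0 \<le> ?N x" by (intro prod_nonneg) (auto simp: normal_density_nonneg)
      then show "norm (f ((?s k / (2 * pi)) *\<^sub>R x) * of_real (?N x)) \<le> B * ?N x"
        unfolding norm_mult norm_of_real using B by (simp add: mult_right_mono)
    qed
    show "integrable lborel (%z::real^'n. B * ?N z)" using Ni by (rule integrable_mult_right)
  qed (auto)
  moreover have "(LINT z|lborel. f 0 * complex_of_real (?N (z::real^'n))) = f 0"
  proof -
    have "(LINT z|lborel. f 0 * complex_of_real (?N (z::real^'n))) = f 0 * of_real (LINT z|lborel. ?N (z::real^'n))"
      by (simp only: integral_mult_right_zero integral_complex_of_real)
    then show ?thesis by (simp only: NI) simp
  qed
  ultimately show ?thesis by (simp only: LIMSEQ_unique)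
qed

lemma fourier_translate:
  assumes f: "f \<in> borel_measurable borel"
  shows "fourier (%y. f (x + y)) \<xi> = cis (2 * pi * (x \<bullet> \<xi>)) * fourier f \<xi>"
proof -
  have "fourier f \<xi> = (LINT y|lborel. f (x + y) * cis (- 2 * pi * ((x + y) \<bullet> \<xi>)))"
    unfolding fourier_cis using f by (subst integral_translate[of _ x]) auto
  also have "\<dots> = (LINT y|lborel. cis (- 2 * pi * (x \<bullet> \<xi>)) * (f (x + y) * cis (- 2 * pi * (y \<bullet> \<xi>))))"
    by (intro Bochner_Integration.integral_cong refl) (simp add: inner_add_left cis_mult algebra_simps)
  also have "\<dots> = cis (- 2 * pi * (x \<bullet> \<xi>)) * fourier (%y. f (x + y)) \<xi>"
    by (simp add: fourier_cis)
  finally show ?thesis by (simp add: cis_mult mult.assoc[symmetric])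
qed

lemma fourier_inversion:
  fixes f :: "real^'n::finite => complex"
  assumes f: "schwartz f"
  shows "f x = (LINT \<xi>|lborel. fourier f \<xi> * cis (2 * pi * (x \<bullet> \<xi>)))"
proof -
  have "schwartz (%y. f (x + y))"
    using schwartz_affine[OF f, of "%_. 1" x] by simp
  from fourier_integral_zero[OF this] show ?thesis
    using f by (simp add: fourier_translate mult.commute schwartz_measurable)
qed

lemma fourier_modulate: "fourier (%x. f x * cis (2 * pi * (x \<bullet> v))) \<xi> = fourier f (\<xi> - v)"
  unfolding fourier_cis
  by (intro Bochner_Integration.integral_cong refl)
     (simp add: mult.assoc cis_mult inner_diff_right algebra_simps)

lemma fourier_add:
  "schwartz f ==> schwartz g ==> fourier (%x. f x + g x) \<xi> = fourier f \<xi> + fourier g \<xi>"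
  unfolding fourier_cis distrib_right
  by (intro Bochner_Integration.integral_add schwartz_integrable schwartz_cis_mult)

lemma fourier_cmult: "fourier (%x. c * f x) \<xi> = c * fourier f \<xi>"
  unfolding fourier_cis mult.assoc by simp

lemma fourier_sum:
  "(\<And>k. k \<in> I ==> schwartz (f k)) ==> fourier (%x. \<Sum>k\<in>I. f k x) \<xi> = (\<Sum>k\<in>I. fourier (f k) \<xi>)"
proof (induction I rule: infinite_finite_induct)
  case (insert k I)
  then have "fourier (%x. f k x + (\<Sum>k\<in>I. f k x)) \<xi> = fourier (f k) \<xi> + fourier (%x. \<Sum>k\<in>I. f k x) \<xi>"
    by (intro fourier_add schwartz_sum) auto
  then show ?case using insert by simp
qed (auto simp: fourier_def)

section \<open>Fourier multipliers and the multilinear form\<close>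

text \<open>The inverse transform is written as the forward transform at \<open>- x\<close>, so that
  the Schwartz property is inherited from \<open>schwartz_fourier\<close> through a
  reflection.\<close>

definition fmult :: "(real^'n::finite => complex) => (real^'n => complex) => real^'n => complex" where
  "fmult a f x = fourier (%\<xi>. a \<xi> * fourier f \<xi>) (- x)"

lemma
  fixes f :: "real^'n::finite => complex"
  assumes a: "bsmooth a" and f: "schwartz f"
  shows schwartz_fmult: "schwartz (fmult a f)"
    and fourier_fmult: "fourier (fmult a f) \<xi> = a \<xi> * fourier f \<xi>"
proof -
  let ?g = "%\<xi>. a \<xi> * fourier f \<xi>"
  have g: "schwartz ?g"
    using schwartz_mult_bsmooth[OF schwartz_fourier[OF f] a] by (simp add: mult.commute)
  have neg: "(\<chi> j. - 1 * x $ j) = - x" for x :: "real^'n" by (simp add: vec_eq_iff)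
  have "schwartz (%x. fourier ?g (0 + (\<chi> j. - 1 * x $ j)))"
    by (rule schwartz_affine[OF schwartz_fourier[OF g]]) simp
  then show s: "schwartz (fmult a f)" unfolding neg fmult_def[abs_def] by simp
  have "(LINT x|lborel. fourier ?g (- x) * cis (- 2 * pi * (x \<bullet> \<xi>))) = (LINT x|lborel. fourier ?g x * cis (2 * pi * (x \<bullet> \<xi>)))"
  proof -
    have [measurable]: "fourier ?g \<in> borel_measurable borel" using schwartz_fourier[OF g] by measurable
    show ?thesis
      by (subst (2) integral_diag[where l = "%_. - 1" and a = 0]) (auto simp: neg[simplified])
  qed
  then show "fourier (fmult a f) \<xi> = a \<xi> * fourier f \<xi>"
    using fourier_inversion[OF g, of \<xi>] unfolding fmult_def fourier_cis[of "%x. fourier ?g (- x)"]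
    by (simp add: inner_commute)
qed

lemma bounded_fn_const [simp]: "bounded_fn (%_. c)"
  unfolding bounded_fn_def by blast

definition diagonal :: "real^'n^'n::finite => real^'n" where
  "diagonal \<tau> = (\<chi> j. \<tau> $ j $ j)"

definition Fprod :: "('n::finite => real^'n => complex) => real^'n^'n => complex" where
  "Fprod F \<tau> = (\<Prod>j\<in>UNIV. fourier (F j) (\<tau> $ j))"

definition Fker :: "(real^'n::finite => complex) => ('n => real^'n => complex) => real^'n^'n => complex" where
  "Fker F0 F \<tau> = fourier F0 (- (\<Sum>j\<in>UNIV. \<tau> $ j)) * Fprod F \<tau>"

lemma Lambda_m_eq: "Lambda_m m F0 F = (LINT \<tau>|lborel. Fker F0 F \<tau> * m (diagonal \<tau>))"
  unfolding Lambda_m_def Fker_def Fprod_def diagonal_def ..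

lemma diagonal_measurable [measurable]: "diagonal \<in> borel \<rightarrow>\<^sub>M borel"
  unfolding diagonal_def by (intro borel_measurable_continuous_onI continuous_intros)

lemma fourier_measurable: "schwartz f ==> fourier f \<in> borel_measurable borel"
  using schwartz_fourier schwartz_measurable by blast

lemma Fprod_integrable:
  assumes F: "\<And>j. schwartz (F j)"
  shows "integrable lborel (Fprod F)"
  unfolding Fprod_def by (intro integrable_prod_vec schwartz_integrable schwartz_fourier F)

lemma Fker_measurable:
  assumes F0: "schwartz F0" and F: "\<And>j. schwartz (F j)"
  shows "Fker F0 F \<in> borel_measurable borel"
proof -
  have [measurable]: "fourier F0 \<in> borel_measurable borel" "\<And>j. fourier (F j) \<in> borel_measurable borel"
    using F0 F by (auto intro: fourier_measurable)
  show ?thesis unfolding Fker_def Fprod_def by measurable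
qed

lemma Fker_integrable:
  assumes F0: "schwartz F0" and F: "\<And>j. schwartz (F j)"
  shows "integrable lborel (Fker F0 F)"
proof -
  obtain B where B: "\<And>x. norm (fourier F0 x) \<le> B" using schwartz_bounded[OF schwartz_fourier[OF F0]] by blast
  show ?thesis
  proof (rule Bochner_Integration.integrable_bound[where f = "%\<tau>. of_real B * Fprod F \<tau>"])
    show "integrable lborel (%\<tau>. of_real B * Fprod F \<tau>)" by (intro integrable_mult_right Fprod_integrable F)
    show "Fker F0 F \<in> borel_measurable lborel" using Fker_measurable[OF F0 F] by simp
    have "0 \<le> B" using B[of 0] norm_ge_zero order_trans by blast
    then show "AE \<tau> in lborel. norm (Fker F0 F \<tau>) \<le> norm (of_real B * Fprod F \<tau>)"
      using B by (intro AE_I2) (simp add: Fker_def norm_mult mult_right_mono)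
  qed
qed

lemma Fker_mult_integrable:
  assumes F0: "schwartz F0" and F: "\<And>j. schwartz (F j)"
    and m: "m \<in> borel_measurable borel" and B: "bounded_fn m"
  shows "integrable lborel (%\<tau>. Fker F0 F \<tau> * m (diagonal \<tau>))"
proof -
  obtain C where C: "\<And>x. norm (m x) \<le> C" using B unfolding bounded_fn_def by blast
  note [measurable] = m Fker_measurable[OF F0 F]
  have "0 \<le> C" using C[of undefined] norm_ge_zero order_trans by blast
  show ?thesis
  proof (rule Bochner_Integration.integrable_bound[where f = "%\<tau>. of_real C * Fker F0 F \<tau>"])
    show "integrable lborel (%\<tau>. of_real C * Fker F0 F \<tau>)" by (intro integrable_mult_right Fker_integrable F0 F)
    show "AE \<tau> in lborel. norm (Fker F0 F \<tau> * m (diagonal \<tau>)) \<le> norm (of_real C * Fker F0 F \<tau>)"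
      using C \<open>0 \<le> C\<close> by (intro AE_I2) (simp add: norm_mult mult.commute[of C] mult_left_mono)
  qed simp
qed

text \<open>Writing out the transform of \<open>F0\<close> exposes an outer integral over x; for
  fixed x the inner integral is the multilinear operator dual to the form. This is the bridge to
  \<open>Lambda_n\<close>, which is defined pointwise in x.\<close>

lemma Lambda_m_physical:
  assumes F0: "schwartz F0" and F: "\<And>j. schwartz (F j)"
    and m: "m \<in> borel_measurable borel" and B: "bounded_fn m"
  shows "Lambda_m m F0 F = (LINT x|lborel. F0 x * (LINT \<tau>|lborel. Fprod F \<tau> * cis (2 * pi * (x \<bullet> (\<Sum>j\<in>UNIV. \<tau> $ j))) * m (diagonal \<tau>)))"
proof -
  obtain C where C: "\<And>x. norm (m x) \<le> C" using B unfolding bounded_fn_def by blast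
  note [measurable] = m
  let ?h = "%\<tau> x. cis (2 * pi * (x \<bullet> (\<Sum>j\<in>UNIV. \<tau> $ j))) * m (diagonal \<tau>)"
  have "Lambda_m m F0 F = (LINT \<tau>|lborel. LINT x|lborel. Fprod F \<tau> * F0 x * ?h \<tau> x)"
    unfolding Lambda_m_eq
  proof (intro Bochner_Integration.integral_cong refl)
    fix \<tau> :: "real^'a^'a"
    have "Fker F0 F \<tau> * m (diagonal \<tau>) = (Fprod F \<tau> * m (diagonal \<tau>)) * fourier F0 (- (\<Sum>j\<in>UNIV. \<tau> $ j))"
      by (simp add: Fker_def)
    also have "\<dots> = (LINT x|lborel. (Fprod F \<tau> * m (diagonal \<tau>)) * (F0 x * cis (2 * pi * (x \<bullet> (\<Sum>j\<in>UNIV. \<tau> $ j)))))"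
      unfolding fourier_cis by simp
    finally show "Fker F0 F \<tau> * m (diagonal \<tau>) = (LINT x|lborel. Fprod F \<tau> * F0 x * ?h \<tau> x)"
      by (simp add: mult_ac)
  qed
  also have "\<dots> = (LINT x|lborel. LINT \<tau>|lborel. Fprod F \<tau> * F0 x * ?h \<tau> x)"
    by (rule Fubini_mult[where B = C])
       (use C Fprod_integrable[OF F] schwartz_integrable[OF F0] in \<open>auto simp: norm_mult sigma_finite_lborel\<close>)
  also have "\<dots> = (LINT x|lborel. F0 x * (LINT \<tau>|lborel. Fprod F \<tau> * cis (2 * pi * (x \<bullet> (\<Sum>j\<in>UNIV. \<tau> $ j))) * m (diagonal \<tau>)))"
    by (subst integral_mult_right_zero[symmetric]) (simp only: mult_ac)
  finally show ?thesis .
qed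

lemma Fprod_integral_product:
  assumes F: "\<And>j. schwartz (F j)" and k: "\<And>j. k j \<in> borel_measurable borel" "\<And>j. bounded_fn (k j)"
  shows "(LINT \<tau>|lborel. Fprod F \<tau> * cis (2 * pi * (x \<bullet> (\<Sum>j\<in>UNIV. \<tau> $ j))) * (\<Prod>j\<in>UNIV. k j (\<tau> $ j)))
    = (\<Prod>j\<in>UNIV. LINT \<xi>|lborel. fourier (F j) \<xi> * cis (2 * pi * (x \<bullet> \<xi>)) * k j \<xi>)"
    and "\<And>j. integrable lborel (%\<xi>. fourier (F j) \<xi> * cis (2 * pi * (x \<bullet> \<xi>)) * k j \<xi>)"
proof -
  show i: "integrable lborel (%\<xi>. fourier (F j) \<xi> * cis (2 * pi * (x \<bullet> \<xi>)) * k j \<xi>)" for j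
  proof -
    obtain C where C: "\<And>x. norm (k j x) \<le> C" using k(2)[of j] unfolding bounded_fn_def by blast
    have "0 \<le> C" using C[of undefined] norm_ge_zero order_trans by blast
    note [measurable] = k(1)[of j] fourier_measurable[OF F, of j]
    show ?thesis
    proof (rule Bochner_Integration.integrable_bound[where f = "%\<xi>. of_real C * fourier (F j) \<xi>"])
      show "integrable lborel (%\<xi>. of_real C * fourier (F j) \<xi>)" by (intro integrable_mult_right schwartz_integrable schwartz_fourier F)
      show "AE \<xi> in lborel. norm (fourier (F j) \<xi> * cis (2 * pi * (x \<bullet> \<xi>)) * k j \<xi>) \<le> norm (of_real C * fourier (F j) \<xi>)"
        using C \<open>0 \<le> C\<close> by (intro AE_I2) (simp add: norm_mult mult.commute[of C] mult_left_mono)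
    qed simp
  qed
  have "Fprod F \<tau> * cis (2 * pi * (x \<bullet> (\<Sum>j\<in>UNIV. \<tau> $ j))) * (\<Prod>j\<in>UNIV. k j (\<tau> $ j))
     = (\<Prod>j\<in>UNIV. fourier (F j) (\<tau> $ j) * cis (2 * pi * (x \<bullet> (\<tau> $ j))) * k j (\<tau> $ j))" for \<tau> :: "real^'a^'a"
    unfolding Fprod_def inner_sum_right sum_distrib_left by (simp add: cis_sum prod.distrib)
  then show "(LINT \<tau>|lborel. Fprod F \<tau> * cis (2 * pi * (x \<bullet> (\<Sum>j\<in>UNIV. \<tau> $ j))) * (\<Prod>j\<in>UNIV. k j (\<tau> $ j)))
    = (\<Prod>j\<in>UNIV. LINT \<xi>|lborel. fourier (F j) \<xi> * cis (2 * pi * (x \<bullet> \<xi>)) * k j \<xi>)"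
    by (simp only: integral_prod_vec[OF i])
qed

lemma Lambda_m_one:
  assumes F0: "schwartz F0" and F: "\<And>j. schwartz (F j)"
  shows "Lambda_m (%_. 1) F0 F = (LINT x|lborel. F0 x * (\<Prod>j\<in>UNIV. F j x))"
proof -
  have "(LINT \<tau>|lborel. Fprod F \<tau> * cis (2 * pi * (x \<bullet> (\<Sum>j\<in>UNIV. \<tau> $ j)))) = (\<Prod>j\<in>UNIV. F j x)" for x
    using Fprod_integral_product(1)[of F "%_ _. 1" x, OF F]
    by (simp add: fourier_inversion[OF F, of _ x])
  then show ?thesis
    using Lambda_m_physical[OF F0 F, of "%_. 1"] by simp
qed

definition dil :: "('n::finite => real) => real^'n => real^'n" where
  "dil l x = (\<chi> j. l j * x $ j)"

lemma dil_nth [simp]: "dil l x $ j = l j * x $ j" by (simp add: dil_def)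

lemma dil_measurable [measurable]: "dil l \<in> borel \<rightarrow>\<^sub>M borel"
  unfolding dil_def by (intro borel_measurable_continuous_onI continuous_intros)

lemma schwartz_dil: "schwartz f ==> (\<And>j. l j \<noteq> 0) ==> schwartz (%x. f (dil l x))"
  using schwartz_affine[of f l 0] by (simp add: dil_def)

lemma integral_dil:
  fixes f :: "real^'n::finite => 'b::{banach, second_countable_topology}"
  assumes "\<And>j. l j \<noteq> 0" "f \<in> borel_measurable borel"
  shows "(LINT x|lborel. f x) = (\<Prod>j\<in>UNIV. \<bar>l j\<bar>) *\<^sub>R (LINT x|lborel. f (dil l x))"
  using integral_diag[of l f 0] assms by (simp add: dil_def)

lemma fourier_dil:
  assumes l: "\<And>j. l j \<noteq> 0" and f: "schwartz f"
  shows "fourier (%x. f (dil l x)) (dil l \<eta>) = fourier f \<eta> / of_real (\<Prod>j\<in>UNIV. \<bar>l j\<bar>)"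
proof -
  have [measurable]: "f \<in> borel_measurable borel" using f by measurable
  have P: "(\<Prod>j\<in>UNIV. \<bar>l j\<bar>) \<noteq> 0" using l by simp
  have "dil l x \<bullet> \<eta> = x \<bullet> dil l \<eta>" for x by (simp add: inner_vec_def mult_ac)
  then have "fourier f \<eta> = (\<Prod>j\<in>UNIV. \<bar>l j\<bar>) *\<^sub>R fourier (%x. f (dil l x)) (dil l \<eta>)"
    unfolding fourier_cis by (subst integral_dil[of l]) (use l in auto)
  then show ?thesis using P by (simp add: scaleR_conv_of_real field_simps)
qed

text \<open>Power counting in the Jacobian: each of the \<open>CARD('n) + 1\<close> transforms
  contributes one inverse factor, the substitution in \<tau> contributes \<open>CARD('n)\<close>
  factors, and exactly one remains.\<close>

lemma Lambda_m_dil: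
  fixes F :: "'n::finite => real^'n => complex"
  assumes l: "\<And>j. l j \<noteq> 0" and F0: "schwartz F0" and F: "\<And>j. schwartz (F j)"
    and m [measurable]: "m \<in> borel_measurable borel"
  shows "Lambda_m (%\<xi>. m (dil l \<xi>)) F0 F
    = of_real (\<Prod>j\<in>UNIV. \<bar>l j\<bar>) * Lambda_m m (%x. F0 (dil l x)) (%j x. F j (dil l x))"
proof -
  let ?P = "\<Prod>j\<in>UNIV. \<bar>l j\<bar>"
  have P: "?P \<noteq> 0" using l by simp
  let ?A = "%x. F0 (dil l x)" and ?G = "%j x. F j (dil l x)"
  have G: "schwartz ?A" "schwartz (?G j)" for j using F0 F l by (auto intro: schwartz_dil)
  have [measurable]: "Fker ?A ?G \<in> borel_measurable borel" by (rule Fker_measurable[OF G])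
  let ?T = "%\<tau>::real^'n^'n. \<chi> i. \<chi> j. l j * \<tau> $ i $ j"
  have row: "?T \<tau> $ i = dil l (\<tau> $ i)" for \<tau> i by (simp add: vec_eq_iff)
  have s: "- (\<Sum>j\<in>UNIV. ?T \<tau> $ j) = dil l (- (\<Sum>j\<in>UNIV. \<tau> $ j))" for \<tau>
    by (simp add: vec_eq_iff sum_distrib_left)
  have "Fker ?A ?G (?T \<tau>) = fourier F0 (- (\<Sum>j\<in>UNIV. \<tau> $ j)) / of_real ?P * (\<Prod>j\<in>UNIV. fourier (F j) (\<tau> $ j) / of_real ?P)" for \<tau>
    unfolding Fker_def Fprod_def s unfolding row by (simp only: fourier_dil[OF l F0] fourier_dil[OF l F])
  then have k: "Fker ?A ?G (?T \<tau>) = Fker F0 F \<tau> / of_real (?P ^ Suc (CARD('n)))" for \<tau>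
    by (simp add: Fker_def Fprod_def prod_dividef)
  have d: "diagonal (?T \<tau>) = dil l (diagonal \<tau>)" for \<tau> by (simp add: vec_eq_iff diagonal_def)
  have "Lambda_m m ?A ?G = (?P ^ CARD('n)) *\<^sub>R (LINT \<tau>|lborel. Fker ?A ?G (?T \<tau>) * m (diagonal (?T \<tau>)))"
    unfolding Lambda_m_eq by (rule integral_diag_matrix[OF l]) measurable
  also have "\<dots> = (?P ^ CARD('n)) *\<^sub>R (Lambda_m (%\<xi>. m (dil l \<xi>)) F0 F / of_real (?P ^ Suc (CARD('n))))"
    unfolding Lambda_m_eq k d by simp
  finally show ?thesis using P by (simp add: scaleR_conv_of_real field_simps)
qed

lemma Lp_norm_nonneg: "0 \<le> Lp_norm q f" by (simp add: Lp_norm_def)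

lemma Lp_norm_dil:
  assumes l: "\<And>j. l j \<noteq> 0" and f: "schwartz f"
  shows "Lp_norm q (%x. f (dil l x)) = (\<Prod>j\<in>UNIV. \<bar>l j\<bar>) powr (- 1 / q) * Lp_norm q f"
proof -
  let ?P = "\<Prod>j\<in>UNIV. \<bar>l j\<bar>"
  have P: "?P > 0" using l by (auto intro: prod_pos)
  have [measurable]: "f \<in> borel_measurable borel" using f by measurable
  let ?I = "LINT x|lborel. norm (f (dil l x)) powr q"
  have "(LINT x|lborel. norm (f x) powr q) = ?P * ?I"
    by (subst integral_dil[of l]) (use l in auto)
  moreover have "0 \<le> ?I" by simp
  ultimately show ?thesis
    using P l by (simp add: Lp_norm_def powr_mult powr_minus field_simps)
qed

text \<open>A multiplier sees \<tau> only through its diagonal, and each diagonal entry vanishes on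
  a hyperplane. Hence multipliers may be compared, and limits taken, away from the coordinate
  hyperplanes, where quotients of coordinates make sense.\<close>

lemma coordinate_null:
  fixes P :: "real^'n::finite => bool"
  assumes "\<And>\<xi>. (\<forall>j. \<xi> $ j \<noteq> 0) ==> P \<xi>"
  shows "AE \<tau> in lborel. P (diagonal \<tau>)"
proof -
  have "AE \<tau> in lborel. (\<tau>::real^'n^'n) $ j $ j \<noteq> 0" for j
  proof -
    have "negligible {\<tau>::real^'n^'n. \<tau> \<bullet> axis j (axis j 1) = 0}"
      by (intro negligible_standard_hyperplane) (auto simp: Basis_vec_def)
    then have "{\<tau>::real^'n^'n. \<tau> $ j $ j = 0} \<in> null_sets lebesgue"
      by (simp add: inner_axis negligible_iff_null_sets)
    then have "AE \<tau> in lebesgue. (\<tau>::real^'n^'n) $ j $ j \<noteq> 0"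
      by (auto intro: AE_I')
    then show ?thesis by (simp add: AE_completion_iff)
  qed
  then have "AE \<tau> in lborel. \<forall>j\<in>UNIV. (\<tau>::real^'n^'n) $ j $ j \<noteq> 0" by (intro AE_finite_allI) auto
  then show ?thesis by eventually_elim (auto intro!: assms simp: diagonal_def)
qed

lemma Lambda_m_cong:
  assumes F0: "schwartz F0" and F: "\<And>j. schwartz (F j)"
    and m: "m \<in> borel_measurable borel" "m' \<in> borel_measurable borel"
    and eq: "\<And>\<xi>. (\<forall>j. \<xi> $ j \<noteq> 0) ==> m \<xi> = m' \<xi>"
  shows "Lambda_m m F0 F = Lambda_m m' F0 F"
proof -
  note [measurable] = m Fker_measurable[OF F0 F]
  have "AE \<tau> in lborel. m (diagonal \<tau>) = m' (diagonal \<tau>)" by (rule coordinate_null) (rule eq)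
  then show ?thesis unfolding Lambda_m_eq by (intro integral_cong_AE) (auto elim: eventually_mono)
qed

lemma Lambda_m_limit:
  assumes F0: "schwartz F0" and F: "\<And>j. schwartz (F j)"
    and m: "\<And>k. m k \<in> borel_measurable borel" "m' \<in> borel_measurable borel"
    and B: "\<And>k \<xi>. norm (m k \<xi>) \<le> B"
    and lim: "\<And>\<xi>. (\<forall>j. \<xi> $ j \<noteq> 0) ==> (%k. m k \<xi>) \<longlonglongrightarrow> m' \<xi>"
  shows "(%k. Lambda_m (m k) F0 F) \<longlonglongrightarrow> Lambda_m m' F0 F"
  unfolding Lambda_m_eq
proof (rule integral_dominated_convergence[where w = "%\<tau>. B * norm (Fker F0 F \<tau>)"])
  note [measurable] = m Fker_measurable[OF F0 F]
  show "(%\<tau>. Fker F0 F \<tau> * m' (diagonal \<tau>)) \<in> borel_measurable lborel"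
    "\<And>k. (%\<tau>. Fker F0 F \<tau> * m k (diagonal \<tau>)) \<in> borel_measurable lborel" by measurable
  show "integrable lborel (%\<tau>. B * norm (Fker F0 F \<tau>))"
    by (intro integrable_mult_right integrable_norm Fker_integrable F0 F)
  have "AE \<tau> in lborel. (%k. m k (diagonal \<tau>)) \<longlonglongrightarrow> m' (diagonal \<tau>)" by (rule coordinate_null) (rule lim)
  then show "AE \<tau> in lborel. (%k. Fker F0 F \<tau> * m k (diagonal \<tau>)) \<longlonglongrightarrow> Fker F0 F \<tau> * m' (diagonal \<tau>)"
    by eventually_elim (intro tendsto_intros)
  show "AE \<tau> in lborel. norm (Fker F0 F \<tau> * m k (diagonal \<tau>)) \<le> B * norm (Fker F0 F \<tau>)" for k
    using B by (intro AE_I2) (simp add: norm_mult mult.commute[of B] mult_left_mono)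
qed

lemma measurable_split2:
  assumes "case_prod m \<in> borel_measurable (M \<Otimes>\<^sub>M N)" "f \<in> K \<rightarrow>\<^sub>M M" "g \<in> K \<rightarrow>\<^sub>M N"
  shows "(%x. m (f x) (g x)) \<in> borel_measurable K"
  using measurable_compose[OF measurable_Pair[OF assms(2,3)] assms(1)] by simp

lemma Lambda_m_average:
  fixes m :: "real => real^'n::finite => complex"
  assumes F0: "schwartz F0" and F: "\<And>j. schwartz (F j)"
    and m: "case_prod m \<in> borel_measurable (borel \<Otimes>\<^sub>M borel)" and B: "\<And>a \<xi>. norm (m a \<xi>) \<le> B"
  shows "Lambda_m (%\<xi>. LINT a:{u..v}|lborel. m a \<xi>) F0 F = (LINT a:{u..v}|lborel. Lambda_m (m a) F0 F)"
proof -
  let ?I = "%a. complex_of_real (indicator {u..v} a)"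
  have "(LINT a|lborel. LINT \<tau>|lborel. ?I a * Fker F0 F \<tau> * m a (diagonal \<tau>)) = (LINT \<tau>|lborel. LINT a|lborel. ?I a * Fker F0 F \<tau> * m a (diagonal \<tau>))"
  proof (rule Fubini_mult[where B = B])
    show "integrable lborel ?I" by (intro integrable_of_real integrable_real_indicator) (auto simp: emeasure_lborel_Icc_eq)
    show "(%(x, y). m x (diagonal y)) \<in> borel_measurable (lborel \<Otimes>\<^sub>M lborel)"
      unfolding case_prod_beta' by (rule measurable_split2[OF m]) measurable
  qed (use Fker_integrable[OF F0 F] B in \<open>auto simp: sigma_finite_lborel\<close>)
  moreover have "(LINT \<tau>|lborel. ?I a * Fker F0 F \<tau> * m a (diagonal \<tau>)) = indicator {u..v} a *\<^sub>R Lambda_m (m a) F0 F" for a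
    unfolding Lambda_m_eq scaleR_conv_of_real by (simp add: mult.assoc)
  moreover have "(LINT a|lborel. ?I a * Fker F0 F \<tau> * m a (diagonal \<tau>)) = Fker F0 F \<tau> * (LINT a:{u..v}|lborel. m a (diagonal \<tau>))" for \<tau>
    unfolding set_lebesgue_integral_def scaleR_conv_of_real
    by (subst integral_mult_right_zero[symmetric]) (simp only: mult_ac)
  ultimately show ?thesis unfolding set_lebesgue_integral_def by (subst Lambda_m_eq) simp
qed

lemma set_integral_measurable_param:
  fixes m :: "real => real^'n::finite => complex"
  assumes m: "case_prod m \<in> borel_measurable (borel \<Otimes>\<^sub>M borel)"
  shows "(%\<xi>. LINT a:{u..v}|lborel. m a \<xi>) \<in> borel_measurable borel"
proof -
  have [measurable]: "(%q. m (snd q) (fst q)) \<in> borel_measurable (borel \<Otimes>\<^sub>M (lborel :: real measure))"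
    by (rule measurable_split2[OF m]) measurable
  have "(%q. indicator {u..v} (snd q) *\<^sub>R m (snd q) (fst q)) \<in> borel_measurable (borel \<Otimes>\<^sub>M (lborel :: real measure))"
    by measurable
  then show ?thesis unfolding set_lebesgue_integral_def
    by (intro sigma_finite_measure.borel_measurable_lebesgue_integral sigma_finite_lborel) (simp add: case_prod_beta')
qed

lemma set_integral_norm_le:
  fixes f :: "real => complex"
  assumes f: "f \<in> borel_measurable borel" and B: "\<And>a. a \<in> {u..v} ==> norm (f a) \<le> B" and "u \<le> v"
  shows "norm (LINT a:{u..v}|lborel. f a) \<le> B * (v - u)"
proof -
  have "norm (LINT a:{u..v}|lborel. f a) \<le> (LINT a|lborel. norm (indicator {u..v} a *\<^sub>R f a))"
    unfolding set_lebesgue_integral_def by (rule integral_norm_bound)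
  also have "\<dots> \<le> (LINT a|lborel. B * indicator {u..v} a)"
  proof (rule integral_mono_AE')
    show "integrable lborel (%a. B * indicator {u..v} a)" by (intro integrable_mult_right integrable_real_indicator) (auto simp: emeasure_lborel_Icc_eq)
    show "AE a in lborel. norm (indicator {u..v} a *\<^sub>R f a) \<le> B * indicator {u..v} a"
      using B by (intro AE_I2) (auto simp: indicator_def)
    show "AE a in lborel. 0 \<le> B * indicator {u..v} a"
      using B by (intro AE_I2) (auto simp: indicator_def intro: order_trans[OF norm_ge_zero])
  qed
  also have "\<dots> = B * (v - u)" using \<open>u \<le> v\<close> by simp
  finally show ?thesis .
qed

section \<open>Averages of multipliers over slopes\<close>

text \<open>The n-th frequency is shifted by a multiple of the j-th one and the slope
  \<open>a\<close> is averaged. The integral is not divided by the length of the interval; the lower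
  limits that matter below are 0 and 1/2.\<close>

definition average_along :: "'n::finite => 'n => real => (real^'n => complex) => real^'n => complex" where
  "average_along n j l f \<xi> = (LINT a:{l..1}|lborel. f (\<xi> + (a * \<xi> $ j) *\<^sub>R unit_vec n))"

fun averages :: "'n::finite => ('n \<times> real) list => (real^'n => complex) => real^'n => complex" where
  "averages n [] f = f"
| "averages n ((j, l) # r) f = average_along n j l (averages n r f)"

lemma average_along_measurable_param:
  fixes g :: "'a => real^'n::finite => complex"
  assumes g: "case_prod g \<in> borel_measurable (M \<Otimes>\<^sub>M borel)"
  shows "(%(t, \<xi>). average_along n j l (g t) \<xi>) \<in> borel_measurable (M \<Otimes>\<^sub>M borel)"
proof -
  have [measurable]: "(%q. g (fst (fst q)) (snd (fst q) + (snd q * snd (fst q) $ j) *\<^sub>R unit_vec n)) \<in> borel_measurable ((M \<Otimes>\<^sub>M borel) \<Otimes>\<^sub>M lborel)"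
    by (rule measurable_split2[OF g]) measurable
  have "(%q. indicator {l..1} (snd q) *\<^sub>R g (fst (fst q)) (snd (fst q) + (snd q * snd (fst q) $ j) *\<^sub>R unit_vec n)) \<in> borel_measurable ((M \<Otimes>\<^sub>M borel) \<Otimes>\<^sub>M (lborel :: real measure))"
    by measurable
  then show ?thesis
    unfolding average_along_def set_lebesgue_integral_def case_prod_beta'
    by (intro sigma_finite_measure.borel_measurable_lebesgue_integral sigma_finite_lborel) (simp add: case_prod_beta')
qed

lemma averages_measurable_param:
  fixes g :: "'a => real^'n::finite => complex"
  assumes g: "case_prod g \<in> borel_measurable (M \<Otimes>\<^sub>M borel)"
  shows "(%(t, \<xi>). averages n r (g t) \<xi>) \<in> borel_measurable (M \<Otimes>\<^sub>M borel)"
  using g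
proof (induction r)
  case (Cons x r)
  obtain j l where x: "x = (j, l)" by force
  show ?case using average_along_measurable_param[OF Cons.IH[OF Cons.prems], of n j l] by (simp add: x)
qed simp

lemma averages_measurable:
  fixes f :: "real^'n::finite => complex"
  assumes f: "f \<in> borel_measurable borel"
  shows "averages n r f \<in> borel_measurable borel"
proof -
  \<comment> \<open>Measurability without a parameter is the parametrised statement over a one-point
    space.\<close>
  have "(%(t::unit, \<xi>). f \<xi>) \<in> borel_measurable (count_space UNIV \<Otimes>\<^sub>M borel)"
    unfolding case_prod_beta' using f by measurable
  from averages_measurable_param[OF this]
  have 1: "(%(t::unit, \<xi>). averages n r f \<xi>) \<in> borel_measurable (count_space UNIV \<Otimes>\<^sub>M borel)" .
  show ?thesis using measurable_split2[OF 1, of "%_. ()" borel "%x. x"] by simp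
qed

lemma shift_measurable:
  fixes f :: "real^'n::finite => complex"
  assumes f: "f \<in> borel_measurable borel"
  shows "(%a. f (\<xi> + (a * c) *\<^sub>R v)) \<in> borel_measurable borel"
  by (rule measurable_compose[OF _ f]) measurable

lemma average_along_norm_le:
  assumes f: "f \<in> borel_measurable borel" and B: "\<And>\<xi>. norm (f \<xi>) \<le> B" and l: "0 \<le> l" "l \<le> 1"
  shows "norm (average_along n j l f \<xi>) \<le> B"
proof -
  have "norm (average_along n j l f \<xi>) \<le> B * (1 - l)"
    unfolding average_along_def by (rule set_integral_norm_le) (use shift_measurable[OF f] B l in auto)
  also have "\<dots> \<le> B" using l order_trans[OF norm_ge_zero B[of \<xi>]] by (simp add: mult_left_le)
  finally show ?thesis .
qed

lemma averages_norm_le: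
  assumes f: "f \<in> borel_measurable borel" and B: "\<And>\<xi>. norm (f \<xi>) \<le> B" and l: "\<And>x. x \<in> set r ==> 0 \<le> snd x \<and> snd x \<le> 1"
  shows "norm (averages n r f \<xi>) \<le> B"
  using l
proof (induction r arbitrary: \<xi>)
  case (Cons x r)
  obtain j l where x: "x = (j, l)" by force
  show ?case unfolding x averages.simps
    by (rule average_along_norm_le) (use averages_measurable[OF f] Cons.IH Cons.prems Cons.prems[of x] x in auto)
qed (use B in simp)

lemma average_along_limit:
  fixes f :: "nat => real^'n::finite => complex"
  assumes f: "\<And>k. f k \<in> borel_measurable borel" "g \<in> borel_measurable borel" and B: "\<And>k \<xi>. norm (f k \<xi>) \<le> B"
    and lim: "\<And>\<xi>. (%k. f k \<xi>) \<longlonglongrightarrow> g \<xi>"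
  shows "(%k. average_along n j l (f k) \<xi>) \<longlonglongrightarrow> average_along n j l g \<xi>"
  unfolding average_along_def set_lebesgue_integral_def
proof (rule integral_dominated_convergence[where w = "%a. B * indicator {l..1} a"])
  show "integrable lborel (%a. B * indicator {l..1} a)"
    by (intro integrable_mult_right integrable_real_indicator) (auto simp: emeasure_lborel_Icc_eq)
  show "AE x in lborel. norm (indicator {l..1} x *\<^sub>R f k (\<xi> + (x * \<xi> $ j) *\<^sub>R unit_vec n)) \<le> B * indicator {l..1} x" for k
    using B by (intro AE_I2) (auto simp: indicator_def)
  show "AE x in lborel. (%k. indicator {l..1} x *\<^sub>R f k (\<xi> + (x * \<xi> $ j) *\<^sub>R unit_vec n)) \<longlonglongrightarrow> indicator {l..1} x *\<^sub>R g (\<xi> + (x * \<xi> $ j) *\<^sub>R unit_vec n)"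
    by (intro AE_I2 tendsto_intros lim)
  show "(%x. indicator {l..1} x *\<^sub>R g (\<xi> + (x * \<xi> $ j) *\<^sub>R unit_vec n)) \<in> borel_measurable lborel"
    using shift_measurable[OF f(2)] by simp
  show "(%x. indicator {l..1} x *\<^sub>R f k (\<xi> + (x * \<xi> $ j) *\<^sub>R unit_vec n)) \<in> borel_measurable lborel" for k
    using shift_measurable[OF f(1)] by simp
qed

lemma averages_limit:
  fixes f :: "nat => real^'n::finite => complex"
  assumes f: "\<And>k. f k \<in> borel_measurable borel" "g \<in> borel_measurable borel" and B: "\<And>k \<xi>. norm (f k \<xi>) \<le> B"
    and lim: "\<And>\<xi>. (%k. f k \<xi>) \<longlonglongrightarrow> g \<xi>" and l: "\<And>x. x \<in> set r ==> 0 \<le> snd x \<and> snd x \<le> 1"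
  shows "(%k. averages n r (f k) \<xi>) \<longlonglongrightarrow> averages n r g \<xi>"
  using l
proof (induction r arbitrary: \<xi>)
  case (Cons x r)
  obtain j l where x: "x = (j, l)" by force
  show ?case unfolding x averages.simps
    by (rule average_along_limit[where B = B])
       (use averages_measurable[OF f(1)] averages_measurable[OF f(2)] averages_norm_le[OF f(1) B] Cons in auto)
qed (use lim in simp)

text \<open>Averages commute with superpositions of multipliers. This is used for the truncated
  kernel dt/t and, with an indicator as the weight, to exchange two averages.\<close>

lemma averages_integral:
  fixes g :: "real => real^'n::finite => complex"
  assumes w: "integrable lborel w" and g: "case_prod g \<in> borel_measurable (borel \<Otimes>\<^sub>M borel)" and B: "\<And>t \<xi>. norm (g t \<xi>) \<le> B"
    and l: "\<And>x. x \<in> set r ==> 0 \<le> snd x \<and> snd x \<le> 1"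
  shows "averages n r (%\<xi>. LINT t|lborel. w t * g t \<xi>) \<xi> = (LINT t|lborel. w t * averages n r (g t) \<xi>)"
  using l
proof (induction r arbitrary: \<xi>)
  case (Cons x r)
  obtain j l where x: "x = (j, l)" by force
  have "(%(t, \<xi>). averages n r (g t) \<xi>) \<in> borel_measurable (borel \<Otimes>\<^sub>M borel)"
    by (rule averages_measurable_param[OF g])
  note m = measurable_split2[OF this]
  have gm: "g t \<in> borel_measurable borel" for t
    using measurable_split2[OF g, of "%_. t" borel "%x. x"] by simp
  let ?I = "%a. complex_of_real (indicator {l..1} a)"
  have "averages n (x # r) (%\<xi>. LINT t|lborel. w t * g t \<xi>) \<xi> = (LINT a|lborel. LINT t|lborel. ?I a * w t * averages n r (g t) (\<xi> + (a * \<xi> $ j) *\<^sub>R unit_vec n))"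
    unfolding x averages.simps average_along_def set_lebesgue_integral_def
    using Cons by (simp add: scaleR_conv_of_real mult.assoc)
  also have "\<dots> = (LINT t|lborel. LINT a|lborel. ?I a * w t * averages n r (g t) (\<xi> + (a * \<xi> $ j) *\<^sub>R unit_vec n))"
  proof (rule Fubini_mult[where B = B])
    show "integrable lborel ?I" by (intro integrable_of_real integrable_real_indicator) (auto simp: emeasure_lborel_Icc_eq)
    show "(%(a, t). averages n r (g t) (\<xi> + (a * \<xi> $ j) *\<^sub>R unit_vec n)) \<in> borel_measurable (lborel \<Otimes>\<^sub>M lborel)"
      unfolding case_prod_beta' by (rule m) measurable
    show "norm (averages n r (g t) (\<xi> + (a * \<xi> $ j) *\<^sub>R unit_vec n)) \<le> B" for a t
      by (rule averages_norm_le[OF gm B]) (use Cons.prems in auto)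
  qed (use w in \<open>auto simp: sigma_finite_lborel\<close>)
  also have "\<dots> = (LINT t|lborel. w t * averages n (x # r) (g t) \<xi>)"
    unfolding x averages.simps average_along_def set_lebesgue_integral_def scaleR_conv_of_real
    by (subst integral_mult_right_zero[symmetric]) (simp only: mult_ac)
  finally show ?case .
qed simp

definition unit_average :: "real => complex" where
  "unit_average s = (LINT a:{0..1}|lborel. cis (2 * pi * (s * a)))"

text \<open>On a character of the n-th coordinate the shifts add up in the exponent, so each slope
  integral factors out. Since \<open>n \<notin> set js\<close>, the shifts do not alter the
  coefficients \<xi>_j; distinctness lets the product run over a set.\<close>

lemma averages_cis:
  assumes "distinct js" "n \<notin> set js"
  shows "averages n (map (%j. (j, 0)) js) (%\<xi>. cis (2 * pi * (t * \<xi> $ n))) \<xi>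
     = (\<Prod>j\<in>set js. unit_average (t * \<xi> $ j)) * cis (2 * pi * (t * \<xi> $ n))"
  using assms
proof (induction js arbitrary: \<xi>)
  case (Cons i js)
  then have IH: "averages n (map (%j. (j, 0)) js) (%\<xi>. cis (2 * pi * (t * \<xi> $ n))) \<xi>
     = (\<Prod>j\<in>set js. unit_average (t * \<xi> $ j)) * cis (2 * pi * (t * \<xi> $ n))" for \<xi> by auto
  have c: "(\<xi> + (a * \<xi> $ i) *\<^sub>R unit_vec n) $ k = \<xi> $ k + (if k = n then a * \<xi> $ i else 0)" for a k
    by (simp add: unit_vec_def axis_def)
  have "averages n (map (%j. (j, 0)) (i # js)) (%\<xi>. cis (2 * pi * (t * \<xi> $ n))) \<xi>
    = (LINT a:{0..1}|lborel. (\<Prod>j\<in>set js. unit_average (t * \<xi> $ j)) * cis (2 * pi * (t * \<xi> $ n)) * cis (2 * pi * (t * \<xi> $ i * a)))"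
  proof -
    have "(\<Prod>j\<in>set js. unit_average (t * (\<xi> + (a * \<xi> $ i) *\<^sub>R unit_vec n) $ j)) * cis (2 * pi * (t * (\<xi> + (a * \<xi> $ i) *\<^sub>R unit_vec n) $ n))
      = (\<Prod>j\<in>set js. unit_average (t * \<xi> $ j)) * cis (2 * pi * (t * \<xi> $ n)) * cis (2 * pi * (t * \<xi> $ i * a))" for a
    proof -
      have "(\<Prod>j\<in>set js. unit_average (t * (\<xi> + (a * \<xi> $ i) *\<^sub>R unit_vec n) $ j)) = (\<Prod>j\<in>set js. unit_average (t * \<xi> $ j))"
        using Cons.prems unfolding c by (intro prod.cong refl) auto
      then show ?thesis unfolding c by (simp add: cis_mult algebra_simps)
    qed
    then show ?thesis by (simp add: average_along_def IH)
  qed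
  also have "\<dots> = (\<Prod>j\<in>set (i # js). unit_average (t * \<xi> $ j)) * cis (2 * pi * (t * \<xi> $ n))"
    using Cons.prems by (simp add: unit_average_def set_integral_mult_right mult_ac)
  finally show ?case .
qed simp

section \<open>Truncated principal values and the Fourier side of \<open>Lambda_n\<close>\<close>

text \<open>The kernel is cut off at infinity too, because 1/t is not integrable there and Fubini is
  needed. \<open>R\<close> is sent to infinity before \<epsilon> is sent to 0.\<close>

definition trunc_pv :: "real => real => real => complex" where
  "trunc_pv \<epsilon> R c = (LINT t|lborel. complex_of_real (indicator {t. \<epsilon> < \<bar>t\<bar> \<and> \<bar>t\<bar> < R} t / t) * cis (2 * pi * (t * c)))"

lemma trunc_integrable:
  assumes "0 < \<epsilon>"
  shows "integrable lborel (%t. complex_of_real (indicator {t. \<epsilon> < \<bar>t\<bar> \<and> \<bar>t\<bar> < R} t / t))"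
proof (rule integrable_of_real, rule Bochner_Integration.integrable_bound[where f = "%t. (1 / \<epsilon>) * indicator {-R..R} t"])
  show "integrable lborel (%t. (1 / \<epsilon>) * indicator {-R..R} t)"
    by (intro integrable_mult_right integrable_real_indicator) (auto simp: emeasure_lborel_Icc_eq)
  show "AE t in lborel. norm (indicator {t. \<epsilon> < \<bar>t\<bar> \<and> \<bar>t\<bar> < R} t / t) \<le> norm ((1 / \<epsilon>) * indicator {-R..R} t)"
    using assms by (intro AE_I2) (auto simp: indicator_def field_simps)
qed measurable

lemma sin_integral_eq_Si:
  assumes T: "0 \<le> T"
  shows "(LINT t|lborel. indicator {0<..<T} t * (sin (t * \<theta>) / t)) = sgn \<theta> * Si (T * \<bar>\<theta>\<bar>)"
proof -
  have "(LBINT t=ereal 0..ereal T. sin (t * \<theta>) / t) = (LINT t|lborel. indicator {0<..<T} t * (sin (t * \<theta>) / t))"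
    unfolding interval_lebesgue_integral_def set_lebesgue_integral_def einterval_eq using T by simp
  then show ?thesis using LBINT_I0c_sin_scale_divide[OF T, of \<theta>] by (simp add: zero_ereal_def)
qed

text \<open>Averaging with the reflection of t leaves only the sine, and the integral of sin(t
  \<theta>)/t over an interval is a difference of values of \<open>Si\<close>.\<close>

lemma trunc_pv_eq:
  assumes e: "0 < \<epsilon>" "\<epsilon> < R"
  shows "trunc_pv \<epsilon> R c = 2 * \<i> * of_real (sgn c * (Si (R * \<bar>2 * pi * c\<bar>) - Si (\<epsilon> * \<bar>2 * pi * c\<bar>)))"
proof -
  let ?\<theta> = "2 * pi * c"
  let ?w = "%t. complex_of_real (indicator {t. \<epsilon> < \<bar>t\<bar> \<and> \<bar>t\<bar> < R} t / t)"
  let ?s = "%t. sin (t * ?\<theta>) / t"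
  have i: "integrable lborel (%t. ?w t * cis (2 * pi * (t * c)))"
    by (rule Bochner_Integration.integrable_bound[OF trunc_integrable[OF e(1), of R]]) (auto intro!: AE_I2 simp: norm_mult norm_divide)
  have i': "integrable lborel (%t. - (?w t * cis (- 2 * pi * (t * c))))"
    using lborel_integrable_real_affine[OF i, of "-1" 0] by (simp add: indicator_def)
  have "trunc_pv \<epsilon> R c = (LINT t|lborel. - (?w t * cis (- 2 * pi * (t * c))))"
    unfolding trunc_pv_def using lborel_integral_real_affine[of "-1" "%t. ?w t * cis (2 * pi * (t * c))" 0]
    by (simp add: indicator_def)
  then have "2 * trunc_pv \<epsilon> R c = (LINT t|lborel. ?w t * cis (2 * pi * (t * c)) + - (?w t * cis (- 2 * pi * (t * c))))"
    using Bochner_Integration.integral_add[OF i i'] by (simp add: trunc_pv_def)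
  also have "\<dots> = (LINT t|lborel. (2 * \<i>) * of_real (indicator {t. \<epsilon> < \<bar>t\<bar> \<and> \<bar>t\<bar> < R} t * ?s t))"
    by (intro Bochner_Integration.integral_cong refl) (auto simp: complex_eq_iff mult_ac)
  also have "\<dots> = (2 * \<i>) * of_real (LINT t|lborel. indicator {t. \<epsilon> < \<bar>t\<bar> \<and> \<bar>t\<bar> < R} t * ?s t)"
    by (simp only: integral_mult_right_zero integral_complex_of_real)
  finally have 1: "trunc_pv \<epsilon> R c = \<i> * of_real (LINT t|lborel. indicator {t. \<epsilon> < \<bar>t\<bar> \<and> \<bar>t\<bar> < R} t * ?s t)" by simp
  have sb: "\<bar>?s t\<bar> \<le> \<bar>?\<theta>\<bar>" for t
    using abs_sin_x_le_abs_x[of "t * ?\<theta>"] by (cases "t = 0") (auto simp: abs_mult field_simps)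
  have si: "integrable lborel (%t. indicator A t * ?s t)" if A: "A \<in> sets borel" "A \<subseteq> {-R..R}" for A
  proof (rule Bochner_Integration.integrable_bound[where f = "%t. \<bar>?\<theta>\<bar> * indicator {-R..R} t"])
    show "integrable lborel (%t. \<bar>?\<theta>\<bar> * indicator {-R..R} t)"
      by (intro integrable_mult_right integrable_real_indicator) (auto simp: emeasure_lborel_Icc_eq)
    show "AE t in lborel. norm (indicator A t * ?s t) \<le> norm (\<bar>?\<theta>\<bar> * indicator {-R..R} t)"
      using A(2) sb by (intro AE_I2) (auto simp: indicator_def)
    show "(%t. indicator A t * ?s t) \<in> borel_measurable lborel" using A(1) by measurable
  qed
  have pos: "(LINT t|lborel. indicator {\<epsilon><..<R} t * ?s t) = sgn c * (Si (R * \<bar>?\<theta>\<bar>) - Si (\<epsilon> * \<bar>?\<theta>\<bar>))"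
  proof -
    have "(LINT t|lborel. indicator {0<..<R} t * ?s t) = (LINT t|lborel. indicator {\<epsilon><..<R} t * ?s t + indicator {0<..<\<epsilon>} t * ?s t)"
    proof (rule integral_cong_AE)
      show "AE t in lborel. indicator {0<..<R} t * ?s t = indicator {\<epsilon><..<R} t * ?s t + indicator {0<..<\<epsilon>} t * ?s t"
        using AE_lborel_singleton[of \<epsilon>] by eventually_elim (use e in \<open>auto simp: indicator_def\<close>)
    qed measurable
    also have "\<dots> = (LINT t|lborel. indicator {\<epsilon><..<R} t * ?s t) + (LINT t|lborel. indicator {0<..<\<epsilon>} t * ?s t)"
      by (intro Bochner_Integration.integral_add si) (use e in auto)
    moreover have "sgn ?\<theta> = sgn c" by (simp add: sgn_mult)
    ultimately show ?thesis using sin_integral_eq_Si[of R ?\<theta>] sin_integral_eq_Si[of \<epsilon> ?\<theta>] e by (simp add: algebra_simps)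
  qed
  have neg: "(LINT t|lborel. indicator {-R<..<-\<epsilon>} t * ?s t) = (LINT t|lborel. indicator {\<epsilon><..<R} t * ?s t)"
  proof -
    have eq: "indicator {-R<..<-\<epsilon>} (0 + - 1 * t) * ?s (0 + - 1 * t) = indicator {\<epsilon><..<R} t * ?s t" for t
      by (auto simp: indicator_def)
    show ?thesis
      by (subst lborel_integral_real_affine[of "-1" _ 0], simp) (simp only: eq abs_neg_one scaleR_one)
  qed
  have "indicator {t. \<epsilon> < \<bar>t\<bar> \<and> \<bar>t\<bar> < R} t * ?s t = indicator {\<epsilon><..<R} t * ?s t + indicator {-R<..<-\<epsilon>} t * ?s t" for t
    using e by (auto simp: indicator_def)
  then have "(LINT t|lborel. indicator {t. \<epsilon> < \<bar>t\<bar> \<and> \<bar>t\<bar> < R} t * ?s t) = (LINT t|lborel. indicator {\<epsilon><..<R} t * ?s t) + (LINT t|lborel. indicator {-R<..<-\<epsilon>} t * ?s t)"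
    by (simp only:) (intro Bochner_Integration.integral_add si, use e in auto)
  then show ?thesis unfolding 1 neg pos by simp
qed


lemma norm_trunc_pv_le:
  obtains B where "\<And>\<epsilon> R c. 0 < \<epsilon> ==> \<epsilon> < R ==> norm (trunc_pv \<epsilon> R c) \<le> B"
    and "\<And>\<epsilon> c. norm (2 * \<i> * of_real (sgn c * (pi / 2 - Si (\<epsilon> * \<bar>2 * pi * c\<bar>)))) \<le> B"
proof -
  obtain B where B: "\<And>T. \<bar>Si T\<bar> \<le> B" using bounded_Si by blast
  have b: "norm (2 * \<i> * complex_of_real (sgn c * (u - Si T))) \<le> 2 * (\<bar>u\<bar> + B)" for c u T
  proof -
    have "norm (2 * \<i> * complex_of_real (sgn c * (u - Si T))) = 2 * (\<bar>sgn c\<bar> * \<bar>u - Si T\<bar>)"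
      by (simp only: norm_mult norm_of_real abs_mult) simp
    also have "\<dots> \<le> 2 * (1 * (\<bar>u\<bar> + B))"
      using B[of T] abs_triangle_ineq4[of u "Si T"] by (intro mult_left_mono mult_mono) (auto simp: abs_sgn_eq)
    finally show ?thesis by simp
  qed
  show ?thesis
  proof (rule that[of "2 * (2 * B + pi)"])
    show "norm (trunc_pv \<epsilon> R c) \<le> 2 * (2 * B + pi)" if "0 < \<epsilon>" "\<epsilon> < R" for \<epsilon> R c
    proof -
      have "2 * (\<bar>Si (R * \<bar>2 * pi * c\<bar>)\<bar> + B) \<le> 2 * (2 * B + pi)"
        using B[of "R * \<bar>2 * pi * c\<bar>"] pi_ge_zero by argo
      then show ?thesis unfolding trunc_pv_eq[OF that] by (rule order_trans[OF b])
    qed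
    show "norm (2 * \<i> * of_real (sgn c * (pi / 2 - Si (\<epsilon> * \<bar>2 * pi * c\<bar>)))) \<le> 2 * (2 * B + pi)" for \<epsilon> c
    proof -
      have "0 \<le> B" using order_trans[OF abs_ge_zero B] .
      then have "2 * (\<bar>pi / 2\<bar> + B) \<le> 2 * (2 * B + pi)" using pi_ge_zero by simp
      then show ?thesis by (rule order_trans[OF b])
    qed
  qed
qed

lemma trunc_pv_tendsto:
  assumes e: "0 < \<epsilon>"
  shows "(%k. trunc_pv \<epsilon> (\<epsilon> + 1 + real k) c) \<longlonglongrightarrow> 2 * \<i> * of_real (sgn c * (pi / 2 - Si (\<epsilon> * \<bar>2 * pi * c\<bar>)))"
proof (cases "c = 0")
  case False
  have "filterlim (%k::nat. (\<epsilon> + 1 + real k) * \<bar>2 * pi * c\<bar>) at_top sequentially"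
    using False by (intro filterlim_at_top_mult_tendsto_pos[OF tendsto_const] filterlim_tendsto_add_at_top[OF tendsto_const] filterlim_real_sequentially) auto
  then have "(%k::nat. Si ((\<epsilon> + 1 + real k) * \<bar>2 * pi * c\<bar>)) \<longlonglongrightarrow> pi / 2"
    by (rule filterlim_compose[OF Si_at_top])
  then show ?thesis using e by (simp only: trunc_pv_eq) (intro tendsto_intros)
qed (use e in \<open>simp add: trunc_pv_eq\<close>)

lemma unit_average_measurable [measurable]: "unit_average \<in> borel_measurable borel"
proof -
  have "(%q. indicator {0..1} (snd q) *\<^sub>R cis (2 * pi * (fst q * snd q))) \<in> borel_measurable (borel \<Otimes>\<^sub>M (lborel :: real measure))"
    by measurable
  then show ?thesis unfolding unit_average_def set_lebesgue_integral_def
    by (intro sigma_finite_measure.borel_measurable_lebesgue_integral sigma_finite_lborel) (simp add: case_prod_beta')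
qed

lemma norm_unit_average_le: "norm (unit_average s) \<le> 1"
  using set_integral_norm_le[of "%a. cis (2 * pi * (s * a))" 0 1 1] unfolding unit_average_def by simp

text \<open>Averaging over a segment parallel to e_j is a Fourier multiplier in the j-th frequency.
  This is how a single slope integral of \<open>Lambda_n\<close> passes to the frequency
  side.\<close>

lemma schwartz_segment_average:
  fixes f :: "real^'n::finite => complex"
  assumes f: "schwartz f"
  shows "(LINT a:{0..1}|lborel. f (x + (t * a) *\<^sub>R unit_vec j)) = (LINT \<xi>|lborel. fourier f \<xi> * cis (2 * pi * (x \<bullet> \<xi>)) * unit_average (t * \<xi> $ j))"
proof -
  let ?I = "%a::real. complex_of_real (indicator {0..1} a)"
  let ?g = "%\<xi>. fourier f \<xi> * cis (2 * pi * (x \<bullet> \<xi>))"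
  have gi: "integrable lborel ?g"
    using schwartz_integrable[OF schwartz_cis_mult[OF schwartz_fourier[OF f], of "2 * pi" x]] by (simp add: inner_commute)
  have "f (x + (t * a) *\<^sub>R unit_vec j) = (LINT \<xi>|lborel. ?g \<xi> * cis (2 * pi * (t * \<xi> $ j * a)))" for a
    unfolding fourier_inversion[OF f, of "x + (t * a) *\<^sub>R unit_vec j"]
    by (simp add: mult.assoc cis_mult inner_add_left unit_vec_def inner_axis' algebra_simps)
  then have "(LINT a:{0..1}|lborel. f (x + (t * a) *\<^sub>R unit_vec j)) = (LINT a|lborel. LINT \<xi>|lborel. ?I a * ?g \<xi> * cis (2 * pi * (t * \<xi> $ j * a)))"
    unfolding set_lebesgue_integral_def by (simp add: scaleR_conv_of_real mult.assoc)
  also have "\<dots> = (LINT \<xi>|lborel. LINT a|lborel. ?I a * ?g \<xi> * cis (2 * pi * (t * \<xi> $ j * a)))"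
  proof (rule Fubini_mult[where B = 1])
    show "integrable lborel ?I" by (intro integrable_of_real integrable_real_indicator) (auto simp: emeasure_lborel_Icc_eq)
  qed (use gi in \<open>auto simp: sigma_finite_lborel\<close>)
  also have "\<dots> = (LINT \<xi>|lborel. ?g \<xi> * unit_average (t * \<xi> $ j))"
    unfolding unit_average_def set_lebesgue_integral_def scaleR_conv_of_real
    by (subst integral_mult_right_zero[symmetric]) (simp only: mult_ac)
  finally show ?thesis .
qed

lemma schwartz_line_decay:
  fixes f :: "real^'n::finite => complex"
  assumes f: "schwartz f"
  obtains C where "0 \<le> C" "\<And>t. norm (f (x + t *\<^sub>R unit_vec j)) \<le> C * inverse (1 + (x $ j + t)\<^sup>2)"
proof -
  have "rapid f" using f unfolding schwartz_iff by (rule smooth_classD)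
  then obtain C where C: "\<And>x. (1 + norm x) ^ 2 * norm (f x) \<le> C" unfolding rapid_def by blast
  have "norm (f (x + t *\<^sub>R unit_vec j)) \<le> C * inverse (1 + (x $ j + t)\<^sup>2)" for t
  proof -
    let ?y = "x + t *\<^sub>R unit_vec j"
    have y: "?y $ j = x $ j + t" by (simp add: unit_vec_def)
    have "(?y $ j)\<^sup>2 \<le> (norm ?y)\<^sup>2" using component_le_norm_cart[of ?y j] by (metis abs_le_square_iff abs_norm_cancel)
    then have "1 + (?y $ j)\<^sup>2 \<le> (1 + norm ?y) ^ 2" by (simp add: power2_sum add_increasing2)
    then have "(1 + (?y $ j)\<^sup>2) * norm (f ?y) \<le> (1 + norm ?y) ^ 2 * norm (f ?y)" by (rule mult_right_mono) simp
    also have "\<dots> \<le> C" by (rule C)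
    finally have "norm (f ?y) \<le> C / (1 + (?y $ j)\<^sup>2)"
      by (simp add: pos_le_divide_eq add_pos_nonneg mult.commute)
    then show ?thesis unfolding y by (simp add: divide_inverse)
  qed
  moreover have "0 \<le> C" using order_trans[OF mult_nonneg_nonneg C[of 0]] by simp
  ultimately show ?thesis using that by blast
qed

context
  fixes F0 :: "real^('n::{finite,linorder}) => complex" and F :: "'n::{finite,linorder} => real^('n::{finite,linorder}) => complex"
    and js :: "'n::{finite,linorder} list"
  assumes F0: "schwartz F0" and F: "\<And>j. schwartz (F j)"
    and js: "distinct js" "set js = UNIV - {last_idx}"
begin

abbreviation (input) "idx_n \<equiv> last_idx :: 'n"
abbreviation (input) "zero_list \<equiv> map (%j::'n. (j, 0::real)) js"

definition inner_form :: "real^('n::{finite,linorder}) => real => complex" where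
  "inner_form x t = (LINT \<alpha>:(PiE (UNIV - {last_idx}) (%_. {0..1::real}))|PiM (UNIV - {last_idx}) (%_. lborel).
             F0 x * (\<Prod>j\<in>UNIV - {last_idx}. F j (x + (t * \<alpha> j) *\<^sub>R unit_vec j))
               * F last_idx (x + t *\<^sub>R unit_vec last_idx))"

text \<open>For fixed t this is the multiplier of \<open>inner_form\<close>. Written with
  \<open>averages\<close>, it allows the integral over t to be carried out inside the
  averages.\<close>

definition wave :: "real => real^('n::{finite,linorder}) => complex" where
  "wave t \<xi> = averages idx_n zero_list (%\<xi>. cis (2 * pi * (t * \<xi> $ idx_n))) \<xi>"

definition carrier_fn :: "real^('n::{finite,linorder}) => real^('n::{finite,linorder})^('n::{finite,linorder}) => complex" where
  "carrier_fn x \<tau> = Fprod F \<tau> * cis (2 * pi * (x \<bullet> (\<Sum>j\<in>UNIV. \<tau> $ j)))"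

text \<open>On extensional functions the indicator of the cube is a product of one-dimensional
  indicators, so the integral over the cube factorises.\<close>

lemma inner_form_product:
  "inner_form x t = F0 x * (\<Prod>j\<in>UNIV - {idx_n}. LINT a:{0..1}|lborel. F j (x + (t * a) *\<^sub>R unit_vec j)) * F idx_n (x + t *\<^sub>R unit_vec idx_n)"
proof -
  interpret product_sigma_finite "%_::'n. lborel :: real measure" ..
  let ?J = "UNIV - {idx_n}"
  let ?c = "F0 x * F idx_n (x + t *\<^sub>R unit_vec idx_n)"
  let ?f = "%j a. indicator {0..1::real} a *\<^sub>R F j (x + (t * a) *\<^sub>R unit_vec j)"
  have fi: "integrable lborel (?f j)" for j
  proof -
    obtain C where C: "\<And>x. norm (F j x) \<le> C" using schwartz_bounded[OF F[of j]] by blast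
    have [measurable]: "F j \<in> borel_measurable borel" using F by measurable
    show ?thesis
    proof (rule Bochner_Integration.integrable_bound[where f = "%a. C * indicator {0..1} a"])
      show "integrable lborel (%a. C * indicator {0..1::real} a)"
        by (intro integrable_mult_right integrable_real_indicator) (auto simp: emeasure_lborel_Icc_eq)
      show "AE a in lborel. norm (?f j a) \<le> norm (C * indicator {0..1} a)"
        using C order_trans[OF norm_ge_zero C] by (intro AE_I2) (auto simp: indicator_def)
    qed measurable
  qed
  have "inner_form x t = (LINT \<alpha>|PiM ?J (%_. lborel). ?c * (\<Prod>j\<in>?J. ?f j (\<alpha> j)))"
    unfolding inner_form_def set_lebesgue_integral_def
  proof (intro Bochner_Integration.integral_cong refl)
    fix \<alpha> assume "\<alpha> \<in> space (PiM ?J (%_. lborel :: real measure))"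
    then have "\<alpha> \<in> extensional ?J" by (auto simp: space_PiM PiE_def)
    then have "indicator (PiE ?J (%_. {0..1::real})) \<alpha> = (\<Prod>j\<in>?J. indicator {0..1::real} (\<alpha> j) :: real)"
      by (auto simp: indicator_def PiE_def Pi_def)
    then show "indicator (PiE ?J (%_. {0..1::real})) \<alpha> *\<^sub>R (F0 x * (\<Prod>j\<in>?J. F j (x + (t * \<alpha> j) *\<^sub>R unit_vec j)) * F idx_n (x + t *\<^sub>R unit_vec idx_n))
       = ?c * (\<Prod>j\<in>?J. ?f j (\<alpha> j))"
      by (simp add: scaleR_conv_of_real prod.distrib mult_ac)
  qed
  also have "\<dots> = ?c * (\<Prod>j\<in>?J. LINT a|lborel. ?f j a)"
    by (subst integral_mult_right_zero, subst product_integral_prod) (use fi in auto)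
  finally show ?thesis by (simp add: set_lebesgue_integral_def mult_ac)
qed

lemma wave_eq: "wave t \<xi> = (\<Prod>j\<in>UNIV - {idx_n}. unit_average (t * \<xi> $ j)) * cis (2 * pi * (t * \<xi> $ idx_n))"
  unfolding wave_def using averages_cis[OF js(1), of idx_n t \<xi>] js(2) by simp

lemma wave_measurable: "case_prod wave \<in> borel_measurable (borel \<Otimes>\<^sub>M borel)"
proof -
  have "(%(t, \<xi>). cis (2 * pi * (t * \<xi> $ idx_n))) \<in> borel_measurable (borel \<Otimes>\<^sub>M borel)"
    unfolding case_prod_beta' by measurable
  from averages_measurable_param[OF this] show ?thesis unfolding wave_def .
qed

lemma norm_wave_le: "norm (wave t \<xi>) \<le> 1"
  unfolding wave_def by (rule averages_norm_le) (auto intro: measurable_compose)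

lemma carrier_integrable: "integrable lborel (carrier_fn x)"
proof -
  have "integrable lborel (%\<tau>::real^('n::{finite,linorder})^('n::{finite,linorder}). \<Prod>j\<in>UNIV. fourier (F j) (\<tau> $ j) * cis (2 * pi * (x \<bullet> \<tau> $ j)))"
    using Fprod_integral_product(2)[where F = F and k = "%_ _. 1" and x = x, OF F] by (intro integrable_prod_vec) simp
  moreover have "(\<Prod>j\<in>UNIV. fourier (F j) (\<tau> $ j) * cis (2 * pi * (x \<bullet> \<tau> $ j))) = carrier_fn x \<tau>" for \<tau> :: "real^('n::{finite,linorder})^('n::{finite,linorder})"
    unfolding carrier_fn_def Fprod_def inner_sum_right sum_distrib_left by (simp add: cis_sum prod.distrib)
  ultimately show ?thesis by simp
qed

lemma inner_form_fourier: "inner_form x t = F0 x * (LINT \<tau>|lborel. carrier_fn x \<tau> * wave t (diagonal \<tau>))"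
proof -
  let ?k = "%j \<xi>. if j = idx_n then cis (2 * pi * (t * \<xi> $ idx_n)) else unit_average (t * \<xi> $ j)"
  have k: "?k j \<in> borel_measurable borel" "bounded_fn (?k j)" for j
    by (auto simp: bounded_fn_def intro!: exI[of _ 1] norm_unit_average_le)
  have w: "wave t (diagonal \<tau>) = (\<Prod>j\<in>UNIV. ?k j (\<tau> $ j))" for \<tau>
    unfolding wave_eq by (subst prod.remove[of UNIV idx_n]) (auto simp: diagonal_def mult.commute)
  have n: "F idx_n (x + t *\<^sub>R unit_vec idx_n) = (LINT \<xi>|lborel. fourier (F idx_n) \<xi> * cis (2 * pi * (x \<bullet> \<xi>)) * cis (2 * pi * (t * \<xi> $ idx_n)))"
    unfolding fourier_inversion[OF F, of idx_n "x + t *\<^sub>R unit_vec idx_n"]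
    by (simp add: mult.assoc cis_mult inner_add_left unit_vec_def inner_axis' algebra_simps)
  have "(LINT \<tau>|lborel. carrier_fn x \<tau> * wave t (diagonal \<tau>)) = (\<Prod>j\<in>UNIV. LINT \<xi>|lborel. fourier (F j) \<xi> * cis (2 * pi * (x \<bullet> \<xi>)) * ?k j \<xi>)"
    unfolding w carrier_fn_def by (rule Fprod_integral_product(1)[OF F k])
  also have "\<dots> = F idx_n (x + t *\<^sub>R unit_vec idx_n) * (\<Prod>j\<in>UNIV - {idx_n}. LINT a:{0..1}|lborel. F j (x + (t * a) *\<^sub>R unit_vec j))"
    by (subst prod.remove[of UNIV idx_n]) (auto simp: n schwartz_segment_average[OF F])
  finally show ?thesis unfolding inner_form_product by (simp add: mult_ac)
qed

lemma inner_form_measurable: "inner_form x \<in> borel_measurable borel"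
proof -
  have [measurable]: "carrier_fn x \<in> borel_measurable borel" using carrier_integrable[of x] by auto
  have [measurable]: "(%q. wave (fst q) (diagonal (snd q))) \<in> borel_measurable (borel \<Otimes>\<^sub>M (lborel :: (real^('n::{finite,linorder})^('n::{finite,linorder})) measure))"
    by (rule measurable_split2[OF wave_measurable]) measurable
  have "(%t. LINT \<tau>|lborel. carrier_fn x \<tau> * wave t (diagonal \<tau>)) \<in> borel_measurable borel"
    by (rule sigma_finite_measure.borel_measurable_lebesgue_integral[OF sigma_finite_lborel]) (simp add: case_prod_beta')
  then show ?thesis unfolding inner_form_fourier[abs_def] by simp
qed

text \<open>The decay in t is due to \<open>F last_idx\<close> alone, the one function evaluated at
  x + t e_n without an average; the averaged functions are merely bounded.\<close>

lemma inner_form_decay: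
  obtains D where "0 \<le> D" "\<And>t. norm (inner_form x t) \<le> D * inverse (1 + (x $ idx_n + t)\<^sup>2)"
proof -
  obtain C where C: "0 \<le> C" "\<And>t. norm (F idx_n (x + t *\<^sub>R unit_vec idx_n)) \<le> C * inverse (1 + (x $ idx_n + t)\<^sup>2)"
    using schwartz_line_decay[OF F[of idx_n], where x = x and j = idx_n] by blast
  have "\<exists>B. \<forall>y. norm (F j y) \<le> B" for j using schwartz_bounded[OF F[of j]] by blast
  then obtain B where B: "\<And>j y. norm (F j y) \<le> B j" by metis
  have a: "norm (LINT a:{0..1}|lborel. F j (x + (t * a) *\<^sub>R unit_vec j)) \<le> B j" for j t
  proof -
    have [measurable]: "F j \<in> borel_measurable borel" using F by measurable
    show ?thesis using set_integral_norm_le[of "%a. F j (x + (t * a) *\<^sub>R unit_vec j)" 0 1 "B j"] B by simp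
  qed
  let ?D = "norm (F0 x) * (\<Prod>j\<in>UNIV - {idx_n}. B j)"
  have D0: "0 \<le> ?D" using order_trans[OF norm_ge_zero B] by (intro mult_nonneg_nonneg prod_nonneg) auto
  have "norm (inner_form x t) \<le> (?D * C) * inverse (1 + (x $ idx_n + t)\<^sup>2)" for t
  proof -
    have "norm (inner_form x t) \<le> ?D * (C * inverse (1 + (x $ idx_n + t)\<^sup>2))"
      unfolding inner_form_product norm_mult prod_norm[symmetric]
      by (intro mult_mono C(2) prod_mono conjI a mult_left_mono D0) (auto intro!: mult_nonneg_nonneg prod_nonneg)
    then show ?thesis by (simp add: mult_ac)
  qed
  moreover have "0 \<le> ?D * C" using D0 C(1) by simp
  ultimately show ?thesis using that by blast
qed

lemma trunc_form:
  assumes e: "0 < \<epsilon>"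
  shows "(LINT t|lborel. complex_of_real (indicator {t. \<epsilon> < \<bar>t\<bar> \<and> \<bar>t\<bar> < R} t / t) * inner_form x t)
    = F0 x * (LINT \<tau>|lborel. carrier_fn x \<tau> * averages idx_n zero_list (%\<xi>. trunc_pv \<epsilon> R (\<xi> $ idx_n)) (diagonal \<tau>))"
proof -
  let ?w = "%t. complex_of_real (indicator {t. \<epsilon> < \<bar>t\<bar> \<and> \<bar>t\<bar> < R} t / t)"
  have wi: "integrable lborel ?w" by (rule trunc_integrable[OF e])
  have "(LINT t|lborel. ?w t * inner_form x t) = F0 x * (LINT t|lborel. LINT \<tau>|lborel. ?w t * carrier_fn x \<tau> * wave t (diagonal \<tau>))"
    unfolding inner_form_fourier
    by (subst integral_mult_right_zero[symmetric])+ (simp only: mult_ac)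
  also have "(LINT t|lborel. LINT \<tau>|lborel. ?w t * carrier_fn x \<tau> * wave t (diagonal \<tau>)) = (LINT \<tau>|lborel. LINT t|lborel. ?w t * carrier_fn x \<tau> * wave t (diagonal \<tau>))"
  proof (rule Fubini_mult[where B = 1])
    show "(%(t, \<tau>). wave t (diagonal \<tau>)) \<in> borel_measurable (lborel \<Otimes>\<^sub>M lborel)"
      unfolding case_prod_beta' by (rule measurable_split2[OF wave_measurable]) measurable
  qed (use wi carrier_integrable norm_wave_le in \<open>auto simp: sigma_finite_lborel\<close>)
  also have "\<dots> = (LINT \<tau>|lborel. carrier_fn x \<tau> * (LINT t|lborel. ?w t * wave t (diagonal \<tau>)))"
    by (subst integral_mult_right_zero[symmetric]) (simp only: mult_ac)
  also have "(%\<tau>. LINT t|lborel. ?w t * wave t (diagonal \<tau>)) = (%\<tau>. averages idx_n zero_list (%\<xi>. trunc_pv \<epsilon> R (\<xi> $ idx_n)) (diagonal \<tau>))"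
  proof
    fix \<tau> :: "real^('n::{finite,linorder})^('n::{finite,linorder})"
    have "(%(t, \<xi>). cis (2 * pi * (t * \<xi> $ idx_n))) \<in> borel_measurable (borel \<Otimes>\<^sub>M borel)"
      unfolding case_prod_beta' by measurable
    note m = this
    have l: "0 \<le> snd x \<and> snd x \<le> 1" if "x \<in> set zero_list" for x using that by auto
    have "averages idx_n zero_list (%\<xi>. LINT t|lborel. ?w t * cis (2 * pi * (t * \<xi> $ idx_n))) (diagonal \<tau>)
      = (LINT t|lborel. ?w t * averages idx_n zero_list (%\<xi>. cis (2 * pi * (t * \<xi> $ idx_n))) (diagonal \<tau>))"
      by (rule averages_integral[OF wi m _ l, where B = 1]) simp
    then show "(LINT t|lborel. ?w t * wave t (diagonal \<tau>)) = averages idx_n zero_list (%\<xi>. trunc_pv \<epsilon> R (\<xi> $ idx_n)) (diagonal \<tau>)"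
      unfolding trunc_pv_def wave_def by (rule sym)
  qed
  finally show ?thesis .
qed

definition pv_mult :: "real => real => complex" where
  "pv_mult \<epsilon> c = 2 * \<i> * of_real (sgn c * (pi / 2 - Si (\<epsilon> * \<bar>2 * pi * c\<bar>)))"

lemma trunc_pv_measurable: "0 < \<epsilon> ==> \<epsilon> < R ==> trunc_pv \<epsilon> R \<in> borel_measurable borel"
  using measurable_cong[of borel "trunc_pv \<epsilon> R" "%c. 2 * \<i> * of_real (sgn c * (Si (R * \<bar>2 * pi * c\<bar>) - Si (\<epsilon> * \<bar>2 * pi * c\<bar>)))" borel] by (simp add: trunc_pv_eq)

lemma pv_mult_measurable [measurable]: "pv_mult \<epsilon> \<in> borel_measurable borel"
  unfolding pv_mult_def[abs_def] by measurable

lemma carrier_limit: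
  assumes m: "\<And>k. m k \<in> borel_measurable borel" "m' \<in> borel_measurable borel" and B: "\<And>k \<xi>. norm (m k \<xi>) \<le> B"
    and lim: "\<And>\<xi>. (%k. m k \<xi>) \<longlonglongrightarrow> m' \<xi>"
  shows "(%k. LINT \<tau>|lborel. carrier_fn x \<tau> * averages idx_n zero_list (m k) (diagonal \<tau>)) \<longlonglongrightarrow> (LINT \<tau>|lborel. carrier_fn x \<tau> * averages idx_n zero_list m' (diagonal \<tau>))"
proof (rule integral_dominated_convergence[where w = "%\<tau>. B * norm (carrier_fn x \<tau>)"])
  have [measurable]: "carrier_fn x \<in> borel_measurable borel" using carrier_integrable[of x] by auto
  note [measurable] = averages_measurable[OF m(1)] averages_measurable[OF m(2)]
  show "(%\<tau>. carrier_fn x \<tau> * averages idx_n zero_list m' (diagonal \<tau>)) \<in> borel_measurable lborel"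
    "\<And>k. (%\<tau>. carrier_fn x \<tau> * averages idx_n zero_list (m k) (diagonal \<tau>)) \<in> borel_measurable lborel" by measurable
  show "integrable lborel (%\<tau>. B * norm (carrier_fn x \<tau>))"
    by (intro integrable_mult_right integrable_norm carrier_integrable)
  show "AE \<tau> in lborel. (%k. carrier_fn x \<tau> * averages idx_n zero_list (m k) (diagonal \<tau>)) \<longlonglongrightarrow> carrier_fn x \<tau> * averages idx_n zero_list m' (diagonal \<tau>)"
    by (intro AE_I2 tendsto_mult tendsto_const averages_limit[OF m B lim]) auto
  show "AE \<tau> in lborel. norm (carrier_fn x \<tau> * averages idx_n zero_list (m k) (diagonal \<tau>)) \<le> B * norm (carrier_fn x \<tau>)" for k
    unfolding norm_mult mult.commute[of B]
    by (intro AE_I2 mult_left_mono averages_norm_le[OF m(1) B]) auto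
qed

text \<open>The cutoff at infinity is removed on both sides: in space the decay of
  \<open>inner_form\<close> provides a majorant, in frequency the uniform bound on
  \<open>trunc_pv\<close> does.\<close>

lemma pv_form:
  assumes e: "0 < \<epsilon>"
  shows "(LINT t:{t. \<epsilon> < \<bar>t\<bar>}|lborel. inner_form x t / complex_of_real t)
    = F0 x * (LINT \<tau>|lborel. carrier_fn x \<tau> * averages idx_n zero_list (%\<xi>. pv_mult \<epsilon> (\<xi> $ idx_n)) (diagonal \<tau>))"
proof -
  let ?w = "%R t. complex_of_real (indicator {t. \<epsilon> < \<bar>t\<bar> \<and> \<bar>t\<bar> < R} t / t)"
  \<comment> \<open>Stays above \<epsilon>, as \<open>trunc_pv_eq\<close> requires.\<close>
  let ?R = "%k. \<epsilon> + 1 + real k"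
  obtain D where D: "0 \<le> D" "\<And>t. norm (inner_form x t) \<le> D * inverse (1 + (x $ idx_n + t)\<^sup>2)"
    using inner_form_decay[of x] by blast
  obtain B where B: "\<And>\<epsilon> R c. 0 < \<epsilon> ==> \<epsilon> < R ==> norm (trunc_pv \<epsilon> R c) \<le> B"
    and B': "\<And>\<epsilon> c. norm (2 * \<i> * of_real (sgn c * (pi / 2 - Si (\<epsilon> * \<bar>2 * pi * c\<bar>)))) \<le> B"
    using norm_trunc_pv_le by blast
  note [measurable] = inner_form_measurable[of x]
  have "(%k. LINT t|lborel. ?w (?R k) t * inner_form x t) \<longlonglongrightarrow> (LINT t|lborel. indicator {t. \<epsilon> < \<bar>t\<bar>} t *\<^sub>R (inner_form x t / complex_of_real t))"
  proof (rule integral_dominated_convergence[where w = "%t. (D / \<epsilon>) * inverse (1 + (x $ idx_n + t)\<^sup>2)"])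
    show "integrable lborel (%t. (D / \<epsilon>) * inverse (1 + (x $ idx_n + t)\<^sup>2))"
      using lborel_integrable_real_affine[OF integrable_inverse_1_plus_square_UNIV, of 1 "x $ idx_n"] by simp
    show "AE t in lborel. (%k. ?w (?R k) t * inner_form x t) \<longlonglongrightarrow> indicator {t. \<epsilon> < \<bar>t\<bar>} t *\<^sub>R (inner_form x t / complex_of_real t)"
    proof (rule AE_I2, rule tendsto_eventually)
      fix t :: real
      obtain N :: nat where "\<bar>t\<bar> < real N" using reals_Archimedean2 by blast
      then have "?w (?R k) t * inner_form x t = indicator {t. \<epsilon> < \<bar>t\<bar>} t *\<^sub>R (inner_form x t / complex_of_real t)" if "k \<ge> N" for k
        using that e by (auto simp: indicator_def)
      then show "\<forall>\<^sub>F k in sequentially. ?w (?R k) t * inner_form x t = indicator {t. \<epsilon> < \<bar>t\<bar>} t *\<^sub>R (inner_form x t / complex_of_real t)"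
        by (auto simp: eventually_sequentially)
    qed
    show "AE t in lborel. norm (?w (?R k) t * inner_form x t) \<le> (D / \<epsilon>) * inverse (1 + (x $ idx_n + t)\<^sup>2)" for k
    proof (rule AE_I2)
      fix t
      have "norm (?w (?R k) t) \<le> 1 / \<epsilon>" using e by (auto simp: indicator_def norm_divide field_simps)
      then have "norm (?w (?R k) t * inner_form x t) \<le> (1 / \<epsilon>) * (D * inverse (1 + (x $ idx_n + t)\<^sup>2))"
        unfolding norm_mult by (intro mult_mono D) (use e in auto)
      then show "norm (?w (?R k) t * inner_form x t) \<le> (D / \<epsilon>) * inverse (1 + (x $ idx_n + t)\<^sup>2)" by simp
    qed
    show "(%t. indicator {t. \<epsilon> < \<bar>t\<bar>} t *\<^sub>R (inner_form x t / complex_of_real t)) \<in> borel_measurable lborel"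
      "\<And>k. (%t. ?w (?R k) t * inner_form x t) \<in> borel_measurable lborel"
      by measurable
  qed
  moreover have "(%k. LINT t|lborel. ?w (?R k) t * inner_form x t) \<longlonglongrightarrow> F0 x * (LINT \<tau>|lborel. carrier_fn x \<tau> * averages idx_n zero_list (%\<xi>. pv_mult \<epsilon> (\<xi> $ idx_n)) (diagonal \<tau>))"
    unfolding trunc_form[OF e]
  proof (intro tendsto_mult tendsto_const carrier_limit[where B = B])
    show "(%\<xi>. trunc_pv \<epsilon> (?R k) (\<xi> $ idx_n)) \<in> borel_measurable borel" for k
      by (rule measurable_compose[OF _ trunc_pv_measurable]) (use e in auto)
    show "norm (trunc_pv \<epsilon> (?R k) (\<xi> $ idx_n)) \<le> B" for k \<xi> using B[of \<epsilon> "?R k"] e by simp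
    show "(%k. trunc_pv \<epsilon> (?R k) (\<xi> $ idx_n)) \<longlonglongrightarrow> pv_mult \<epsilon> (\<xi> $ idx_n)" for \<xi>
      unfolding pv_mult_def by (rule trunc_pv_tendsto[OF e])
  qed measurable
  ultimately show ?thesis unfolding set_lebesgue_integral_def by (rule LIMSEQ_unique)
qed

text \<open>The limit as \<epsilon> tends to 0 exists for every x, so \<open>Lim\<close> denotes a
  true limit. As \<open>Si\<close> vanishes at 0, the remaining constant is 2i times pi/2. The outer
  integral over x is then that of \<open>Lambda_m_physical\<close>.\<close>

theorem Lambda_n_eq_Lambda_m:
  "Lambda_n F0 F = Lambda_m (%\<xi>. averages idx_n zero_list (%\<xi>. \<i> * pi * of_real (sgn (\<xi> $ idx_n))) \<xi>) F0 F"
proof -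
  let ?s = "%\<xi>::real^('n::{finite,linorder}). \<i> * pi * complex_of_real (sgn (\<xi> $ idx_n))"
  have sm: "?s \<in> borel_measurable borel" by measurable
  have sb: "norm (?s \<xi>) \<le> pi" for \<xi> by (simp add: norm_mult abs_sgn_eq)
  obtain B where B': "\<And>\<epsilon> R c. 0 < \<epsilon> ==> \<epsilon> < R ==> norm (trunc_pv \<epsilon> R c) \<le> B"
    and B: "\<And>\<epsilon> c. norm (2 * \<i> * of_real (sgn c * (pi / 2 - Si (\<epsilon> * \<bar>2 * pi * c\<bar>)))) \<le> B"
    using norm_trunc_pv_le by blast
  have "((%\<epsilon>. LINT t:{t. \<epsilon> < \<bar>t\<bar>}|lborel. inner_form x t / complex_of_real t) \<longlongrightarrow> F0 x * (LINT \<tau>|lborel. carrier_fn x \<tau> * averages idx_n zero_list ?s (diagonal \<tau>))) (at_right 0)" for x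
  proof (rule tendsto_at_right_sequentially[of 0 1])
    fix S :: "nat => real" assume S: "\<And>n. 0 < S n" "S \<longlonglongrightarrow> 0"
    show "(%k. LINT t:{t. S k < \<bar>t\<bar>}|lborel. inner_form x t / complex_of_real t) \<longlonglongrightarrow> F0 x * (LINT \<tau>|lborel. carrier_fn x \<tau> * averages idx_n zero_list ?s (diagonal \<tau>))"
      unfolding pv_form[OF S(1)]
    proof (intro tendsto_mult tendsto_const carrier_limit[where B = B] sm)
      show "norm (pv_mult (S k) (\<xi> $ idx_n)) \<le> B" for k \<xi> unfolding pv_mult_def by (rule B)
      show "(%k. pv_mult (S k) (\<xi> $ idx_n)) \<longlonglongrightarrow> ?s \<xi>" for \<xi> :: "real^('n::{finite,linorder})"
      proof -
        let ?c = "\<xi> $ idx_n"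
        have "(%k. S k * \<bar>2 * pi * ?c\<bar>) \<longlonglongrightarrow> 0 * \<bar>2 * pi * ?c\<bar>" by (intro tendsto_intros S)
        then have "(%k. S k * \<bar>2 * pi * ?c\<bar>) \<longlonglongrightarrow> 0" by simp
        then have "(%k. Si (S k * \<bar>2 * pi * ?c\<bar>)) \<longlonglongrightarrow> Si 0" by (rule isCont_tendsto_compose[OF isCont_Si])
        then have "(%k. pv_mult (S k) ?c) \<longlonglongrightarrow> 2 * \<i> * of_real (sgn ?c * (pi / 2 - Si 0))"
          unfolding pv_mult_def by (intro tendsto_intros)
        moreover have "Si 0 = 0" by (simp add: Si_def zero_ereal_def[symmetric])
        ultimately show ?thesis by (simp add: mult_ac)
      qed
    qed measurable
  qed simp
  then have L: "Lim (at_right 0) (%\<epsilon>. LINT t:{t. \<epsilon> < \<bar>t\<bar>}|lborel. inner_form x t / complex_of_real t) = F0 x * (LINT \<tau>|lborel. carrier_fn x \<tau> * averages idx_n zero_list ?s (diagonal \<tau>))" for x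
    by (intro tendsto_Lim) auto
  have "averages idx_n zero_list ?s \<in> borel_measurable borel" by (rule averages_measurable[OF sm])
  moreover have "bounded_fn (averages idx_n zero_list ?s)"
    unfolding bounded_fn_def by (intro exI[of _ pi] allI averages_norm_le[OF sm sb]) auto
  ultimately show ?thesis
    unfolding Lambda_n_def inner_form_def[symmetric] L
    by (simp add: Lambda_m_physical[OF F0 F] carrier_fn_def)
qed

end

subsection \<open>Random signs\<close>

text \<open>Independent random signs indexed by \<open>I\<close> are encoded by subsets
  \<open>A\<close> of \<open>I\<close>. Expectations are averages over \<open>Pow I\<close>, written
  as sums without normalisation.\<close>

definition sign_of :: "'a set => 'a => real" where
  "sign_of A k = (if k \<in> A then 1 else - 1)"

lemma sum_Pow_insert:
  assumes "finite I" "x \<notin> I"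
  shows "sum f (Pow (insert x I)) = (\<Sum>A\<in>Pow I. f A + f (insert x A))"
proof -
  have "sum f (Pow (insert x I)) = sum f (Pow I) + sum f (insert x ` Pow I)"
    unfolding Pow_insert using assms by (intro sum.union_disjoint) auto
  also have "sum f (insert x ` Pow I) = (\<Sum>A\<in>Pow I. f (insert x A))"
  proof -
    have "inj_on (insert x) (Pow I)" using assms by (auto simp: inj_on_def)
    then show ?thesis by (simp add: sum.reindex)
  qed
  finally show ?thesis by (simp add: sum.distrib)
qed

lemma powr_convex_combination:
  fixes a b x y q :: real
  assumes ab: "0 \<le> a" "0 \<le> b" "a + b = 1" and xy: "0 \<le> x" "0 \<le> y" and q: "1 \<le> q"
  shows "(a * x + b * y) powr q \<le> a * x powr q + b * y powr q"
proof -
  have *: "(t * z) powr q \<le> t * z powr q" if "0 \<le> t" "t \<le> 1" "0 \<le> z" for t z :: real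
  proof -
    have "t powr q \<le> t" using powr_mono'[of 1 q t] that q by auto
    then have "t powr q * z powr q \<le> t * z powr q" by (intro mult_right_mono) auto
    then show ?thesis using that by (simp add: powr_mult)
  qed
  consider "x = 0" | "y = 0" | "0 < x" "0 < y" using xy by linarith
  then show ?thesis
  proof cases
    case 1 then show ?thesis using *[of b y] ab xy by simp
  next
    case 2 then show ?thesis using *[of a x] ab xy by simp
  next
    case 3
    have "(a *\<^sub>R x + b *\<^sub>R y) powr q \<le> a * x powr q + b * y powr q"
      using powr_convex[OF q] ab 3 unfolding convex_on_def by auto
    then show ?thesis by simp
  qed
qed

text \<open>For \<open>\<bar>c\<bar> \<le> 1\<close> the points w + cz and w - cz are convex
  combinations of w + z and w - z, with the two weights interchanged, and the q-th power of the norm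
  is convex.\<close>

lemma powr_norm_two_point:
  fixes w z :: complex and c q :: real
  assumes c: "\<bar>c\<bar> \<le> 1" and q: "1 \<le> q"
  shows "norm (w + of_real c * z) powr q + norm (w - of_real c * z) powr q \<le> norm (w + z) powr q + norm (w - z) powr q"
proof -
  define a b where "a = (1 + c) / 2" and "b = (1 - c) / 2"
  have ab: "0 \<le> a" "0 \<le> b" "a + b = 1" "b + a = 1" using c unfolding a_def b_def by (auto simp: field_simps)
  have 1: "norm (of_real s * u + of_real t * v) powr q \<le> s * norm u powr q + t * norm v powr q"
    if "0 \<le> s" "0 \<le> t" "s + t = 1" for s t :: real and u v :: complex
  proof -
    have "norm (of_real s * u + of_real t * v) \<le> s * norm u + t * norm v"
      using that by (intro order_trans[OF norm_triangle_ineq]) (simp add: norm_mult)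
    then have "norm (of_real s * u + of_real t * v) powr q \<le> (s * norm u + t * norm v) powr q"
      using q by (intro powr_mono2) auto
    also have "\<dots> \<le> s * norm u powr q + t * norm v powr q"
      by (rule powr_convex_combination) (use that q in auto)
    finally show ?thesis .
  qed
  have e1: "of_real a * (w + z) + of_real b * (w - z) = w + of_real c * z" and e2: "of_real b * (w + z) + of_real a * (w - z) = w - of_real c * z"
    unfolding a_def b_def by (auto simp: field_simps)
  have "norm (w + of_real c * z) powr q + norm (w - of_real c * z) powr q
     \<le> (a * norm (w + z) powr q + b * norm (w - z) powr q) + (b * norm (w + z) powr q + a * norm (w - z) powr q)"
    using 1[of a b "w + z" "w - z"] 1[of b a "w + z" "w - z"] ab unfolding e1 e2 by (intro add_mono) auto
  also have "\<dots> = (a + b) * (norm (w + z) powr q + norm (w - z) powr q)" by (simp add: algebra_simps)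
  finally show ?thesis using ab by simp
qed

lemma contraction_real:
  fixes z :: "'a => complex"
  assumes I: "finite I" and c: "\<And>k. \<bar>c k\<bar> \<le> 1" and q: "1 \<le> q"
  shows "(\<Sum>A\<in>Pow I. norm (w + (\<Sum>k\<in>I. of_real (sign_of A k) * (of_real (c k) * z k))) powr q)
    \<le> (\<Sum>A\<in>Pow I. norm (w + (\<Sum>k\<in>I. of_real (sign_of A k) * z k)) powr q)"
  using I
proof (induction I arbitrary: w rule: finite_induct)
  case (insert x I)
  have sg: "sign_of (insert x A) k = sign_of A k" if "k \<in> I" for A k
    using that insert by (auto simp: sign_of_def)
  have sx: "sign_of (insert x A) x = 1" for A by (simp add: sign_of_def)
  have nx: "sign_of A x = - 1" if "A \<in> Pow I" for A using that insert by (auto simp: sign_of_def)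
  let ?S = "%u A. \<Sum>k\<in>I. of_real (sign_of A k) * u k"
  have split: "(\<Sum>A\<in>Pow (insert x I). norm (w + (\<Sum>k\<in>insert x I. of_real (sign_of A k) * u k)) powr q)
    = (\<Sum>A\<in>Pow I. norm ((w - u x) + ?S u A) powr q) + (\<Sum>A\<in>Pow I. norm ((w + u x) + ?S u A) powr q)" for u :: "'a => complex"
  proof -
    have "(\<Sum>A\<in>Pow (insert x I). norm (w + (\<Sum>k\<in>insert x I. of_real (sign_of A k) * u k)) powr q)
      = (\<Sum>A\<in>Pow I. norm ((w - u x) + ?S u A) powr q + norm ((w + u x) + ?S u A) powr q)"
      unfolding sum_Pow_insert[OF insert(1,2)]
    proof (rule sum.cong[OF refl])
      fix A assume A: "A \<in> Pow I"
      have "(\<Sum>k\<in>insert x I. of_real (sign_of A k) * u k) = - u x + ?S u A"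
        using insert(1,2) nx[OF A] by simp
      moreover have "(\<Sum>k\<in>insert x I. of_real (sign_of (insert x A) k) * u k) = u x + ?S u A"
        using insert(1,2) sx sg by simp
      ultimately show "norm (w + (\<Sum>k\<in>insert x I. of_real (sign_of A k) * u k)) powr q + norm (w + (\<Sum>k\<in>insert x I. of_real (sign_of (insert x A) k) * u k)) powr q
        = norm ((w - u x) + ?S u A) powr q + norm ((w + u x) + ?S u A) powr q"
        by (simp only:) (simp add: add_diff_eq diff_add_eq add.assoc)
    qed
    then show ?thesis by (simp add: sum.distrib)
  qed
  let ?cz = "%k. of_real (c k) * z k"
  have "(\<Sum>A\<in>Pow I. norm ((w - ?cz x) + ?S ?cz A) powr q) + (\<Sum>A\<in>Pow I. norm ((w + ?cz x) + ?S ?cz A) powr q)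
    \<le> (\<Sum>A\<in>Pow I. norm ((w - ?cz x) + ?S z A) powr q) + (\<Sum>A\<in>Pow I. norm ((w + ?cz x) + ?S z A) powr q)"
    by (intro add_mono insert.IH)
  also have "\<dots> = (\<Sum>A\<in>Pow I. norm ((w + ?S z A) + of_real (c x) * z x) powr q + norm ((w + ?S z A) - of_real (c x) * z x) powr q)"
    by (simp add: sum.distrib algebra_simps)
  also have "\<dots> \<le> (\<Sum>A\<in>Pow I. norm ((w + ?S z A) + z x) powr q + norm ((w + ?S z A) - z x) powr q)"
    by (intro sum_mono powr_norm_two_point c q)
  also have "\<dots> = (\<Sum>A\<in>Pow I. norm ((w - z x) + ?S z A) powr q) + (\<Sum>A\<in>Pow I. norm ((w + z x) + ?S z A) powr q)"
    by (simp add: sum.distrib algebra_simps)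
  finally show ?case unfolding split .
qed simp

text \<open>Coefficients of modulus one are reduced to the real coefficients cos and sin;
  \<open>2 powr q\<close> is the price of adding the two parts.\<close>

lemma contraction_cis:
  fixes z :: "'a => complex"
  assumes I: "finite I" and q: "1 \<le> q"
  shows "(\<Sum>A\<in>Pow I. norm (\<Sum>k\<in>I. of_real (sign_of A k) * (z k * cis (\<theta> k))) powr q)
    \<le> 2 powr q * (\<Sum>A\<in>Pow I. norm (\<Sum>k\<in>I. of_real (sign_of A k) * z k) powr q)"
proof -
  let ?R = "\<Sum>A\<in>Pow I. norm (\<Sum>k\<in>I. of_real (sign_of A k) * z k) powr q"
  let ?C = "%c A. \<Sum>k\<in>I. of_real (sign_of A k) * (complex_of_real (c k) * z k)"
  have C: "(\<Sum>A\<in>Pow I. norm (?C c A) powr q) \<le> ?R" if "\<And>k. \<bar>c k\<bar> \<le> 1" for c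
    using contraction_real[where I = I and c = c and q = q and w = 0 and z = z, OF I that q] by simp
  have "norm (\<Sum>k\<in>I. of_real (sign_of A k) * (z k * cis (\<theta> k))) powr q
     \<le> 2 powr q / 2 * (norm (?C (%k. cos (\<theta> k)) A) powr q + norm (?C (%k. sin (\<theta> k)) A) powr q)" for A
  proof -
    let ?a = "?C (%k. cos (\<theta> k)) A" and ?b = "?C (%k. sin (\<theta> k)) A"
    have "cis t = of_real (cos t) + \<i> * of_real (sin t)" for t by (simp add: complex_eq_iff)
    then have "(\<Sum>k\<in>I. of_real (sign_of A k) * (z k * cis (\<theta> k))) = ?a + \<i> * ?b"
      by (simp add: sum_distrib_left sum.distrib[symmetric] algebra_simps)
    then have "norm (\<Sum>k\<in>I. of_real (sign_of A k) * (z k * cis (\<theta> k))) \<le> norm ?a + norm ?b"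
      using norm_triangle_ineq[of ?a "\<i> * ?b"] by (simp add: norm_mult)
    then have "norm (\<Sum>k\<in>I. of_real (sign_of A k) * (z k * cis (\<theta> k))) powr q \<le> (2 * ((1/2) * norm ?a + (1/2) * norm ?b)) powr q"
      using q by (intro powr_mono2) auto
    also have "\<dots> = 2 powr q * ((1/2) * norm ?a + (1/2) * norm ?b) powr q" by (intro powr_mult)
    also have "\<dots> \<le> 2 powr q * ((1/2) * norm ?a powr q + (1/2) * norm ?b powr q)"
      by (intro mult_left_mono powr_convex_combination) (use q in auto)
    finally show ?thesis by (simp add: algebra_simps)
  qed
  then have "(\<Sum>A\<in>Pow I. norm (\<Sum>k\<in>I. of_real (sign_of A k) * (z k * cis (\<theta> k))) powr q)
    \<le> (\<Sum>A\<in>Pow I. 2 powr q / 2 * (norm (?C (%k. cos (\<theta> k)) A) powr q + norm (?C (%k. sin (\<theta> k)) A) powr q))"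
    by (intro sum_mono)
  also have "\<dots> = 2 powr q / 2 * ((\<Sum>A\<in>Pow I. norm (?C (%k. cos (\<theta> k)) A) powr q) + (\<Sum>A\<in>Pow I. norm (?C (%k. sin (\<theta> k)) A) powr q))"
    by (simp only: sum_distrib_left[symmetric] sum.distrib)
  also have "\<dots> \<le> 2 powr q / 2 * (?R + ?R)"
    by (intro mult_left_mono add_mono C) auto
  finally show ?thesis by simp
qed

text \<open>Only equal indices survive the average over signs. The constants \<open>a\<close> and
  \<open>b\<close> absorb the split-off terms in the induction; the application takes both to be
  0.\<close>

lemma sign_orthogonality:
  fixes u v :: "'a => complex"
  assumes I: "finite I"
  shows "(\<Sum>A\<in>Pow I. (a + (\<Sum>k\<in>I. of_real (sign_of A k) * u k)) * (b + (\<Sum>k\<in>I. of_real (sign_of A k) * v k)))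
    = 2 ^ card I * (a * b + (\<Sum>k\<in>I. u k * v k))"
  using I
proof (induction I arbitrary: a b rule: finite_induct)
  case (insert x I)
  have sg: "sign_of (insert x A) k = sign_of A k" if "k \<in> I" for A k
    using that insert by (auto simp: sign_of_def)
  have sx: "sign_of (insert x A) x = 1" for A by (simp add: sign_of_def)
  have nx: "sign_of A x = - 1" if "A \<in> Pow I" for A using that insert by (auto simp: sign_of_def)
  let ?S = "%u A. \<Sum>k\<in>I. of_real (sign_of A k) * u k"
  have 1: "(\<Sum>k\<in>insert x I. of_real (sign_of A k) * u k) = - u x + ?S u A" if "A \<in> Pow I" for A and u :: "'a => complex"
    using insert(1,2) nx[OF that] by simp
  have 2: "(\<Sum>k\<in>insert x I. of_real (sign_of (insert x A) k) * u k) = u x + ?S u A" for A and u :: "'a => complex"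
    using insert(1,2) sx sg by simp
  have "(\<Sum>A\<in>Pow (insert x I). (a + (\<Sum>k\<in>insert x I. of_real (sign_of A k) * u k)) * (b + (\<Sum>k\<in>insert x I. of_real (sign_of A k) * v k)))
    = (\<Sum>A\<in>Pow I. ((a - u x) + ?S u A) * ((b - v x) + ?S v A)) + (\<Sum>A\<in>Pow I. ((a + u x) + ?S u A) * ((b + v x) + ?S v A))"
    unfolding sum_Pow_insert[OF insert(1,2)] sum.distrib[symmetric]
    by (rule sum.cong[OF refl]) (simp only: 1 2, simp add: algebra_simps)
  then show ?case unfolding insert.IH using insert(1,2) by (simp add: algebra_simps)
qed simp

text \<open>\<open>T\<close> dominates 1 and both powers, so the product is at most T to the power
  1/p + 1/q, hence at most T. The additive 1 makes an inequality between the exponents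
  sufficient.\<close>

lemma Young_crude:
  fixes x y p q :: real
  assumes xy: "0 \<le> x" "0 \<le> y" and pq: "0 < p" "0 < q" "1 / p + 1 / q \<le> 1"
  shows "x * y \<le> 1 + x powr p + y powr q"
proof -
  define T where "T = max 1 (max (x powr p) (y powr q))"
  have T: "1 \<le> T" "x powr p \<le> T" "y powr q \<le> T" unfolding T_def by auto
  have "x = (x powr p) powr (1 / p)" using xy pq by (simp add: powr_powr)
  also have "\<dots> \<le> T powr (1 / p)" using T pq by (intro powr_mono2) auto
  finally have 1: "x \<le> T powr (1 / p)" .
  have "y = (y powr q) powr (1 / q)" using xy pq by (simp add: powr_powr)
  also have "\<dots> \<le> T powr (1 / q)" using T pq by (intro powr_mono2) auto
  finally have 2: "y \<le> T powr (1 / q)" .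
  have "x * y \<le> T powr (1 / p) * T powr (1 / q)" using 1 2 xy by (intro mult_mono) auto
  also have "\<dots> = T powr (1 / p + 1 / q)" by (simp add: powr_add)
  also have "\<dots> \<le> T powr 1" using T pq by (intro powr_mono) auto
  also have "\<dots> \<le> 1 + x powr p + y powr q" using T unfolding T_def by (auto simp: max_def)
  finally show ?thesis .
qed

text \<open>Hoelder on a probability space, where 1/p + 1/q may be below 1. The constant 3 counts
  the terms of \<open>Young_crude\<close> after both families are scaled to size one.\<close>

lemma sum_Hoelder_crude:
  fixes X Y :: "'a => real"
  assumes P: "finite P" and XY: "\<And>A. 0 \<le> X A" "\<And>A. 0 \<le> Y A" and pq: "0 < p" "0 < q" "1 / p + 1 / q \<le> 1"
    and a: "0 \<le> a" "(\<Sum>A\<in>P. X A powr p) \<le> real (card P) * a powr p"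
    and b: "0 \<le> b" "(\<Sum>A\<in>P. Y A powr q) \<le> real (card P) * b powr q"
  shows "(\<Sum>A\<in>P. X A * Y A) \<le> 3 * real (card P) * (a * b)"
proof -
  have z: "(\<Sum>A\<in>P. Z A powr s) = 0 ==> A \<in> P ==> 0 < s ==> Z A = 0" for Z :: "'a => real" and s A
    using P by (subst (asm) sum_nonneg_eq_0_iff) auto
  consider "a = 0" | "b = 0" | "0 < a" "0 < b" using a b by linarith
  then show ?thesis
  proof cases
    case 1
    then have "(\<Sum>A\<in>P. X A powr p) = 0" using a sum_nonneg[of P "%A. X A powr p"] by simp
    then show ?thesis using z[of X p] pq 1 by simp
  next
    case 2
    then have "(\<Sum>A\<in>P. Y A powr q) = 0" using b sum_nonneg[of P "%A. Y A powr q"] by simp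
    then show ?thesis using z[of Y q] pq 2 by simp
  next
    case 3
    have "(\<Sum>A\<in>P. (X A / a) * (Y A / b)) \<le> (\<Sum>A\<in>P. 1 + (X A / a) powr p + (Y A / b) powr q)"
      using 3 XY pq by (intro sum_mono Young_crude) auto
    also have "\<dots> = real (card P) + (\<Sum>A\<in>P. X A powr p) / a powr p + (\<Sum>A\<in>P. Y A powr q) / b powr q"
      using 3 XY by (simp add: sum.distrib powr_divide sum_divide_distrib)
    also have "\<dots> \<le> real (card P) + real (card P) + real (card P)"
      using a b 3 by (intro add_mono order_refl) (auto simp: field_simps)
    finally have "(\<Sum>A\<in>P. X A * Y A) / (a * b) \<le> 3 * real (card P)" by (simp add: sum_divide_distrib)
    then show ?thesis using 3 by (simp add: field_simps)
  qed
qed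

subsection \<open>Bounded multipliers\<close>

text \<open>The constant is a parameter, not existentially quantified, because limits and averages
  of multipliers need a bound common to the family. Measurability and boundedness are carried along
  so that all forms are genuine integrals.\<close>

definition mult_bound :: "real => ('n::finite => real) => real => (real^'n => complex) => bool" where
  "mult_bound p0 p c m \<longleftrightarrow> 0 \<le> c \<and> m \<in> borel_measurable borel \<and> bounded_fn m \<and>
    (\<forall>F0 F. schwartz F0 \<and> (\<forall>j. schwartz (F j)) \<longrightarrow>
       norm (Lambda_m m F0 F) \<le> c * (Lp_norm p0 F0 * (\<Prod>j\<in>UNIV. Lp_norm (p j) (F j))))"

lemma mult_boundD:
  assumes "mult_bound p0 p c m"
  shows "0 \<le> c" "m \<in> borel_measurable borel" "bounded_fn m"
    and "schwartz F0 ==> (\<And>j. schwartz (F j)) ==> norm (Lambda_m m F0 F) \<le> c * (Lp_norm p0 F0 * (\<Prod>j\<in>UNIV. Lp_norm (p j) (F j)))"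
  using assms unfolding mult_bound_def by blast+

lemma Lp_prod_nonneg: "0 \<le> Lp_norm p0 F0 * (\<Prod>j\<in>UNIV. Lp_norm (p j) (F j))"
  by (intro mult_nonneg_nonneg prod_nonneg) (auto simp: Lp_norm_nonneg)

lemma mult_boundI:
  assumes "0 \<le> c" "m \<in> borel_measurable borel" "bounded_fn m"
    and "\<And>F0 F. schwartz F0 ==> (\<And>j. schwartz (F j)) ==> norm (Lambda_m m F0 F) \<le> c * (Lp_norm p0 F0 * (\<Prod>j\<in>UNIV. Lp_norm (p j) (F j)))"
  shows "mult_bound p0 p c m"
  unfolding mult_bound_def using assms(1-3) by (intro conjI allI impI; (elim conjE)?) (assumption | rule assms(4) | blast)+

lemma mult_bound_mono:
  fixes m :: "real^'n::finite => complex"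
  shows "mult_bound p0 p c m ==> c \<le> d ==> mult_bound p0 p d m"
  unfolding mult_bound_def
proof (intro conjI allI impI; (elim conjE)?)
  fix F0 :: "real^'n => complex" and F :: "'n => real^'n => complex"
  assume *: "c \<le> d" "schwartz F0" "\<forall>j. schwartz (F j)"
    "\<forall>F0 F. schwartz F0 \<and> (\<forall>j. schwartz (F j)) \<longrightarrow> norm (Lambda_m m F0 F) \<le> c * (Lp_norm p0 F0 * (\<Prod>j\<in>UNIV. Lp_norm (p j) (F j)))"
  then have "norm (Lambda_m m F0 F) \<le> c * (Lp_norm p0 F0 * (\<Prod>j\<in>UNIV. Lp_norm (p j) (F j)))" by simp
  also have "\<dots> \<le> d * (Lp_norm p0 F0 * (\<Prod>j\<in>UNIV. Lp_norm (p j) (F j)))"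
    by (rule mult_right_mono[OF *(1) Lp_prod_nonneg])
  finally show "norm (Lambda_m m F0 F) \<le> d * (Lp_norm p0 F0 * (\<Prod>j\<in>UNIV. Lp_norm (p j) (F j)))" .
qed auto

lemma mult_bound_cmult:
  assumes "mult_bound p0 p c m"
  shows "mult_bound p0 p (norm k * c) (%\<xi>. k * m \<xi>)"
proof -
  note D = mult_boundD[OF assms]
  have "Lambda_m (%\<xi>. k * m \<xi>) F0 F = k * Lambda_m m F0 F" for F0 F
    unfolding Lambda_m_eq by (subst integral_mult_right_zero[symmetric]) (simp only: mult_ac)
  then have "norm (Lambda_m (%\<xi>. k * m \<xi>) F0 F) \<le> norm k * c * (Lp_norm p0 F0 * (\<Prod>j\<in>UNIV. Lp_norm (p j) (F j)))"
    if "schwartz F0" "\<And>j. schwartz (F j)" for F0 F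
    using D(4)[of F0 F, OF that] by (simp add: norm_mult mult.assoc mult_left_mono)
  then show ?thesis using D bounded_fn_mult[of "%_. k" m] by (intro mult_boundI) simp_all
qed

lemma mult_bound_add:
  assumes "mult_bound p0 p c m" "mult_bound p0 p c' m'"
  shows "mult_bound p0 p (c + c') (%\<xi>. m \<xi> + m' \<xi>)"
proof -
  note D = mult_boundD[OF assms(1)] mult_boundD[OF assms(2)]
  have "norm (Lambda_m (%\<xi>. m \<xi> + m' \<xi>) F0 F) \<le> (c + c') * (Lp_norm p0 F0 * (\<Prod>j\<in>UNIV. Lp_norm (p j) (F j)))"
    if F: "schwartz F0" "\<And>j. schwartz (F j)" for F0 F
  proof -
    have "Lambda_m (%\<xi>. m \<xi> + m' \<xi>) F0 F = Lambda_m m F0 F + Lambda_m m' F0 F"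
      unfolding Lambda_m_eq distrib_left using D F by (intro Bochner_Integration.integral_add Fker_mult_integrable) auto
    then show ?thesis using D(4)[of F0 F, OF F] D(8)[of F0 F, OF F] norm_triangle_ineq[of "Lambda_m m F0 F" "Lambda_m m' F0 F"]
      by (simp add: algebra_simps)
  qed
  then show ?thesis using D bounded_fn_add[of m m'] by (intro mult_boundI) simp_all
qed

lemma mult_bound_diff:
  assumes "mult_bound p0 p c m" "mult_bound p0 p c' m'"
  shows "mult_bound p0 p (c + c') (%\<xi>. m \<xi> - m' \<xi>)"
  using mult_bound_add[OF assms(1) mult_bound_cmult[OF assms(2), of "-1"]] by simp

lemma mult_bound_zero: "mult_bound p0 p 0 (%\<xi>. 0)"
  unfolding mult_bound_def Lambda_m_def by simp

lemma mult_bound_sum: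
  "finite I ==> (\<And>k. k \<in> I ==> mult_bound p0 p (c k) (m k)) ==> mult_bound p0 p (\<Sum>k\<in>I. c k) (%\<xi>. \<Sum>k\<in>I. m k \<xi>)"
  by (induction I rule: finite_induct) (auto intro: mult_bound_zero mult_bound_add)

lemma mult_bound_limit:
  assumes m: "\<And>k. mult_bound p0 p c (m k)" "m' \<in> borel_measurable borel"
    and B: "\<And>k \<xi>. norm (m k \<xi>) \<le> B" "bounded_fn m'"
    and lim: "\<And>\<xi>. (\<forall>j. \<xi> $ j \<noteq> 0) ==> (%k. m k \<xi>) \<longlonglongrightarrow> m' \<xi>"
  shows "mult_bound p0 p c m'"
proof -
  have bd: "norm (Lambda_m m' F0 F) \<le> c * (Lp_norm p0 F0 * (\<Prod>j\<in>UNIV. Lp_norm (p j) (F j)))"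
    if F: "schwartz F0" "\<And>j. schwartz (F j)" for F0 F
  proof (rule LIMSEQ_le_const2)
    show "(%k. norm (Lambda_m (m k) F0 F)) \<longlonglongrightarrow> norm (Lambda_m m' F0 F)"
      by (intro tendsto_norm Lambda_m_limit[where B = B]) (use F m B lim mult_boundD(2)[OF m(1)] in auto)
    show "\<exists>N. \<forall>n\<ge>N. norm (Lambda_m (m n) F0 F) \<le> c * (Lp_norm p0 F0 * (\<Prod>j\<in>UNIV. Lp_norm (p j) (F j)))"
      using mult_boundD(4)[OF m(1), of F0 F, OF F] by blast
  qed
  show ?thesis by (rule mult_boundI[OF mult_boundD(1)[OF m(1)] m(2) B(2) bd])
qed

lemma mult_bound_cong:
  assumes m: "mult_bound p0 p c m" and m': "m' \<in> borel_measurable borel" "bounded_fn m'"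
    and eq: "\<And>\<xi>. (\<forall>j. \<xi> $ j \<noteq> 0) ==> m \<xi> = m' \<xi>"
  shows "mult_bound p0 p c m'"
proof -
  have bd: "norm (Lambda_m m' F0 F) \<le> c * (Lp_norm p0 F0 * (\<Prod>j\<in>UNIV. Lp_norm (p j) (F j)))"
    if F: "schwartz F0" "\<And>j. schwartz (F j)" for F0 F
    using mult_boundD(4)[OF m, of F0 F, OF F] Lambda_m_cong[OF F mult_boundD(2)[OF m] m'(1) eq] by simp
  show ?thesis by (rule mult_boundI[OF mult_boundD(1)[OF m] m' bd])
qed

lemma mult_bound_average:
  fixes m :: "real => real^'n::finite => complex"
  assumes m: "case_prod m \<in> borel_measurable (borel \<Otimes>\<^sub>M borel)" and B: "\<And>a \<xi>. norm (m a \<xi>) \<le> B"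
    and c: "0 \<le> c" "\<And>a. a \<in> {u..v} ==> mult_bound p0 p c (m a)" and "u \<le> v"
  shows "mult_bound p0 p (c * (v - u)) (%\<xi>. LINT a:{u..v}|lborel. m a \<xi>)"
proof -
  have ma: "(%a. m a \<xi>) \<in> borel_measurable borel" for \<xi>
    by (rule measurable_split2[OF m]) auto
  have "norm (LINT a:{u..v}|lborel. m a \<xi>) \<le> B * (v - u)" for \<xi>
    by (rule set_integral_norm_le) (use ma B \<open>u \<le> v\<close> in auto)
  then have b: "bounded_fn (%\<xi>. LINT a:{u..v}|lborel. m a \<xi>)" unfolding bounded_fn_def by blast
  have "norm (Lambda_m (%\<xi>. LINT a:{u..v}|lborel. m a \<xi>) F0 F) \<le> c * (v - u) * (Lp_norm p0 F0 * (\<Prod>j\<in>UNIV. Lp_norm (p j) (F j)))"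
    if F: "schwartz F0" "\<And>j. schwartz (F j)" for F0 F
  proof -
    have Lm: "(%a. Lambda_m (m a) F0 F) \<in> borel_measurable borel"
    proof -
      have [measurable]: "(%q. m (fst q) (diagonal (snd q))) \<in> borel_measurable (borel \<Otimes>\<^sub>M (lborel :: (real^'n^'n) measure))"
        by (rule measurable_split2[OF m]) measurable
      note [measurable] = Fker_measurable[OF F]
      show ?thesis unfolding Lambda_m_eq
        by (rule sigma_finite_measure.borel_measurable_lebesgue_integral[OF sigma_finite_lborel]) (simp add: case_prod_beta')
    qed
    have "norm (LINT a:{u..v}|lborel. Lambda_m (m a) F0 F) \<le> (c * (Lp_norm p0 F0 * (\<Prod>j\<in>UNIV. Lp_norm (p j) (F j)))) * (v - u)"
      by (rule set_integral_norm_le) (use Lm mult_boundD(4)[OF c(2), of _ F0 F, OF _ F] \<open>u \<le> v\<close> in auto)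
    then show ?thesis unfolding Lambda_m_average[OF F m B] by (simp add: mult_ac)
  qed
  then show ?thesis using c(1) \<open>u \<le> v\<close>
    by (intro mult_boundI b set_integral_measurable_param[OF m]) simp_all
qed

lemma Lp_prod_dil:
  assumes l: "\<And>j. l j \<noteq> 0" and F0: "schwartz F0" and F: "\<And>j. schwartz (F j)"
  shows "Lp_norm p0 (%x. F0 (dil l x)) * (\<Prod>j\<in>UNIV. Lp_norm (p j) (%x. F j (dil l x)))
    = (\<Prod>j\<in>UNIV. \<bar>l j\<bar>) powr (- (1 / p0 + (\<Sum>j\<in>UNIV. 1 / p j))) * (Lp_norm p0 F0 * (\<Prod>j\<in>UNIV. Lp_norm (p j) (F j)))"
proof -
  let ?P = "\<Prod>j\<in>UNIV. \<bar>l j\<bar>"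
  have P: "?P > 0" using l by (auto intro: prod_pos)
  have "?P powr (- (1 / p0 + (\<Sum>j\<in>UNIV. 1 / p j))) = ?P powr (- 1 / p0) * (\<Prod>j\<in>UNIV. ?P powr (- 1 / p j))"
    using P l by (simp add: powr_add[symmetric] powr_sum[symmetric] sum_negf)
  then show ?thesis
    by (simp add: Lp_norm_dil[OF l F0] Lp_norm_dil[OF l F] prod.distrib mult_ac)
qed

lemma Lambda_m_dil_bound:
  assumes m: "mult_bound p0 p c m" and l: "\<And>j. l j \<noteq> 0" and F: "schwartz F0" "\<And>j. schwartz (F j)"
  shows "norm (Lambda_m (%\<xi>. m (dil l \<xi>)) F0 F)
    \<le> (\<Prod>j\<in>UNIV. \<bar>l j\<bar>) powr (1 - (1 / p0 + (\<Sum>j\<in>UNIV. 1 / p j))) * (c * (Lp_norm p0 F0 * (\<Prod>j\<in>UNIV. Lp_norm (p j) (F j))))"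
proof -
  let ?P = "\<Prod>j\<in>UNIV. \<bar>l j\<bar>"
  have P: "?P > 0" using l by (auto intro: prod_pos)
  have "norm (Lambda_m (%\<xi>. m (dil l \<xi>)) F0 F) = ?P * norm (Lambda_m m (%x. F0 (dil l x)) (%j x. F j (dil l x)))"
    using P by (simp add: Lambda_m_dil[OF l F mult_boundD(2)[OF m]] norm_mult prod_norm[symmetric] abs_prod)
  also have "\<dots> \<le> ?P * (c * (Lp_norm p0 (%x. F0 (dil l x)) * (\<Prod>j\<in>UNIV. Lp_norm (p j) (%x. F j (dil l x)))))"
    using P F l by (intro mult_left_mono mult_boundD(4)[OF m] schwartz_dil) auto
  also have "\<dots> = (?P * ?P powr (- (1 / p0 + (\<Sum>j\<in>UNIV. 1 / p j)))) * (c * (Lp_norm p0 F0 * (\<Prod>j\<in>UNIV. Lp_norm (p j) (F j))))"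
    unfolding Lp_prod_dil[OF l F] by (simp only: mult_ac)
  also have "?P * ?P powr (- (1 / p0 + (\<Sum>j\<in>UNIV. 1 / p j))) = ?P powr (1 - (1 / p0 + (\<Sum>j\<in>UNIV. 1 / p j)))"
    using P by (simp only: diff_conv_add_uminus powr_add powr_one)
  finally show ?thesis .
qed

text \<open>An isotropic dilation by e^t leaves the multiplier 1 unchanged but scales the two sides
  by different powers unless the identity holds. If it failed, t could be chosen to make the bound
  arbitrarily small, so the form would vanish on Gaussians, where it is the integral of a positive
  function.\<close>

lemma exponents_scaling:
  fixes p :: "'n::finite => real"
  assumes m: "mult_bound p0 p c (%_. 1)"
  shows "1 / p0 + (\<Sum>j\<in>UNIV. 1 / p j) = 1"
proof (rule ccontr)
  define s where "s = 1 - (1 / p0 + (\<Sum>j\<in>UNIV. 1 / p j))"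
  assume "1 / p0 + (\<Sum>j\<in>UNIV. 1 / p j) \<noteq> 1"
  then have s: "s \<noteq> 0" by (simp add: s_def)
  define G where "G = (%x::real^'n. complex_of_real (exp (- 1 * (x \<bullet> x))))"
  have G: "schwartz G" unfolding G_def by (rule schwartz_gaussian) simp
  define K where "K = c * (Lp_norm p0 G * (\<Prod>j\<in>UNIV. Lp_norm (p j) G))"
  have K: "0 \<le> K" unfolding K_def by (intro mult_nonneg_nonneg Lp_prod_nonneg mult_boundD(1)[OF m])
  define L where "L = Lambda_m (%_. 1) G (%_::'n. G)"
  have b: "norm L \<le> exp (real CARD('n) * t * s) * K" for t
  proof -
    have "norm L \<le> (\<Prod>j\<in>(UNIV::'n set). \<bar>exp t\<bar>) powr s * K"
      using Lambda_m_dil_bound[OF m, of "%_. exp t" G "%_. G"] G unfolding L_def K_def s_def by simp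
    also have "(\<Prod>j\<in>(UNIV::'n set). \<bar>exp t\<bar>) powr s = exp (real CARD('n) * t * s)"
      by (simp add: exp_of_nat_mult[symmetric] powr_def)
    finally show ?thesis .
  qed
  have "norm L \<le> 0"
  proof (rule ccontr)
    assume "\<not> norm L \<le> 0"
    then have L: "norm L > 0" by simp
    have K': "K > 0" using order_less_le_trans[OF L b[of 0]] by simp
    \<comment> \<open>The choice of t turns the bound into half of \<open>norm L\<close>.\<close>
    have "norm L \<le> exp (ln (norm L / (2 * K))) * K"
      using b[of "ln (norm L / (2 * K)) / (real CARD('n) * s)"] s by simp
    also have "\<dots> = norm L / 2" using L K' by (simp add: field_simps)
    finally show False using L by simp
  qed
  moreover have "L \<noteq> 0"
  proof -
    define N where "N = real (Suc (CARD('n)))"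
    have eq: "G x * (\<Prod>j\<in>(UNIV::'n set). G x) = of_real (exp (- N * (x \<bullet> x)))" for x
      unfolding G_def N_def by (simp add: exp_of_nat_mult[symmetric] exp_add[symmetric] algebra_simps flip: of_real_power of_real_mult)
    have i: "integrable lborel (%x::real^'n. exp (- N * (x \<bullet> x)))"
    proof -
      have "schwartz (%x::real^'n. complex_of_real (exp (- N * (x \<bullet> x))))"
        by (rule schwartz_gaussian) (simp add: N_def)
      from integrable_norm[OF schwartz_integrable[OF this]] show ?thesis by simp
    qed
    have "L = of_real (LINT x|lborel. exp (- N * (x \<bullet> (x::real^'n))))"
      unfolding L_def Lambda_m_one[OF G G] eq by (rule integral_complex_of_real)
    moreover have "(LINT x|lborel. exp (- N * (x \<bullet> (x::real^'n)))) \<noteq> 0"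
    proof
      assume "(LINT x|lborel. exp (- N * (x \<bullet> (x::real^'n)))) = 0"
      then have "AE x in lborel. exp (- N * (x \<bullet> (x::real^'n))) = 0"
        using integral_nonneg_eq_0_iff_AE[OF i] by simp
      then have "AE x in (lborel :: (real^'n) measure). False" by simp
      then have "emeasure lborel (UNIV :: (real^'n) set) = 0" by (simp add: AE_iff_null null_sets_def)
      then show False by simp
    qed
    ultimately show ?thesis by simp
  qed
  ultimately show False by simp
qed

section \<open>Dilation invariance and translations of multipliers\<close>

locale exponents =
  fixes p0 :: real and p :: "'n::finite => real"
  assumes p0: "p0 > 1" and p: "\<And>j. p j > 1" and scaling: "1 / p0 + (\<Sum>j\<in>UNIV. 1 / p j) = 1"
begin

abbreviation "mb \<equiv> mult_bound p0 p"

text \<open>By the scaling identity the powers of the Jacobian cancel, so the constant does not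
  change, however anisotropic the dilation. This uniformity is what makes the limits of dilates
  below possible.\<close>

lemma mb_dil:
  assumes m: "mb c m" and l: "\<And>j. l j \<noteq> 0"
  shows "mb c (%\<xi>. m (dil l \<xi>))"
  unfolding mult_bound_def
proof (intro conjI allI impI)
  show "0 \<le> c" by (rule mult_boundD(1)[OF m])
  show "(%\<xi>. m (dil l \<xi>)) \<in> borel_measurable borel"
    by (rule measurable_compose[OF dil_measurable mult_boundD(2)[OF m]])
  show "bounded_fn (%\<xi>. m (dil l \<xi>))" using mult_boundD(3)[OF m] unfolding bounded_fn_def by blast
  fix F0 :: "real^'n => complex" and F :: "'n => real^'n => complex"
  assume "schwartz F0 \<and> (\<forall>j. schwartz (F j))"
  then show "norm (Lambda_m (%\<xi>. m (dil l \<xi>)) F0 F) \<le> c * (Lp_norm p0 F0 * (\<Prod>j\<in>UNIV. Lp_norm (p j) (F j)))"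
    using Lambda_m_dil_bound[OF m l, of F0 F] l by (simp add: scaling)
qed

lemma exponent_pair: "i \<noteq> j ==> 1 / p i + 1 / p j \<le> 1"
proof -
  assume "i \<noteq> j"
  then have "1 / p i + 1 / p j = (\<Sum>k\<in>{i, j}. 1 / p k)" by simp
  also have "\<dots> \<le> (\<Sum>k\<in>UNIV. 1 / p k)"
    by (rule sum_mono2) (auto intro: less_imp_le order_less_trans[OF zero_less_one p])
  also have "\<dots> \<le> 1" using scaling p0 by (smt (verit) zero_le_divide_1_iff)
  finally show ?thesis .
qed

end

text \<open>Opposite modulations shift \<tau>_i by -c e_j and \<tau>_j by c e_j. The sum of the
  rows, and with it the argument of the transform of \<open>F0\<close>, stays fixed. The diagonal
  only sees the change in row j, because the i-th entry of e_j is 0.\<close>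

lemma Lambda_m_translate:
  fixes F :: "'n::finite => real^'n => complex"
  assumes ij: "i \<noteq> j" and F0: "schwartz F0" and F: "\<And>j. schwartz (F j)" and f: "schwartz f" and g: "schwartz g"
    and m: "m \<in> borel_measurable borel" 
  shows "Lambda_m m F0 (F(i := %x. f x * cis (2 * pi * (x \<bullet> ((- c) *\<^sub>R unit_vec j))), j := %x. g x * cis (2 * pi * (x \<bullet> (c *\<^sub>R unit_vec j)))))
    = Lambda_m (%\<xi>. m (\<xi> + c *\<^sub>R unit_vec j)) F0 (F(i := f, j := g))"
proof -
  let ?G = "F(i := %x. f x * cis (2 * pi * (x \<bullet> ((- c) *\<^sub>R unit_vec j))), j := %x. g x * cis (2 * pi * (x \<bullet> (c *\<^sub>R unit_vec j))))"
  let ?H = "F(i := f, j := g)"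
  have G: "schwartz (?G k)" for k using F schwartz_cis_mult[OF f, of "2 * pi"] schwartz_cis_mult[OF g, of "2 * pi"] by (simp only: fun_upd_apply split: if_split) blast
  define S :: "real^'n^'n" where "S = (\<chi> k. if k = i then (- c) *\<^sub>R unit_vec j else if k = j then c *\<^sub>R unit_vec j else 0)"
  note [measurable] = m Fker_measurable[OF F0 G]
  have "(\<Sum>k\<in>UNIV. S $ k) = (\<Sum>k\<in>UNIV. (if k = i then (- c) *\<^sub>R unit_vec j else 0) + (if k = j then c *\<^sub>R unit_vec j else 0))"
    using ij by (intro sum.cong refl) (auto simp: S_def)
  then have S0: "(\<Sum>k\<in>UNIV. S $ k) = 0" by (simp add: sum.distrib)
  have k: "fourier (?G k) ((S + \<tau>) $ k) = fourier (?H k) (\<tau> $ k)" for k \<tau>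
  proof -
    consider "k = i" | "k = j" | "k \<noteq> i" "k \<noteq> j" by blast
    then show ?thesis
    proof cases
      case 1
      then have "?G k = (%x. f x * cis (2 * pi * (x \<bullet> ((- c) *\<^sub>R unit_vec j))))" "?H k = f" "(S + \<tau>) $ k - (- c) *\<^sub>R unit_vec j = \<tau> $ k"
        using ij by (auto simp: S_def)
      then show ?thesis by (simp only: fourier_modulate)
    next
      case 2
      then have "?G k = (%x. g x * cis (2 * pi * (x \<bullet> (c *\<^sub>R unit_vec j))))" "?H k = g" "(S + \<tau>) $ k - c *\<^sub>R unit_vec j = \<tau> $ k"
        using ij by (auto simp: S_def)
      then show ?thesis by (simp only: fourier_modulate)
    next
      case 3 then show ?thesis by (simp add: S_def)
    qed
  qed
  have K: "Fker F0 ?G (S + \<tau>) = Fker F0 ?H \<tau>" for \<tau>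
    unfolding Fker_def Fprod_def k by (simp add: sum.distrib S0)
  have d: "diagonal (S + \<tau>) = diagonal \<tau> + c *\<^sub>R unit_vec j" for \<tau>
    using ij by (auto simp: vec_eq_iff diagonal_def S_def unit_vec_def axis_def)
  have "Lambda_m m F0 ?G = (LINT \<tau>|lborel. Fker F0 ?G (S + \<tau>) * m (diagonal (S + \<tau>)))"
    unfolding Lambda_m_eq by (rule integral_translate[symmetric]) measurable
  then show ?thesis unfolding K d Lambda_m_eq .
qed

section \<open>Smooth functions and cutoffs on the line\<close>

text \<open>Smoothness on \<open>U\<close> in the coinductive style of \<open>smooth_classI\<close>:
  some set containing \<open>g\<close> is closed under differentiation on \<open>U\<close>.
  Derivatives are prescribed on \<open>U\<close> only, so their values elsewhere are
  arbitrary.\<close>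

definition smooth1 :: "real set => (real => real) => bool" where
  "smooth1 U g \<longleftrightarrow> (\<exists>X. g \<in> X \<and> (\<forall>h\<in>X. \<exists>h'\<in>X. \<forall>u\<in>U. (h has_real_derivative h' u) (at u)))"

lemma smooth1I:
  assumes "g \<in> X" "\<And>h. h \<in> X ==> \<exists>h'\<in>X. \<forall>u\<in>U. (h has_real_derivative h' u) (at u)"
  shows "smooth1 U g"
  unfolding smooth1_def by (rule exI[of _ X]) (simp add: assms)

lemma smooth1_deriv:
  assumes "smooth1 U g"
  obtains g' where "smooth1 U g'" "\<And>u. u \<in> U ==> (g has_real_derivative g' u) (at u)"
proof -
  obtain X where X: "g \<in> X" "\<And>h. h \<in> X ==> \<exists>h'\<in>X. \<forall>u\<in>U. (h has_real_derivative h' u) (at u)"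
    using assms unfolding smooth1_def by blast
  obtain g' where "g' \<in> X" "\<forall>u\<in>U. (g has_real_derivative g' u) (at u)" using X by blast
  then show ?thesis using that smooth1I[of g' X U, OF _ X(2)] by blast
qed

lemma smooth1_step:
  assumes "\<And>u. u \<in> U ==> (g has_real_derivative g' u) (at u)" "smooth1 U g'"
  shows "smooth1 U g"
proof (rule smooth1I[where X = "insert g (Collect (smooth1 U))"])
  fix h assume "h \<in> insert g (Collect (smooth1 U))"
  then consider "h = g" | "smooth1 U h" by blast
  then show "\<exists>h'\<in>insert g (Collect (smooth1 U)). \<forall>u\<in>U. (h has_real_derivative h' u) (at u)"
  proof cases
    case 1 then show ?thesis using assms by (intro bexI[of _ g']) auto
  next
    case 2
    then obtain h' where "smooth1 U h'" "\<And>u. u \<in> U ==> (h has_real_derivative h' u) (at u)"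
      using smooth1_deriv by blast
    then show ?thesis by (intro bexI[of _ h']) auto
  qed
qed simp

lemma smooth1_subset: "smooth1 U g ==> V \<subseteq> U ==> smooth1 V g"
  unfolding smooth1_def by (meson subsetD)

lemma smooth1_const: "smooth1 U (%_. c)"
  by (rule smooth1I[where X = "range (%(c::real) _. c)"]) (auto intro!: bexI[of _ "%_. 0"] derivative_eq_intros)

lemma smooth1_id: "smooth1 U (%u. u)"
  by (rule smooth1_step[where g' = "%_. 1"]) (auto intro!: smooth1_const derivative_eq_intros)

text \<open>Closed under derivatives by the chain and product rules. Composition, product and sum
  are all special cases, with \<open>r\<close> the constant 1 or \<open>q\<close> the
  identity.\<close>

inductive_set comp_span :: "real set => real set => (real => real) => (real => real) set" for U V q where
  base: "smooth1 V g ==> smooth1 U r ==> (%u. g (q u) * r u) \<in> comp_span U V q"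
| add: "f \<in> comp_span U V q ==> g \<in> comp_span U V q ==> (%u. f u + g u) \<in> comp_span U V q"

lemma smooth1_comp_span:
  assumes q: "smooth1 U q" and qV: "q ` U \<subseteq> V" and f: "f \<in> comp_span U V q"
  shows "smooth1 U f"
proof (rule smooth1I[OF f])
  fix h assume "h \<in> comp_span U V q"
  then show "\<exists>h'\<in>comp_span U V q. \<forall>u\<in>U. (h has_real_derivative h' u) (at u)"
  proof induction
    case (base g r)
    obtain g' where g': "smooth1 V g'" "\<And>u. u \<in> V ==> (g has_real_derivative g' u) (at u)" using smooth1_deriv[OF base(1)] by blast
    obtain r' where r': "smooth1 U r'" "\<And>u. u \<in> U ==> (r has_real_derivative r' u) (at u)" using smooth1_deriv[OF base(2)] by blast
    obtain q' where q': "smooth1 U q'" "\<And>u. u \<in> U ==> (q has_real_derivative q' u) (at u)" using smooth1_deriv[OF q] by blast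
    \<comment> \<open>The chain rule leaves the factor q' r. That it is smooth is the case of
      products, proved in place with the identity in the role of \<open>q\<close>.\<close>
    have m: "smooth1 U (%u. q' u * r u)"
    proof (rule smooth1I[where X = "comp_span U U (%u. u)"])
      show "(%u. q' u * r u) \<in> comp_span U U (%u. u)" using comp_span.base[OF q'(1) base(2), of "%u. u"] by simp
      fix h assume "h \<in> comp_span U U (%u. u)"
      then show "\<exists>h'\<in>comp_span U U (%u. u). \<forall>u\<in>U. (h has_real_derivative h' u) (at u)"
      proof induction
        case (base g r)
        obtain g' where g': "smooth1 U g'" "\<And>u. u \<in> U ==> (g has_real_derivative g' u) (at u)" using smooth1_deriv[OF base(1)] by blast
        obtain r' where r': "smooth1 U r'" "\<And>u. u \<in> U ==> (r has_real_derivative r' u) (at u)" using smooth1_deriv[OF base(2)] by blast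
        show ?case
          by (rule bexI[where x = "%u. g' u * r u + g u * r' u"])
             (use comp_span.add[OF comp_span.base[OF g'(1) base(2), of "%u. u"] comp_span.base[OF base(1) r'(1), of "%u. u"]] in
               \<open>auto intro!: derivative_eq_intros g'(2) r'(2)\<close>)
      next
        case (add f g) then show ?case
        proof (elim bexE)
          fix f' g' assume *: "f' \<in> comp_span U U (%u. u)" "\<forall>u\<in>U. (f has_real_derivative f' u) (at u)"
            "g' \<in> comp_span U U (%u. u)" "\<forall>u\<in>U. (g has_real_derivative g' u) (at u)"
          show ?thesis by (rule bexI[OF _ comp_span.add[OF *(1,3)]]) (use * in \<open>auto intro!: DERIV_add\<close>)
        qed
      qed
    qed
    have d: "((%u. g (q u) * r u) has_real_derivative (g' (q u) * (q' u * r u) + g (q u) * r' u)) (at u)" if "u \<in> U" for u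
    proof -
      have "((%u. g (q u)) has_real_derivative g' (q u) * q' u) (at u)"
        by (rule DERIV_chain2[OF g'(2) q'(2)]) (use that qV in auto)
      from DERIV_mult[OF this r'(2)[OF that]] show ?thesis by (simp add: algebra_simps)
    qed
    show ?case
      by (rule bexI[OF _ comp_span.add[OF comp_span.base[OF g'(1) m] comp_span.base[OF base(1) r'(1)]]]) (use d in auto)
  next
    case (add f g) then show ?case
    proof (elim bexE)
      fix f' g' assume *: "f' \<in> comp_span U V q" "\<forall>u\<in>U. (f has_real_derivative f' u) (at u)"
        "g' \<in> comp_span U V q" "\<forall>u\<in>U. (g has_real_derivative g' u) (at u)"
      show ?thesis by (rule bexI[OF _ comp_span.add[OF *(1,3)]]) (use * in \<open>auto intro!: DERIV_add\<close>)
    qed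
  qed
qed

lemma smooth1_compose:
  assumes "smooth1 V g" "smooth1 U q" "q ` U \<subseteq> V"
  shows "smooth1 U (%u. g (q u))"
  using smooth1_comp_span[OF assms(2,3) comp_span.base[OF assms(1) smooth1_const[of U 1]]] by simp

lemma smooth1_mult:
  assumes "smooth1 U f" "smooth1 U g"
  shows "smooth1 U (%u. f u * g u)"
  using smooth1_comp_span[OF smooth1_id _ comp_span.base[OF assms, of "%u. u"]] by simp

lemma smooth1_add:
  assumes "smooth1 U f" "smooth1 U g"
  shows "smooth1 U (%u. f u + g u)"
  using smooth1_comp_span[OF smooth1_id _ comp_span.add[OF comp_span.base[OF assms(1) smooth1_const[of U 1], of "%u. u"] comp_span.base[OF assms(2) smooth1_const[of U 1], of "%u. u"]]]
  by simp

lemma smooth1_diff: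
  assumes "smooth1 U f" "smooth1 U g"
  shows "smooth1 U (%u. f u - g u)"
  using smooth1_add[OF assms(1) smooth1_mult[OF smooth1_const[of U "-1"] assms(2)]] by simp

lemma smooth1_inverse: "smooth1 (- {0}) inverse"
proof (rule smooth1I[where X = "{%u::real. c * inverse u ^ k | c k. True}"])
  show "inverse \<in> {%u::real. c * inverse u ^ k | c k. True}" by (rule CollectI, rule exI[of _ 1], rule exI[of _ 1]) (auto simp: fun_eq_iff)
  fix h assume "h \<in> {%u::real. c * inverse u ^ k | c k. True}"
  then obtain c k where h: "h = (%u. c * inverse u ^ k)" by blast
  have d: "(h has_real_derivative (- c * real k) * inverse u ^ Suc k) (at u)" if "u \<noteq> 0" for u
  proof (cases k)
    case (Suc i)
    have "((%u. inverse u ^ k) has_real_derivative real k * (- (inverse u ^ Suc (Suc 0))) * inverse u ^ (k - Suc 0)) (at u)"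
      using DERIV_power[OF DERIV_inverse[OF that], of k] by (simp add: mult_ac)
    from DERIV_cmult[OF this, of c] show ?thesis unfolding h by (rule DERIV_cong) (simp add: Suc mult_ac)
  qed (simp add: h)
  have "(%u. (- c * real k) * inverse u ^ Suc k) \<in> {%u::real. c * inverse u ^ k | c k. True}"
    unfolding mem_Collect_eq by (intro exI conjI TrueI) (rule refl)
  then show "\<exists>h'\<in>{%u::real. c * inverse u ^ k | c k. True}. \<forall>u\<in>- {0}. (h has_real_derivative h' u) (at u)"
    by (rule bexI[rotated]) (use d in blast)
qed

lemma smooth1_cong:
  assumes g: "smooth1 U g" and U: "open U" and eq: "\<And>u. u \<in> U ==> f u = g u"
  shows "smooth1 U f"
proof -
  obtain g' where g': "smooth1 U g'" "\<And>u. u \<in> U ==> (g has_real_derivative g' u) (at u)" using smooth1_deriv[OF g] by blast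
  show ?thesis
  proof (rule smooth1_step[OF _ g'(1)])
    fix u assume u: "u \<in> U"
    show "(f has_real_derivative g' u) (at u)"
      by (rule has_field_derivative_transform_within_open[OF g'(2)[OF u] U u]) (simp add: eq)
  qed
qed

lemma smooth1_continuous: "smooth1 U g ==> continuous_on U g"
  by (meson DERIV_isCont continuous_at_imp_continuous_on smooth1_deriv)

lemma deriv_locally_zero:
  assumes "(h has_real_derivative d) (at u)" "open V" "u \<in> V" "\<And>v. v \<in> V ==> h v = 0"
  shows "d = 0"
proof -
  have "((%_. 0) has_real_derivative d) (at u)"
    by (rule has_field_derivative_transform_within_open[OF assms(1-3)]) (simp add: assms(4))
  then show ?thesis using DERIV_unique[OF _ DERIV_const] by blast
qed

text \<open>The profiles of a Littlewood-Paley decomposition. Smoothness is asked for off 0 only,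
  but the function vanishes near 0; therefore multiplication by singular factors such as 1/u stays
  within the class.\<close>

definition annular :: "real => (real => real) => bool" where
  "annular r g \<longleftrightarrow> 1 \<le> r \<and> smooth1 (- {0}) g \<and> (\<forall>u. \<bar>u\<bar> < 1 / r \<or> r < \<bar>u\<bar> \<longrightarrow> g u = 0)"

lemma annularD:
  assumes "annular r g"
  shows "1 \<le> r" "smooth1 (- {0}) g" "\<And>u. \<bar>u\<bar> < 1 / r ==> g u = 0" "\<And>u. r < \<bar>u\<bar> ==> g u = 0"
  using assms unfolding annular_def by auto

lemma annular_mult:
  assumes "annular r g" "smooth1 (- {0}) f"
  shows "annular r (%u. g u * f u)"
  using assms smooth1_mult unfolding annular_def by auto

lemma annular_deriv:
  assumes g: "annular r g"
  obtains g' where "annular r g'" "\<And>u. (g has_real_derivative g' u) (at u)"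
proof -
  note D = annularD[OF g]
  obtain h where h: "smooth1 (- {0}) h" "\<And>u. u \<in> - {0} ==> (g has_real_derivative h u) (at u)" using smooth1_deriv[OF D(2)] by blast
  define g' where "g' u = (if u = 0 then 0 else h u)" for u
  have s: "smooth1 (- {0}) g'" by (rule smooth1_cong[OF h(1)]) (auto simp: g'_def)
  have o: "open {u. \<bar>u\<bar> < 1 / r}" "open {u. r < \<bar>u\<bar>}"
    by (auto intro!: open_Collect_less continuous_intros)
  have d: "(g has_real_derivative g' u) (at u)" for u
  proof (cases "u = 0")
    case True
    have "((%_. 0) has_real_derivative 0) (at u)" by simp
    from has_field_derivative_transform_within_open[OF this o(1), of g] show ?thesis
      using True D(1,3) by (auto simp: g'_def)
  qed (use h in \<open>auto simp: g'_def\<close>)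
  have "g' u = 0" if "\<bar>u\<bar> < 1 / r" for u by (rule deriv_locally_zero[OF d o(1)]) (use that D in auto)
  moreover have "g' u = 0" if "r < \<bar>u\<bar>" for u by (rule deriv_locally_zero[OF d o(2)]) (use that D in auto)
  ultimately have "annular r g'" using D(1) s unfolding annular_def by auto
  then show ?thesis using that d by blast
qed

lemma annular_bounded:
  assumes "annular r g"
  obtains C where "\<And>u. \<bar>g u\<bar> \<le> C"
proof -
  obtain g' where d: "\<And>u. (g has_real_derivative g' u) (at u)" using annular_deriv[OF assms] by blast
  have "continuous_on {-r..r} g" by (meson DERIV_isCont continuous_at_imp_continuous_on d)
  then have "bounded (g ` {-r..r})" by (intro compact_imp_bounded compact_continuous_image) auto
  then obtain C where "\<forall>u\<in>{-r..r}. \<bar>g u\<bar> \<le> C" unfolding bounded_iff by auto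
  then have C: "\<bar>g u\<bar> \<le> C" if "u \<in> {-r..r}" for u using that by blast
  have "\<bar>g u\<bar> \<le> max C 0" for u
  proof (cases "r < \<bar>u\<bar>")
    case False
    then have "u \<in> {-r..r}" by (auto simp: abs_le_iff not_less)
    then show ?thesis using C[of u] by (simp add: le_max_iff_disj)
  qed (simp add: annularD(4)[OF assms])
  then show ?thesis by (rule that)
qed

text \<open>The family exp(-1/u) q(1/u), extended by 0, is closed under differentiation: the
  derivative replaces q(y) by y^2 (q(y) - q'(y)). The member with q = 1 is the classical flat
  function.\<close>

definition flat_exp :: "real poly => real => real" where
  "flat_exp q u = (if u \<le> 0 then 0 else exp (- (1 / u)) * poly q (1 / u))"

lemma exp_poly_tendsto_0: "((%y::real. exp (- y) * poly q y) \<longlongrightarrow> 0) at_top"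
proof -
  have "((%y::real. \<Sum>i\<le>degree q. coeff q i * (y ^ i / exp y)) \<longlongrightarrow> (\<Sum>i\<le>degree q. coeff q i * 0)) at_top"
    by (intro tendsto_intros tendsto_power_div_exp_0)
  then show ?thesis by (simp add: poly_altdef sum_distrib_left exp_minus field_simps)
qed

lemma flat_exp_deriv: "(flat_exp q has_real_derivative flat_exp (monom 1 2 * (q - pderiv q)) u) (at u)"
proof -
  consider "u < 0" | "u = 0" | "u > 0" by linarith
  then show ?thesis
  proof cases
    case 1
    have "((%_. 0) has_real_derivative 0) (at u)" by simp
    from has_field_derivative_transform_within_open[OF this, of "{..<0}" "flat_exp q"] show ?thesis
      using 1 by (simp add: flat_exp_def)
  next
    case 3
    have "((%u. exp (- (1 / u)) * poly q (1 / u)) has_real_derivative flat_exp (monom 1 2 * (q - pderiv q)) u) (at u)"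
    proof -
      have i: "((%u. 1 / u) has_real_derivative - (1 / u\<^sup>2)) (at u)"
        using 3 by (auto intro!: derivative_eq_intros simp: power2_eq_square field_simps)
      have e: "((%u. exp (- (1 / u))) has_real_derivative exp (- (1 / u)) * (1 / u\<^sup>2)) (at u)"
        using DERIV_fun_exp[OF DERIV_minus[OF i]] by simp
      have p: "((%u. poly q (1 / u)) has_real_derivative poly (pderiv q) (1 / u) * - (1 / u\<^sup>2)) (at u)"
        by (rule DERIV_chain2[OF poly_DERIV i])
      from DERIV_mult[OF e p] show ?thesis
        using 3 by (simp add: flat_exp_def poly_monom power2_eq_square field_simps)
    qed
    from has_field_derivative_transform_within_open[OF this, of "{0<..}" "flat_exp q"] show ?thesis
      using 3 by (simp add: flat_exp_def)
  next
    case 2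
    have "((%h. (flat_exp q h - flat_exp q 0) / (h - 0)) \<longlongrightarrow> 0) (at 0)"
    proof (rule filterlim_split_at_real)
      show "((%h. (flat_exp q h - flat_exp q 0) / (h - 0)) \<longlongrightarrow> 0) (at_left 0)"
        by (rule tendsto_eventually) (auto simp: flat_exp_def eventually_at_filter)
      have "((%h. exp (- inverse h) * poly (monom 1 1 * q) (inverse h)) \<longlongrightarrow> 0) (at_right 0)"
        by (rule filterlim_compose[OF exp_poly_tendsto_0 filterlim_inverse_at_top_right])
      then show "((%h. (flat_exp q h - flat_exp q 0) / (h - 0)) \<longlongrightarrow> 0) (at_right 0)"
        by (rule Lim_transform_eventually) (auto simp: flat_exp_def eventually_at_filter poly_monom field_simps)
    qed
    then show ?thesis using 2 by (simp add: has_field_derivative_iff flat_exp_def)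
  qed
qed

lemma smooth1_flat_exp: "smooth1 UNIV (flat_exp q)"
  by (rule smooth1I[where X = "range flat_exp"]) (auto intro: flat_exp_deriv)

definition smooth_step :: "real => real" where
  "smooth_step u = flat_exp 1 u * inverse (flat_exp 1 u + flat_exp 1 (1 - u))"

lemma flat_exp_pos: "0 < u ==> 0 < flat_exp 1 u" and flat_exp_nonneg: "0 \<le> flat_exp 1 u" and flat_exp_zero: "u \<le> 0 ==> flat_exp q u = 0"
  by (auto simp: flat_exp_def)

lemma smooth_step_denominator: "0 < flat_exp 1 u + flat_exp 1 (1 - u)"
  using flat_exp_pos[of u] flat_exp_pos[of "1 - u"] flat_exp_nonneg[of u] flat_exp_nonneg[of "1 - u"]
  by (cases "0 < u") linarith+

lemma smooth1_smooth_step: "smooth1 UNIV smooth_step"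
proof -
  have r: "smooth1 UNIV (%u. 1 - u)" by (intro smooth1_diff smooth1_const smooth1_id)
  have "smooth1 UNIV (%u. flat_exp 1 u + flat_exp 1 (1 - u))"
    by (intro smooth1_add smooth1_flat_exp smooth1_compose[OF smooth1_flat_exp r]) auto
  from smooth1_compose[OF smooth1_inverse this]
  have "smooth1 UNIV (%u. inverse (flat_exp 1 u + flat_exp 1 (1 - u)))"
    using smooth_step_denominator by (force simp: less_le)
  from smooth1_mult[OF smooth1_flat_exp this] show ?thesis unfolding smooth_step_def[abs_def] .
qed

lemma smooth_step_le_0: "u \<le> 0 ==> smooth_step u = 0"
  by (simp add: smooth_step_def flat_exp_zero)

lemma smooth_step_ge_1: "1 \<le> u ==> smooth_step u = 1"
  using smooth_step_denominator[of u] by (simp add: smooth_step_def flat_exp_zero)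

lemma smooth_step_bounds: "0 \<le> smooth_step u" "smooth_step u \<le> 1"
  using smooth_step_denominator[of u] flat_exp_nonneg[of u] flat_exp_nonneg[of "1 - u"]
  unfolding smooth_step_def by (auto simp: field_simps)

text \<open>The quadratic argument turns a one-sided step into an even function that is smooth at 0.
  It reaches 1 when u^2 = 1/2, so quotients of modulus at most 1/2 lie on the plateau.\<close>

definition bump :: "real => real" where
  "bump u = smooth_step (2 - 2 * u\<^sup>2)"

lemma smooth1_bump: "smooth1 UNIV bump"
proof -
  have "smooth1 UNIV (%u. 2 - 2 * u\<^sup>2)"
    unfolding power2_eq_square by (intro smooth1_diff smooth1_const smooth1_mult smooth1_id)
  from smooth1_compose[OF smooth1_smooth_step this] show ?thesis unfolding bump_def[abs_def] by simp
qed

lemma bump_inner: "u\<^sup>2 \<le> 1 / 2 ==> bump u = 1" by (simp add: bump_def smooth_step_ge_1)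

lemma bump_outer: "1 \<le> \<bar>u\<bar> ==> bump u = 0"
proof -
  assume "1 \<le> \<bar>u\<bar>" then have "1 \<le> u\<^sup>2" using one_le_power[of "\<bar>u\<bar>" 2] by simp
  then show ?thesis by (simp add: bump_def smooth_step_le_0)
qed

lemma bump_bounds: "0 \<le> bump u" "bump u \<le> 1" unfolding bump_def by (rule smooth_step_bounds)+

text \<open>A difference of two dilates vanishes both where the two bumps equal 1 and where both are
  0; the conditions on \<open>r\<close> put small and large arguments into these two
  regions.\<close>

lemma bump_annular:
  assumes ab: "0 < a" "a \<le> b" and r: "1 \<le> r" "1 / a \<le> r" "2 * b \<le> r"
  shows "annular r (%u. bump (a * u) - bump (b * u))"
  unfolding annular_def
proof (intro conjI allI impI)
  show "1 \<le> r" by (rule r)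
  have "smooth1 UNIV (%u. bump (a * u) - bump (b * u))"
    by (intro smooth1_diff smooth1_compose[OF smooth1_bump] smooth1_mult smooth1_const smooth1_id) auto
  then show "smooth1 (- {0}) (%u. bump (a * u) - bump (b * u))" by (rule smooth1_subset) auto
  fix u assume "\<bar>u\<bar> < 1 / r \<or> r < \<bar>u\<bar>"
  then show "bump (a * u) - bump (b * u) = 0"
  proof
    assume "\<bar>u\<bar> < 1 / r"
    then have "\<bar>u\<bar> * r < 1" using r by (simp add: field_simps)
    moreover have "\<bar>u\<bar> * (2 * b) \<le> \<bar>u\<bar> * r" using r by (intro mult_left_mono) auto
    moreover have "\<bar>u\<bar> * (2 * b) = 2 * \<bar>b * u\<bar>" using ab by (simp add: abs_mult)
    ultimately have bu: "\<bar>b * u\<bar> \<le> 1 / 2" by linarith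
    moreover have "\<bar>a * u\<bar> \<le> \<bar>b * u\<bar>" using ab by (simp add: abs_mult mult_right_mono)
    ultimately have au: "\<bar>a * u\<bar> \<le> 1 / 2" by linarith
    have sq: "v\<^sup>2 \<le> 1 / 2" if "\<bar>v\<bar> \<le> 1 / 2" for v :: real
      using power_mono[OF that, of 2] by (simp add: power2_eq_square)
    show ?thesis using sq[OF au] sq[OF bu] by (simp add: bump_inner)
  next
    assume "r < \<bar>u\<bar>"
    then have "1 / a \<le> \<bar>u\<bar>" using r by linarith
    then have "1 \<le> \<bar>a * u\<bar>" using ab by (simp add: abs_mult field_simps)
    moreover have "\<bar>a * u\<bar> \<le> \<bar>b * u\<bar>" using ab by (simp add: abs_mult mult_right_mono)
    ultimately have "1 \<le> \<bar>a * u\<bar>" "1 \<le> \<bar>b * u\<bar>" by linarith+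
    then show ?thesis by (simp only: bump_outer)
  qed
qed

text \<open>The bounded counterpart of \<open>smooth1\<close> on the whole line. Composed with an
  affine function of one coordinate it yields members of \<open>bsmooth\<close>, the class on which
  \<open>fmult\<close> preserves Schwartz functions.\<close>

definition bsmooth1 :: "(real => real) => bool" where
  "bsmooth1 g \<longleftrightarrow> (\<exists>X. g \<in> X \<and> (\<forall>h\<in>X. (\<exists>C. \<forall>u. \<bar>h u\<bar> \<le> C) \<and> (\<exists>h'\<in>X. \<forall>u. (h has_real_derivative h' u) (at u))))"

lemma bsmooth1_annular: "annular r g ==> bsmooth1 g"
  unfolding bsmooth1_def
proof (rule exI[of _ "Collect (annular r)"], intro conjI ballI)
  fix h assume "h \<in> Collect (annular r)"
  then have h: "annular r h" by simp
  show "\<exists>C. \<forall>u. \<bar>h u\<bar> \<le> C" using annular_bounded[OF h] by blast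
  show "\<exists>h'\<in>Collect (annular r). \<forall>u. (h has_real_derivative h' u) (at u)" using annular_deriv[OF h] by blast
qed simp

lemma smooth1_UNIV_deriv:
  assumes "smooth1 UNIV g"
  obtains g' where "smooth1 UNIV g'" "\<And>u. (g has_real_derivative g' u) (at u)"
proof -
  obtain g' where "smooth1 UNIV g'" "\<And>u. u \<in> UNIV ==> (g has_real_derivative g' u) (at u)"
    using smooth1_deriv[OF assms] by blast
  then show ?thesis using that[of g'] by simp
qed

lemma compact_support_deriv:
  assumes g: "smooth1 UNIV g" and supp: "\<And>u. R < \<bar>u\<bar> ==> g u = 0"
  obtains g' where "smooth1 UNIV g'" "\<And>u. R < \<bar>u\<bar> ==> g' u = 0" "\<And>u. (g has_real_derivative g' u) (at u)"
proof -
  obtain g' where g': "smooth1 UNIV g'" "\<And>u. (g has_real_derivative g' u) (at u)" using smooth1_UNIV_deriv[OF g] by blast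
  have "open {u::real. R < \<bar>u\<bar>}" by (auto intro!: open_Collect_less continuous_intros)
  then have "g' u = 0" if "R < \<bar>u\<bar>" for u using deriv_locally_zero[OF g'(2), of "{u. R < \<bar>u\<bar>}"] that supp by simp
  then show ?thesis using that g' by blast
qed

lemma compact_support_bounded:
  assumes g: "smooth1 UNIV g" and supp: "\<And>u. R < \<bar>u\<bar> ==> g u = 0"
  obtains C where "\<And>u. \<bar>g u\<bar> \<le> C"
proof -
  have "continuous_on {-R..R} g" using smooth1_continuous[OF g] by (rule continuous_on_subset) auto
  then have "bounded (g ` {-R..R})" by (intro compact_imp_bounded compact_continuous_image) auto
  then obtain C where "\<forall>u\<in>{-R..R}. \<bar>g u\<bar> \<le> C" unfolding bounded_iff by auto
  then have C: "\<bar>g u\<bar> \<le> C" if "u \<in> {-R..R}" for u using that by blast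
  have "\<bar>g u\<bar> \<le> max C 0" for u
  proof (cases "R < \<bar>u\<bar>")
    case False
    then have "u \<in> {-R..R}" by (auto simp: abs_le_iff not_less)
    then show ?thesis using C[of u] by (simp add: le_max_iff_disj)
  qed (simp add: supp)
  then show ?thesis by (rule that)
qed

lemma smooth_step_deriv:
  obtains g' where "smooth1 UNIV g'" "\<And>u. 1 < \<bar>u\<bar> ==> g' u = 0" "\<And>u. (smooth_step has_real_derivative g' u) (at u)"
proof -
  obtain g' where g': "smooth1 UNIV g'" "\<And>u. (smooth_step has_real_derivative g' u) (at u)" using smooth1_UNIV_deriv[OF smooth1_smooth_step] by blast
  have "g' u = 0" if "1 < \<bar>u\<bar>" for u
  proof (cases "0 < u")
    case True
    have "((%v. smooth_step v - 1) has_real_derivative g' u) (at u)" using g'(2) by (auto intro!: derivative_eq_intros)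
    from deriv_locally_zero[OF this, of "{1<..}"] show ?thesis using True that by (auto simp: smooth_step_ge_1)
  next
    case False
    from deriv_locally_zero[OF g'(2), of "{..<0}" u] show ?thesis using False that by (auto simp: smooth_step_le_0)
  qed
  then show ?thesis using that g' by blast
qed

lemma smooth_step_abs: "\<bar>smooth_step u\<bar> \<le> 1"
  using smooth_step_bounds[of u] by simp

lemma bsmooth1_smooth_step: "bsmooth1 smooth_step"
  unfolding bsmooth1_def
proof (rule exI[of _ "insert smooth_step {g. smooth1 UNIV g \<and> (\<forall>u. 1 < \<bar>u\<bar> \<longrightarrow> g u = 0)}"], intro conjI ballI)
  fix h assume "h \<in> insert smooth_step {g. smooth1 UNIV g \<and> (\<forall>u. 1 < \<bar>u\<bar> \<longrightarrow> g u = 0)}"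
  then consider "h = smooth_step" | "smooth1 UNIV h" "\<And>u. 1 < \<bar>u\<bar> ==> h u = 0" by blast
  note cases = this
  show "\<exists>C. \<forall>u. \<bar>h u\<bar> \<le> C"
  proof (cases rule: cases)
    case 1 then show ?thesis using smooth_step_abs by blast
  next
    case 2 then show ?thesis using compact_support_bounded[of h 1] by blast
  qed
  obtain h' where h': "smooth1 UNIV h'" "\<And>u. 1 < \<bar>u\<bar> ==> h' u = 0" "\<And>u. (h has_real_derivative h' u) (at u)"
  proof (cases rule: cases)
    case 1 then show ?thesis using smooth_step_deriv that by blast
  next
    case 2 then show ?thesis using compact_support_deriv[of h 1] that by blast
  qed
  show "\<exists>h'\<in>insert smooth_step {g. smooth1 UNIV g \<and> (\<forall>u. 1 < \<bar>u\<bar> \<longrightarrow> g u = 0)}. \<forall>u. (h has_real_derivative h' u) (at u)"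
    by (rule bexI[of _ h']) (use h' in auto)
qed simp

lemma bsmooth_lift:
  assumes "bsmooth1 g"
  shows "bsmooth (%\<xi>::real^'n::finite. complex_of_real (g (c * \<xi> $ j + d)))"
proof -
  obtain X where X: "g \<in> X" "\<And>h. h \<in> X ==> \<exists>C. \<forall>u. \<bar>h u\<bar> \<le> C"
    "\<And>h. h \<in> X ==> \<exists>h'\<in>X. \<forall>u. (h has_real_derivative h' u) (at u)"
    using assms unfolding bsmooth1_def by blast
  let ?Y = "{%\<xi>::real^'n. complex_of_real (k * h (c * \<xi> $ j + d)) | k h. h \<in> X}"
  have dd: "((%\<xi>::real^'n. complex_of_real (k * h (c * \<xi> $ j + d))) has_derivative (%v. complex_of_real (k * (h' (c * \<xi> $ j + d) * (c * v $ j))))) (at \<xi>)"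
    if "\<And>u. (h has_real_derivative h' u) (at u)" for h h' \<xi> k
  proof -
    have 1: "((%\<xi>::real^'n. c * \<xi> $ j + d) has_derivative (%v. c * v $ j)) (at \<xi>)"
      by (auto intro!: derivative_eq_intros bounded_linear_imp_has_derivative bounded_linear_vec_nth)
    have "(h has_derivative (%t. h' (c * \<xi> $ j + d) * t)) (at (c * \<xi> $ j + d))"
      using that[of "c * \<xi> $ j + d"] by (simp add: has_field_derivative_def)
    from diff_chain_at[OF 1 this] have "((%\<xi>::real^'n. h (c * \<xi> $ j + d)) has_derivative (%v. h' (c * \<xi> $ j + d) * (c * v $ j))) (at \<xi>)"
      by (simp add: o_def)
    from has_derivative_of_real[OF has_derivative_mult_right[OF this, of k]] show ?thesis .
  qed
  show ?thesis
  proof (rule smooth_classI[where X = ?Y])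
    show "(%\<xi>. complex_of_real (g (c * \<xi> $ j + d))) \<in> ?Y"
      by (rule CollectI, rule exI[of _ 1], rule exI[of _ g]) (simp add: X)
    fix f assume "f \<in> ?Y"
    then obtain k h where f: "f = (%\<xi>. complex_of_real (k * h (c * \<xi> $ j + d)))" and h: "h \<in> X" by blast
    obtain h' where h': "h' \<in> X" "\<And>u. (h has_real_derivative h' u) (at u)" using X(3)[OF h] by blast
    obtain C where C: "\<And>u. \<bar>h u\<bar> \<le> C" using X(2)[OF h] by blast
    show "f differentiable at x" for x unfolding f differentiable_def by (rule exI) (rule dd[OF h'(2)])
    have "norm (f x) \<le> \<bar>k\<bar> * C" for x unfolding f norm_of_real abs_mult by (intro mult_left_mono C) simp
    then show "bounded_fn f" unfolding bounded_fn_def by (intro exI allI)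
    fix i
    have "partial i f = (%\<xi>. complex_of_real ((k * (c * unit_vec i $ j)) * h' (c * \<xi> $ j + d)))"
      unfolding f by (rule ext) (simp only: partial_eq[OF dd[OF h'(2)]] mult_ac)
    then show "partial i f \<in> ?Y" using h'(1) by blast
  qed
qed

section \<open>One-dimensional symbols and cone multipliers\<close>

text \<open>One-dimensional symbols: all iterates of the Euler operator \<open>u d/du\<close> are bounded.\<close>
definition symbol1 :: "(real => real) => bool" where
  "symbol1 b \<longleftrightarrow> (\<exists>X. b \<in> X \<and> (\<forall>h\<in>X. (\<exists>C. \<forall>u. u \<noteq> 0 \<longrightarrow> \<bar>h u\<bar> \<le> C) \<and>
     (\<exists>h'\<in>X. \<forall>u. u \<noteq> 0 \<longrightarrow> (h has_real_derivative h' u / u) (at u))))"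

lemma symbol1_euler:
  assumes "symbol1 b"
  obtains b' where "symbol1 b'" "\<And>u. u \<noteq> 0 ==> (b has_real_derivative b' u / u) (at u)"
proof -
  obtain X where X: "b \<in> X" "\<forall>h\<in>X. (\<exists>C. \<forall>u. u \<noteq> 0 \<longrightarrow> \<bar>h u\<bar> \<le> C) \<and>
     (\<exists>h'\<in>X. \<forall>u. u \<noteq> 0 \<longrightarrow> (h has_real_derivative h' u / u) (at u))"
    using assms unfolding symbol1_def by blast
  then obtain b' where "b' \<in> X" "\<forall>u. u \<noteq> 0 \<longrightarrow> (b has_real_derivative b' u / u) (at u)" by blast
  moreover have "symbol1 b'" if "b' \<in> X" for b' unfolding symbol1_def using X(2) that by blast
  ultimately show ?thesis using that by blast
qed

lemma symbol1_bounded: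
  assumes "symbol1 b"
  obtains C where "\<And>u. u \<noteq> 0 ==> \<bar>b u\<bar> \<le> C"
  using assms unfolding symbol1_def by blast

lemma symbol1_lincomb:
  assumes "symbol1 a" "symbol1 b"
  shows "symbol1 (%u. s * a u + t * b u)"
  unfolding symbol1_def
proof (rule exI[of _ "{%u. s * a u + t * b u | a b. symbol1 a \<and> symbol1 b}"], intro conjI ballI)
  show "(%u. s * a u + t * b u) \<in> {%u. s * a u + t * b u | a b. symbol1 a \<and> symbol1 b}" using assms by blast
  fix h assume "h \<in> {%u. s * a u + t * b u | a b. symbol1 a \<and> symbol1 b}"
  then obtain a b where h: "h = (%u. s * a u + t * b u)" "symbol1 a" "symbol1 b" by blast
  obtain C where C: "\<And>u. u \<noteq> 0 ==> \<bar>a u\<bar> \<le> C" using symbol1_bounded[OF h(2)] by blast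
  obtain D where D: "\<And>u. u \<noteq> 0 ==> \<bar>b u\<bar> \<le> D" using symbol1_bounded[OF h(3)] by blast
  have "\<bar>h u\<bar> \<le> \<bar>s\<bar> * C + \<bar>t\<bar> * D" if "u \<noteq> 0" for u
    unfolding h(1) by (rule order_trans[OF abs_triangle_ineq]) (auto simp: abs_mult intro!: add_mono mult_left_mono C D that)
  then show "\<exists>C. \<forall>u. u \<noteq> 0 \<longrightarrow> \<bar>h u\<bar> \<le> C" by blast
  obtain a' where a': "symbol1 a'" "\<And>u. u \<noteq> 0 ==> (a has_real_derivative a' u / u) (at u)" using symbol1_euler[OF h(2)] by blast
  obtain b' where b': "symbol1 b'" "\<And>u. u \<noteq> 0 ==> (b has_real_derivative b' u / u) (at u)" using symbol1_euler[OF h(3)] by blast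
  have d: "(h has_real_derivative (s * a' u + t * b' u) / u) (at u)" if "u \<noteq> 0" for u
    unfolding h(1) using DERIV_add[OF DERIV_cmult[OF a'(2)[OF that], of s] DERIV_cmult[OF b'(2)[OF that], of t]] by (simp add: add_divide_distrib)
  have "(%u. s * a' u + t * b' u) \<in> {%u. s * a u + t * b u | a b. symbol1 a \<and> symbol1 b}"
    unfolding mem_Collect_eq by (rule exI[of _ a'], rule exI[of _ b']) (simp add: a' b')
  then show "\<exists>h'\<in>{%u. s * a u + t * b u | a b. symbol1 a \<and> symbol1 b}. \<forall>u. u \<noteq> 0 \<longrightarrow> (h has_real_derivative h' u / u) (at u)"
    by (rule bexI[rotated]) (use d in blast)
qed

lemma symbol1_measurable: "symbol1 b ==> b \<in> borel_measurable borel"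
proof -
  assume b: "symbol1 b"
  obtain b' where d: "\<And>u. u \<noteq> 0 ==> (b has_real_derivative b' u / u) (at u)" using symbol1_euler[OF b] by blast
  have "continuous_on (- {0}) b" by (rule continuous_at_imp_continuous_on) (auto intro!: DERIV_isCont d)
  then have "(%u. if u \<in> - {0} then b u else (%_. b 0) u) \<in> borel_measurable borel"
    by (intro borel_measurable_continuous_on_if) auto
  moreover have "(%u. if u \<in> - {0} then b u else (%_. b 0) u) = b" by auto
  ultimately show ?thesis by simp
qed

text \<open>The derivative is 0 off the origin, and \<open>symbol1\<close> imposes nothing at the
  origin. This symbol gives the cone multipliers that replace averages of signs where one frequency
  dominates.\<close>

lemma symbol1_sgn: "symbol1 sgn"
  unfolding symbol1_def
proof (rule exI[of _ "{sgn, %_. 0}"], intro conjI ballI)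
  fix h :: "real => real" assume h: "h \<in> {sgn, %_. 0}"
  show "\<exists>C. \<forall>u. u \<noteq> 0 \<longrightarrow> \<bar>h u\<bar> \<le> C" using h by (intro exI[of _ 1]) (auto simp: abs_sgn_eq)
  have "(sgn has_real_derivative 0) (at u)" if "u \<noteq> 0" for u :: real
  proof -
    have "((%_. sgn u) has_real_derivative 0) (at u)" by simp
    from has_field_derivative_transform_within_open[OF this, of "{0<..}" sgn] has_field_derivative_transform_within_open[OF this, of "{..<0}" sgn]
    show ?thesis using that by (cases "u > 0") auto
  qed
  then show "\<exists>h'\<in>{sgn, %_. 0}. \<forall>u. u \<noteq> 0 \<longrightarrow> (h has_real_derivative h' u / u) (at u)"
    using h by (intro bexI[of _ "%_. 0"]) auto
qed simp

lemma symbol1_smooth_step: "symbol1 smooth_step"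
  unfolding symbol1_def
proof (rule exI[of _ "insert smooth_step {g. smooth1 UNIV g \<and> (\<forall>u. 1 < \<bar>u\<bar> \<longrightarrow> g u = 0)}"], intro conjI ballI)
  fix h assume "h \<in> insert smooth_step {g. smooth1 UNIV g \<and> (\<forall>u. 1 < \<bar>u\<bar> \<longrightarrow> g u = 0)}"
  then consider "h = smooth_step" | "smooth1 UNIV h" "\<And>u. 1 < \<bar>u\<bar> ==> h u = 0" by blast
  note cases = this
  show "\<exists>C. \<forall>u. u \<noteq> 0 \<longrightarrow> \<bar>h u\<bar> \<le> C"
  proof (cases rule: cases)
    case 1 then show ?thesis by (intro exI[of _ 1] allI impI) (simp add: smooth_step_abs)
  next
    case 2
    obtain C where "\<And>u. \<bar>h u\<bar> \<le> C" using compact_support_bounded[OF 2(1), of 1] 2(2) by blast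
    then show ?thesis by (intro exI[of _ C] allI impI)
  qed
  obtain h' where h': "smooth1 UNIV h'" "\<And>u. 1 < \<bar>u\<bar> ==> h' u = 0" "\<And>u. (h has_real_derivative h' u) (at u)"
  proof (cases rule: cases)
    case 1 then show ?thesis using smooth_step_deriv that by blast
  next
    case 2 then show ?thesis using compact_support_deriv[of h 1] that by blast
  qed
  show "\<exists>h'\<in>insert smooth_step {g. smooth1 UNIV g \<and> (\<forall>u. 1 < \<bar>u\<bar> \<longrightarrow> g u = 0)}. \<forall>u. u \<noteq> 0 \<longrightarrow> (h has_real_derivative h' u / u) (at u)"
    by (rule bexI[of _ "%u. u * h' u"]) (use h' smooth1_mult[OF smooth1_id h'(1)] in auto)
qed simp

lemma finite_sum_in:
  assumes "finite L" "z \<in> S" "\<And>f g. f \<in> S ==> g \<in> S ==> (%x. f x + g x) \<in> S" "z = (%_. 0)" "\<And>l. l \<in> L ==> f l \<in> S"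
  shows "(%x. \<Sum>l\<in>L. f l x) \<in> (S :: ('a => real) set)"
  using assms(1,5) by (induction L rule: finite_induct) (use assms(2-4) in auto)

definition compact_profile :: "(real => real) => bool" where
  "compact_profile t \<longleftrightarrow> smooth1 UNIV t \<and> (\<forall>u. 1 < \<bar>u\<bar> \<longrightarrow> t u = 0)"

text \<open>A symbol of order \<open>-d\<close> supported in the cone where the coordinate \<open>j\<close> dominates.\<close>
definition cone_fn :: "'n::finite => nat => (real => real) => ('n => real => real) => real^'n => real" where
  "cone_fn j d b t \<xi> = (if \<xi> $ j = 0 then 0 else b (\<xi> $ j) / (\<xi> $ j) ^ d * (\<Prod>l\<in>UNIV - {j}. t l (\<xi> $ l / \<xi> $ j)))"

inductive_set cone_span :: "'n::finite => nat => (real^'n => real) set" for j d where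
  base: "symbol1 b ==> (\<And>l. compact_profile (t l)) ==> cone_fn j d b t \<in> cone_span j d"
| add: "f \<in> cone_span j d ==> g \<in> cone_span j d ==> (%x. f x + g x) \<in> cone_span j d"

text \<open>At a nonzero point with \<xi>_j = 0 some other coordinate is larger than the j-th one
  throughout a neighbourhood, and its profile vanishes there. Hence the function is smooth across
  the hyperplane although its formula divides by \<xi>_j.\<close>

lemma cone_fn_locally_zero:
  fixes \<xi> :: "real^'n::finite"
  assumes t: "\<And>l. compact_profile (t l)" and "\<xi> $ j = 0" "\<xi> \<noteq> 0"
  obtains U where "open U" "\<xi> \<in> U" "\<And>x. x \<in> U ==> cone_fn j d b t x = 0"
proof -
  obtain l where l: "\<xi> $ l \<noteq> 0" using assms(3) by (auto simp: vec_eq_iff)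
  then have lj: "l \<noteq> j" using assms(2) by auto
  let ?U = "{x::real^'n. \<bar>x $ j\<bar> < \<bar>x $ l\<bar>}"
  have "open ?U" by (auto intro!: open_Collect_less continuous_intros)
  moreover have "\<xi> \<in> ?U" using l assms(2) by simp
  moreover have "cone_fn j d b t x = 0" if "x \<in> ?U" for x
  proof (cases "x $ j = 0")
    case False
    then have "1 < \<bar>x $ l / x $ j\<bar>" using that by (simp add: field_simps)
    then have "t l (x $ l / x $ j) = 0" using t[of l] unfolding compact_profile_def by blast
    then have "(\<Prod>l\<in>UNIV - {j}. t l (x $ l / x $ j)) = 0" using lj by (intro prod_zero) auto
    then show ?thesis by (simp add: cone_fn_def)
  qed (simp add: cone_fn_def)
  ultimately show ?thesis by (rule that)
qed

lemma vec_nth_has_derivative: "((%x::real^'n::finite. x $ j) has_derivative (%v. v $ j)) (at x)"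
  by (rule bounded_linear_imp_has_derivative[OF bounded_linear_vec_nth])

lemma cone_fn_derivative:
  fixes \<xi> :: "real^'n::finite"
  assumes b': "\<And>u. u \<noteq> 0 ==> (b has_real_derivative b' u / u) (at u)"
    and t': "\<And>l u. (t l has_real_derivative t' l u) (at u)" and \<xi>: "\<xi> $ j \<noteq> 0"
  shows "(cone_fn j d b t has_derivative (%v.
      (b (\<xi> $ j) / (\<xi> $ j) ^ d) * (\<Sum>l\<in>UNIV - {j}. (t' l (\<xi> $ l / \<xi> $ j) * (v $ l / \<xi> $ j - \<xi> $ l * v $ j / (\<xi> $ j)\<^sup>2)) * (\<Prod>k\<in>UNIV - {j} - {l}. t k (\<xi> $ k / \<xi> $ j)))
      + ((b' (\<xi> $ j) - real d * b (\<xi> $ j)) / (\<xi> $ j) ^ Suc d * v $ j) * (\<Prod>l\<in>UNIV - {j}. t l (\<xi> $ l / \<xi> $ j)))) (at \<xi>)"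
proof -
  let ?x = "\<xi> $ j"
  have A: "((%\<xi>::real^'n. b (\<xi> $ j) / (\<xi> $ j) ^ d) has_derivative (%v. (b' ?x - real d * b ?x) / ?x ^ Suc d * v $ j)) (at \<xi>)"
  proof -
    have "((%u. b u / u ^ d) has_real_derivative (b' ?x - real d * b ?x) / ?x ^ Suc d) (at ?x)"
    proof -
      have p: "((%u. u ^ d) has_real_derivative real d * ?x ^ (d - 1)) (at ?x)" using DERIV_pow[of d ?x] by simp
      have "((%u. b u / u ^ d) has_real_derivative (b' ?x / ?x * ?x ^ d - b ?x * (real d * ?x ^ (d - 1))) / (?x ^ d * ?x ^ d)) (at ?x)"
        by (rule DERIV_divide[OF b'[OF \<xi>] p]) (use \<xi> in simp)
      moreover have "(b' ?x / ?x * ?x ^ d - b ?x * (real d * ?x ^ (d - 1))) / (?x ^ d * ?x ^ d) = (b' ?x - real d * b ?x) / ?x ^ Suc d"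
        using \<xi> by (cases d) (auto simp: field_simps)
      ultimately show ?thesis by simp
    qed
    then have "((%u. b u / u ^ d) has_derivative (%h. (b' ?x - real d * b ?x) / ?x ^ Suc d * h)) (at ?x)"
      by (simp only: has_field_derivative_def)
    from diff_chain_at[OF vec_nth_has_derivative this] show ?thesis by (simp add: o_def)
  qed
  have T: "((%\<xi>::real^'n. t l (\<xi> $ l / \<xi> $ j)) has_derivative (%v. t' l (\<xi> $ l / ?x) * (v $ l / ?x - \<xi> $ l * v $ j / ?x\<^sup>2))) (at \<xi>)" for l
  proof -
    have "((%\<xi>::real^'n. \<xi> $ l / \<xi> $ j) has_derivative (%v. v $ l / ?x - \<xi> $ l * v $ j / ?x\<^sup>2)) (at \<xi>)"
      by (rule has_derivative_eq_rhs[OF has_derivative_divide[OF vec_nth_has_derivative vec_nth_has_derivative \<xi>]])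
         (use \<xi> in \<open>auto simp: fun_eq_iff field_simps power2_eq_square\<close>)
    moreover have "(t l has_derivative (%h. t' l (\<xi> $ l / ?x) * h)) (at (\<xi> $ l / ?x))"
      using t'[of l "\<xi> $ l / ?x"] by (simp add: has_field_derivative_def)
    ultimately show ?thesis using diff_chain_at[of "%\<xi>::real^'n. \<xi> $ l / \<xi> $ j"] by (auto simp: o_def)
  qed
  have P: "((%\<xi>::real^'n. \<Prod>l\<in>UNIV - {j}. t l (\<xi> $ l / \<xi> $ j)) has_derivative
     (%v. \<Sum>l\<in>UNIV - {j}. (t' l (\<xi> $ l / ?x) * (v $ l / ?x - \<xi> $ l * v $ j / ?x\<^sup>2)) * (\<Prod>k\<in>UNIV - {j} - {l}. t k (\<xi> $ k / ?x)))) (at \<xi>)"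
    by (rule has_derivative_prod) (rule T)
  have "open {x::real^'n. x $ j \<noteq> 0}" by (intro open_Collect_neq continuous_intros)
  from has_derivative_transform_within_open[OF has_derivative_mult[OF A P] this, of "cone_fn j d b t"] show ?thesis
    using \<xi> by (simp add: cone_fn_def)
qed

lemma compact_profile_deriv:
  assumes "compact_profile t"
  obtains t' where "compact_profile t'" "\<And>u. (t has_real_derivative t' u) (at u)"
proof -
  obtain t' where "smooth1 UNIV t'" "\<And>u. 1 < \<bar>u\<bar> ==> t' u = 0" "\<And>u. (t has_real_derivative t' u) (at u)"
    using compact_support_deriv[of t 1] assms unfolding compact_profile_def by blast
  then show ?thesis using that[of t'] unfolding compact_profile_def by simp
qed

lemma compact_profile_mult_id: "compact_profile t ==> compact_profile (%u. u * t u)"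
  unfolding compact_profile_def using smooth1_mult[OF smooth1_id] by auto

lemma partial_of_real:
  "(f has_derivative D) (at x) ==> partial j (%x. complex_of_real (f x)) x = of_real (D (unit_vec j))"
  by (rule partial_eq) (rule has_derivative_of_real)

lemma cone_span_zero: "(%_. 0) \<in> cone_span j d"
proof -
  have "cone_fn j d (%u. 0 * sgn u + 0 * sgn u) (%_. bump) \<in> cone_span j d"
    by (intro cone_span.base symbol1_lincomb symbol1_sgn) (auto simp: compact_profile_def smooth1_bump bump_outer)
  moreover have "cone_fn j d (%u. 0 * sgn u + 0 * sgn u) (%_. bump) = (%_. 0)" by (auto simp: cone_fn_def)
  ultimately show ?thesis by simp
qed

text \<open>A derivative raises the order by one and stays in the span. In a direction other than
  \<open>j\<close> it hits a single profile. In direction \<open>j\<close> it hits the symbol,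
  through the Euler derivative, and each profile, through the quotient, which produces the profile
  \<open>u * t' u\<close>.\<close>

lemma cone_span_partial:
  fixes f :: "real^'n::finite => real"
  assumes "f \<in> cone_span j d"
  shows "(\<forall>\<xi>. \<xi> \<noteq> 0 \<longrightarrow> f differentiable at \<xi>) \<and>
    (\<forall>i. \<exists>g\<in>cone_span j (Suc d). \<forall>\<xi>. \<xi> \<noteq> 0 \<longrightarrow> partial i (%x. complex_of_real (f x)) \<xi> = of_real (g \<xi>))"
  using assms
proof induction
  case (base b t)
  obtain b' where b': "symbol1 b'" "\<And>u. u \<noteq> 0 ==> (b has_real_derivative b' u / u) (at u)" using symbol1_euler[OF base(1)] by blast
  have "\<exists>t'. compact_profile t' \<and> (\<forall>u. (t l has_real_derivative t' u) (at u))" for l using compact_profile_deriv[OF base(2)[of l]] by blast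
  then obtain t' where t': "\<And>l. compact_profile (t' l)" "\<And>l u. (t l has_real_derivative t' l u) (at u)" by metis
  have D: "(cone_fn j d b t has_derivative (%v.
      (b (\<xi> $ j) / (\<xi> $ j) ^ d) * (\<Sum>l\<in>UNIV - {j}. (t' l (\<xi> $ l / \<xi> $ j) * (v $ l / \<xi> $ j - \<xi> $ l * v $ j / (\<xi> $ j)\<^sup>2)) * (\<Prod>k\<in>UNIV - {j} - {l}. t k (\<xi> $ k / \<xi> $ j)))
      + ((b' (\<xi> $ j) - real d * b (\<xi> $ j)) / (\<xi> $ j) ^ Suc d * v $ j) * (\<Prod>l\<in>UNIV - {j}. t l (\<xi> $ l / \<xi> $ j)))) (at \<xi>)"
    if nz: "\<xi> $ j \<noteq> 0" for \<xi> :: "real^'n"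
    by (rule cone_fn_derivative[where t = t and t' = t' and b = b and b' = b']) (use b'(2) t'(2) nz in auto)
  have zero: "(cone_fn j d b t has_derivative (%v. 0)) (at \<xi>)" if z: "\<xi> $ j = 0" "\<xi> \<noteq> 0" for \<xi> :: "real^'n"
  proof -
    obtain U where U: "open U" "\<xi> \<in> U" "\<And>x. x \<in> U ==> cone_fn j d b t x = 0" using cone_fn_locally_zero[of t \<xi> j d b, OF base(2) z] by blast
    show ?thesis by (rule has_derivative_transform_within_open[OF has_derivative_const U(1,2)]) (simp add: U(3))
  qed
  have diff: "cone_fn j d b t differentiable at \<xi>" if "\<xi> \<noteq> 0" for \<xi> :: "real^'n"
  proof (cases "\<xi> $ j = 0")
    case True then show ?thesis using zero that unfolding differentiable_def by blast
  next
    case False show ?thesis unfolding differentiable_def by (rule exI) (rule D[OF False])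
  qed
  have ex: "\<exists>g\<in>cone_span j (Suc d). \<forall>\<xi>. \<xi> \<noteq> 0 \<longrightarrow> partial i (%x. complex_of_real (cone_fn j d b t x)) \<xi> = of_real (g \<xi>)" for i
  proof (cases "i = j")
    case False
    let ?g = "cone_fn j (Suc d) b (t(i := t' i))"
    have mem: "?g \<in> cone_span j (Suc d)" by (rule cone_span.base) (use base t' in auto)
    have "partial i (%x. complex_of_real (cone_fn j d b t x)) \<xi> = of_real (?g \<xi>)" if "\<xi> \<noteq> 0" for \<xi>
    proof (cases "\<xi> $ j = 0")
      case True then show ?thesis using partial_of_real[OF zero[OF True that]] by (simp add: cone_fn_def)
    next
      case nz: False
      let ?x = "\<xi> $ j"
      have u: "unit_vec i $ j = 0" "unit_vec i $ l = (if l = i then 1 else 0)" for l using False by (auto simp: unit_vec_def axis_def)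
      have "(\<Sum>l\<in>UNIV - {j}. (t' l (\<xi> $ l / ?x) * (unit_vec i $ l / ?x - \<xi> $ l * unit_vec i $ j / ?x\<^sup>2)) * (\<Prod>k\<in>UNIV - {j} - {l}. t k (\<xi> $ k / ?x)))
        = (\<Sum>l\<in>UNIV - {j}. if l = i then (t' i (\<xi> $ i / ?x) / ?x) * (\<Prod>k\<in>UNIV - {j} - {i}. t k (\<xi> $ k / ?x)) else 0)"
        using False unfolding u by (intro sum.cong refl) auto
      also have "\<dots> = (t' i (\<xi> $ i / ?x) / ?x) * (\<Prod>k\<in>UNIV - {j} - {i}. t k (\<xi> $ k / ?x))"
        using False by simp
      also have "\<dots> = (\<Prod>l\<in>UNIV - {j}. (t(i := t' i)) l (\<xi> $ l / ?x)) / ?x"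
        using False by (subst prod.remove[of "UNIV - {j}" i]) auto
      finally have E: "(\<Sum>l\<in>UNIV - {j}. (t' l (\<xi> $ l / ?x) * (unit_vec i $ l / ?x - \<xi> $ l * unit_vec i $ j / ?x\<^sup>2)) * (\<Prod>k\<in>UNIV - {j} - {l}. t k (\<xi> $ k / ?x)))
        = (\<Prod>l\<in>UNIV - {j}. (t(i := t' i)) l (\<xi> $ l / ?x)) / ?x" .
      show ?thesis unfolding partial_of_real[OF D[OF nz]] E
        by (intro arg_cong[where f = complex_of_real]) (simp add: cone_fn_def u(1) nz)
    qed
    then show ?thesis using mem by blast
  next
    case True
    \<comment> \<open>The derivative of b(x)/x^d is (b'(x) - d b(x))/x^(d+1), where b' is the Euler
      derivative of b.\<close>
    let ?b = "%u. 1 * b' u + (- real d) * b u"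
    let ?g1 = "cone_fn j (Suc d) ?b t"
    let ?h = "%l. cone_fn j (Suc d) (%u. (-1) * b u + 0 * b u) (t(l := %u. u * t' l u))"
    let ?g = "%\<xi>. ?g1 \<xi> + (\<Sum>l\<in>UNIV - {j}. ?h l \<xi>)"
    have m1: "?g1 \<in> cone_span j (Suc d)" by (intro cone_span.base symbol1_lincomb base b')
    have m2: "?h l \<in> cone_span j (Suc d)" for l
      by (intro cone_span.base symbol1_lincomb base(1)) (use base(2) compact_profile_mult_id[OF t'(1)] in auto)
    have "(%\<xi>. \<Sum>l\<in>UNIV - {j}. ?h l \<xi>) \<in> cone_span j (Suc d)"
      by (rule finite_sum_in[OF _ cone_span_zero cone_span.add]) (use m2 in auto)
    then have mem: "?g \<in> cone_span j (Suc d)" by (rule cone_span.add[OF m1])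
    have "partial i (%x. complex_of_real (cone_fn j d b t x)) \<xi> = of_real (?g \<xi>)" if "\<xi> \<noteq> 0" for \<xi>
    proof (cases "\<xi> $ j = 0")
      case z: True then show ?thesis using partial_of_real[OF zero[OF z that]] by (simp add: cone_fn_def)
    next
      case nz: False
      let ?x = "\<xi> $ j"
      have u: "unit_vec i $ j = 1" "l \<in> UNIV - {j} ==> unit_vec i $ l = 0" for l using True by (auto simp: unit_vec_def axis_def)
      have h: "?h l \<xi> = (b ?x / ?x ^ d) * ((t' l (\<xi> $ l / ?x) * (unit_vec i $ l / ?x - \<xi> $ l * unit_vec i $ j / ?x\<^sup>2)) * (\<Prod>k\<in>UNIV - {j} - {l}. t k (\<xi> $ k / ?x)))"
        if l: "l \<in> UNIV - {j}" for l
      proof -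
        have "(\<Prod>k\<in>UNIV - {j}. (t(l := %u. u * t' l u)) k (\<xi> $ k / ?x)) = (\<xi> $ l / ?x * t' l (\<xi> $ l / ?x)) * (\<Prod>k\<in>UNIV - {j} - {l}. t k (\<xi> $ k / ?x))"
          using l by (subst prod.remove[of "UNIV - {j}" l]) auto
        then show ?thesis using nz unfolding cone_fn_def u(1) u(2)[OF l] by (simp add: field_simps power2_eq_square)
      qed
      have "(\<Sum>l\<in>UNIV - {j}. ?h l \<xi>) = (b ?x / ?x ^ d) * (\<Sum>l\<in>UNIV - {j}. (t' l (\<xi> $ l / ?x) * (unit_vec i $ l / ?x - \<xi> $ l * unit_vec i $ j / ?x\<^sup>2)) * (\<Prod>k\<in>UNIV - {j} - {l}. t k (\<xi> $ k / ?x)))"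
        unfolding sum_distrib_left by (rule sum.cong[OF refl]) (rule h)
      moreover have "?g1 \<xi> = ((b' ?x - real d * b ?x) / ?x ^ Suc d * unit_vec i $ j) * (\<Prod>l\<in>UNIV - {j}. t l (\<xi> $ l / ?x))"
        using nz u(1) by (simp add: cone_fn_def)
      ultimately show ?thesis unfolding partial_of_real[OF D[OF nz]] by (intro arg_cong[where f = complex_of_real]) (simp only: add.commute)
    qed
    then show ?thesis using mem by (intro bexI[of _ ?g]) auto
  qed
  show ?case using diff ex by blast
next
  case (add f g)
  have diff: "(%x. f x + g x) differentiable at \<xi>" if "\<xi> \<noteq> 0" for \<xi> using add.IH that by (intro differentiable_add) auto
  have ex: "\<exists>h\<in>cone_span j (Suc d). \<forall>\<xi>. \<xi> \<noteq> 0 \<longrightarrow> partial i (%x. complex_of_real (f x + g x)) \<xi> = of_real (h \<xi>)" for i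
  proof -
    obtain f' where f': "f' \<in> cone_span j (Suc d)" "\<And>\<xi>. \<xi> \<noteq> 0 ==> partial i (%x. complex_of_real (f x)) \<xi> = of_real (f' \<xi>)" using add.IH(1) by blast
    obtain g' where g': "g' \<in> cone_span j (Suc d)" "\<And>\<xi>. \<xi> \<noteq> 0 ==> partial i (%x. complex_of_real (g x)) \<xi> = of_real (g' \<xi>)" using add.IH(2) by blast
    have od: "(%x. complex_of_real (h x)) differentiable at \<xi>" if "h differentiable at \<xi>" for h :: "real^'n => real" and \<xi>
      using that unfolding differentiable_def by (blast intro: has_derivative_of_real)
    have "partial i (%x. complex_of_real (f x + g x)) \<xi> = of_real (f' \<xi> + g' \<xi>)" if "\<xi> \<noteq> 0" for \<xi>
      using partial_add[OF od od, of f \<xi> g i] add.IH that f'(2)[OF that] g'(2)[OF that] by simp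
    then show ?thesis using cone_span.add[OF f'(1) g'(1)] by (intro bexI[of _ "%\<xi>. f' \<xi> + g' \<xi>"]) auto
  qed
  show ?case using diff ex by blast
qed

text \<open>On the support all quotients have modulus at most 1, so \<xi>_j is the largest
  coordinate and the norm is at most \<open>CARD('n)\<close> times its modulus.\<close>

lemma cone_span_bound:
  fixes f :: "real^'n::finite => real"
  assumes "f \<in> cone_span j d"
  shows "\<exists>C. \<forall>\<xi>. \<xi> \<noteq> 0 \<longrightarrow> \<bar>f \<xi>\<bar> \<le> C / norm \<xi> ^ d"
  using assms
proof induction
  case (base b t)
  obtain B where B: "\<And>u. u \<noteq> 0 ==> \<bar>b u\<bar> \<le> B" using symbol1_bounded[OF base(1)] by blast
  have "\<exists>C. \<forall>u. \<bar>t l u\<bar> \<le> C" for l using compact_support_bounded[of "t l" 1] base(2)[of l] unfolding compact_profile_def by blast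
  then obtain T where T: "\<And>l u. \<bar>t l u\<bar> \<le> T l" by metis
  have T0: "0 \<le> T l" for l using T[of l 0] by linarith
  have B0: "0 \<le> B" using B[of 1] by simp
  let ?n = "real CARD('n)"
  let ?P = "\<Prod>l\<in>UNIV - {j}. T l"
  have P0: "0 \<le> ?P" using T0 by (intro prod_nonneg) auto
  have "\<bar>cone_fn j d b t \<xi>\<bar> \<le> (B * ?P * ?n ^ d) / norm \<xi> ^ d" if nz: "\<xi> \<noteq> 0" for \<xi>
  proof (cases "cone_fn j d b t \<xi> = 0")
    case True then show ?thesis using B0 P0 by simp
  next
    case False
    then have x: "\<xi> $ j \<noteq> 0" and p: "(\<Prod>l\<in>UNIV - {j}. t l (\<xi> $ l / \<xi> $ j)) \<noteq> 0" by (auto simp: cone_fn_def split: if_splits)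
    have le: "\<bar>\<xi> $ l\<bar> \<le> \<bar>\<xi> $ j\<bar>" for l
    proof (cases "l = j")
      case False
      then have "t l (\<xi> $ l / \<xi> $ j) \<noteq> 0" using p by (auto simp: prod_zero_iff)
      then have "\<not> 1 < \<bar>\<xi> $ l / \<xi> $ j\<bar>" using base(2)[of l] unfolding compact_profile_def by blast
      then show ?thesis using x by (simp add: field_simps)
    qed simp
    have "norm \<xi> \<le> (\<Sum>l\<in>UNIV. \<bar>\<xi> $ l\<bar>)" by (rule norm_le_l1_cart)
    also have "\<dots> \<le> (\<Sum>l\<in>(UNIV::'n set). \<bar>\<xi> $ j\<bar>)" by (intro sum_mono le)
    finally have n: "norm \<xi> \<le> ?n * \<bar>\<xi> $ j\<bar>" by simp
    have "\<bar>cone_fn j d b t \<xi>\<bar> = \<bar>b (\<xi> $ j)\<bar> / \<bar>\<xi> $ j\<bar> ^ d * (\<Prod>l\<in>UNIV - {j}. \<bar>t l (\<xi> $ l / \<xi> $ j)\<bar>)"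
      using x by (simp add: cone_fn_def abs_mult abs_prod power_abs)
    also have "\<dots> \<le> B / \<bar>\<xi> $ j\<bar> ^ d * ?P"
      by (intro mult_mono divide_right_mono B x prod_mono conjI T prod_nonneg divide_nonneg_nonneg B0) auto
    also have "\<dots> \<le> (B * ?P * ?n ^ d) / norm \<xi> ^ d"
    proof -
      have "norm \<xi> ^ d \<le> ?n ^ d * \<bar>\<xi> $ j\<bar> ^ d" using power_mono[OF n, of d] by (simp add: power_mult_distrib)
      then have "B * ?P * norm \<xi> ^ d \<le> B * ?P * (?n ^ d * \<bar>\<xi> $ j\<bar> ^ d)" using B0 P0 by (intro mult_left_mono) auto
      then show ?thesis using x nz by (simp add: field_simps)
    qed
    finally show ?thesis .
  qed
  then show ?case by blast
next
  case (add f g)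
  then obtain C D where CD: "\<And>\<xi>. \<xi> \<noteq> 0 ==> \<bar>f \<xi>\<bar> \<le> C / norm \<xi> ^ d" "\<And>\<xi>. \<xi> \<noteq> 0 ==> \<bar>g \<xi>\<bar> \<le> D / norm \<xi> ^ d" by blast
  have "\<bar>f \<xi> + g \<xi>\<bar> \<le> (C + D) / norm \<xi> ^ d" if "\<xi> \<noteq> 0" for \<xi>
    unfolding add_divide_distrib by (rule order_trans[OF abs_triangle_ineq add_mono[OF CD[OF that]]])
  then show ?case by blast
qed

lemma cone_span_pderivs:
  fixes f :: "real^'n::finite => real"
  assumes f: "f \<in> cone_span j 0"
  shows "\<exists>g\<in>cone_span j (length js). \<forall>\<xi>. \<xi> \<noteq> 0 \<longrightarrow> pderivs js (%x. complex_of_real (f x)) \<xi> = of_real (g \<xi>)"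
proof (induction js)
  case Nil show ?case using f by auto
next
  case (Cons i js)
  then obtain g where g: "g \<in> cone_span j (length js)" "\<And>\<xi>. \<xi> \<noteq> 0 ==> pderivs js (%x. complex_of_real (f x)) \<xi> = of_real (g \<xi>)" by blast
  note P = cone_span_partial[OF g(1)]
  obtain h where h: "h \<in> cone_span j (Suc (length js))" "\<And>\<xi>. \<xi> \<noteq> 0 ==> partial i (%x. complex_of_real (g x)) \<xi> = of_real (h \<xi>)" using P by blast
  have "partial i (pderivs js (%x. complex_of_real (f x))) \<xi> = of_real (h \<xi>)" if "\<xi> \<noteq> 0" for \<xi>
  proof -
    have d: "(%x. complex_of_real (g x)) differentiable at \<xi>"
      using P that unfolding differentiable_def by (blast intro: has_derivative_of_real)
    have "partial i (pderivs js (%x. complex_of_real (f x))) \<xi> = partial i (%x. complex_of_real (g x)) \<xi>"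
      by (rule partial_cong_open(1)[of "- {0}"]) (use that g(2) d in auto)
    then show ?thesis using h(2)[OF that] by simp
  qed
  then show ?case using h(1) by auto
qed

lemma cone_fn_standard_symbol:
  assumes b: "symbol1 b"
  shows "standard_symbol (%\<xi>. complex_of_real (cone_fn j 0 b (%_. bump) \<xi>))"
proof -
  let ?f = "cone_fn j 0 b (%_. bump)"
  have f: "?f \<in> cone_span j 0"
    by (intro cone_span.base b) (auto simp: compact_profile_def smooth1_bump bump_outer)
  show ?thesis
    unfolding standard_symbol_def
  proof (intro conjI allI impI)
    obtain C where "\<And>\<xi>. \<xi> \<noteq> 0 ==> \<bar>?f \<xi>\<bar> \<le> C / norm \<xi> ^ 0" using cone_span_bound[OF f] by blast
    then show "\<exists>B. \<forall>\<xi>. \<xi> \<noteq> 0 \<longrightarrow> norm (complex_of_real (?f \<xi>)) \<le> B" by (intro exI[of _ C]) simp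
    fix js
    obtain g where g: "g \<in> cone_span j (length js)" "\<And>\<xi>. \<xi> \<noteq> 0 ==> pderivs js (%x. complex_of_real (?f x)) \<xi> = of_real (g \<xi>)"
      using cone_span_pderivs[OF f, of js] by blast
    show "pderivs js (%x. complex_of_real (?f x)) differentiable at \<xi>" if "\<xi> \<noteq> 0" for \<xi>
    proof -
      have d: "(%x. complex_of_real (g x)) differentiable at \<xi>"
        using cone_span_partial[OF g(1)] that unfolding differentiable_def by (blast intro: has_derivative_of_real)
      show ?thesis by (rule partial_cong_open(2)[of "- {0}"]) (use that g(2) d in auto)
    qed
    obtain C where "\<And>\<xi>. \<xi> \<noteq> 0 ==> \<bar>g \<xi>\<bar> \<le> C / norm \<xi> ^ length js" using cone_span_bound[OF g(1)] by blast
    then show "\<exists>c. \<forall>\<xi>. \<xi> \<noteq> 0 \<longrightarrow> norm (pderivs js (%x. complex_of_real (?f x)) \<xi>) \<le> c / norm \<xi> ^ length js"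
      by (intro exI[of _ C]) (simp add: g(2))
  qed
qed

lemma standard_symbol_one: "standard_symbol (%_::real^'n::finite. 1)"
proof -
  have "pderivs js (%_::real^'n. 1::complex) = (%_. if js = [] then 1 else 0)" for js
  proof (induction js)
    case (Cons j js) then show ?case by (cases "js = []") auto
  qed simp
  then show ?thesis unfolding standard_symbol_def by (auto intro!: exI[of _ 1])
qed

section \<open>Duality for multipliers of one frequency\<close>

text \<open>Powers of |g| need not be smooth at the zeros of \<open>g\<close>; adding \<delta>
  repairs this for every real exponent. A derivative lowers the exponent by one and leaves a
  cofactor in \<open>bsmooth\<close>, which gives the closed set.\<close>

lemma powr_regularised_bsmooth:
  fixes g :: "real^'n::finite => complex"
  assumes g: "schwartz g" and \<delta>: "0 < \<delta>"
  shows "bsmooth (%x. complex_of_real ((norm (g x) ^ 2 + \<delta>) powr s))"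
proof -
  let ?u = "%x. norm (g x) ^ 2 + \<delta>"
  let ?X = "{%x. complex_of_real (?u x powr s) * h x | s h. bsmooth h}"
  have gb: "bsmooth g" by (rule schwartz_bsmooth[OF g])
  have cb: "bsmooth (%x. cnj (g x))"
    by (rule smooth_class_cnj[OF gb]) (auto simp: bounded_fn_def)
  have ub: "bsmooth (%x. complex_of_real (?u x))"
  proof -
    have "(%x. complex_of_real (?u x)) = (%x. g x * cnj (g x) + of_real \<delta>)"
      by (auto simp: complex_norm_square simp flip: of_real_power)
    then show ?thesis using bsmooth_add[OF bsmooth_mult[OF gb cb] bsmooth_const[of "of_real \<delta>"]] by simp
  qed
  obtain M where M: "\<And>x. norm (g x) \<le> M" using schwartz_bounded[OF g] by blast
  have u0: "\<delta> \<le> ?u x" "0 < ?u x" for x using \<delta> by (auto intro: add_nonneg_pos)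
  have uM: "?u x \<le> M\<^sup>2 + \<delta>" for x using M[of x] by (simp add: power_mono)
  have pb: "bounded_fn (%x. complex_of_real (?u x powr s))" for s
  proof -
    have "?u x powr s \<le> max (\<delta> powr s) ((M\<^sup>2 + \<delta>) powr s)" for x
    proof (cases "s \<ge> 0")
      case True then show ?thesis using u0[of x] uM[of x] \<delta> by (intro max.coboundedI2 powr_mono2) auto
    next
      case False then show ?thesis using u0[of x] \<delta> by (intro max.coboundedI1 powr_mono2') auto
    qed
    then show ?thesis unfolding bounded_fn_def by (intro exI[of _ "max (\<delta> powr s) ((M\<^sup>2 + \<delta>) powr s)"]) simp
  qed
  have d: "\<exists>D. ((%x. complex_of_real (?u x powr s)) has_derivative (%v. of_real (s * ?u x powr (s - 1)) * D v)) (at x)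
      \<and> ((%x. complex_of_real (?u x)) has_derivative D) (at x)" for s x
  proof -
    obtain D where D: "((%x. complex_of_real (?u x)) has_derivative D) (at x)"
      using smooth_classD(2)[OF ub, of x] unfolding differentiable_def by blast
    have R: "(?u has_derivative (%v. Re (D v))) (at x)" using has_derivative_Re[OF D] by simp
    have E: "D = (%v. complex_of_real (Re (D v)))" using has_derivative_unique[OF D has_derivative_of_real[OF R]] .
    have "((%t. t powr s) has_derivative (%h. (s * ?u x powr (s - 1)) * h)) (at (?u x))"
      using has_real_derivative_powr[OF u0(2)[of x], of s] unfolding has_field_derivative_def .
    from diff_chain_at[OF R this] have "((%x. ?u x powr s) has_derivative (%v. (s * ?u x powr (s - 1)) * Re (D v))) (at x)" by (simp add: o_def)
    from has_derivative_of_real[OF this] have "((%x. complex_of_real (?u x powr s)) has_derivative (%v. of_real (s * ?u x powr (s - 1)) * complex_of_real (Re (D v)))) (at x)" by simp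
    then have "((%x. complex_of_real (?u x powr s)) has_derivative (%v. of_real (s * ?u x powr (s - 1)) * D v)) (at x)"
      by (subst E)
    then show ?thesis using D by blast
  qed
  show ?thesis
  proof (rule smooth_classI[where X = ?X])
    show "(%x. complex_of_real (?u x powr s)) \<in> ?X"
      by (rule CollectI, rule exI[of _ s], rule exI[of _ "%_. 1"]) (simp add: bsmooth_const)
    fix f assume "f \<in> ?X"
    then obtain s h where f: "f = (%x. complex_of_real (?u x powr s) * h x)" and h: "bsmooth h" by blast
    have pd: "(%x. complex_of_real (?u x powr s)) differentiable at x" for x using d[of s x] unfolding differentiable_def by blast
    have hd: "h differentiable at x" for x by (rule smooth_classD(2)[OF h])
    show "f differentiable at x" for x unfolding f by (rule differentiable_mult[OF pd hd])
    show "bounded_fn f" unfolding f by (rule bounded_fn_mult[OF pb smooth_classD(1)[OF h]])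
    fix j
    let ?h = "%x. (of_real s * partial j (%x. complex_of_real (?u x)) x) * h x + complex_of_real (?u x) * partial j h x"
    have hb: "bsmooth ?h"
      by (intro bsmooth_add bsmooth_mult bsmooth_const smooth_class_partial ub h)
    have "partial j f x = complex_of_real (?u x powr (s - 1)) * ?h x" for x
    proof -
      obtain D where D: "((%x. complex_of_real (?u x powr s)) has_derivative (%v. of_real (s * ?u x powr (s - 1)) * D v)) (at x)"
        "((%x. complex_of_real (?u x)) has_derivative D) (at x)" using d by blast
      have e: "?u x powr s = ?u x powr (s - 1) * ?u x" using u0(2)[of x] by (simp add: powr_diff)
      have "partial j f x = (of_real (s * ?u x powr (s - 1)) * D (unit_vec j)) * h x + complex_of_real (?u x powr s) * partial j h x"
        unfolding f partial_mult[OF pd hd] partial_eq[OF D(1)] ..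
      also have "\<dots> = complex_of_real (?u x powr (s - 1)) * ?h x"
        unfolding partial_eq[OF D(2)] e by (simp add: algebra_simps)
      finally show ?thesis .
    qed
    then have "partial j f = (%x. complex_of_real (?u x powr (s - 1)) * ?h x)" by (rule ext)
    then show "partial j f \<in> ?X" using hb by (intro CollectI exI[of _ "s - 1"] exI[of _ ?h]) simp
  qed
qed

lemma Lp_norm_le:
  assumes "integrable lborel (%x. norm (f x) powr q)" "integrable lborel w" "\<And>x. norm (f x) powr q \<le> w x" "0 < q"
  shows "Lp_norm q f \<le> (LINT x|lborel. w x) powr (1 / q)"
  unfolding Lp_norm_def using assms by (intro powr_mono2 integral_mono) auto

context exponents
begin

text \<open>The form is tested on functions that are extremal for Hoelder: powers of |g|, with g the
  image of f. The form then becomes the integral N of |g|^q, q = p_j, while the norms of the other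
  functions multiply to N^(1 - 1/q). As N is finite, the inequality between N and N^(1 - 1/q) can be
  divided. Two regularisations make the test functions Schwartz: \<delta> for the zeros of g, the
  Gaussian \<open>w\<close> for decay.\<close>

lemma fmult_duality:
  fixes f :: "real^'n => complex"
  assumes a: "bsmooth (%\<xi>. a (\<xi> $ j))" and C: "mb C (%\<xi>. a (\<xi> $ j))" and f: "schwartz f"
  shows "Lp_norm (p j) (fmult (%\<xi>. a (\<xi> $ j)) f) \<le> C * Lp_norm (p j) f"
proof -
  define g where "g = fmult (%\<xi>. a (\<xi> $ j)) f"
  have g: "schwartz g" unfolding g_def by (rule schwartz_fmult[OF a f])
  have gm [measurable]: "g \<in> borel_measurable borel" using g by measurable
  define q where "q = p j"
  have q: "1 < q" unfolding q_def by (rule p)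
  define B where "B = C * Lp_norm q f"
  have B0: "0 \<le> B" unfolding B_def by (intro mult_nonneg_nonneg mult_boundD(1)[OF C] Lp_norm_nonneg)
  obtain M where M: "\<And>x. norm (g x) \<le> M" using schwartz_bounded[OF g] by blast
  define w where "w \<eta> x = exp (- \<eta> * (x \<bullet> (x::real^'n)))" for \<eta> x
  have wm [measurable]: "w \<eta> \<in> borel_measurable borel" for \<eta> unfolding w_def by measurable
  have w01: "0 < w \<eta> x" "w \<eta> x \<le> 1" if "0 < \<eta>" for \<eta> x
    using that unfolding w_def by (auto simp: mult_nonneg_nonneg)
  have ws: "schwartz (%x. complex_of_real (w \<eta> x))" if "0 < \<eta>" for \<eta>
    unfolding w_def using schwartz_gaussian[OF that] .
  have wi: "integrable lborel (w \<eta>)" if "0 < \<eta>" for \<eta>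
    using integrable_norm[OF schwartz_integrable[OF ws[OF that]]] w01[OF that] by (simp add: less_imp_le)
  let ?n = "CARD('n)"
  let ?u = "%\<delta> x. norm (g x) ^ 2 + \<delta>"
  have main: "(LINT x|lborel. norm (g x) ^ 2 * ?u \<delta> x powr (q / 2 - 1) * w \<eta> x ^ ?n) \<le> B * (LINT x|lborel. ?u \<delta> x powr (q / 2) * w \<eta> x) powr (1 - 1 / q)"
    if \<delta>: "0 < \<delta>" and \<eta>: "0 < \<eta>" for \<delta> \<eta>
  proof -
    define J where "J = (LINT x|lborel. ?u \<delta> x powr (q / 2) * w \<eta> x)"
    define P where "P s = (%x. complex_of_real (?u \<delta> x powr s))" for s
    have Pb: "bsmooth (P s)" for s unfolding P_def by (rule powr_regularised_bsmooth[OF g \<delta>])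
    \<comment> \<open>Together with the function \<open>g\<close> in slot \<open>j\<close>, the
      conjugate supplies |g|^2. The remaining exponent gives \<open>F0\<close> at most the size
      u^(q/(2 p0)), which matches the functions \<open>F l\<close>.\<close>
    define F0 where "F0 = (%x. complex_of_real (w \<eta> x) * (cnj (g x) * P ((q / p0 - 1) / 2) x))"
    define F where "F l = (%x. complex_of_real (w \<eta> x) * P (q / (2 * p l)) x)" for l
    have cb: "bsmooth (%x. cnj (g x))"
      by (rule smooth_class_cnj[OF schwartz_bsmooth[OF g]]) (auto simp: bounded_fn_def)
    have F0s: "schwartz F0" unfolding F0_def by (intro schwartz_mult_bsmooth ws \<eta> bsmooth_mult cb Pb)
    have Fs: "schwartz (F l)" for l unfolding F_def by (intro schwartz_mult_bsmooth ws \<eta> Pb)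
    have u0: "0 < ?u \<delta> x" for x using \<delta> by (intro add_nonneg_pos) auto
    have Ji: "integrable lborel (%x. ?u \<delta> x powr (q / 2) * w \<eta> x)"
    proof -
      have "schwartz (%x. complex_of_real (w \<eta> x) * P (q / 2) x)" by (intro schwartz_mult_bsmooth ws \<eta> Pb)
      from integrable_norm[OF schwartz_integrable[OF this]] show ?thesis
        using w01[OF \<eta>] by (simp add: P_def norm_mult mult.commute less_imp_le)
    qed
    have wq: "w \<eta> x powr r \<le> w \<eta> x" if "1 \<le> r" for r x
      using powr_mono'[of 1 r "w \<eta> x"] w01[OF \<eta>, of x] that by simp
    have FL: "Lp_norm (p l) (F l) \<le> J powr (1 / p l)" for l
      unfolding J_def
    proof (rule Lp_norm_le[OF _ Ji])
      show "integrable lborel (%x. norm (F l x) powr p l)" by (rule schwartz_powr_integrable[OF Fs]) (use p[of l] in simp)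
      show "norm (F l x) powr p l \<le> ?u \<delta> x powr (q / 2) * w \<eta> x" for x
      proof -
        have "norm (F l x) powr p l = w \<eta> x powr p l * ?u \<delta> x powr (q / 2)"
          using w01[OF \<eta>, of x] u0[of x] p[of l] by (simp add: F_def P_def norm_mult powr_mult powr_powr)
        also have "\<dots> \<le> w \<eta> x * ?u \<delta> x powr (q / 2)" using wq[of "p l" x] p[of l] by (intro mult_right_mono) auto
        finally show ?thesis by (simp add: mult.commute)
      qed
    qed (use p[of l] in simp)
    have FL0: "Lp_norm p0 F0 \<le> J powr (1 / p0)"
      unfolding J_def
    proof (rule Lp_norm_le[OF _ Ji])
      show "integrable lborel (%x. norm (F0 x) powr p0)" by (rule schwartz_powr_integrable[OF F0s]) (use p0 in simp)
      show "norm (F0 x) powr p0 \<le> ?u \<delta> x powr (q / 2) * w \<eta> x" for x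
      proof -
        have "norm (g x) = (norm (g x) ^ 2) powr (1 / 2)" by (simp add: powr_half_sqrt)
        also have "\<dots> \<le> ?u \<delta> x powr (1 / 2)" using \<delta> by (intro powr_mono2) auto
        finally have gu: "norm (g x) \<le> ?u \<delta> x powr (1 / 2)" .
        have "norm (F0 x) powr p0 = w \<eta> x powr p0 * (norm (g x) powr p0 * ?u \<delta> x powr ((q / p0 - 1) / 2 * p0))"
          using w01[OF \<eta>, of x] u0[of x] by (simp add: F0_def P_def norm_mult powr_mult powr_powr)
        also have "\<dots> \<le> w \<eta> x * ((?u \<delta> x powr (1 / 2)) powr p0 * ?u \<delta> x powr ((q / p0 - 1) / 2 * p0))"
          using wq[of p0 x] p0 gu w01[OF \<eta>, of x] by (intro mult_mono mult_right_mono powr_mono2) auto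
        also have "(?u \<delta> x powr (1 / 2)) powr p0 * ?u \<delta> x powr ((q / p0 - 1) / 2 * p0) = ?u \<delta> x powr (q / 2)"
          unfolding powr_powr powr_add[symmetric] using p0 by (intro arg_cong[where f = "%t. ?u \<delta> x powr t"]) (simp add: field_simps)
        finally show ?thesis by (simp add: mult.commute)
      qed
    qed (use p0 in simp)
    let ?F = "F(j := f)" and ?G = "F(j := g)"
    have Ffs: "schwartz (?F l)" "schwartz (?G l)" for l using Fs f g by auto
    \<comment> \<open>The multiplier depends on \<tau>_j only, so it is absorbed by the function in
      slot \<open>j\<close>.\<close>
    have L: "Lambda_m (%\<xi>. a (\<xi> $ j)) F0 ?F = Lambda_m (%_. 1) F0 ?G"
      unfolding Lambda_m_eq
    proof (intro Bochner_Integration.integral_cong refl)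
      fix \<tau> :: "real^'n^'n"
      have "Fprod ?G \<tau> = fourier g (\<tau> $ j) * (\<Prod>l\<in>UNIV - {j}. fourier (F l) (\<tau> $ l))"
        unfolding Fprod_def by (subst prod.remove[of UNIV j]) auto
      moreover have "Fprod ?F \<tau> = fourier f (\<tau> $ j) * (\<Prod>l\<in>UNIV - {j}. fourier (F l) (\<tau> $ l))"
        unfolding Fprod_def by (subst prod.remove[of UNIV j]) auto
      ultimately show "Fker F0 ?F \<tau> * a (diagonal \<tau> $ j) = Fker F0 ?G \<tau> * 1"
        unfolding Fker_def g_def fourier_fmult[OF a f] by (simp add: diagonal_def)
    qed
    have se: "(\<Sum>l\<in>UNIV - {j}. 1 / p l) + 1 / p0 = 1 - 1 / q"
      using scaling unfolding q_def by (subst (asm) sum.remove[of UNIV j]) auto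
    have prod_eq: "F0 x * (\<Prod>l\<in>UNIV. ?G l x) = of_real (norm (g x) ^ 2 * ?u \<delta> x powr (q / 2 - 1) * w \<eta> x ^ ?n)" for x
    proof -
      have "(\<Prod>l\<in>UNIV. ?G l x) = g x * (\<Prod>l\<in>UNIV - {j}. F l x)" by (subst prod.remove[of UNIV j]) auto
      also have "(\<Prod>l\<in>UNIV - {j}. F l x) = of_real (w \<eta> x ^ (?n - 1) * ?u \<delta> x powr (\<Sum>l\<in>UNIV - {j}. q / (2 * p l)))"
        using u0[of x] by (simp add: F_def P_def prod.distrib powr_sum card_Diff_singleton less_imp_neq[symmetric])
      finally have "F0 x * (\<Prod>l\<in>UNIV. ?G l x) = (g x * cnj (g x)) * of_real (w \<eta> x * w \<eta> x ^ (?n - 1) * (?u \<delta> x powr ((q / p0 - 1) / 2) * ?u \<delta> x powr (\<Sum>l\<in>UNIV - {j}. q / (2 * p l))))"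
        unfolding F0_def P_def by (simp add: mult_ac)
      also have "?u \<delta> x powr ((q / p0 - 1) / 2) * ?u \<delta> x powr (\<Sum>l\<in>UNIV - {j}. q / (2 * p l)) = ?u \<delta> x powr (q / 2 - 1)"
      proof -
        have "(\<Sum>l\<in>UNIV - {j}. q / (2 * p l)) = q / 2 * (\<Sum>l\<in>UNIV - {j}. 1 / p l)" by (simp add: sum_distrib_left)
        also have "(\<Sum>l\<in>UNIV - {j}. 1 / p l) = 1 - 1 / q - 1 / p0" using se by linarith
        finally have S: "(\<Sum>l\<in>UNIV - {j}. q / (2 * p l)) = q / 2 * (1 - 1 / q - 1 / p0)" .
        have "(q / p0 - 1) / 2 + (\<Sum>l\<in>UNIV - {j}. q / (2 * p l)) = q / 2 - 1"
          unfolding S using q by (simp add: field_simps)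
        then show ?thesis by (simp add: powr_add[symmetric])
      qed
      also have "w \<eta> x * w \<eta> x ^ (?n - 1) = w \<eta> x ^ ?n" by (simp add: power_eq_if)
      also have "g x * cnj (g x) = of_real (norm (g x) ^ 2)" using complex_norm_square[of "g x"] by (simp add: mult.commute)
      finally show ?thesis by (simp add: mult_ac)
    qed
    have "Lambda_m (%_. 1) F0 ?G = of_real (LINT x|lborel. norm (g x) ^ 2 * ?u \<delta> x powr (q / 2 - 1) * w \<eta> x ^ ?n)"
      unfolding Lambda_m_one[OF F0s Ffs(2)] prod_eq by (rule integral_complex_of_real)
    then have "(LINT x|lborel. norm (g x) ^ 2 * ?u \<delta> x powr (q / 2 - 1) * w \<eta> x ^ ?n) \<le> norm (Lambda_m (%\<xi>. a (\<xi> $ j)) F0 ?F)"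
      unfolding L by simp
    also have "\<dots> \<le> C * (Lp_norm p0 F0 * (\<Prod>l\<in>UNIV. Lp_norm (p l) (?F l)))"
      by (rule mult_boundD(4)[OF C F0s Ffs(1)])
    also have "(\<Prod>l\<in>UNIV. Lp_norm (p l) (?F l)) = Lp_norm q f * (\<Prod>l\<in>UNIV - {j}. Lp_norm (p l) (F l))"
      unfolding q_def by (subst prod.remove[of UNIV j]) auto
    also have "C * (Lp_norm p0 F0 * (Lp_norm q f * (\<Prod>l\<in>UNIV - {j}. Lp_norm (p l) (F l)))) = B * (Lp_norm p0 F0 * (\<Prod>l\<in>UNIV - {j}. Lp_norm (p l) (F l)))"
      by (simp add: B_def)
    also have "\<dots> \<le> B * (J powr (1 / p0) * (\<Prod>l\<in>UNIV - {j}. J powr (1 / p l)))"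
      using B0 by (intro mult_left_mono mult_mono prod_mono conjI FL FL0 Lp_norm_nonneg prod_nonneg) auto
    also have "J powr (1 / p0) * (\<Prod>l\<in>UNIV - {j}. J powr (1 / p l)) = J powr (1 - 1 / q)"
    proof (cases "J = 0")
      case True then show ?thesis using q by simp
    next
      case False then show ?thesis using se by (simp add: powr_sum[symmetric] powr_add[symmetric] add.commute)
    qed
    finally show ?thesis unfolding J_def .
  qed
  have Mq: "norm (g x) powr q \<le> M powr q" for x using M q by (intro powr_mono2) auto
  \<comment> \<open>The Gaussian is kept while \<delta> tends to 0, since for positive \<delta> the
    regularised powers do not decay.\<close>
  have lim1: "(LINT x|lborel. norm (g x) powr q * w \<eta> x ^ ?n) \<le> B * (LINT x|lborel. norm (g x) powr q * w \<eta> x) powr (1 - 1 / q)" if \<eta>: "0 < \<eta>" for \<eta>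
  proof (rule LIMSEQ_le)
    let ?d = "%k. 1 / real (Suc k)"
    have d0: "?d \<longlonglongrightarrow> 0" by (rule LIMSEQ_Suc[OF lim_1_over_n])
    have ud: "?u (?d k) x powr (q / 2) \<le> (M\<^sup>2 + 1) powr (q / 2)" for k x
      using M[of x] q by (intro powr_mono2 add_mono power_mono) (auto simp: field_simps)
    have gq: "(norm (g x) ^ 2) powr (q / 2) = norm (g x) powr q" for x
      using powr_powr[of "norm (g x)" 2 "q / 2"] by simp
    have ulim: "(%k. ?u (?d k) x powr (q / 2)) \<longlonglongrightarrow> norm (g x) powr q" for x
    proof -
      have l: "(%k. ?u (?d k) x) \<longlonglongrightarrow> norm (g x) ^ 2 + 0" by (intro tendsto_add tendsto_const d0)
      have "(%k. ?u (?d k) x powr (q / 2)) \<longlonglongrightarrow> (norm (g x) ^ 2 + 0) powr (q / 2)"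
        by (rule tendsto_powr'[OF l tendsto_const]) (use q in simp)
      then show ?thesis using gq by simp
    qed
    show "(%k. LINT x|lborel. norm (g x) ^ 2 * ?u (?d k) x powr (q / 2 - 1) * w \<eta> x ^ ?n) \<longlonglongrightarrow> (LINT x|lborel. norm (g x) powr q * w \<eta> x ^ ?n)"
    proof (rule integral_dominated_convergence[where w = "%x. (M\<^sup>2 + 1) powr (q / 2) * w \<eta> x"])
      show "integrable lborel (%x. (M\<^sup>2 + 1) powr (q / 2) * w \<eta> x)" using wi[OF \<eta>] by simp
      show "AE x in lborel. (%k. norm (g x) ^ 2 * ?u (?d k) x powr (q / 2 - 1) * w \<eta> x ^ ?n) \<longlonglongrightarrow> norm (g x) powr q * w \<eta> x ^ ?n"
      proof (rule AE_I2)
        fix x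
        show "(%k. norm (g x) ^ 2 * ?u (?d k) x powr (q / 2 - 1) * w \<eta> x ^ ?n) \<longlonglongrightarrow> norm (g x) powr q * w \<eta> x ^ ?n"
        proof (cases "g x = 0")
          case False
          have "(%k. norm (g x) ^ 2 * ?u (?d k) x powr (q / 2 - 1) * w \<eta> x ^ ?n) \<longlonglongrightarrow> norm (g x) ^ 2 * (norm (g x) ^ 2 + 0) powr (q / 2 - 1) * w \<eta> x ^ ?n"
            by (intro tendsto_intros d0) (use False in simp)
          moreover have "norm (g x) ^ 2 * (norm (g x) ^ 2 + 0) powr (q / 2 - 1) = norm (g x) powr q"
            using False gq[of x] by (simp add: powr_diff)
          ultimately show ?thesis by simp
        qed simp
      qed
      show "AE x in lborel. norm (norm (g x) ^ 2 * ?u (?d k) x powr (q / 2 - 1) * w \<eta> x ^ ?n) \<le> (M\<^sup>2 + 1) powr (q / 2) * w \<eta> x" for k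
      proof (rule AE_I2)
        fix x
        have up: "0 < ?u (?d k) x" by (intro add_nonneg_pos) auto
        have "norm (g x) ^ 2 * ?u (?d k) x powr (q / 2 - 1) \<le> ?u (?d k) x * ?u (?d k) x powr (q / 2 - 1)" by (intro mult_right_mono) auto
        also have "\<dots> = ?u (?d k) x powr (q / 2)" using up by (simp add: powr_diff)
        also have "\<dots> \<le> (M\<^sup>2 + 1) powr (q / 2)" by (rule ud)
        finally have 1: "norm (g x) ^ 2 * ?u (?d k) x powr (q / 2 - 1) \<le> (M\<^sup>2 + 1) powr (q / 2)" .
        have "w \<eta> x ^ ?n \<le> w \<eta> x ^ 1" using w01[OF \<eta>, of x] by (intro power_decreasing) (auto simp: less_imp_le Suc_leI)
        then have "norm (g x) ^ 2 * ?u (?d k) x powr (q / 2 - 1) * w \<eta> x ^ ?n \<le> (M\<^sup>2 + 1) powr (q / 2) * w \<eta> x"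
          using 1 w01[OF \<eta>, of x] by (intro mult_mono) auto
        moreover have "0 \<le> norm (g x) ^ 2 * ?u (?d k) x powr (q / 2 - 1) * w \<eta> x ^ ?n" using w01[OF \<eta>, of x] by simp
        ultimately show "norm (norm (g x) ^ 2 * ?u (?d k) x powr (q / 2 - 1) * w \<eta> x ^ ?n) \<le> (M\<^sup>2 + 1) powr (q / 2) * w \<eta> x" by simp
      qed
    qed measurable
    have "(%k. LINT x|lborel. ?u (?d k) x powr (q / 2) * w \<eta> x) \<longlonglongrightarrow> (LINT x|lborel. norm (g x) powr q * w \<eta> x)"
    proof (rule integral_dominated_convergence[where w = "%x. (M\<^sup>2 + 1) powr (q / 2) * w \<eta> x"])
      show "integrable lborel (%x. (M\<^sup>2 + 1) powr (q / 2) * w \<eta> x)" using wi[OF \<eta>] by simp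
      show "AE x in lborel. (%k. ?u (?d k) x powr (q / 2) * w \<eta> x) \<longlonglongrightarrow> norm (g x) powr q * w \<eta> x"
        by (intro AE_I2 tendsto_intros ulim)
      show "AE x in lborel. norm (?u (?d k) x powr (q / 2) * w \<eta> x) \<le> (M\<^sup>2 + 1) powr (q / 2) * w \<eta> x" for k
        using w01[OF \<eta>] ud by (intro AE_I2) (simp add: abs_mult less_imp_le mult_right_mono)
    qed measurable
    then show "(%k. B * (LINT x|lborel. ?u (?d k) x powr (q / 2) * w \<eta> x) powr (1 - 1 / q)) \<longlonglongrightarrow> B * (LINT x|lborel. norm (g x) powr q * w \<eta> x) powr (1 - 1 / q)"
      by (intro tendsto_mult tendsto_const tendsto_powr') (use q w01[OF \<eta>] in \<open>auto intro!: always_eventually integral_nonneg simp: less_imp_le\<close>)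
    show "\<exists>N. \<forall>k\<ge>N. (LINT x|lborel. norm (g x) ^ 2 * ?u (?d k) x powr (q / 2 - 1) * w \<eta> x ^ ?n) \<le> B * (LINT x|lborel. ?u (?d k) x powr (q / 2) * w \<eta> x) powr (1 - 1 / q)"
      using main[OF _ \<eta>] by (intro exI[of _ 0]) simp
  qed
  define N where "N = (LINT x|lborel. norm (g x) powr q)"
  have gi: "integrable lborel (%x. norm (g x) powr q)" by (rule schwartz_powr_integrable[OF g]) (use q in simp)
  have N0: "0 \<le> N" unfolding N_def by simp
  have "N \<le> B * N powr (1 - 1 / q)"
  proof (rule LIMSEQ_le_const2)
    let ?e = "%k. 1 / real (Suc k)"
    have e0: "?e \<longlonglongrightarrow> 0" by (rule LIMSEQ_Suc[OF lim_1_over_n])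
    show "(%k. LINT x|lborel. norm (g x) powr q * w (?e k) x ^ ?n) \<longlonglongrightarrow> N"
      unfolding N_def
    proof (rule integral_dominated_convergence[where w = "%x. norm (g x) powr q"])
      show "AE x in lborel. (%k. norm (g x) powr q * w (?e k) x ^ ?n) \<longlonglongrightarrow> norm (g x) powr q"
      proof (rule AE_I2)
        fix x
        have "(%k. norm (g x) powr q * w (?e k) x ^ ?n) \<longlonglongrightarrow> norm (g x) powr q * exp (- 0 * (x \<bullet> x)) ^ ?n"
          unfolding w_def by (intro tendsto_intros e0)
        then show "(%k. norm (g x) powr q * w (?e k) x ^ ?n) \<longlonglongrightarrow> norm (g x) powr q" by simp
      qed
      show "AE x in lborel. norm (norm (g x) powr q * w (?e k) x ^ ?n) \<le> norm (g x) powr q" for k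
      proof (rule AE_I2)
        fix x
        have "0 < ?e k" by simp
        from w01[OF this, of x] have "0 \<le> w (?e k) x ^ ?n" "w (?e k) x ^ ?n \<le> 1" by (auto intro: power_le_one less_imp_le)
        then show "norm (norm (g x) powr q * w (?e k) x ^ ?n) \<le> norm (g x) powr q" by (simp add: abs_mult mult_left_le)
      qed
    qed (use gi in auto)
    have "(LINT x|lborel. norm (g x) powr q * w \<eta> x ^ ?n) \<le> B * N powr (1 - 1 / q)" if \<eta>: "0 < \<eta>" for \<eta>
    proof -
      have "(LINT x|lborel. norm (g x) powr q * w \<eta> x) \<le> N"
        unfolding N_def using w01[OF \<eta>] gi by (intro integral_mono') (auto simp: mult_left_le)
      then have "B * (LINT x|lborel. norm (g x) powr q * w \<eta> x) powr (1 - 1 / q) \<le> B * N powr (1 - 1 / q)"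
        using B0 q w01[OF \<eta>] by (intro mult_left_mono powr_mono2 integral_nonneg) (auto simp: less_imp_le)
      then show ?thesis using lim1[OF \<eta>] by linarith
    qed
    then show "\<exists>K. \<forall>k\<ge>K. (LINT x|lborel. norm (g x) powr q * w (?e k) x ^ ?n) \<le> B * N powr (1 - 1 / q)"
      by (intro exI[of _ 0]) simp
  qed
  then have "N powr (1 / q) \<le> B"
  proof (cases "N = 0")
    case False
    then have "0 < N" using N0 by simp
    then have "N powr (1 / q) * N powr (1 - 1 / q) \<le> B * N powr (1 - 1 / q)"
      using \<open>N \<le> B * N powr (1 - 1 / q)\<close> by (simp add: powr_add[symmetric])
    then show ?thesis using \<open>0 < N\<close> by simp
  qed (use B0 in simp)
  moreover have "Lp_norm q g = N powr (1 / q)" unfolding Lp_norm_def N_def ..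
  ultimately show ?thesis unfolding g_def[symmetric] q_def[symmetric] B_def by simp
qed

end

subsection \<open>A universal sign sequence\<close>

text \<open>All integer lists are laid end to end in the order of their codes under
  \<open>from_nat\<close>; this is the position at which the list with code \<open>q\<close>
  begins.\<close>

fun block_start :: "nat => nat" where
  "block_start 0 = 0"
| "block_start (Suc q) = block_start q + length (from_nat q :: int list)"

lemma block_start_mono: "q < q' ==> block_start q + length (from_nat q :: int list) \<le> block_start q'"
proof (induction q')
  case (Suc q') then show ?case by (cases "q = q'") auto
qed simp

lemma block_unique:
  assumes "block_start q + i = block_start q' + i'" "i < length (from_nat q :: int list)" "i' < length (from_nat q' :: int list)"
  shows "q = q' \<and> i = i'"
  using block_start_mono[of q q'] block_start_mono[of q' q] assms by (cases q q' rule: linorder_cases) auto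

text \<open>The concatenation of all finite sequences with entries in \<open>{-1, 0, 1}\<close>.\<close>
definition universal_signs :: "int => real" where
  "universal_signs k = (if \<exists>q i. k = int (block_start q + i) \<and> i < length (from_nat q :: int list) \<and> (from_nat q :: int list) ! i = 1 then 1
     else if \<exists>q i. k = int (block_start q + i) \<and> i < length (from_nat q :: int list) \<and> (from_nat q :: int list) ! i = - 1 then - 1 else 0)"

lemma universal_signs_abs: "\<bar>universal_signs k\<bar> \<le> 1"
  by (simp add: universal_signs_def)

lemma universal_signs_block:
  assumes i: "i < length (from_nat q :: int list)" and v: "(from_nat q :: int list) ! i \<in> {-1, 0, 1}"
  shows "universal_signs (int (block_start q + i)) = real_of_int ((from_nat q :: int list) ! i)"
proof -
  have "(\<exists>q' i'. int (block_start q + i) = int (block_start q' + i') \<and> i' < length (from_nat q' :: int list) \<and> (from_nat q' :: int list) ! i' = c)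
    \<longleftrightarrow> (from_nat q :: int list) ! i = c" for c
    using i block_unique[of q i] by (metis of_nat_eq_iff)
  then show ?thesis using v unfolding universal_signs_def by auto
qed

lemma universal_signs_pattern:
  fixes s :: "int => int"
  assumes s: "\<And>k. s k \<in> {-1, 0, 1}"
  obtains n where "\<And>k. \<bar>k\<bar> \<le> int N ==> universal_signs (k + n) = real_of_int (s k)"
proof -
  define xs where "xs = map (%i. s (int i - int N)) [0..<2 * N + 1]"
  define q where "q = to_nat xs"
  have q: "(from_nat q :: int list) = xs" unfolding q_def by simp
  have "universal_signs (k + (int (block_start q) + int N)) = real_of_int (s k)" if "\<bar>k\<bar> \<le> int N" for k
  proof -
    define i where "i = nat (k + int N)"
    have i: "int i = k + int N" "i < 2 * N + 1" using that unfolding i_def by auto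
    have "universal_signs (int (block_start q + i)) = real_of_int (xs ! i)"
    proof (rule universal_signs_block[of i q, unfolded q])
      show "i < length xs" using i(2) by (simp add: xs_def)
      then show "xs ! i \<in> {-1, 0, 1}" using s by (simp add: xs_def del: upt_Suc)
    qed
    moreover have "xs ! i = s k" using i by (simp add: xs_def del: upt_Suc)
    ultimately show ?thesis using i(1) by (simp add: add_ac)
  qed
  then show ?thesis by (rule that)
qed

text \<open>The exponent is negated so that \<open>dyadic k * u\<close> has size about one when k is
  close to the binary logarithm of |u|: the index names the frequency band.\<close>

definition dyadic :: "int => real" where
  "dyadic k = 2 powr (- real_of_int k)"

lemma dyadic_pos: "0 < dyadic k" by (simp add: dyadic_def)

lemma dyadic_diff: "dyadic (k - n) = dyadic k * 2 powr real_of_int n"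
  by (simp add: dyadic_def powr_add[symmetric])

lemma annular_window:
  assumes g: "annular r g" and nz: "g (dyadic k * u) \<noteq> 0"
  shows "\<bar>real_of_int k - log 2 \<bar>u\<bar>\<bar> \<le> log 2 r"
proof -
  note D = annularD[OF g]
  have le: "1 / r \<le> dyadic k * \<bar>u\<bar>" "dyadic k * \<bar>u\<bar> \<le> r"
    using D(3)[of "dyadic k * u"] D(4)[of "dyadic k * u"] nz dyadic_pos[of k] by (auto simp: abs_mult not_less[symmetric])
  have u: "0 < \<bar>u\<bar>" using le(1) D(1) by (cases "u = 0") (auto simp: divide_le_0_iff)
  have l: "log 2 (dyadic k * \<bar>u\<bar>) = log 2 \<bar>u\<bar> - real_of_int k"
    using u dyadic_pos[of k] by (simp add: log_mult dyadic_def)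
  have "log 2 (1 / r) \<le> log 2 (dyadic k * \<bar>u\<bar>)" "log 2 (dyadic k * \<bar>u\<bar>) \<le> log 2 r"
    using le D(1) u dyadic_pos[of k] by (intro log_le_cancel_iff[THEN iffD2]; simp)+
  then show ?thesis unfolding l using D(1) by (simp add: log_divide abs_le_iff)
qed

definition window :: "real => real => int set" where
  "window R u = {\<lceil>log 2 \<bar>u\<bar> - R\<rceil>..\<lfloor>log 2 \<bar>u\<bar> + R\<rfloor>}"

lemma mem_window: "k \<in> window R u \<longleftrightarrow> \<bar>real_of_int k - log 2 \<bar>u\<bar>\<bar> \<le> R"
  unfolding window_def by (auto simp: ceiling_le_iff le_floor_iff abs_le_iff)

lemma card_window: "0 \<le> R ==> real (card (window R u)) \<le> 2 * R + 1"
proof -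
  assume R: "0 \<le> R"
  define f c where "f = \<lfloor>log 2 \<bar>u\<bar> + R\<rfloor>" and "c = \<lceil>log 2 \<bar>u\<bar> - R\<rceil>"
  have fc: "real_of_int f \<le> log 2 \<bar>u\<bar> + R" "log 2 \<bar>u\<bar> - R \<le> real_of_int c" unfolding f_def c_def by auto
  have "real (card (window R u)) = real (nat (f - c + 1))" unfolding window_def f_def c_def by simp
  also have "\<dots> \<le> 2 * R + 1"
    using R fc by (cases "0 \<le> f - c + 1") (auto simp: of_nat_nat)
  finally show ?thesis .
qed

lemma finite_window [simp]: "finite (window R u)" by (simp add: window_def)

text \<open>A sum over all integers, cut to the window of indices that can contribute, so that it is
  finite at every point. At u = 0 all terms vanish because annular functions do, whatever the window
  is there.\<close>

definition sign_series :: "real => (real => real) => real => real" where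
  "sign_series r g u = (\<Sum>k\<in>window (log 2 r) u. universal_signs k * g (dyadic k * u))"

lemma sign_series_eq:
  assumes g: "annular r g" and K: "finite K" "\<And>k. g (dyadic k * u) \<noteq> 0 ==> k \<in> K"
  shows "sign_series r g u = (\<Sum>k\<in>K. universal_signs k * g (dyadic k * u))"
proof -
  have "(\<Sum>k\<in>window (log 2 r) u. universal_signs k * g (dyadic k * u)) = (\<Sum>k\<in>window (log 2 r) u \<inter> K. universal_signs k * g (dyadic k * u))"
    using K by (intro sum.mono_neutral_right) auto
  also have "\<dots> = (\<Sum>k\<in>K. universal_signs k * g (dyadic k * u))"
    using K annular_window[OF g, of _ u] by (intro sum.mono_neutral_left) (auto simp: mem_window)
  finally show ?thesis unfolding sign_series_def .
qed

text \<open>The Euler operator commutes with dilations, so it sends the series of \<open>g\<close>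
  to the series of the annular function v g'(v), with the same signs. Boundedness needs only signs
  of modulus at most 1 and windows of bounded size; no regularity of the sign sequence
  enters.\<close>

lemma symbol1_sign_series:
  assumes "annular r g"
  shows "symbol1 (sign_series r g)"
  unfolding symbol1_def
proof (rule exI[of _ "sign_series r ` Collect (annular r)"], intro conjI ballI)
  show "sign_series r g \<in> sign_series r ` Collect (annular r)" using assms by simp
  fix h assume "h \<in> sign_series r ` Collect (annular r)"
  then obtain g where h: "h = sign_series r g" and g: "annular r g" by blast
  note D = annularD[OF g]
  have R: "0 \<le> log 2 r" using D(1) by simp
  obtain C where C: "\<And>u. \<bar>g u\<bar> \<le> C" using annular_bounded[OF g] by blast
  have C0: "0 \<le> C" using C[of 0] by linarith
  have "\<bar>h u\<bar> \<le> (2 * log 2 r + 1) * C" for u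
  proof -
    have "\<bar>h u\<bar> \<le> (\<Sum>k\<in>window (log 2 r) u. \<bar>universal_signs k * g (dyadic k * u)\<bar>)" unfolding h sign_series_def by (rule sum_abs)
    also have "\<dots> \<le> (\<Sum>k\<in>window (log 2 r) u. C)"
    proof (rule sum_mono)
      fix k
      have "\<bar>universal_signs k\<bar> * \<bar>g (dyadic k * u)\<bar> \<le> 1 * C" by (intro mult_mono universal_signs_abs C) auto
      then show "\<bar>universal_signs k * g (dyadic k * u)\<bar> \<le> C" by (simp add: abs_mult)
    qed
    also have "\<dots> \<le> (2 * log 2 r + 1) * C" using card_window[OF R, of u] C0 by (simp add: mult_right_mono)
    finally show ?thesis .
  qed
  then show "\<exists>C. \<forall>u. u \<noteq> 0 \<longrightarrow> \<bar>h u\<bar> \<le> C" by (intro exI allI impI)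
  obtain g' where g': "annular r g'" "\<And>u. (g has_real_derivative g' u) (at u)" using annular_deriv[OF g] by blast
  define e where "e v = g' v * v" for v
  have e: "annular r e" unfolding e_def using annular_mult[OF g'(1) smooth1_id] .
  have "(h has_real_derivative sign_series r e u / u) (at u)" if u: "u \<noteq> 0" for u
  proof -
    \<comment> \<open>Enlarging the radius by one yields a single finite index set valid throughout
      the neighbourhood \<open>U\<close> of \<open>u\<close>, so that the series can be
      differentiated termwise.\<close>
    define W where "W = window (log 2 r + 1) u"
    define U where "U = {v::real. v \<noteq> 0 \<and> \<bar>log 2 \<bar>v\<bar> - log 2 \<bar>u\<bar>\<bar> < 1}"
    have fW: "finite W" unfolding W_def by simp
    have inW: "k \<in> W" if "g0 (dyadic k * v) \<noteq> 0" "v \<in> U" "annular r g0" for g0 k v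
      using annular_window[OF that(3,1)] that(2) unfolding W_def mem_window U_def by auto
    have "open U"
    proof -
      have "U = (%v. \<bar>log 2 \<bar>v\<bar> - log 2 \<bar>u\<bar>\<bar>) -` {..<1} \<inter> (- {0})" unfolding U_def by auto
      moreover have "continuous_on (- {0}) (%v. \<bar>log 2 \<bar>v\<bar> - log 2 \<bar>u\<bar>\<bar>)" by (auto intro!: continuous_intros)
      ultimately show ?thesis
        using continuous_on_open_vimage[of "- {0}" "%v. \<bar>log 2 \<bar>v\<bar> - log 2 \<bar>u\<bar>\<bar>", THEN iffD1, rule_format, of "{..<1}"] open_Compl[OF closed_singleton[of "0::real"]] by simp
    qed
    moreover have uU: "u \<in> U" using u unfolding U_def by simp
    moreover have "((%v. \<Sum>k\<in>W. universal_signs k * g (dyadic k * v)) has_real_derivative (\<Sum>k\<in>W. universal_signs k * (g' (dyadic k * u) * dyadic k))) (at u)"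
    proof (rule DERIV_sum, rule DERIV_cmult)
      fix k
      have "((%v. dyadic k * v) has_real_derivative dyadic k) (at u)" by (auto intro!: derivative_eq_intros)
      from DERIV_chain2[OF g'(2) this] show "((%v. g (dyadic k * v)) has_real_derivative g' (dyadic k * u) * dyadic k) (at u)" .
    qed
    moreover have "(\<Sum>k\<in>W. universal_signs k * (g' (dyadic k * u) * dyadic k)) = sign_series r e u / u"
    proof -
      have "sign_series r e u = (\<Sum>k\<in>W. universal_signs k * e (dyadic k * u))"
        by (rule sign_series_eq[OF e fW]) (rule inW[OF _ uU e])
      then show ?thesis using u by (simp add: e_def sum_divide_distrib mult_ac)
    qed
    moreover have "h v = (\<Sum>k\<in>W. universal_signs k * g (dyadic k * v))" if "v \<in> U" for v
      unfolding h by (rule sign_series_eq[OF g fW]) (rule inW[OF _ that g])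
    ultimately show ?thesis
      using has_field_derivative_transform_within_open[of "%v. \<Sum>k\<in>W. universal_signs k * g (dyadic k * v)" _ u U h] by simp
  qed
  then show "\<exists>h'\<in>sign_series r ` Collect (annular r). \<forall>u. u \<noteq> 0 \<longrightarrow> (h has_real_derivative h' u / u) (at u)"
    using e by (intro bexI[of _ "sign_series r e"]) auto
qed

section \<open>Uniform bounds obtained by dilation\<close>

text \<open>The boundedness hypothesis in terms of \<open>mb\<close>: every standard symbol has some
  constant, with no control of it by seminorms of the symbol.\<close>

locale symbol_bounds = exponents +
  assumes standard_mb: "standard_symbol m ==> m \<in> borel_measurable borel ==> bounded_fn m ==> \<exists>c. mb c m"
begin

text \<open>Scaling the coordinates outside \<open>A\<close> to 0 sends their factors to
  \<open>bump 0\<close>, which is 1. One standard symbol thus controls the cone multipliers of all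
  subsets \<open>A\<close> containing \<open>i\<close>, with the same constant.\<close>

lemma mb_cone:
  assumes b: "symbol1 b"
  obtains c where "\<And>A. i \<in> A ==> mb c (%\<xi>. complex_of_real (b (\<xi> $ i) * (\<Prod>l\<in>A - {i}. bump (\<xi> $ l / \<xi> $ i))))"
proof -
  let ?m = "%\<xi>. complex_of_real (cone_fn i 0 b (%_. bump) \<xi>)"
  have [measurable]: "b \<in> borel_measurable borel" by (rule symbol1_measurable[OF b])
  have bc: "continuous_on UNIV bump" by (rule smooth1_continuous[OF smooth1_bump])
  have [measurable]: "bump \<in> borel_measurable borel" using bc by (rule borel_measurable_continuous_onI)
  obtain C where C: "\<And>u. u \<noteq> 0 ==> \<bar>b u\<bar> \<le> C" using symbol1_bounded[OF b] by blast
  \<comment> \<open>A \<open>symbol1\<close> is controlled off 0 only; its value at 0 enters because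
    multipliers have to be bounded everywhere.\<close>
  define D where "D = max C \<bar>b 0\<bar>"
  have D: "\<bar>b u\<bar> \<le> D" for u using C[of u] unfolding D_def by (cases "u = 0") auto
  have pb: "\<bar>\<Prod>l\<in>A. bump (x l)\<bar> \<le> 1" for A :: "'a set" and x
    unfolding abs_prod by (rule prod_le_1) (use bump_bounds in auto)
  have bb: "norm (complex_of_real (b u * (\<Prod>l\<in>A. bump (x l)))) \<le> D" for A :: "'a set" and x u
    unfolding norm_of_real abs_mult using mult_mono[OF D[of u] pb[of x A]] order_trans[OF abs_ge_zero D] by simp
  have mB: "norm (?m \<xi>) \<le> D" for \<xi>
    using bb[of "\<xi> $ i" _ "UNIV - {i}", unfolded norm_of_real] order_trans[OF abs_ge_zero D[of 0]] by (simp add: cone_fn_def)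
  have mm: "?m \<in> borel_measurable borel" unfolding cone_fn_def by measurable
  have "bounded_fn ?m" unfolding bounded_fn_def using mB by blast
  then obtain c where c: "mb c ?m" using standard_mb[OF cone_fn_standard_symbol[OF b] mm] by blast
  show ?thesis
  proof (rule that[of c])
    fix A assume A: "i \<in> A"
    define l where "l k = (%j. if j \<in> A then 1 else 1 / real (Suc k))" for k
    show "mb c (%\<xi>. complex_of_real (b (\<xi> $ i) * (\<Prod>l\<in>A - {i}. bump (\<xi> $ l / \<xi> $ i))))"
    proof (rule mult_bound_limit[where m = "%k \<xi>. ?m (dil (l k) \<xi>)" and B = D])
      show "mb c (%\<xi>. ?m (dil (l k) \<xi>))" for k by (rule mb_dil[OF c]) (simp add: l_def)
      show "norm (?m (dil (l k) \<xi>)) \<le> D" for k \<xi> by (rule mB)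
      show "(%\<xi>. complex_of_real (b (\<xi> $ i) * (\<Prod>l\<in>A - {i}. bump (\<xi> $ l / \<xi> $ i)))) \<in> borel_measurable borel" by measurable
      show "bounded_fn (%\<xi>. complex_of_real (b (\<xi> $ i) * (\<Prod>l\<in>A - {i}. bump (\<xi> $ l / \<xi> $ i))))"
        unfolding bounded_fn_def by (rule exI[of _ D], rule allI, rule bb)
      fix \<xi> :: "real^'a" assume \<xi>: "\<forall>j. \<xi> $ j \<noteq> 0"
      have e: "?m (dil (l k) \<xi>) = complex_of_real (b (\<xi> $ i) * (\<Prod>j\<in>UNIV - {i}. bump (l k j * (\<xi> $ j / \<xi> $ i))))" for k
        using \<xi> A by (simp add: cone_fn_def l_def)
      have t: "(%k. bump (l k j * (\<xi> $ j / \<xi> $ i))) \<longlonglongrightarrow> (if j \<in> A then bump (\<xi> $ j / \<xi> $ i) else 1)" for j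
      proof (cases "j \<in> A")
        case False
        have "(%k. 1 / real (Suc k) * (\<xi> $ j / \<xi> $ i)) \<longlonglongrightarrow> 0 * (\<xi> $ j / \<xi> $ i)"
          by (intro tendsto_mult tendsto_const LIMSEQ_Suc[OF lim_1_over_n])
        then have "(%k. 1 / real (Suc k) * (\<xi> $ j / \<xi> $ i)) \<longlonglongrightarrow> 0" by simp
        moreover have "isCont bump 0" using bc by (simp add: continuous_on_eq_continuous_at)
        ultimately have "(%k. bump (1 / real (Suc k) * (\<xi> $ j / \<xi> $ i))) \<longlonglongrightarrow> bump 0" by (rule isCont_tendsto_compose[rotated])
        then show ?thesis using False by (simp add: l_def bump_inner)
      qed (simp add: l_def)
      have "(%k. ?m (dil (l k) \<xi>)) \<longlonglongrightarrow> complex_of_real (b (\<xi> $ i) * (\<Prod>j\<in>UNIV - {i}. if j \<in> A then bump (\<xi> $ j / \<xi> $ i) else 1))"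
        unfolding e by (intro tendsto_of_real tendsto_mult tendsto_const tendsto_prod t)
      moreover have "(\<Prod>j\<in>UNIV - {i}. if j \<in> A then bump (\<xi> $ j / \<xi> $ i) else 1) = (\<Prod>j\<in>A - {i}. bump (\<xi> $ j / \<xi> $ i))"
        by (rule prod.mono_neutral_cong_right) auto
      ultimately show "(%k. ?m (dil (l k) \<xi>)) \<longlonglongrightarrow> complex_of_real (b (\<xi> $ i) * (\<Prod>l\<in>A - {i}. bump (\<xi> $ l / \<xi> $ i)))" by simp
    qed
  qed
qed

text \<open>The case \<open>A = {i}\<close>, in which no cone factor is left: a multiplier that need
  not be a standard symbol is reached as a limit of dilates of one.\<close>

lemma mb_symbol1:
  assumes "symbol1 b"
  obtains c where "mb c (%\<xi>. complex_of_real (b (\<xi> $ i)))"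
proof -
  obtain c where "\<And>A. i \<in> A ==> mb c (%\<xi>. complex_of_real (b (\<xi> $ i) * (\<Prod>l\<in>A - {i}. bump (\<xi> $ l / \<xi> $ i))))"
    using mb_cone[OF assms] by blast
  from this[of "{i}"] show ?thesis using that by simp
qed

text \<open>The constant is independent of the signs and of \<open>I\<close>. Dilating the one
  symbol \<open>sign_series r g\<close> by a power of 2 shifts its sign sequence, and the shift is
  chosen so that on [-N, N] the prescribed signs appear, with 0 outside \<open>I\<close>. At a given
  \<xi> only finitely many bands are active, so for large N the dilate equals the signed
  sum.\<close>

lemma mb_random_signs:
  assumes g: "annular r g"
  obtains c where "\<And>I s. finite I ==> (\<And>k. s k \<in> {-1, 1}) ==> mb c (%\<xi>. complex_of_real (\<Sum>k\<in>I. real_of_int (s k) * g (dyadic k * \<xi> $ i)))"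
proof -
  let ?b = "sign_series r g"
  have b: "symbol1 ?b" by (rule symbol1_sign_series[OF g])
  obtain c where c: "mb c (%\<xi>. complex_of_real (?b (\<xi> $ i)))" using mb_symbol1[OF b] by blast
  obtain B where B: "\<And>\<xi>. norm (complex_of_real (?b (\<xi> $ i))) \<le> B" using mult_boundD(3)[OF c] unfolding bounded_fn_def by blast
  obtain G where G: "\<And>u. \<bar>g u\<bar> \<le> G" using annular_bounded[OF g] by blast
  obtain g' where "\<And>u. (g has_real_derivative g' u) (at u)" using annular_deriv[OF g] by blast
  then have "continuous_on UNIV g" by (meson DERIV_isCont continuous_at_imp_continuous_on)
  then have [measurable]: "g \<in> borel_measurable borel" by (rule borel_measurable_continuous_onI)
  show ?thesis
  proof (rule that[of c])
    fix I :: "int set" and s :: "int => int" assume I: "finite I" and s: "\<And>k. s k \<in> {-1, 1}"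
    define z where "z k = (if k \<in> I then s k else 0)" for k
    have z: "z k \<in> {-1, 0, 1}" for k using s[of k] unfolding z_def by auto
    have "\<exists>n. \<forall>k. \<bar>k\<bar> \<le> int N \<longrightarrow> universal_signs (k + n) = real_of_int (z k)" for N
      using universal_signs_pattern[of z N, OF z] by blast
    then obtain n where n: "\<And>N k. \<bar>k\<bar> \<le> int N ==> universal_signs (k + n N) = real_of_int (z k)" by metis
    define l where "l N = (%j::'a. 2 powr real_of_int (n N))" for N
    show "mb c (%\<xi>. complex_of_real (\<Sum>k\<in>I. real_of_int (s k) * g (dyadic k * \<xi> $ i)))"
    proof (rule mult_bound_limit[where m = "%N \<xi>. complex_of_real (?b (dil (l N) \<xi> $ i))" and B = B])
      show "mb c (%\<xi>. complex_of_real (?b (dil (l N) \<xi> $ i)))" for N by (rule mb_dil[OF c]) (simp add: l_def)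
      show "norm (complex_of_real (?b (dil (l N) \<xi> $ i))) \<le> B" for N \<xi> by (rule B)
      show "(%\<xi>. complex_of_real (\<Sum>k\<in>I. real_of_int (s k) * g (dyadic k * \<xi> $ i))) \<in> borel_measurable borel" by measurable
      have "\<bar>\<Sum>k\<in>I. real_of_int (s k) * g (dyadic k * \<xi> $ i)\<bar> \<le> (\<Sum>k\<in>I. G)" for \<xi> :: "real^'a"
      proof (rule order_trans[OF sum_abs sum_mono])
        fix k show "\<bar>real_of_int (s k) * g (dyadic k * \<xi> $ i)\<bar> \<le> G" using s[of k] G by (auto simp: abs_mult)
      qed
      then show "bounded_fn (%\<xi>. complex_of_real (\<Sum>k\<in>I. real_of_int (s k) * g (dyadic k * \<xi> $ i)))"
        unfolding bounded_fn_def norm_of_real by (intro exI allI)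
      fix \<xi> :: "real^'a" assume \<xi>: "\<forall>j. \<xi> $ j \<noteq> 0"
      let ?u = "\<xi> $ i"
      \<comment> \<open>\<open>N1\<close> covers the bands active at \<xi>, \<open>N2\<close> the
        indices in \<open>I\<close>.\<close>
      obtain N1 :: nat where N1: "\<bar>log 2 \<bar>?u\<bar>\<bar> + log 2 r \<le> real N1" using real_arch_simple by blast
      obtain N2 :: nat where N2: "\<And>k. k \<in> I ==> \<bar>k\<bar> \<le> int N2"
      proof -
        have "finite ((%k. nat \<bar>k\<bar>) ` I)" using I by simp
        then have "\<And>k. k \<in> I ==> nat \<bar>k\<bar> \<le> Max ((%k. nat \<bar>k\<bar>) ` I)" by simp
        then show ?thesis using that[of "Max ((%k. nat \<bar>k\<bar>) ` I)"] by (simp add: nat_le_iff)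
      qed
      have "?b (dil (l N) \<xi> $ i) = (\<Sum>k\<in>I. real_of_int (s k) * g (dyadic k * ?u))" if N: "N \<ge> max N1 N2" for N
      proof -
        let ?v = "dil (l N) \<xi> $ i"
        let ?K = "(%k. k + n N) ` {- int N..int N}"
        have v: "dyadic (k + n N) * ?v = dyadic k * ?u" for k
          using dyadic_diff[of "k + n N" "n N"] by (simp add: l_def)
        have "?b ?v = (\<Sum>k\<in>?K. universal_signs k * g (dyadic k * ?v))"
        proof (rule sign_series_eq[OF g])
          fix k assume "g (dyadic k * ?v) \<noteq> 0"
          moreover have "dyadic k * ?v = dyadic (k - n N) * ?u" using v[of "k - n N"] by (simp only: diff_add_cancel)
          ultimately have "g (dyadic (k - n N) * ?u) \<noteq> 0" by (simp only: not_False_eq_True)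
          from annular_window[OF g this] have "\<bar>real_of_int (k - n N)\<bar> \<le> real N" using N1 N by linarith
          then have "\<bar>k - n N\<bar> \<le> int N" by linarith
          then show "k \<in> ?K" by (intro image_eqI[where x = "k - n N"]) auto
        qed simp
        also have "\<dots> = (\<Sum>k\<in>{- int N..int N}. universal_signs (k + n N) * g (dyadic k * ?u))"
          by (subst sum.reindex, simp add: inj_on_def, simp only: comp_def v)
        also have "\<dots> = (\<Sum>k\<in>{- int N..int N}. real_of_int (z k) * g (dyadic k * ?u))"
          by (intro sum.cong refl) (simp add: n abs_le_iff)
        also have "\<dots> = (\<Sum>k\<in>I. real_of_int (s k) * g (dyadic k * ?u))"
        proof (rule sum.mono_neutral_cong_right)
          have "k \<in> {- int N..int N}" if "k \<in> I" for k using N2[OF that] N by auto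
          then show "I \<subseteq> {- int N..int N}" by blast
        qed (auto simp: z_def)
        finally show ?thesis .
      qed
      then have "\<forall>\<^sub>F N in sequentially. complex_of_real (?b (dil (l N) \<xi> $ i)) = complex_of_real (\<Sum>k\<in>I. real_of_int (s k) * g (dyadic k * ?u))"
        unfolding eventually_sequentially by (metis)
      then show "(%N. complex_of_real (?b (dil (l N) \<xi> $ i))) \<longlonglongrightarrow> complex_of_real (\<Sum>k\<in>I. real_of_int (s k) * g (dyadic k * ?u))"
        by (rule tendsto_eventually)
    qed
  qed
qed

end

subsection \<open>Randomisation\<close>

text \<open>Lets identities between operators on Schwartz functions be checked on the Fourier side,
  where they are products of multipliers and shifts.\<close>

lemma fourier_inject:
  assumes "schwartz f" "schwartz g" "\<And>\<xi>. fourier f \<xi> = fourier g \<xi>"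
  shows "f = g"
proof
  fix x
  have "f x = (LINT \<xi>|lborel. fourier f \<xi> * cis (2 * pi * (x \<bullet> \<xi>)))" by (rule fourier_inversion[OF assms(1)])
  also have "\<dots> = (LINT \<xi>|lborel. fourier g \<xi> * cis (2 * pi * (x \<bullet> \<xi>)))" by (simp only: assms(3))
  also have "\<dots> = g x" by (rule fourier_inversion[OF assms(2), symmetric])
  finally show "f x = g x" .
qed

lemma bsmooth_sum: "finite I ==> (\<And>k. bsmooth (f k)) ==> bsmooth (%x. \<Sum>k\<in>I. f k x)"
  by (induction I rule: finite_induct) (simp_all add: bsmooth_const bsmooth_add)

lemma annular_measurable: "annular r g ==> g \<in> borel_measurable borel"
proof -
  assume g: "annular r g"
  obtain g' where "\<And>u. (g has_real_derivative g' u) (at u)" using annular_deriv[OF g] by blast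
  then have "continuous_on UNIV g" by (meson DERIV_isCont continuous_at_imp_continuous_on)
  then show ?thesis by (rule borel_measurable_continuous_onI)
qed

definition signed :: "'a set => 'a set => ('a => real^'n::finite => complex) => real^'n => complex" where
  "signed I A z x = (\<Sum>k\<in>I. of_real (sign_of A k) * z k x)"

lemma schwartz_signed: "(\<And>k. schwartz (z k)) ==> schwartz (signed I A z)"
  unfolding signed_def[abs_def] by (intro schwartz_sum schwartz_cmult)

lemma fourier_signed:
  assumes "\<And>k. schwartz (z k)"
  shows "fourier (signed I A z) \<xi> = (\<Sum>k\<in>I. of_real (sign_of A k) * fourier (z k) \<xi>)"
  unfolding signed_def[abs_def] using fourier_sum[of I "%k x. of_real (sign_of A k) * z k x" \<xi>] assms
  by (simp add: schwartz_cmult fourier_cmult)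

lemma Lp_norm_powr: "0 < q ==> Lp_norm q f powr q = (LINT x|lborel. norm (f x) powr q)"
  unfolding Lp_norm_def by (simp add: powr_powr)

text \<open>\<open>a\<close> bounds the q-th root of the mean, over all signs, of the q-th power of
  the norm. It plays the role of a square function estimate.\<close>

definition random_bound :: "real => 'a set => ('a => real^'n::finite => complex) => real => bool" where
  "random_bound q I z a \<longleftrightarrow> 0 \<le> a \<and> (\<Sum>A\<in>Pow I. Lp_norm q (signed I A z) powr q) \<le> real (card (Pow I)) * a powr q"

text \<open>At each x the modulations multiply the terms by numbers of modulus one, so the pointwise
  contraction principle can be integrated over x. The frequencies \<open>v k\<close> may vary with
  k, which no bound for a single operator would allow.\<close>

lemma random_bound_modulate:
  assumes I: "finite I" and q: "1 \<le> q" and z: "\<And>k. schwartz (z k)" and b: "random_bound q I z a"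
  shows "random_bound q I (%k x. z k x * cis (2 * pi * (x \<bullet> v k))) (2 * a)"
proof -
  let ?w = "%k x. z k x * cis (2 * pi * (x \<bullet> v k))"
  have w: "schwartz (?w k)" for k by (rule schwartz_cis_mult[OF z])
  have q0: "0 < q" using q by simp
  note bd = b[unfolded random_bound_def]
  have int: "integrable lborel (%x. norm (signed I A y x) powr q)" if "\<And>k. schwartz (y k)" for A y
    by (rule schwartz_powr_integrable[OF schwartz_signed[of y, OF that] q])
  have "(\<Sum>A\<in>Pow I. Lp_norm q (signed I A ?w) powr q) = (LINT x|lborel. (\<Sum>A\<in>Pow I. norm (signed I A ?w x) powr q))"
    unfolding Lp_norm_powr[OF q0] using int[OF w] by (intro Bochner_Integration.integral_sum[symmetric])
  also have "\<dots> \<le> (LINT x|lborel. 2 powr q * (\<Sum>A\<in>Pow I. norm (signed I A z x) powr q))"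
  proof (rule integral_mono)
    show "integrable lborel (%x. \<Sum>A\<in>Pow I. norm (signed I A ?w x) powr q)" by (rule Bochner_Integration.integrable_sum) (rule int[OF w])
    show "integrable lborel (%x. 2 powr q * (\<Sum>A\<in>Pow I. norm (signed I A z x) powr q))"
      by (rule integrable_mult_right, rule Bochner_Integration.integrable_sum) (rule int[OF z])
    fix x
    show "(\<Sum>A\<in>Pow I. norm (signed I A ?w x) powr q) \<le> 2 powr q * (\<Sum>A\<in>Pow I. norm (signed I A z x) powr q)"
      unfolding signed_def by (rule contraction_cis[OF I q])
  qed
  also have "\<dots> = 2 powr q * (\<Sum>A\<in>Pow I. Lp_norm q (signed I A z) powr q)"
    unfolding Lp_norm_powr[OF q0] integral_mult_right_zero using int[OF z] by (subst Bochner_Integration.integral_sum) auto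
  also have "\<dots> \<le> 2 powr q * (real (card (Pow I)) * a powr q)" using bd by (intro mult_left_mono) auto
  also have "\<dots> = real (card (Pow I)) * (2 * a) powr q" using bd by (simp add: powr_mult)
  finally show ?thesis using bd unfolding random_bound_def by simp
qed

text \<open>A linear operator common to all k commutes with signed sums, so a norm bound for it
  supplies the hypothesis for each choice of signs.\<close>

lemma random_bound_operator:
  assumes "random_bound q I z a" "0 \<le> C" "0 < q"
    and le: "\<And>A. Lp_norm q (signed I A z') \<le> C * Lp_norm q (signed I A z)"
  shows "random_bound q I z' (C * a)"
proof -
  note bd = assms(1)[unfolded random_bound_def]
  have "(\<Sum>A\<in>Pow I. Lp_norm q (signed I A z') powr q) \<le> (\<Sum>A\<in>Pow I. C powr q * Lp_norm q (signed I A z) powr q)"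
  proof (rule sum_mono)
    fix A
    have "Lp_norm q (signed I A z') powr q \<le> (C * Lp_norm q (signed I A z)) powr q"
      using le[of A] assms(3) by (intro powr_mono2) (auto simp: Lp_norm_nonneg)
    then show "Lp_norm q (signed I A z') powr q \<le> C powr q * Lp_norm q (signed I A z) powr q"
      using assms(2) by (simp add: powr_mult Lp_norm_nonneg)
  qed
  also have "\<dots> \<le> C powr q * (real (card (Pow I)) * a powr q)" unfolding sum_distrib_left[symmetric] using bd by (intro mult_left_mono) auto
  also have "\<dots> = real (card (Pow I)) * (C * a) powr q" using bd assms(2) by (simp add: powr_mult)
  finally show ?thesis using bd assms(2) unfolding random_bound_def by simp
qed

lemma random_bound_uniform:
  assumes "0 < q" and le: "\<And>A. Lp_norm q (signed I A z) \<le> a"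
  shows "random_bound q I z a"
proof -
  have a: "0 \<le> a" using order_trans[OF Lp_norm_nonneg le] by blast
  have "(\<Sum>A\<in>Pow I. Lp_norm q (signed I A z) powr q) \<le> (\<Sum>A\<in>Pow I. a powr q)"
    using assms by (intro sum_mono powr_mono2) (auto simp: Lp_norm_nonneg)
  then show ?thesis using a unfolding random_bound_def by simp
qed

lemma Fker_update2:
  assumes ij: "i \<noteq> j"
  shows "Fker F0 (F(i := f, j := g)) \<tau> = fourier F0 (- (\<Sum>l\<in>UNIV. \<tau> $ l)) * (\<Prod>l\<in>UNIV - {i, j}. fourier (F l) (\<tau> $ l)) * fourier f (\<tau> $ i) * fourier g (\<tau> $ j)"
proof -
  have U: "UNIV = insert i (insert j (UNIV - {i, j}))" by auto
  have "Fprod (F(i := f, j := g)) \<tau> = fourier f (\<tau> $ i) * (fourier g (\<tau> $ j) * (\<Prod>l\<in>UNIV - {i, j}. fourier (F l) (\<tau> $ l)))"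
    unfolding Fprod_def by (subst U) (use ij in simp)
  then show ?thesis unfolding Fker_def by (simp add: mult_ac)
qed

lemma prod_update2:
  fixes h :: "'n::finite => 'b => real"
  assumes ij: "i \<noteq> j"
  shows "(\<Prod>l\<in>UNIV. h l ((F(i := f, j := g)) l)) = h i f * h j g * (\<Prod>l\<in>UNIV - {i, j}. h l (F l))"
proof -
  have U: "UNIV = insert i (insert j (UNIV - {i, j}))" by auto
  show ?thesis by (subst U) (use ij in simp)
qed

lemma schwartz_update2:
  fixes F :: "'n::finite => real^'n => complex"
  shows "(\<And>l. schwartz (F l)) ==> schwartz f ==> schwartz g ==> schwartz ((F(i := f, j := g)) l)"
  by simp

context exponents
begin

text \<open>Attaching the same random signs to \<open>u\<close> and \<open>v\<close> and averaging
  leaves the sum of the diagonal terms. Hoelder in space is contained in the bound for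
  \<open>m\<close>; Hoelder over the signs needs 1/p_i + 1/p_j at most 1, which the scaling identity
  provides.\<close>

lemma randomised_form:
  fixes F :: "'n => real^'n => complex"
  assumes ij: "i \<noteq> j" and F0: "schwartz F0" and F: "\<And>l. schwartz (F l)" and m: "mb c m" and I: "finite I"
    and u: "\<And>k. schwartz (u k)" and v: "\<And>k. schwartz (v k)"
    and a: "random_bound (p i) I u a" and b: "random_bound (p j) I v b"
  shows "norm (\<Sum>k\<in>I. Lambda_m m F0 (F(i := u k, j := v k))) \<le> 3 * c * (a * b) * (Lp_norm p0 F0 * (\<Prod>l\<in>UNIV - {i, j}. Lp_norm (p l) (F l)))"
proof -
  note mD = mult_boundD[OF m]
  let ?G = "%A. F(i := signed I A u, j := signed I A v)"
  let ?H = "%k. F(i := u k, j := v k)"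
  let ?P = "Lp_norm p0 F0 * (\<Prod>l\<in>UNIV - {i, j}. Lp_norm (p l) (F l))"
  have G: "schwartz (?G A l)" for A l by (rule schwartz_update2[OF F schwartz_signed[OF u] schwartz_signed[OF v]])
  have H: "schwartz (?H k l)" for k l by (rule schwartz_update2[OF F u v])
  have GI: "integrable lborel (%\<tau>. Fker F0 (?G A) \<tau> * m (diagonal \<tau>))" for A
    by (rule Fker_mult_integrable[OF F0 G mD(2,3)])
  have HI: "integrable lborel (%\<tau>. Fker F0 (?H k) \<tau> * m (diagonal \<tau>))" for k
    by (rule Fker_mult_integrable[OF F0 H mD(2,3)])
  have pt: "(\<Sum>A\<in>Pow I. Fker F0 (?G A) \<tau> * m (diagonal \<tau>)) = 2 ^ card I * (\<Sum>k\<in>I. Fker F0 (?H k) \<tau> * m (diagonal \<tau>))" for \<tau>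
  proof -
    let ?R = "fourier F0 (- (\<Sum>l\<in>UNIV. \<tau> $ l)) * (\<Prod>l\<in>UNIV - {i, j}. fourier (F l) (\<tau> $ l))"
    let ?U = "%k. fourier (u k) (\<tau> $ i)" and ?V = "%k. fourier (v k) (\<tau> $ j)"
    have "(\<Sum>A\<in>Pow I. Fker F0 (?G A) \<tau> * m (diagonal \<tau>))
      = ?R * m (diagonal \<tau>) * (\<Sum>A\<in>Pow I. (0 + (\<Sum>k\<in>I. of_real (sign_of A k) * ?U k)) * (0 + (\<Sum>k\<in>I. of_real (sign_of A k) * ?V k)))"
      unfolding Fker_update2[OF ij] fourier_signed[OF u] fourier_signed[OF v] sum_distrib_left[of _ _ "Pow I"] by (intro sum.cong refl) (simp add: mult_ac)
    also have "\<dots> = ?R * m (diagonal \<tau>) * (2 ^ card I * (0 * 0 + (\<Sum>k\<in>I. ?U k * ?V k)))" by (simp only: sign_orthogonality[OF I])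
    also have "\<dots> = 2 ^ card I * (\<Sum>k\<in>I. Fker F0 (?H k) \<tau> * m (diagonal \<tau>))"
      unfolding Fker_update2[OF ij] by (simp add: sum_distrib_left mult_ac)
    finally show ?thesis .
  qed
  have "(\<Sum>A\<in>Pow I. Lambda_m m F0 (?G A)) = (LINT \<tau>|lborel. (\<Sum>A\<in>Pow I. Fker F0 (?G A) \<tau> * m (diagonal \<tau>)))"
    unfolding Lambda_m_eq by (rule Bochner_Integration.integral_sum[symmetric]) (rule GI)
  also have "\<dots> = 2 ^ card I * (\<Sum>k\<in>I. Lambda_m m F0 (?H k))"
    unfolding pt integral_mult_right_zero Lambda_m_eq by (subst Bochner_Integration.integral_sum) (simp_all add: HI)
  finally have eq: "2 ^ card I * (\<Sum>k\<in>I. Lambda_m m F0 (?H k)) = (\<Sum>A\<in>Pow I. Lambda_m m F0 (?G A))" ..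
  have "2 ^ card I * norm (\<Sum>k\<in>I. Lambda_m m F0 (?H k)) = norm (2 ^ card I * (\<Sum>k\<in>I. Lambda_m m F0 (?H k)))" by (simp add: norm_mult norm_power)
  also have "\<dots> \<le> (\<Sum>A\<in>Pow I. norm (Lambda_m m F0 (?G A)))" unfolding eq by (rule norm_sum)
  also have "\<dots> \<le> (\<Sum>A\<in>Pow I. c * ?P * (Lp_norm (p i) (signed I A u) * Lp_norm (p j) (signed I A v)))"
  proof (rule sum_mono)
    fix A
    have "norm (Lambda_m m F0 (?G A)) \<le> c * (Lp_norm p0 F0 * (\<Prod>l\<in>UNIV. Lp_norm (p l) (?G A l)))" by (rule mD(4)[OF F0 G])
    then show "norm (Lambda_m m F0 (?G A)) \<le> c * ?P * (Lp_norm (p i) (signed I A u) * Lp_norm (p j) (signed I A v))"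
      unfolding prod_update2[OF ij, of "%l. Lp_norm (p l)"] by (simp add: mult_ac)
  qed
  also have "\<dots> = c * ?P * (\<Sum>A\<in>Pow I. Lp_norm (p i) (signed I A u) * Lp_norm (p j) (signed I A v))" by (rule sum_distrib_left[symmetric])
  also have "\<dots> \<le> c * ?P * (3 * real (card (Pow I)) * (a * b))"
  proof (rule mult_left_mono)
    show "(\<Sum>A\<in>Pow I. Lp_norm (p i) (signed I A u) * Lp_norm (p j) (signed I A v)) \<le> 3 * real (card (Pow I)) * (a * b)"
      using a b I p[of i] p[of j] exponent_pair[OF ij] unfolding random_bound_def
      by (intro sum_Hoelder_crude) (auto simp: Lp_norm_nonneg)
    show "0 \<le> c * ?P" using mD(1) by (intro mult_nonneg_nonneg prod_nonneg) (auto simp: Lp_norm_nonneg)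
  qed
  also have "\<dots> = 2 ^ card I * (3 * c * (a * b) * ?P)" using I by (simp add: card_Pow)
  finally show ?thesis by simp
qed

end

context symbol_bounds
begin

text \<open>A signed sum of the pieces is one Fourier multiplier applied to \<open>f\<close>. It is
  bounded uniformly in the signs by \<open>mb_random_signs\<close>, and \<open>fmult_duality\<close>
  turns the bound on forms into a bound on functions. This is the Littlewood-Paley input.\<close>

lemma random_projection:
  assumes g: "annular r g"
  obtains C where "0 \<le> C" "\<And>I f. finite I ==> schwartz f ==> random_bound (p i) I (%k. fmult (%\<xi>. of_real (g (dyadic k * \<xi> $ i))) f) (C * Lp_norm (p i) f)"
proof -
  obtain c where c: "\<And>I s. finite I ==> (\<And>k. s k \<in> {-1, 1}) ==> mb c (%\<xi>. complex_of_real (\<Sum>k\<in>I. real_of_int (s k) * g (dyadic k * \<xi> $ i)))"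
    using mb_random_signs[OF g] by blast
  have gb: "bsmooth (%\<xi>::real^'a. complex_of_real (g (dyadic k * \<xi> $ i)))" for k
    using bsmooth_lift[OF bsmooth1_annular[OF g], of "dyadic k" i 0] by simp
  show ?thesis
  proof (rule that[of c])
    show "0 \<le> c" using mult_boundD(1)[OF c[of "{}" "%_. 1"]] by simp
    fix I :: "int set" and f :: "real^'a => complex" assume I: "finite I" and f: "schwartz f"
    let ?z = "%k. fmult (%\<xi>. of_real (g (dyadic k * \<xi> $ i))) f"
    have z: "schwartz (?z k)" for k by (rule schwartz_fmult[OF gb f])
    show "random_bound (p i) I ?z (c * Lp_norm (p i) f)"
    proof (rule random_bound_uniform)
      show "0 < p i" using p[of i] by simp
      fix A :: "int set"
      define s :: "int => int" where "s k = (if k \<in> A then 1 else - 1)" for k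
      have s: "real_of_int (s k) = sign_of A k" for k by (simp add: s_def sign_of_def)
      define a where "a t = complex_of_real (\<Sum>k\<in>I. real_of_int (s k) * g (dyadic k * t))" for t
      have mba: "mb c (%\<xi>. a (\<xi> $ i))" unfolding a_def by (rule c[OF I]) (simp add: s_def)
      have ab: "bsmooth (%\<xi>::real^'a. a (\<xi> $ i))"
        unfolding a_def of_real_sum of_real_mult by (intro bsmooth_sum[OF I] bsmooth_mult bsmooth_const gb)
      have "signed I A ?z = fmult (%\<xi>. a (\<xi> $ i)) f"
      proof (rule fourier_inject[OF schwartz_signed[OF z] schwartz_fmult[OF ab f]])
        show "fourier (signed I A ?z) \<xi> = fourier (fmult (%\<xi>. a (\<xi> $ i)) f) \<xi>" for \<xi>
          unfolding fourier_signed[OF z] fourier_fmult[OF gb f] fourier_fmult[OF ab f] unfolding a_def s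
          by (simp add: sum_distrib_left mult_ac)
      qed
      then show "Lp_norm (p i) (signed I A ?z) \<le> c * Lp_norm (p i) f" using fmult_duality[OF ab mba f] by simp
    qed
  qed
qed

text \<open>The constant depends neither on the shifts \<open>a k\<close> and step positions
  \<open>b k\<close>, which are arbitrary in each band, nor on the steepness \<open>d\<close>.
  Shifts and positions are realised by modulations that vary with k, which random bounds tolerate at
  a factor 2 each. Every term becomes the form of the same \<open>m\<close> on modulated pieces of
  \<open>F i\<close> and \<open>F j\<close>, and \<open>randomised_form\<close> adds them
  up.\<close>

lemma paraproduct_smooth:
  assumes ij: "i \<noteq> j" and \<psi>: "annular r \<psi>" and \<phi>: "annular r' \<phi>"
  obtains C where "0 \<le> C" "\<And>m c a b d I. mb c m ==> finite I ==> 0 < d ==>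
    mb (C * c) (%\<xi>. \<Sum>k\<in>I. of_real (\<psi> (dyadic k * \<xi> $ i) * smooth_step (d * (\<xi> $ i - b k)) * \<phi> (dyadic k * \<xi> $ j)) * m (\<xi> + a k *\<^sub>R unit_vec j))"
proof -
  obtain C1 where C1: "0 \<le> C1" "\<And>I f. finite I ==> schwartz f ==> random_bound (p i) I (%k. fmult (%\<xi>. of_real (\<psi> (dyadic k * \<xi> $ i))) f) (C1 * Lp_norm (p i) f)"
    using random_projection[OF \<psi>] by blast
  obtain C2 where C2: "0 \<le> C2" "\<And>I f. finite I ==> schwartz f ==> random_bound (p j) I (%k. fmult (%\<xi>. of_real (\<phi> (dyadic k * \<xi> $ j))) f) (C2 * Lp_norm (p j) f)"
    using random_projection[OF \<phi>] by blast
  obtain CS where CS: "mb CS (%\<xi>. of_real (smooth_step (\<xi> $ i)))" using mb_symbol1[OF symbol1_smooth_step] by blast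
  have CS0: "0 \<le> CS" by (rule mult_boundD(1)[OF CS])
  note [measurable] = annular_measurable[OF \<psi>] annular_measurable[OF \<phi>]
    borel_measurable_continuous_onI[OF smooth1_continuous[OF smooth1_smooth_step]]
  obtain B1 where B1: "\<And>u. \<bar>\<psi> u\<bar> \<le> B1" using annular_bounded[OF \<psi>] by blast
  obtain B2 where B2: "\<And>u. \<bar>\<phi> u\<bar> \<le> B2" using annular_bounded[OF \<phi>] by blast
  have \<psi>b: "bsmooth (%\<xi>::real^'a. complex_of_real (\<psi> (dyadic k * \<xi> $ i)))" for k
    using bsmooth_lift[OF bsmooth1_annular[OF \<psi>], of "dyadic k" i 0] by simp
  have \<phi>b: "bsmooth (%\<xi>::real^'a. complex_of_real (\<phi> (dyadic k * \<xi> $ j)))" for k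
    using bsmooth_lift[OF bsmooth1_annular[OF \<phi>], of "dyadic k" j 0] by simp
  show ?thesis
  \<comment> \<open>The factor 3 of \<open>randomised_form\<close> times 2 for each of four
    modulations: three on the side of \<open>i\<close>, one on the side of \<open>j\<close>.\<close>
  proof (rule that[of "48 * CS * C1 * C2"])
    show "0 \<le> 48 * CS * C1 * C2" using CS0 C1(1) C2(1) by simp
    fix m :: "real^'a => complex" and c d :: real and a b :: "int => real" and I :: "int set"
    assume m: "mb c m" and I: "finite I" and d: "0 < d"
    note mD = mult_boundD[OF m]
    note [measurable] = mD(2)
    have Sb: "bsmooth (%\<xi>::real^'a. complex_of_real (smooth_step (d * (\<xi> $ i - e))))" for e
      using bsmooth_lift[OF bsmooth1_smooth_step, of d i "- (d * e)"] by (simp add: algebra_simps)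
    have S0b: "bsmooth (%\<xi>::real^'a. complex_of_real (smooth_step (d * \<xi> $ i)))" using Sb[of 0] by simp
    have Smb: "mb CS (%\<xi>. complex_of_real (smooth_step (d * \<xi> $ i)))"
      using mb_dil[OF CS, of "%_. d"] d by simp
    let ?w = "%k \<xi>. \<psi> (dyadic k * \<xi> $ i) * smooth_step (d * (\<xi> $ i - b k)) * \<phi> (dyadic k * \<xi> $ j)"
    let ?M = "%\<xi>. \<Sum>k\<in>I. of_real (?w k \<xi>) * m (\<xi> + a k *\<^sub>R unit_vec j)"
    let ?mk = "%k \<xi>. m (\<xi> + a k *\<^sub>R unit_vec j)"
    obtain B where B: "\<And>\<xi>. norm (m \<xi>) \<le> B" using mD(3) unfolding bounded_fn_def by blast
    have wB: "\<bar>?w k \<xi>\<bar> \<le> B1 * 1 * B2" for k and \<xi> :: "real^'a"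
      unfolding abs_mult by (intro mult_mono B1 B2 smooth_step_abs mult_nonneg_nonneg order_trans[OF abs_ge_zero B1]) auto
    have MB: "bounded_fn ?M"
      unfolding bounded_fn_def
    proof (rule exI[of _ "\<Sum>k\<in>I. B1 * 1 * B2 * B"], rule allI, rule order_trans[OF norm_sum sum_mono])
      fix k and \<xi> :: "real^'a"
      show "norm (of_real (?w k \<xi>) * m (\<xi> + a k *\<^sub>R unit_vec j)) \<le> B1 * 1 * B2 * B"
        unfolding norm_mult norm_of_real by (rule mult_mono[OF wB B]) (use order_trans[OF abs_ge_zero wB] in auto)
    qed
    have MM: "?M \<in> borel_measurable borel" by measurable
    show "mb (48 * CS * C1 * C2 * c) ?M"
    proof (rule mult_boundI[OF _ MM MB])
      show "0 \<le> 48 * CS * C1 * C2 * c" using CS0 C1(1) C2(1) mD(1) by simp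
      fix F0 :: "real^'a => complex" and F :: "'a => real^'a => complex"
      assume F0: "schwartz F0" and F: "\<And>l. schwartz (F l)"
      define E where "E l e f = (%x. f x * cis (2 * pi * (x \<bullet> (e *\<^sub>R unit_vec l))))" for l e and f :: "real^'a => complex"
      have E: "schwartz f ==> schwartz (E l e f)" for l e f unfolding E_def by (rule schwartz_cis_mult)
      have fE: "fourier (E l e f) \<xi> = fourier f (\<xi> - e *\<^sub>R unit_vec l)" for l e f \<xi> unfolding E_def by (rule fourier_modulate)
      define P where "P k = fmult (%\<xi>. of_real (\<psi> (dyadic k * \<xi> $ i))) (F i)" for k
      define Q where "Q k = fmult (%\<xi>. of_real (\<phi> (dyadic k * \<xi> $ j))) (F j)" for k
      define S where "S = fmult (%\<xi>::real^'a. complex_of_real (smooth_step (d * \<xi> $ i)))"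
      define U where "U k = fmult (%\<xi>. of_real (\<psi> (dyadic k * \<xi> $ i)) * of_real (smooth_step (d * (\<xi> $ i - b k)))) (F i)" for k
      have P: "schwartz (P k)" for k unfolding P_def by (rule schwartz_fmult[OF \<psi>b F])
      have Q: "schwartz (Q k)" for k unfolding Q_def by (rule schwartz_fmult[OF \<phi>b F])
      have U: "schwartz (U k)" for k unfolding U_def by (rule schwartz_fmult[OF bsmooth_mult[OF \<psi>b Sb] F])
      have S: "schwartz f ==> schwartz (S f)" for f unfolding S_def by (rule schwartz_fmult[OF S0b])
      have fS: "schwartz f ==> fourier (S f) \<xi> = of_real (smooth_step (d * \<xi> $ i)) * fourier f \<xi>" for f \<xi>
        unfolding S_def by (rule fourier_fmult[OF S0b])
      \<comment> \<open>Conjugation by a modulation moves the step from \<open>b k\<close> to 0, so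
        that the operator \<open>S\<close> in the middle is the same for all k.\<close>
      have UE: "U k = E i (b k) (S (E i (- b k) (P k)))" for k
      proof (rule fourier_inject[OF U E[OF S[OF E[OF P]]]])
        fix \<xi> :: "real^'a"
        have "unit_vec i $ i = 1" by (simp add: unit_vec_def axis_def)
        then show "fourier (U k) \<xi> = fourier (E i (b k) (S (E i (- b k) (P k)))) \<xi>"
          unfolding fE fS[OF E[OF P]] unfolding U_def P_def fourier_fmult[OF bsmooth_mult[OF \<psi>b Sb] F] fourier_fmult[OF \<psi>b F] by (simp add: mult_ac)
      qed
      have pi: "1 \<le> p i" "0 < p i" "1 \<le> p j" using p[of i] p[of j] by auto
      have "random_bound (p i) I P (C1 * Lp_norm (p i) (F i))" unfolding P_def by (rule C1(2)[OF I F])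
      from random_bound_modulate[OF I pi(1) P this, of "%k. (- b k) *\<^sub>R unit_vec i"]
      have "random_bound (p i) I (%k. E i (- b k) (P k)) (2 * (C1 * Lp_norm (p i) (F i)))" unfolding E_def .
      then have "random_bound (p i) I (%k. S (E i (- b k) (P k))) (CS * (2 * (C1 * Lp_norm (p i) (F i))))"
      proof (rule random_bound_operator[OF _ CS0 pi(2)])
        fix A
        let ?f = "signed I A (%k. E i (- b k) (P k))"
        have f: "schwartz ?f" by (rule schwartz_signed[OF E[OF P]])
        have "signed I A (%k. S (E i (- b k) (P k))) = S ?f"
        proof (rule fourier_inject[OF schwartz_signed[OF S[OF E[OF P]]] S[OF f]])
          show "fourier (signed I A (%k. S (E i (- b k) (P k)))) \<xi> = fourier (S ?f) \<xi>" for \<xi>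
            unfolding fourier_signed[OF S[OF E[OF P]]] fS[OF f] fourier_signed[OF E[OF P]] fS[OF E[OF P]]
            by (simp add: sum_distrib_left mult_ac)
        qed
        then show "Lp_norm (p i) (signed I A (%k. S (E i (- b k) (P k)))) \<le> CS * Lp_norm (p i) ?f"
          unfolding S_def using fmult_duality[of "%t. of_real (smooth_step (d * t))" i, OF S0b Smb f] by simp
      qed
      from random_bound_modulate[OF I pi(1) S[OF E[OF P]] this, of "%k. b k *\<^sub>R unit_vec i"]
      have "random_bound (p i) I U (2 * (CS * (2 * (C1 * Lp_norm (p i) (F i)))))" unfolding UE[abs_def] E_def[of i "b _"] .
      \<comment> \<open>Translating \<open>m\<close> by \<open>a k\<close> along e_j requires
        opposite modulations of the i-th and the j-th function, both in the direction e_j.\<close>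
      from random_bound_modulate[OF I pi(1) U this, of "%k. (- a k) *\<^sub>R unit_vec j"]
      have rU: "random_bound (p i) I (%k. E j (- a k) (U k)) (2 * (2 * (CS * (2 * (C1 * Lp_norm (p i) (F i))))))" unfolding E_def .
      have "random_bound (p j) I Q (C2 * Lp_norm (p j) (F j))" unfolding Q_def by (rule C2(2)[OF I F])
      from random_bound_modulate[OF I pi(3) Q this, of "%k. a k *\<^sub>R unit_vec j"]
      have rQ: "random_bound (p j) I (%k. E j (a k) (Q k)) (2 * (C2 * Lp_norm (p j) (F j)))" unfolding E_def .
      let ?H = "%k. F(i := U k, j := Q k)"
      have H: "schwartz (?H k l)" for k l by (rule schwartz_update2[OF F U Q])
      have mkb: "bounded_fn (?mk k)" for k using mD(3) unfolding bounded_fn_def by blast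
      have "Lambda_m ?M F0 F = (\<Sum>k\<in>I. Lambda_m (?mk k) F0 (?H k))"
      proof -
        have "Fker F0 F \<tau> * ?M (diagonal \<tau>) = (\<Sum>k\<in>I. Fker F0 (?H k) \<tau> * ?mk k (diagonal \<tau>))" for \<tau>
        proof -
          have "Fker F0 F \<tau> = Fker F0 (F(i := F i, j := F j)) \<tau>" by simp
          then show ?thesis
            unfolding Fker_update2[OF ij] U_def Q_def fourier_fmult[OF bsmooth_mult[OF \<psi>b Sb] F] fourier_fmult[OF \<phi>b F]
            by (simp add: sum_distrib_left diagonal_def mult_ac)
        qed
        then show ?thesis
          unfolding Lambda_m_eq by (subst Bochner_Integration.integral_sum[symmetric]) (auto intro!: Fker_mult_integrable F0 H mkb)
      qed
      also have "\<dots> = (\<Sum>k\<in>I. Lambda_m m F0 (F(i := E j (- a k) (U k), j := E j (a k) (Q k))))"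
        unfolding E_def by (intro sum.cong refl Lambda_m_translate[OF ij F0 F U Q mD(2), symmetric])
      also have "norm \<dots> \<le> 3 * c * ((2 * (2 * (CS * (2 * (C1 * Lp_norm (p i) (F i)))))) * (2 * (C2 * Lp_norm (p j) (F j)))) * (Lp_norm p0 F0 * (\<Prod>l\<in>UNIV - {i, j}. Lp_norm (p l) (F l)))"
        by (rule randomised_form[OF ij F0 F m I E[OF U] E[OF Q] rU rQ])
      also have "\<dots> = 48 * CS * C1 * C2 * c * (Lp_norm p0 F0 * (Lp_norm (p i) (F i) * Lp_norm (p j) (F j) * (\<Prod>l\<in>UNIV - {i, j}. Lp_norm (p l) (F l))))"
        by simp
      also have "Lp_norm (p i) (F i) * Lp_norm (p j) (F j) * (\<Prod>l\<in>UNIV - {i, j}. Lp_norm (p l) (F l)) = (\<Prod>l\<in>UNIV. Lp_norm (p l) (F l))"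
        using prod_update2[OF ij, of "%l. Lp_norm (p l)" F "F i" "F j"] by simp
      finally show "norm (Lambda_m ?M F0 F) \<le> 48 * CS * C1 * C2 * c * (Lp_norm p0 F0 * (\<Prod>l\<in>UNIV. Lp_norm (p l) (F l)))" .
    qed
  qed
qed

text \<open>As the constant does not see \<open>d\<close>, the step may be steepened to a jump.
  Differences of jumps are indicators of intervals in \<xi>_i whose endpoints may depend on the
  band.\<close>

lemma paraproduct_step:
  assumes ij: "i \<noteq> j" and \<psi>: "annular r \<psi>" and \<phi>: "annular r' \<phi>"
  obtains C where "0 \<le> C" "\<And>m c a b I. mb c m ==> finite I ==>
    mb (C * c) (%\<xi>. \<Sum>k\<in>I. of_real (\<psi> (dyadic k * \<xi> $ i) * of_bool (b k < \<xi> $ i) * \<phi> (dyadic k * \<xi> $ j)) * m (\<xi> + a k *\<^sub>R unit_vec j))"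
proof -
  obtain C where C: "0 \<le> C" "\<And>m c a b d I. mb c m ==> finite I ==> 0 < d ==>
    mb (C * c) (%\<xi>. \<Sum>k\<in>I. of_real (\<psi> (dyadic k * \<xi> $ i) * smooth_step (d * (\<xi> $ i - b k)) * \<phi> (dyadic k * \<xi> $ j)) * m (\<xi> + a k *\<^sub>R unit_vec j))"
    using paraproduct_smooth[OF assms] by blast
  note [measurable] = annular_measurable[OF \<psi>] annular_measurable[OF \<phi>]
  obtain B1 where B1: "\<And>u. \<bar>\<psi> u\<bar> \<le> B1" using annular_bounded[OF \<psi>] by blast
  obtain B2 where B2: "\<And>u. \<bar>\<phi> u\<bar> \<le> B2" using annular_bounded[OF \<phi>] by blast
  show ?thesis
  proof (rule that[of C])
    show "0 \<le> C" by (rule C(1))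
    fix m :: "real^'a => complex" and c :: real and a b :: "int => real" and I :: "int set"
    assume m: "mb c m" and I: "finite I"
    note mD = mult_boundD[OF m]
    note [measurable] = mD(2)
    obtain B where B: "\<And>\<xi>. norm (m \<xi>) \<le> B" using mD(3) unfolding bounded_fn_def by blast
    have bd: "norm (\<Sum>k\<in>I. of_real (\<psi> (dyadic k * \<xi> $ i) * s k * \<phi> (dyadic k * \<xi> $ j)) * m (\<xi> + a k *\<^sub>R unit_vec j)) \<le> (\<Sum>k\<in>I. B1 * 1 * B2 * B)"
      if s: "\<And>k. \<bar>s k\<bar> \<le> 1" for s and \<xi> :: "real^'a"
    proof (rule order_trans[OF norm_sum sum_mono])
      fix k
      have "\<bar>\<psi> (dyadic k * \<xi> $ i) * s k * \<phi> (dyadic k * \<xi> $ j)\<bar> \<le> B1 * 1 * B2"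
        unfolding abs_mult by (intro mult_mono B1 B2 s mult_nonneg_nonneg order_trans[OF abs_ge_zero B1]) auto
      from mult_mono[OF this B[of "\<xi> + a k *\<^sub>R unit_vec j"]] order_trans[OF abs_ge_zero this]
      show "norm (of_real (\<psi> (dyadic k * \<xi> $ i) * s k * \<phi> (dyadic k * \<xi> $ j)) * m (\<xi> + a k *\<^sub>R unit_vec j)) \<le> B1 * 1 * B2 * B"
        unfolding norm_mult norm_of_real by simp
    qed
    let ?M = "%N \<xi>. \<Sum>k\<in>I. of_real (\<psi> (dyadic k * \<xi> $ i) * smooth_step (real (Suc N) * (\<xi> $ i - b k)) * \<phi> (dyadic k * \<xi> $ j)) * m (\<xi> + a k *\<^sub>R unit_vec j)"
    show "mb (C * c) (%\<xi>. \<Sum>k\<in>I. of_real (\<psi> (dyadic k * \<xi> $ i) * of_bool (b k < \<xi> $ i) * \<phi> (dyadic k * \<xi> $ j)) * m (\<xi> + a k *\<^sub>R unit_vec j))"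
    proof (rule mult_bound_limit[where m = ?M and B = "\<Sum>k\<in>I. B1 * 1 * B2 * B"])
      show "mb (C * c) (?M N)" for N by (rule C(2)[OF m I]) simp
      show "norm (?M N \<xi>) \<le> (\<Sum>k\<in>I. B1 * 1 * B2 * B)" for N \<xi> by (rule bd) (rule smooth_step_abs)
      show "bounded_fn (%\<xi>. \<Sum>k\<in>I. of_real (\<psi> (dyadic k * \<xi> $ i) * of_bool (b k < \<xi> $ i) * \<phi> (dyadic k * \<xi> $ j)) * m (\<xi> + a k *\<^sub>R unit_vec j))"
        unfolding bounded_fn_def by (rule exI, rule allI, rule bd) simp
      show "(%\<xi>. \<Sum>k\<in>I. of_real (\<psi> (dyadic k * \<xi> $ i) * of_bool (b k < \<xi> $ i) * \<phi> (dyadic k * \<xi> $ j)) * m (\<xi> + a k *\<^sub>R unit_vec j)) \<in> borel_measurable borel"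
        by measurable
      fix \<xi> :: "real^'a"
      have st: "(%N. smooth_step (real (Suc N) * t)) \<longlonglongrightarrow> of_bool (0 < t)" for t
      proof (cases "0 < t")
        case True
        obtain N0 :: nat where N0: "1 / t \<le> real N0" using real_arch_simple by blast
        have "smooth_step (real (Suc N) * t) = 1" if "N \<ge> N0" for N
        proof (rule smooth_step_ge_1)
          have "1 / t \<le> real (Suc N)" using N0 that by simp
          then show "1 \<le> real (Suc N) * t" using True by (simp add: divide_le_eq)
        qed
        then have "\<forall>\<^sub>F N in sequentially. smooth_step (real (Suc N) * t) = of_bool (0 < t)" unfolding eventually_sequentially using True by auto
        then show ?thesis by (rule tendsto_eventually)
      next
        case False
        then have "smooth_step (real (Suc N) * t) = 0" for N by (intro smooth_step_le_0) (simp add: mult_le_0_iff)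
        then show ?thesis using False by simp
      qed
      show "(%N. ?M N \<xi>) \<longlonglongrightarrow> (\<Sum>k\<in>I. of_real (\<psi> (dyadic k * \<xi> $ i) * of_bool (b k < \<xi> $ i) * \<phi> (dyadic k * \<xi> $ j)) * m (\<xi> + a k *\<^sub>R unit_vec j))"
        using st[of "\<xi> $ i - b _"] unfolding diff_gt_0_iff_gt by (intro tendsto_sum tendsto_mult tendsto_const tendsto_of_real) 
    qed
  qed
qed

end

subsection \<open>Averages near a diagonal\<close>

lemma bounded_set_integrable:
  fixes f :: "real => complex"
  assumes f: "f \<in> borel_measurable borel" and B: "\<And>a. a \<in> {u..v} ==> norm (f a) \<le> B"
  shows "set_integrable lborel {u..v} f"
  unfolding set_integrable_def
proof (rule Bochner_Integration.integrable_bound)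
  show "integrable lborel (%a. B * indicator {u..v} a)" by (intro integrable_mult_right) (simp add: emeasure_lborel_Icc_eq)
  show "(%a. indicat_real {u..v} a *\<^sub>R f a) \<in> borel_measurable lborel" using f by measurable
  show "AE a in lborel. norm (indicat_real {u..v} a *\<^sub>R f a) \<le> norm (B * indicat_real {u..v} a)"
    using B by (intro AE_I2) (auto simp: indicator_def intro: order_trans[OF _ abs_ge_self])
qed

text \<open>The substitution a = \<alpha> t. For given a, the condition that a/t lies between
  \<alpha>0 and \<alpha>1 says that t lies between a/\<alpha>1 and a/\<alpha>0, in an order
  depending on the sign of a; hence the minimum and maximum. The averaged slope is thereby expressed
  through jumps in t, which \<open>paraproduct_step\<close> can handle.\<close>

lemma dilated_average:
  fixes h :: "real => complex"
  assumes h [measurable]: "h \<in> borel_measurable borel" and t: "t \<noteq> 0" and al: "0 < \<alpha>0" "\<alpha>0 \<le> \<alpha>1" and \<rho>: "\<bar>t\<bar> * \<alpha>1 \<le> \<rho>"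
  shows "(LINT a:{-\<rho>..\<rho>}|lborel. of_real (a ^ e * (of_bool (min (a / \<alpha>1) (a / \<alpha>0) < t) - of_bool (max (a / \<alpha>1) (a / \<alpha>0) < t))) * h a)
    = of_real (\<bar>t\<bar> * t ^ e) * (LINT \<alpha>:{\<alpha>0..\<alpha>1}|lborel. of_real (\<alpha> ^ e) * h (\<alpha> * t))"
proof -
  define G where "G a = indicat_real {\<alpha>0..\<alpha>1} (a / t) *\<^sub>R (of_real (a ^ e) * h a)" for a
  have [measurable]: "G \<in> borel_measurable borel" unfolding G_def by measurable
  have al1: "0 < \<alpha>1" using al by simp
  have "(LINT a:{-\<rho>..\<rho>}|lborel. of_real (a ^ e * (of_bool (min (a / \<alpha>1) (a / \<alpha>0) < t) - of_bool (max (a / \<alpha>1) (a / \<alpha>0) < t))) * h a)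
    = (LINT a|lborel. G a)"
    unfolding set_lebesgue_integral_def
  proof (rule integral_cong_AE)
    show "AE a in lborel. indicat_real {-\<rho>..\<rho>} a *\<^sub>R (of_real (a ^ e * (of_bool (min (a / \<alpha>1) (a / \<alpha>0) < t) - of_bool (max (a / \<alpha>1) (a / \<alpha>0) < t))) * h a) = G a"
      using AE_lborel_singleton[of "0::real"] AE_lborel_singleton[of "t * \<alpha>0"] AE_lborel_singleton[of "t * \<alpha>1"]
    proof eventually_elim
      case (elim a)
      have ne: "a / t \<noteq> \<alpha>0" "a / t \<noteq> \<alpha>1" using elim t by (auto simp: field_simps)
      have out: "indicat_real {\<alpha>0..\<alpha>1} (a / t) = 0" if "a \<notin> {-\<rho>..\<rho>}"
      proof -
        have "\<bar>t\<bar> * \<alpha>1 < \<bar>a\<bar>" using that \<rho> by auto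
        then have "\<alpha>1 < \<bar>a / t\<bar>" using t by (simp add: abs_divide less_divide_eq mult.commute)
        then show ?thesis using al by (auto simp: indicator_def)
      qed
      have ind: "of_bool (min (a / \<alpha>1) (a / \<alpha>0) < t) - of_bool (max (a / \<alpha>1) (a / \<alpha>0) < t) = indicat_real {\<alpha>0..\<alpha>1} (a / t)"
      proof (cases "0 < a")
        case True
        have mm: "a / \<alpha>1 \<le> a / \<alpha>0" using True al by (simp add: frac_le)
        show ?thesis
        proof (cases "0 < t")
          case t0: True
          have "a / \<alpha>1 < t \<longleftrightarrow> a / t < \<alpha>1" "a / \<alpha>0 < t \<longleftrightarrow> a / t < \<alpha>0" using t0 al al1 by (auto simp: field_simps)
          then show ?thesis using mm ne al by (auto simp: indicator_def min_absorb1 max_absorb2)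
        next
          case False
          then have "t < 0" using t by simp
          moreover have "0 < a / \<alpha>1" "0 < a / \<alpha>0" "a / t < 0" using True al al1 \<open>t < 0\<close> by (auto simp: divide_pos_neg)
          ultimately show ?thesis using mm al by (auto simp: indicator_def min_absorb1 max_absorb2)
        qed
      next
        case False
        then have a0: "a < 0" using elim by simp
        have mm: "a / \<alpha>0 \<le> a / \<alpha>1" using a0 al al1 by (simp add: divide_le_eq le_divide_eq field_simps mult_left_mono_neg)
        show ?thesis
        proof (cases "t < 0")
          case t0: True
          have "a / \<alpha>0 < t \<longleftrightarrow> \<alpha>0 < a / t" "a / \<alpha>1 < t \<longleftrightarrow> \<alpha>1 < a / t" using t0 al al1 by (auto simp: field_simps)
          then show ?thesis using mm ne al by (auto simp: indicator_def min_absorb2 max_absorb1)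
        next
          case False
          then have "0 < t" using t by simp
          moreover have "a / \<alpha>1 < 0" "a / \<alpha>0 < 0" "a / t < 0" using a0 al al1 \<open>0 < t\<close> by (auto simp: divide_neg_pos)
          ultimately show ?thesis using mm al by (auto simp: indicator_def min_absorb2 max_absorb1)
        qed
      qed
      show ?case unfolding G_def ind using out by (cases "a \<in> {-\<rho>..\<rho>}") (auto simp: scaleR_conv_of_real mult_ac)
    qed
  qed measurable
  also have "\<dots> = \<bar>t\<bar> *\<^sub>R (LINT \<alpha>|lborel. G (0 + t * \<alpha>))" by (rule lborel_integral_real_affine[OF t])
  also have "(%\<alpha>. G (0 + t * \<alpha>)) = (%\<alpha>. of_real (t ^ e) * (indicat_real {\<alpha>0..\<alpha>1} \<alpha> *\<^sub>R (of_real (\<alpha> ^ e) * h (\<alpha> * t))))"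
    unfolding G_def using t by (intro ext) (simp add: power_mult_distrib scaleR_conv_of_real mult_ac)
  also have "\<bar>t\<bar> *\<^sub>R (LINT \<alpha>|lborel. of_real (t ^ e) * (indicat_real {\<alpha>0..\<alpha>1} \<alpha> *\<^sub>R (of_real (\<alpha> ^ e) * h (\<alpha> * t))))
    = of_real (\<bar>t\<bar> * t ^ e) * (LINT \<alpha>|lborel. indicat_real {\<alpha>0..\<alpha>1} \<alpha> *\<^sub>R (of_real (\<alpha> ^ e) * h (\<alpha> * t)))"
    unfolding integral_mult_right_zero scaleR_conv_of_real[of "\<bar>t\<bar>"] of_real_mult mult.assoc ..
  finally show ?thesis unfolding set_lebesgue_integral_def .
qed

text \<open>A smooth cutoff to the region where u and v are comparable. The profile
  \<open>\<psi>\<close> alone limits the index, so \<open>\<phi>\<close> may also be a constant, as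
  in \<open>cutoff_partition\<close>.\<close>

definition diag_sum :: "real => (real => real) => (real => real) => real => real => real" where
  "diag_sum r \<psi> \<phi> u v = (\<Sum>k\<in>window (log 2 r) u. \<psi> (dyadic k * u) * \<phi> (dyadic k * v))"

lemma diag_sum_eq:
  assumes \<psi>: "annular r \<psi>" and K: "finite K" "\<And>k. \<psi> (dyadic k * u) \<noteq> 0 ==> k \<in> K"
  shows "diag_sum r \<psi> \<phi> u v = (\<Sum>k\<in>K. \<psi> (dyadic k * u) * \<phi> (dyadic k * v))"
proof -
  have "diag_sum r \<psi> \<phi> u v = (\<Sum>k\<in>window (log 2 r) u \<inter> K. \<psi> (dyadic k * u) * \<phi> (dyadic k * v))"
    unfolding diag_sum_def using K by (intro sum.mono_neutral_right) auto
  also have "\<dots> = (\<Sum>k\<in>K. \<psi> (dyadic k * u) * \<phi> (dyadic k * v))"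
    using K annular_window[OF \<psi>, of _ u] by (intro sum.mono_neutral_left) (auto simp: mem_window)
  finally show ?thesis .
qed

lemma diag_sum_tendsto:
  assumes \<psi>: "annular r \<psi>"
  shows "(%L. \<Sum>k\<in>{- int L..int L}. \<psi> (dyadic k * u) * \<phi> (dyadic k * v)) \<longlonglongrightarrow> diag_sum r \<psi> \<phi> u v"
proof (rule tendsto_eventually)
  obtain L0 :: nat where L0: "\<bar>log 2 \<bar>u\<bar>\<bar> + log 2 r \<le> real L0" using real_arch_simple by blast
  have "(\<Sum>k\<in>{- int L..int L}. \<psi> (dyadic k * u) * \<phi> (dyadic k * v)) = diag_sum r \<psi> \<phi> u v" if L: "L0 \<le> L" for L
  proof (rule diag_sum_eq[OF \<psi>, symmetric])
    fix k assume "\<psi> (dyadic k * u) \<noteq> 0"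
    from annular_window[OF \<psi> this] have "\<bar>real_of_int k\<bar> \<le> real L" using L0 L by linarith
    then show "k \<in> {- int L..int L}" by auto
  qed simp
  then show "\<forall>\<^sub>F L in sequentially. (\<Sum>k\<in>{- int L..int L}. \<psi> (dyadic k * u) * \<phi> (dyadic k * v)) = diag_sum r \<psi> \<phi> u v"
    unfolding eventually_sequentially by (intro exI[of _ L0] allI impI)
qed

lemma diag_sum_bounded:
  assumes \<psi>: "annular r \<psi>" and \<phi>: "annular r' \<phi>"
  obtains D where "0 \<le> D" "\<And>I u v. finite I ==> \<bar>\<Sum>k\<in>I. \<psi> (dyadic k * u) * \<phi> (dyadic k * v)\<bar> \<le> D"
proof -
  obtain B1 where B1: "\<And>u. \<bar>\<psi> u\<bar> \<le> B1" using annular_bounded[OF \<psi>] by blast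
  obtain B2 where B2: "\<And>u. \<bar>\<phi> u\<bar> \<le> B2" using annular_bounded[OF \<phi>] by blast
  have B: "0 \<le> B1" "0 \<le> B2" using order_trans[OF abs_ge_zero B1] order_trans[OF abs_ge_zero B2] by auto
  have R: "0 \<le> log 2 r" using annularD(1)[OF \<psi>] by simp
  show ?thesis
  proof (rule that[of "(2 * log 2 r + 1) * (B1 * B2)"])
    show "0 \<le> (2 * log 2 r + 1) * (B1 * B2)" using B R by simp
    fix I :: "int set" and u v :: real assume I: "finite I"
    have "(\<Sum>k\<in>I. \<psi> (dyadic k * u) * \<phi> (dyadic k * v)) = (\<Sum>k\<in>I \<inter> window (log 2 r) u. \<psi> (dyadic k * u) * \<phi> (dyadic k * v))"
      using I annular_window[OF \<psi>, of _ u] by (intro sum.mono_neutral_right) (auto simp: mem_window)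
    also have "\<bar>\<dots>\<bar> \<le> (\<Sum>k\<in>I \<inter> window (log 2 r) u. B1 * B2)"
      by (rule order_trans[OF sum_abs sum_mono]) (use B in \<open>auto simp: abs_mult intro!: mult_mono B1 B2\<close>)
    also have "\<dots> \<le> (\<Sum>k\<in>window (log 2 r) u. B1 * B2)" using B by (intro sum_mono2) auto
    also have "\<dots> \<le> (2 * log 2 r + 1) * (B1 * B2)" using card_window[OF R, of u] B by (simp add: mult_right_mono)
    finally show "\<bar>\<Sum>k\<in>I. \<psi> (dyadic k * u) * \<phi> (dyadic k * v)\<bar> \<le> (2 * log 2 r + 1) * (B1 * B2)" .
  qed
qed

lemma diag_sum_measurable:
  assumes \<psi>: "annular r \<psi>" and \<phi>: "annular r' \<phi>"
  shows "(%\<xi>::real^'n::finite. diag_sum r \<psi> \<phi> (\<xi> $ i) (\<xi> $ j)) \<in> borel_measurable borel"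
proof (rule borel_measurable_LIMSEQ_real)
  note [measurable] = annular_measurable[OF \<psi>] annular_measurable[OF \<phi>]
  show "(%\<xi>::real^'n. \<Sum>k\<in>{- int L..int L}. \<psi> (dyadic k * \<xi> $ i) * \<phi> (dyadic k * \<xi> $ j)) \<in> borel_measurable borel" for L
    by measurable
qed (rule diag_sum_tendsto[OF \<psi>])

lemma smooth1_sgn: "smooth1 (- {0}) sgn"
proof (rule smooth1_step[where g' = "%_. 0"])
  fix u :: real assume "u \<in> - {0}"
  then have u: "u \<noteq> 0" by simp
  show "(sgn has_real_derivative 0) (at u)"
  proof (cases "0 < u")
    case True
    show ?thesis by (rule has_field_derivative_transform_within_open[of "%_. 1" _ _ "{0<..}"]) (use True in auto)
  next
    case False
    show ?thesis by (rule has_field_derivative_transform_within_open[of "%_. -1" _ _ "{..<0}"]) (use False u in auto)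
  qed
qed (rule smooth1_const)

text \<open>The factor |t| t^e produced by \<open>dilated_average\<close> is divided out in advance,
  which is harmless on an annulus. The two values of \<open>e\<close> correspond to the weights 1
  and \<alpha>.\<close>

lemma annular_divide:
  assumes "annular r \<psi>" "e \<le> 1"
  shows "annular r (%t. \<psi> t * inverse (\<bar>t\<bar> * t ^ e))"
proof -
  have "smooth1 (- {0}) (%t. sgn t * inverse t * (if e = 0 then 1 else inverse t))"
    by (cases "e = 0") (simp_all add: smooth1_mult smooth1_sgn smooth1_inverse)
  moreover have "sgn t * inverse t * (if e = 0 then 1 else inverse t) = inverse (\<bar>t\<bar> * t ^ e)" for t :: real
  proof -
    have "sgn t * inverse t = inverse \<bar>t\<bar>" by (cases t "0::real" rule: linorder_cases) auto
    then show ?thesis using assms(2) by (cases "e = 0") (auto simp: le_Suc_eq)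
  qed
  ultimately show ?thesis using annular_mult[OF assms(1)] by simp
qed

context symbol_bounds
begin

lemma mb_diag_sum_limit:
  assumes \<psi>: "annular r \<psi>" and \<phi>: "annular r' \<phi>" and N: "N \<in> borel_measurable borel" "bounded_fn N"
    and L: "\<And>L. mb c (%\<xi>. of_real (\<Sum>k\<in>{- int L..int L}. \<psi> (dyadic k * \<xi> $ i) * \<phi> (dyadic k * \<xi> $ j)) * N \<xi>)"
  shows "mb c (%\<xi>. of_real (diag_sum r \<psi> \<phi> (\<xi> $ i) (\<xi> $ j)) * N \<xi>)"
proof -
  note [measurable] = N(1) diag_sum_measurable[OF \<psi> \<phi>]
  obtain B where B: "\<And>\<xi>. norm (N \<xi>) \<le> B" using N(2) unfolding bounded_fn_def by blast
  obtain D where D: "0 \<le> D" "\<And>I u v. finite I ==> \<bar>\<Sum>k\<in>I. \<psi> (dyadic k * u) * \<phi> (dyadic k * v)\<bar> \<le> D"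
    using diag_sum_bounded[OF \<psi> \<phi>] by blast
  have bd: "norm (of_real s * N \<xi>) \<le> D * B" if "\<bar>s\<bar> \<le> D" for s \<xi>
    unfolding norm_mult norm_of_real by (rule mult_mono[OF that B D(1)]) simp
  show ?thesis
  proof (rule mult_bound_limit[OF L, where B = "D * B"])
    show "(%\<xi>. of_real (diag_sum r \<psi> \<phi> (\<xi> $ i) (\<xi> $ j)) * N \<xi>) \<in> borel_measurable borel" by measurable
    show "norm (of_real (\<Sum>k\<in>{- int L..int L}. \<psi> (dyadic k * \<xi> $ i) * \<phi> (dyadic k * \<xi> $ j)) * N \<xi>) \<le> D * B" for L \<xi>
      by (rule bd, rule D(2)) simp
    show "bounded_fn (%\<xi>. of_real (diag_sum r \<psi> \<phi> (\<xi> $ i) (\<xi> $ j)) * N \<xi>)"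
      unfolding bounded_fn_def diag_sum_def by (rule exI[of _ "D * B"], rule allI, rule bd, rule D(2)) simp
    show "(%L. of_real (\<Sum>k\<in>{- int L..int L}. \<psi> (dyadic k * \<xi> $ i) * \<phi> (dyadic k * \<xi> $ j)) * N \<xi>) \<longlonglongrightarrow> of_real (diag_sum r \<psi> \<phi> (\<xi> $ i) (\<xi> $ j)) * N \<xi>" for \<xi>
      by (intro tendsto_mult tendsto_const tendsto_of_real diag_sum_tendsto[OF \<psi>])
  qed
qed

text \<open>No translation, and a jump placed at -N: as N grows the jump disappears and the plain
  product with the cutoff remains.\<close>

lemma paraproduct_mult:
  assumes ij: "i \<noteq> j" and \<psi>: "annular r \<psi>" and \<phi>: "annular r' \<phi>" and m: "mb c m"
  obtains c' where "mb c' (%\<xi>. of_real (diag_sum r \<psi> \<phi> (\<xi> $ i) (\<xi> $ j)) * m \<xi>)"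
proof -
  obtain C where C: "0 \<le> C" "\<And>m c a b I. mb c m ==> finite I ==>
    mb (C * c) (%\<xi>. \<Sum>k\<in>I. of_real (\<psi> (dyadic k * \<xi> $ i) * of_bool (b k < \<xi> $ i) * \<phi> (dyadic k * \<xi> $ j)) * m (\<xi> + a k *\<^sub>R unit_vec j))"
    using paraproduct_step[OF ij \<psi> \<phi>] by blast
  note mD = mult_boundD[OF m]
  note [measurable] = mD(2) annular_measurable[OF \<psi>] annular_measurable[OF \<phi>]
  obtain B where B: "\<And>\<xi>. norm (m \<xi>) \<le> B" using mD(3) unfolding bounded_fn_def by blast
  obtain D where D: "0 \<le> D" "\<And>I u v. finite I ==> \<bar>\<Sum>k\<in>I. \<psi> (dyadic k * u) * \<phi> (dyadic k * v)\<bar> \<le> D"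
    using diag_sum_bounded[OF \<psi> \<phi>] by blast
  have bd: "norm (of_real s * m \<xi>) \<le> D * B" if "\<bar>s\<bar> \<le> D" for s \<xi>
    unfolding norm_mult norm_of_real by (rule mult_mono[OF that B D(1)]) simp
  have "mb (C * c) (%\<xi>. of_real (\<Sum>k\<in>{- int L..int L}. \<psi> (dyadic k * \<xi> $ i) * \<phi> (dyadic k * \<xi> $ j)) * m \<xi>)" for L
  proof (rule mult_bound_limit[where m = "%N \<xi>. of_bool (- real N < \<xi> $ i) * (of_real (\<Sum>k\<in>{- int L..int L}. \<psi> (dyadic k * \<xi> $ i) * \<phi> (dyadic k * \<xi> $ j)) * m \<xi>)" and B = "D * B"])
    let ?R = "%\<xi>. of_real (\<Sum>k\<in>{- int L..int L}. \<psi> (dyadic k * \<xi> $ i) * \<phi> (dyadic k * \<xi> $ j)) * m \<xi>"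
    have R: "norm (?R \<xi>) \<le> D * B" for \<xi> by (rule bd, rule D(2)) simp
    show "mb (C * c) (%\<xi>. of_bool (- real N < \<xi> $ i) * ?R \<xi>)" for N
    proof -
      have "(%\<xi>. \<Sum>k\<in>{- int L..int L}. of_real (\<psi> (dyadic k * \<xi> $ i) * of_bool (- real N < \<xi> $ i) * \<phi> (dyadic k * \<xi> $ j)) * m (\<xi> + 0 *\<^sub>R unit_vec j)) = (%\<xi>. of_bool (- real N < \<xi> $ i) * ?R \<xi>)"
        by (rule ext) (simp add: sum_distrib_left sum_distrib_right mult_ac)
      then show ?thesis using C(2)[OF m, of "{- int L..int L}" "%_. - real N" "%_. 0"] by simp
    qed
    show "norm (of_bool (- real N < \<xi> $ i) * ?R \<xi>) \<le> D * B" for N \<xi>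
      using R[of \<xi>] order_trans[OF norm_ge_zero R[of \<xi>]] by (cases "- real N < \<xi> $ i") (simp_all only: of_bool_eq mult_1 mult_zero_left norm_zero simp_thms)
    show "bounded_fn ?R" unfolding bounded_fn_def by (rule exI[of _ "D * B"], rule allI, rule R)
    show "?R \<in> borel_measurable borel" by measurable
    fix \<xi> :: "real^'a"
    obtain N0 :: nat where N0: "- (\<xi> $ i) < real N0" using reals_Archimedean2 by blast
    have "of_bool (- real N < \<xi> $ i) * ?R \<xi> = ?R \<xi>" if "N0 \<le> N" for N
    proof -
      have "- real N < \<xi> $ i" using N0 that by linarith
      then show ?thesis by (simp only: of_bool_eq mult_1)
    qed
    then have "\<forall>\<^sub>F N in sequentially. of_bool (- real N < \<xi> $ i) * ?R \<xi> = ?R \<xi>"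
      unfolding eventually_sequentially by (intro exI[of _ N0] allI impI)
    then show "(%N. of_bool (- real N < \<xi> $ i) * ?R \<xi>) \<longlonglongrightarrow> ?R \<xi>" by (rule tendsto_eventually)
  qed
  from mb_diag_sum_limit[OF \<psi> \<phi> mD(2,3) this] show ?thesis by (rule that)
qed

text \<open>For a fixed number a, translation by a 2^k in band k is covered by
  \<open>paraproduct_step\<close>, and integrating in a preserves such bounds. At a given \<xi> the
  substitution a = \<alpha> 2^(-k) \<xi>_i turns the translation into \<alpha> \<xi>_i, which is the
  same in all bands; so the integral factors out and the sum over k becomes
  \<open>diag_sum\<close>.\<close>

lemma paraproduct_average:
  assumes ij: "i \<noteq> j" and \<psi>: "annular r \<psi>" and \<phi>: "annular r' \<phi>" and m: "mb c m"
    and al: "0 < \<alpha>0" "\<alpha>0 \<le> \<alpha>1" and e: "e \<le> 1"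
  obtains c' where "mb c' (%\<xi>. of_real (diag_sum r \<psi> \<phi> (\<xi> $ i) (\<xi> $ j)) * (LINT \<alpha>:{\<alpha>0..\<alpha>1}|lborel. of_real (\<alpha> ^ e) * m (\<xi> + (\<alpha> * \<xi> $ i) *\<^sub>R unit_vec j)))"
proof -
  define \<psi>e where "\<psi>e t = \<psi> t * inverse (\<bar>t\<bar> * t ^ e)" for t
  have \<psi>e: "annular r \<psi>e" unfolding \<psi>e_def by (rule annular_divide[OF \<psi> e])
  obtain C where C: "0 \<le> C" "\<And>m c a b I. mb c m ==> finite I ==>
    mb (C * c) (%\<xi>. \<Sum>k\<in>I. of_real (\<psi>e (dyadic k * \<xi> $ i) * of_bool (b k < \<xi> $ i) * \<phi> (dyadic k * \<xi> $ j)) * m (\<xi> + a k *\<^sub>R unit_vec j))"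
    using paraproduct_step[OF ij \<psi>e \<phi>] by blast
  note mD = mult_boundD[OF m]
  note [measurable] = mD(2) annular_measurable[OF \<psi>] annular_measurable[OF \<psi>e] annular_measurable[OF \<phi>]
  obtain B where B: "\<And>\<xi>. norm (m \<xi>) \<le> B" using mD(3) unfolding bounded_fn_def by blast
  have B0: "0 \<le> B" using order_trans[OF norm_ge_zero B] by blast
  obtain B1 where B1: "\<And>u. \<bar>\<psi>e u\<bar> \<le> B1" using annular_bounded[OF \<psi>e] by blast
  obtain B2 where B2: "\<And>u. \<bar>\<phi> u\<bar> \<le> B2" using annular_bounded[OF \<phi>] by blast
  have B12: "0 \<le> B1" "0 \<le> B2" using order_trans[OF abs_ge_zero B1] order_trans[OF abs_ge_zero B2] by auto
  \<comment> \<open>On the support of \<open>\<psi>\<close> the scaled frequency t has modulus at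
    most r, so a = \<alpha> t stays within [-\<rho>, \<rho>].\<close>
  define \<rho> where "\<rho> = r * \<alpha>1"
  have \<rho>0: "0 \<le> \<rho>" unfolding \<rho>_def using annularD(1)[OF \<psi>] al by simp
  define w where "w a = (if \<bar>a\<bar> \<le> \<rho> then a ^ e else 0)" for a
  have wle: "\<bar>w a\<bar> \<le> \<rho> ^ e" for a unfolding w_def using \<rho>0 by (auto simp: power_abs intro: power_mono)
  have [measurable]: "w \<in> borel_measurable borel" unfolding w_def by measurable
  define st where "st a t = of_bool (min (a / \<alpha>1) (a / \<alpha>0) < t) - (of_bool (max (a / \<alpha>1) (a / \<alpha>0) < t) :: real)" for a t
  have stle: "\<bar>st a t\<bar> \<le> 1" for a t unfolding st_def by (simp add: of_bool_def)
  define T where "T k a \<xi> = of_real (w a * st a (dyadic k * \<xi> $ i)) * (of_real (\<psi>e (dyadic k * \<xi> $ i) * \<phi> (dyadic k * \<xi> $ j)) * m (\<xi> + (a / dyadic k) *\<^sub>R unit_vec j))" for k a \<xi>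
  have Tm: "(%x. T k (fst x) (snd x)) \<in> borel_measurable (borel \<Otimes>\<^sub>M borel)" for k
    unfolding T_def st_def by measurable
  have Tm1: "(%a. T k a \<xi>) \<in> borel_measurable borel" for k \<xi> unfolding T_def st_def by measurable
  have TB: "norm (T k a \<xi>) \<le> \<rho> ^ e * (B1 * B2 * B)" for k a \<xi>
  proof -
    have 1: "\<bar>w a * st a (dyadic k * \<xi> $ i)\<bar> \<le> \<rho> ^ e" using mult_mono[OF wle[of a] stle[of a "dyadic k * \<xi> $ i"]] \<rho>0 by (simp add: abs_mult)
    have 2: "norm (of_real (\<psi>e (dyadic k * \<xi> $ i) * \<phi> (dyadic k * \<xi> $ j)) * m (\<xi> + (a / dyadic k) *\<^sub>R unit_vec j)) \<le> B1 * B2 * B"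
      unfolding norm_mult norm_of_real abs_mult by (intro mult_mono B1 B2 B mult_nonneg_nonneg B12) auto
    have "norm (T k a \<xi>) = \<bar>w a * st a (dyadic k * \<xi> $ i)\<bar> * norm (of_real (\<psi>e (dyadic k * \<xi> $ i) * \<phi> (dyadic k * \<xi> $ j)) * m (\<xi> + (a / dyadic k) *\<^sub>R unit_vec j))"
      unfolding T_def by (simp only: norm_mult norm_of_real)
    also have "\<dots> \<le> \<rho> ^ e * (B1 * B2 * B)" by (rule mult_mono[OF 1 2]) (use \<rho>0 in simp_all)
    finally show ?thesis .
  qed
  let ?N = "%\<xi>. LINT \<alpha>:{\<alpha>0..\<alpha>1}|lborel. of_real (\<alpha> ^ e) * m (\<xi> + (\<alpha> * \<xi> $ i) *\<^sub>R unit_vec j)"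
  have Nm: "?N \<in> borel_measurable borel"
    by (rule set_integral_measurable_param) (simp only: split_beta', measurable)
  have "norm (?N \<xi>) \<le> \<alpha>1 ^ e * B * (\<alpha>1 - \<alpha>0)" for \<xi>
  proof (rule set_integral_norm_le)
    show "(%a. complex_of_real (a ^ e) * m (\<xi> + (a * \<xi> $ i) *\<^sub>R unit_vec j)) \<in> borel_measurable borel" by measurable
    fix a assume "a \<in> {\<alpha>0..\<alpha>1}"
    then have "\<bar>a ^ e\<bar> \<le> \<alpha>1 ^ e" using al by (auto simp: power_abs intro!: power_mono)
    then show "norm (complex_of_real (a ^ e) * m (\<xi> + (a * \<xi> $ i) *\<^sub>R unit_vec j)) \<le> \<alpha>1 ^ e * B"
      unfolding norm_mult norm_of_real using al by (intro mult_mono B) auto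
  qed (use al in simp)
  then have Nb: "bounded_fn ?N" unfolding bounded_fn_def by (intro exI allI)
  define c' where "c' = \<rho> ^ e * (2 * (C * c)) * (\<rho> - - \<rho>)"
  have "mb c' (%\<xi>. of_real (\<Sum>k\<in>{- int L..int L}. \<psi> (dyadic k * \<xi> $ i) * \<phi> (dyadic k * \<xi> $ j)) * ?N \<xi>)" for L
  proof -
    let ?I = "{- int L..int L}"
    have Wmb: "mb (\<rho> ^ e * (2 * (C * c))) (%\<xi>. \<Sum>k\<in>?I. T k a \<xi>)" for a
    proof -
      have cut: "lo / dyadic k < x \<longleftrightarrow> lo < dyadic k * x" for lo k x using dyadic_pos[of k] by (simp add: divide_less_eq mult.commute)
      have "mb (norm (complex_of_real (w a)) * (C * c + C * c)) (%\<xi>. of_real (w a) *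
        ((\<Sum>k\<in>?I. of_real (\<psi>e (dyadic k * \<xi> $ i) * of_bool (min (a / \<alpha>1) (a / \<alpha>0) < dyadic k * \<xi> $ i) * \<phi> (dyadic k * \<xi> $ j)) * m (\<xi> + (a / dyadic k) *\<^sub>R unit_vec j))
        - (\<Sum>k\<in>?I. of_real (\<psi>e (dyadic k * \<xi> $ i) * of_bool (max (a / \<alpha>1) (a / \<alpha>0) < dyadic k * \<xi> $ i) * \<phi> (dyadic k * \<xi> $ j)) * m (\<xi> + (a / dyadic k) *\<^sub>R unit_vec j))))"
        using C(2)[OF m, of ?I "%k. min (a / \<alpha>1) (a / \<alpha>0) / dyadic k" "%k. a / dyadic k"]
          C(2)[OF m, of ?I "%k. max (a / \<alpha>1) (a / \<alpha>0) / dyadic k" "%k. a / dyadic k"]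
        unfolding cut by (intro mult_bound_cmult mult_bound_diff) auto
      moreover have "(%\<xi>. of_real (w a) *
        ((\<Sum>k\<in>?I. of_real (\<psi>e (dyadic k * \<xi> $ i) * of_bool (min (a / \<alpha>1) (a / \<alpha>0) < dyadic k * \<xi> $ i) * \<phi> (dyadic k * \<xi> $ j)) * m (\<xi> + (a / dyadic k) *\<^sub>R unit_vec j))
        - (\<Sum>k\<in>?I. of_real (\<psi>e (dyadic k * \<xi> $ i) * of_bool (max (a / \<alpha>1) (a / \<alpha>0) < dyadic k * \<xi> $ i) * \<phi> (dyadic k * \<xi> $ j)) * m (\<xi> + (a / dyadic k) *\<^sub>R unit_vec j))))
        = (%\<xi>. \<Sum>k\<in>?I. T k a \<xi>)"
        unfolding sum_subtractf[symmetric] sum_distrib_left T_def st_def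
        by (intro ext sum.cong refl) (simp add: algebra_simps)
      ultimately have "mb (norm (complex_of_real (w a)) * (C * c + C * c)) (%\<xi>. \<Sum>k\<in>?I. T k a \<xi>)" by simp
      then show ?thesis
      proof (rule mult_bound_mono)
        have "\<bar>w a\<bar> * (2 * (C * c)) \<le> \<rho> ^ e * (2 * (C * c))" using C(1) mD(1) by (intro mult_right_mono wle) auto
        then show "norm (complex_of_real (w a)) * (C * c + C * c) \<le> \<rho> ^ e * (2 * (C * c))" by simp
      qed
    qed
    have avg: "mb c' (%\<xi>. LINT a:{-\<rho>..\<rho>}|lborel. (\<Sum>k\<in>?I. T k a \<xi>))"
      unfolding c'_def
    proof (rule mult_bound_average)
      show "(%(a, \<xi>). \<Sum>k\<in>?I. T k a \<xi>) \<in> borel_measurable (borel \<Otimes>\<^sub>M borel)"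
        unfolding split_beta' by (intro borel_measurable_sum Tm)
      show "norm (\<Sum>k\<in>?I. T k a \<xi>) \<le> (\<Sum>k\<in>?I. \<rho> ^ e * (B1 * B2 * B))" for a \<xi>
        by (rule order_trans[OF norm_sum sum_mono]) (rule TB)
      show "0 \<le> \<rho> ^ e * (2 * (C * c))" using \<rho>0 C(1) mD(1) by simp
    qed (use Wmb \<rho>0 in auto)
    have eq: "(LINT a:{-\<rho>..\<rho>}|lborel. T k a \<xi>) = of_real (\<psi> (dyadic k * \<xi> $ i) * \<phi> (dyadic k * \<xi> $ j)) * ?N \<xi>" for k \<xi>
    proof (cases "\<psi> (dyadic k * \<xi> $ i) = 0")
      case True
      then have "\<psi>e (dyadic k * \<xi> $ i) = 0" by (simp add: \<psi>e_def)
      then show ?thesis using True by (simp add: T_def set_lebesgue_integral_def)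
    next
      case False
      let ?t = "dyadic k * \<xi> $ i"
      have t: "?t \<noteq> 0" using annularD(3)[OF \<psi>, of 0] annularD(1)[OF \<psi>] False by (intro notI) simp
      have tr: "\<bar>?t\<bar> \<le> r" using annularD(4)[OF \<psi>, of ?t] False by (meson not_le)
      have tr': "\<bar>?t\<bar> * \<alpha>1 \<le> \<rho>" unfolding \<rho>_def using tr al by (intro mult_right_mono) auto
      define h where "h a = m (\<xi> + (a / dyadic k) *\<^sub>R unit_vec j)" for a
      have [measurable]: "h \<in> borel_measurable borel" unfolding h_def by measurable
      have hs: "h (\<alpha> * ?t) = m (\<xi> + (\<alpha> * \<xi> $ i) *\<^sub>R unit_vec j)" for \<alpha> unfolding h_def using dyadic_pos[of k] by simp
      have "(LINT a:{-\<rho>..\<rho>}|lborel. T k a \<xi>) = (LINT a:{-\<rho>..\<rho>}|lborel. of_real (\<psi>e ?t * \<phi> (dyadic k * \<xi> $ j)) * (of_real (a ^ e * st a ?t) * h a))"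
        by (rule set_lebesgue_integral_cong) (auto simp: T_def h_def w_def abs_le_iff)
      also have "\<dots> = of_real (\<psi>e ?t * \<phi> (dyadic k * \<xi> $ j)) * (LINT a:{-\<rho>..\<rho>}|lborel. of_real (a ^ e * st a ?t) * h a)" by simp
      also have "(LINT a:{-\<rho>..\<rho>}|lborel. of_real (a ^ e * st a ?t) * h a) = of_real (\<bar>?t\<bar> * ?t ^ e) * ?N \<xi>"
        unfolding st_def hs[symmetric] by (rule dilated_average[OF _ t al tr']) measurable
      also have "of_real (\<psi>e ?t * \<phi> (dyadic k * \<xi> $ j)) * (of_real (\<bar>?t\<bar> * ?t ^ e) * ?N \<xi>) = of_real (\<psi>e ?t * \<phi> (dyadic k * \<xi> $ j) * (\<bar>?t\<bar> * ?t ^ e)) * ?N \<xi>"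
        by (simp only: of_real_mult mult.assoc)
      also have "\<psi>e ?t * \<phi> (dyadic k * \<xi> $ j) * (\<bar>?t\<bar> * ?t ^ e) = \<psi> ?t * \<phi> (dyadic k * \<xi> $ j)"
      proof -
        have Z: "x * inverse z * y * z = x * y" if "z \<noteq> 0" for x y z :: real using that by simp
        show ?thesis unfolding \<psi>e_def by (rule Z) (use t in auto)
      qed
      finally show ?thesis .
    qed
    have "(LINT a:{-\<rho>..\<rho>}|lborel. (\<Sum>k\<in>?I. T k a \<xi>)) = (\<Sum>k\<in>?I. LINT a:{-\<rho>..\<rho>}|lborel. T k a \<xi>)" for \<xi>
      unfolding set_lebesgue_integral_def scaleR_sum_right
      by (rule Bochner_Integration.integral_sum) (rule bounded_set_integrable[OF Tm1 TB, unfolded set_integrable_def])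
    then have "(%\<xi>. LINT a:{-\<rho>..\<rho>}|lborel. (\<Sum>k\<in>?I. T k a \<xi>)) = (%\<xi>. of_real (\<Sum>k\<in>?I. \<psi> (dyadic k * \<xi> $ i) * \<phi> (dyadic k * \<xi> $ j)) * ?N \<xi>)"
      unfolding eq of_real_sum sum_distrib_right by blast
    then show ?thesis using avg by simp
  qed
  from mb_diag_sum_limit[OF \<psi> \<phi> Nm Nb this] show ?thesis by (rule that)
qed

end

subsection \<open>Rearranging averages\<close>

lemma unit_vec_nth: "unit_vec j $ k = (if k = j then 1 else 0)"
  by (simp add: unit_vec_def axis_def)

text \<open>The substitution s = y + a x. The oriented interval is written as a difference of
  indicators of half-lines, so later uses need not distinguish the sign of \<open>x\<close>, and
  intervals can be added.\<close>

lemma signed_average: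
  fixes h :: "real => complex"
  assumes [measurable]: "h \<in> borel_measurable borel" and uv: "u \<le> v"
  shows "of_real x * (LINT a:{u..v}|lborel. h (y + a * x)) = (LINT s|lborel. of_real (of_bool (s < y + v * x) - of_bool (s < y + u * x)) * h s)"
proof (cases "x = 0")
  case False
  let ?G = "%s. of_real (of_bool (s < y + v * x) - of_bool (s < y + u * x)) * h s"
  have "(LINT s|lborel. ?G s) = \<bar>x\<bar> *\<^sub>R (LINT a|lborel. ?G (y + x * a))" by (rule lborel_integral_real_affine[OF False])
  also have "\<dots> = (LINT a|lborel. \<bar>x\<bar> *\<^sub>R ?G (y + x * a))" by simp
  also have "\<dots> = (LINT a|lborel. of_real x * (indicat_real {u..v} a *\<^sub>R h (y + a * x)))"
  proof (rule integral_cong_AE)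
    show "AE a in lborel. \<bar>x\<bar> *\<^sub>R ?G (y + x * a) = of_real x * (indicat_real {u..v} a *\<^sub>R h (y + a * x))"
      using AE_lborel_singleton[of u] AE_lborel_singleton[of v]
    proof eventually_elim
      case (elim a)
      have "\<bar>x\<bar> * (of_bool (y + x * a < y + v * x) - of_bool (y + x * a < y + u * x)) = x * indicat_real {u..v} a"
      proof (cases "0 < x")
        case True
        then have "y + x * a < y + v * x \<longleftrightarrow> a < v" "y + x * a < y + u * x \<longleftrightarrow> a < u" by (auto simp: mult.commute)
        then show ?thesis using True elim uv by (auto simp: indicator_def)
      next
        case n: False
        then have "x < 0" using False by simp
        then have "y + x * a < y + v * x \<longleftrightarrow> v < a" "y + x * a < y + u * x \<longleftrightarrow> u < a" by (auto simp: mult.commute)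
        then show ?thesis using \<open>x < 0\<close> elim uv by (auto simp: indicator_def)
      qed
      then have e: "complex_of_real (\<bar>x\<bar> * (of_bool (y + x * a < y + v * x) - of_bool (y + x * a < y + u * x))) * h (y + x * a) = of_real (x * indicat_real {u..v} a) * h (y + x * a)"
        by (simp only:)
      show ?case using e unfolding of_real_mult scaleR_conv_of_real mult.assoc by (simp only: mult.commute[of a x])
    qed
  qed measurable
  also have "\<dots> = of_real x * (LINT a|lborel. indicat_real {u..v} a *\<^sub>R h (y + a * x))" by (rule integral_mult_right_zero)
  finally show ?thesis unfolding set_lebesgue_integral_def by (rule sym)
qed (simp add: set_lebesgue_integral_def)

lemma step_difference_integrable:
  fixes h :: "real => complex"
  assumes [measurable]: "h \<in> borel_measurable borel" and B: "\<And>s. norm (h s) \<le> B"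
  shows "integrable lborel (%s. of_real (of_bool (s < u) - of_bool (s < v)) * h s)"
proof (rule Bochner_Integration.integrable_bound)
  show "integrable lborel (%s. B * indicat_real {min u v..max u v} s)" by (intro integrable_mult_right) (simp add: emeasure_lborel_Icc_eq)
  have B0: "0 \<le> B" using order_trans[OF norm_ge_zero B] by blast
  show "AE s in lborel. norm (of_real (of_bool (s < u) - of_bool (s < v)) * h s) \<le> norm (B * indicat_real {min u v..max u v} s)"
    using B B0 by (intro AE_I2) (auto simp: indicator_def norm_mult of_bool_def)
qed measurable

text \<open>Both sides are the increment of an antiderivative of \<open>h\<close> from y + x/2 to y
  + x. On the right each value of the antiderivative is taken from 0, which makes it an endpoint
  times an average over [0, 1] that depends on y and x only through this endpoint.\<close>

lemma average_interval_difference: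
  fixes h :: "real => complex"
  assumes h [measurable]: "h \<in> borel_measurable borel" and B: "\<And>s. norm (h s) \<le> B"
  shows "of_real x * (LINT a:{1/2..1}|lborel. h (y + a * x))
    = of_real (y + x) * (LINT a:{0..1}|lborel. h (a * (y + x))) - of_real (y + x / 2) * (LINT a:{0..1}|lborel. h (a * (y + x / 2)))"
proof -
  let ?D = "%u v s. of_real (of_bool (s < u) - of_bool (s < v)) * h s"
  have z: "of_real z * (LINT a:{0..1}|lborel. h (a * z)) = (LINT s|lborel. ?D z 0 s)" for z
    using signed_average[OF h, of 0 1 z 0] by simp
  have "of_real x * (LINT a:{1/2..1}|lborel. h (y + a * x)) = (LINT s|lborel. ?D (y + x) (y + x / 2) s)"
    using signed_average[OF h, of "1/2" 1 x y] by simp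
  also have "\<dots> = (LINT s|lborel. ?D (y + x) 0 s - ?D (y + x / 2) 0 s)" by (intro Bochner_Integration.integral_cong refl) (simp add: algebra_simps)
  also have "\<dots> = (LINT s|lborel. ?D (y + x) 0 s) - (LINT s|lborel. ?D (y + x / 2) 0 s)"
    by (intro Bochner_Integration.integral_diff step_difference_integrable[OF h B])
  finally show ?thesis unfolding z .
qed

lemma average_halving:
  fixes h :: "real => complex"
  assumes h [measurable]: "h \<in> borel_measurable borel" and B: "\<And>s. norm (h s) \<le> B"
  shows "(LINT a:{0..1}|lborel. h a) = (LINT a:{1/2..1}|lborel. h a) + (1 / 2) * (LINT a:{0..1}|lborel. h (a / 2))"
  using average_interval_difference[OF h B, of 1 0] by simp

lemma average_doubling:
  fixes h :: "real => complex"
  assumes h: "h \<in> borel_measurable borel"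
  shows "(LINT a:{1/2..1}|lborel. h (2 * a)) = (1 / 2) * (LINT a:{1..2}|lborel. h a)"
proof -
  have "of_real 2 * (LINT a:{1/2..1}|lborel. h (0 + a * 2)) = of_real 1 * (LINT a:{1..2}|lborel. h (0 + a * 1))"
    using signed_average[OF h, of "1/2" 1 2 0] signed_average[OF h, of 1 2 1 0] by simp
  then have "2 * (LINT a:{1/2..1}|lborel. h (a * 2)) = (LINT a:{1..2}|lborel. h a)" by simp
  then have "2 * (LINT a:{1/2..1}|lborel. h (2 * a)) = (LINT a:{1..2}|lborel. h a)" by (simp only: mult.commute[of _ "2::real"])
  moreover have "X = 1 / 2 * Y" if "2 * X = Y" for X Y :: complex using that by auto
  ultimately show ?thesis by blast
qed

text \<open>For a function that ignores coordinate \<open>j\<close>, an average over slopes with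
  coefficient \<xi>_j depends on \<xi>_j only through the size of the shift. This links dilations of
  \<xi>_j with changes of the slope interval.\<close>

definition ignores :: "'n::finite => (real^'n => complex) => bool" where
  "ignores j f \<longleftrightarrow> (\<forall>\<xi> c. f (\<xi> + c *\<^sub>R unit_vec j) = f \<xi>)"

lemma ignoresD: "ignores j f ==> f (\<xi> + c *\<^sub>R unit_vec j) = f \<xi>"
  by (simp add: ignores_def)

lemma ignores_average_along:
  assumes "ignores j f" "j \<noteq> i"
  shows "ignores j (average_along n i l f)"
  unfolding ignores_def
proof (intro allI)
  fix \<xi> c
  have "f (\<xi> + c *\<^sub>R unit_vec j + (a * (\<xi> + c *\<^sub>R unit_vec j) $ i) *\<^sub>R unit_vec n) = f (\<xi> + (a * \<xi> $ i) *\<^sub>R unit_vec n)" for a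
    using ignoresD[OF assms(1), of "\<xi> + (a * \<xi> $ i) *\<^sub>R unit_vec n" c] assms(2) by (simp add: unit_vec_nth add_ac)
  then show "average_along n i l f (\<xi> + c *\<^sub>R unit_vec j) = average_along n i l f \<xi>" unfolding average_along_def by (simp only:)
qed

lemma ignores_averages: "ignores j f ==> j \<notin> fst ` set r ==> ignores j (averages n r f)"
  by (induction r) (auto intro!: ignores_average_along)

text \<open>All shifts are along e_n while the coefficients are other coordinates, so the shifts do
  not interfere and Fubini applies. It serves to bring a chosen average to the outermost
  place.\<close>

lemma average_along_swap:
  fixes f :: "real^'n::finite => complex"
  assumes f [measurable]: "f \<in> borel_measurable borel" and B: "\<And>\<xi>. norm (f \<xi>) \<le> B" and n: "i \<noteq> n" "i' \<noteq> n" and l: "0 \<le> l" "l \<le> 1"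
  shows "average_along n i l (average_along n i' l' f) \<xi> = average_along n i' l' (average_along n i l f) \<xi>"
proof -
  let ?w = "%t. complex_of_real (indicat_real {l'..1} t)"
  let ?g = "%t \<xi>. f (\<xi> + (t * \<xi> $ i') *\<^sub>R unit_vec n)"
  have e: "average_along n i' l' h \<xi> = (LINT t|lborel. ?w t * h (\<xi> + (t * \<xi> $ i') *\<^sub>R unit_vec n))" for h \<xi>
    unfolding average_along_def set_lebesgue_integral_def by (simp add: scaleR_conv_of_real)
  have "averages n [(i, l)] (%\<xi>. LINT t|lborel. ?w t * ?g t \<xi>) \<xi> = (LINT t|lborel. ?w t * averages n [(i, l)] (?g t) \<xi>)"
  proof (rule averages_integral[where B = B])
    show "integrable lborel ?w" by (intro integrable_of_real) (simp add: emeasure_lborel_Icc_eq)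
    show "(%(t, \<xi>). ?g t \<xi>) \<in> borel_measurable (borel \<Otimes>\<^sub>M borel)" by (simp only: split_beta', measurable)
  qed (use B l in auto)
  moreover have "average_along n i l (?g t) \<xi> = average_along n i l f (\<xi> + (t * \<xi> $ i') *\<^sub>R unit_vec n)" for t
    unfolding average_along_def using n by (simp add: unit_vec_nth add_ac)
  ultimately show ?thesis unfolding e by simp
qed

lemma averages_move_front:
  fixes f :: "real^'n::finite => complex"
  assumes f: "f \<in> borel_measurable borel" and B: "\<And>\<xi>. norm (f \<xi>) \<le> B"
    and l: "\<And>x. x \<in> set r ==> fst x \<noteq> n \<and> 0 \<le> snd x \<and> snd x \<le> 1" and x: "x \<in> set r"
  shows "averages n r f = averages n (x # remove1 x r) f"
  using l x
proof (induction r)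
  case (Cons y r)
  obtain j l where y: "y = (j, l)" by force
  obtain i k where x': "x = (i, k)" by force
  show ?case
  proof (cases "x = y")
    case False
    then have "x \<in> set r" using Cons.prems by simp
    then have "averages n r f = average_along n i k (averages n (remove1 x r) f)" using Cons.IH Cons.prems(1) x' by simp
    then have "averages n (y # r) f = average_along n j l (average_along n i k (averages n (remove1 x r) f))" using y by simp
    also have "\<dots> = average_along n i k (average_along n j l (averages n (remove1 x r) f))"
    proof (rule ext, rule average_along_swap[where B = B])
      show "averages n (remove1 x r) f \<in> borel_measurable borel" by (rule averages_measurable[OF f])
      show "norm (averages n (remove1 x r) f \<xi>) \<le> B" for \<xi>
        by (rule averages_norm_le[OF f B]) (use Cons.prems(1) notin_set_remove1 in \<open>auto dest: set_remove1_subset[THEN subsetD]\<close>)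
      show "j \<noteq> n" "i \<noteq> n" "0 \<le> l" "l \<le> 1" using Cons.prems(1)[of y] Cons.prems(1)[of x] Cons.prems(2) x' y by auto
    qed
    finally show ?thesis using False x' y by simp
  qed simp
qed simp

text \<open>For slopes in [1/2, 1] the value a t is at least min(t/2, t), so the hypothesis gives
  the shifted n-th coordinate the sign \<sigma> for all admissible slopes. The power of 1/2 is the
  product of the interval lengths, as averages are not normalised.\<close>

lemma averages_dominated:
  fixes w :: "real^'n::finite => complex"
  assumes "distinct js" "n \<notin> set js" and \<sigma>: "\<sigma> = 1 \<or> \<sigma> = - 1"
    and "0 < \<sigma> * \<xi> $ n + (\<Sum>j\<in>set js. min (\<sigma> * \<xi> $ j / 2) (\<sigma> * \<xi> $ j))"
  shows "averages n (map (%j. (j, 1 / 2)) js) (%\<xi>. of_real (sgn (\<xi> $ n))) \<xi> = of_real ((1 / 2) ^ length js * \<sigma>)"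
  using assms(1,2,4)
proof (induction js arbitrary: \<xi>)
  case Nil
  then show ?case using \<sigma> by (auto simp: sgn_if)
next
  case (Cons j js)
  let ?f = "averages n (map (%j. (j, 1 / 2)) js) (%\<xi>. complex_of_real (sgn (\<xi> $ n)))"
  have "?f (\<xi> + (a * \<xi> $ j) *\<^sub>R unit_vec n) = of_real ((1 / 2) ^ length js * \<sigma>)" if a: "a \<in> {1/2..1}" for a
  proof (rule Cons.IH)
    have le: "min (t / 2) t \<le> a * t" for t
    proof (cases "0 \<le> t")
      case True then have "1 / 2 * t \<le> a * t" using a by (intro mult_right_mono) auto
      then show ?thesis by simp
    next
      case False then have "1 * t \<le> a * t" using a by (intro mult_right_mono_neg) auto
      then show ?thesis by simp
    qed
    have sm: "(\<xi> + (a * \<xi> $ j) *\<^sub>R unit_vec n) $ k = \<xi> $ k" if "k \<in> set js" for k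
      using that Cons.prems(2) by (auto simp: unit_vec_nth)
    have "(\<Sum>k\<in>set js. min (\<sigma> * (\<xi> + (a * \<xi> $ j) *\<^sub>R unit_vec n) $ k / 2) (\<sigma> * (\<xi> + (a * \<xi> $ j) *\<^sub>R unit_vec n) $ k))
      = (\<Sum>k\<in>set js. min (\<sigma> * \<xi> $ k / 2) (\<sigma> * \<xi> $ k))"
      by (intro sum.cong refl) (simp only: sm)
    moreover have "\<sigma> * (\<xi> + (a * \<xi> $ j) *\<^sub>R unit_vec n) $ n = \<sigma> * \<xi> $ n + a * (\<sigma> * \<xi> $ j)"
      by (simp add: unit_vec_nth algebra_simps)
    ultimately show "0 < \<sigma> * (\<xi> + (a * \<xi> $ j) *\<^sub>R unit_vec n) $ n + (\<Sum>k\<in>set js. min (\<sigma> * (\<xi> + (a * \<xi> $ j) *\<^sub>R unit_vec n) $ k / 2) (\<sigma> * (\<xi> + (a * \<xi> $ j) *\<^sub>R unit_vec n) $ k))"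
      using Cons.prems(1,3) le[of "\<sigma> * \<xi> $ j"] by simp
  qed (use Cons.prems in auto)
  then have "average_along n j (1 / 2) ?f \<xi> = (LINT a:{1/2..1::real}|lborel. complex_of_real ((1 / 2) ^ length js * \<sigma>))"
    unfolding average_along_def by (intro set_lebesgue_integral_cong) auto
  also have "\<dots> = of_real ((1 / 2) ^ Suc (length js) * \<sigma>)"
    unfolding set_lebesgue_integral_def by (simp add: scaleR_conv_of_real)
  finally show ?case by simp
qed

text \<open>The ratio u/v is absorbed into the two profiles, because the powers of the dyadic scale
  cancel in each band.\<close>

lemma diag_sum_weight:
  assumes "v \<noteq> 0"
  shows "diag_sum r (%t. \<psi> t * t) (%t. \<phi> t * inverse t) u v = u / v * diag_sum r \<psi> \<phi> u v"
  unfolding diag_sum_def sum_distrib_left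
proof (intro sum.cong refl)
  fix k
  have "dyadic k \<noteq> 0" using dyadic_pos[of k] by simp
  then show "\<psi> (dyadic k * u) * (dyadic k * u) * (\<phi> (dyadic k * v) * inverse (dyadic k * v)) = u / v * (\<psi> (dyadic k * u) * \<phi> (dyadic k * v))"
    using assms by (simp add: field_simps)
qed

context symbol_bounds
begin

text \<open>The slope interval is cut into the dyadic pieces from 2^(-k-1) to 2^(-k). As
  \<open>f\<close> ignores coordinate \<open>j\<close>, such a piece is 2^(-k) times the average
  over [1/2, 1] at the point with \<xi>_j scaled by 2^(-k). Dilations cost nothing, and the
  geometric series gives the factor 2.\<close>

lemma mb_average_zero:
  fixes f :: "real^'a => complex"
  assumes f [measurable]: "f \<in> borel_measurable borel" and B: "\<And>\<xi>. norm (f \<xi>) \<le> B" and j: "ignores j f" "j \<noteq> n"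
    and c: "mb c (average_along n j (1 / 2) f)"
  shows "mb (2 * c) (average_along n j 0 f)"
proof -
  let ?g = "average_along n j (1 / 2) f" and ?A = "average_along n j 0 f"
  let ?D = "%k::nat. dil (%l. if l = j then (1 / 2) ^ k else 1) :: real^'a => real^'a"
  have B0: "0 \<le> B" using order_trans[OF norm_ge_zero B] by blast
  have c0: "0 \<le> c" by (rule mult_boundD(1)[OF c])
  have gB: "norm (?g \<xi>) \<le> B" and AB: "norm (?A \<xi>) \<le> B" for \<xi> by (rule average_along_norm_le[OF f B]; simp)+
  have step: "?A \<xi> = ?g \<xi> + (1 / 2) * ?A (?D 1 \<xi>)" for \<xi>
  proof -
    have "f (?D 1 \<xi> + (a * ?D 1 \<xi> $ j) *\<^sub>R unit_vec n) = f (\<xi> + (a / 2 * \<xi> $ j) *\<^sub>R unit_vec n)" for a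
    proof -
      have "?D 1 \<xi> + (a * ?D 1 \<xi> $ j) *\<^sub>R unit_vec n = (\<xi> + (a / 2 * \<xi> $ j) *\<^sub>R unit_vec n) + ((1 / 2 - 1) * \<xi> $ j) *\<^sub>R unit_vec j"
        using j(2) by (simp add: vec_eq_iff dil_def unit_vec_nth)
      then show ?thesis by (simp only: ignoresD[OF j(1)])
    qed
    then have "?A (?D 1 \<xi>) = (LINT a:{0..1}|lborel. f (\<xi> + (a / 2 * \<xi> $ j) *\<^sub>R unit_vec n))" unfolding average_along_def by (simp only:)
    then show ?thesis
      unfolding average_along_def[of n j _ f \<xi>]
      using average_halving[of "%a. f (\<xi> + (a * \<xi> $ j) *\<^sub>R unit_vec n)" B, OF shift_measurable[OF f] B] by simp
  qed
  have DD: "?D 1 (?D k \<xi>) = ?D (Suc k) \<xi>" for k \<xi> by (simp add: vec_eq_iff dil_def)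
  have iter: "?A \<xi> = (\<Sum>k<K. (1 / 2) ^ k * ?g (?D k \<xi>)) + (1 / 2) ^ K * ?A (?D K \<xi>)" for K \<xi>
  proof (induction K)
    case 0
    have "?D 0 \<xi> = \<xi>" by (simp add: vec_eq_iff dil_def)
    then show ?case by simp
  next
    case (Suc K)
    then show ?case using step[of "?D K \<xi>"] unfolding DD by (simp add: algebra_simps)
  qed
  have geo: "(\<Sum>k<K. (1 / 2 :: real) ^ k) \<le> 2" for K by (simp add: sum_gp_strict)
  show ?thesis
  proof (rule mult_bound_limit[where m = "%K \<xi>. \<Sum>k<K. (1 / 2) ^ k * ?g (?D k \<xi>)" and B = "2 * B"])
    show "mb (2 * c) (%\<xi>. \<Sum>k<K. (1 / 2) ^ k * ?g (?D k \<xi>))" for K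
    proof (rule mult_bound_mono)
      show "mb (\<Sum>k<K. norm ((1 / 2 :: complex) ^ k) * c) (%\<xi>. \<Sum>k<K. (1 / 2) ^ k * ?g (?D k \<xi>))"
        by (intro mult_bound_sum mult_bound_cmult mb_dil[OF c]) auto
      show "(\<Sum>k<K. norm ((1 / 2 :: complex) ^ k) * c) \<le> 2 * c"
        using mult_right_mono[OF geo[of K] c0] by (simp add: sum_distrib_right norm_power norm_divide)
    qed
    show "norm (\<Sum>k<K. (1 / 2) ^ k * ?g (?D k \<xi>)) \<le> 2 * B" for K \<xi>
    proof -
      have "norm (\<Sum>k<K. (1 / 2) ^ k * ?g (?D k \<xi>)) \<le> (\<Sum>k<K. (1 / 2) ^ k * B)"
        by (rule order_trans[OF norm_sum sum_mono]) (simp add: norm_mult norm_power norm_divide mult_left_mono[OF gB] del: power_divide)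
      also have "\<dots> \<le> 2 * B" using mult_right_mono[OF geo[of K] B0] by (simp add: sum_distrib_right)
      finally show ?thesis .
    qed
    show "?A \<in> borel_measurable borel" using averages_measurable[OF f, of n "[(j, 0)]"] by simp
    show "bounded_fn ?A" unfolding bounded_fn_def by (rule exI[of _ B], rule allI, rule AB)
    fix \<xi> :: "real^'a"
    have "(%K. (1 / 2 :: complex) ^ K * ?A (?D K \<xi>)) \<longlonglongrightarrow> 0"
    proof (rule Lim_null_comparison)
      show "\<forall>\<^sub>F K in sequentially. norm ((1 / 2 :: complex) ^ K * ?A (?D K \<xi>)) \<le> (1 / 2) ^ K * B"
        by (intro always_eventually allI) (simp add: norm_mult norm_power norm_divide mult_left_mono[OF AB] del: power_divide)
      show "(%K. (1 / 2 :: real) ^ K * B) \<longlonglongrightarrow> 0" by (intro tendsto_mult_left_zero LIMSEQ_power_zero) simp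
    qed
    from tendsto_diff[OF tendsto_const[of "?A \<xi>"] this]
    have "(%K. ?A \<xi> - (1 / 2) ^ K * ?A (?D K \<xi>)) \<longlonglongrightarrow> ?A \<xi>" by simp
    moreover have "?A \<xi> - (1 / 2) ^ K * ?A (?D K \<xi>) = (\<Sum>k<K. (1 / 2) ^ k * ?g (?D k \<xi>))" for K
      unfolding diff_eq_eq by (rule iter)
    ultimately show "(%K. \<Sum>k<K. (1 / 2) ^ k * ?g (?D k \<xi>)) \<longlonglongrightarrow> ?A \<xi>" by (simp only:)
  qed
qed

text \<open>With h(s) = g(\<xi> + s e_n), the inner average over [1/2, 1] is a difference of
  weighted averages over [0, 1] with endpoints \<alpha> \<xi>_i + \<xi>_j and \<alpha> \<xi>_i +
  \<xi>_j/2. As \<open>g\<close> ignores \<open>j\<close>, the first one is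
  \<open>average_along n j 0 g\<close> at \<xi> + \<alpha> \<xi>_i e_j, and
  \<open>paraproduct_average\<close> applies. One average has disappeared, at the price of the lower
  limit 0 and of factors \<xi>_i/\<xi>_j.\<close>

lemma mb_diagonal_pair:
  fixes g :: "real^'a => complex"
  assumes ij: "i \<noteq> j" "i \<noteq> n" "j \<noteq> n" and g [measurable]: "g \<in> borel_measurable borel" and B: "\<And>\<xi>. norm (g \<xi>) \<le> B"
    and ig: "ignores j g" and f0: "mb c (average_along n j 0 g)"
    and \<psi>: "annular r \<psi>" and \<phi>: "annular r' \<phi>"
  obtains c' where "mb c' (%\<xi>. of_real (diag_sum r \<psi> \<phi> (\<xi> $ i) (\<xi> $ j)) * average_along n i (1 / 2) (average_along n j (1 / 2) g) \<xi>)"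
proof -
  \<comment> \<open>The modified profiles carry the ratio \<xi>_i/\<xi>_j, by
    \<open>diag_sum_weight\<close>.\<close>
  define \<psi>' where "\<psi>' t = \<psi> t * t" for t
  define \<phi>' where "\<phi>' t = \<phi> t * inverse t" for t
  have \<psi>': "annular r \<psi>'" unfolding \<psi>'_def by (rule annular_mult[OF \<psi> smooth1_id])
  have \<phi>': "annular r' \<phi>'" unfolding \<phi>'_def by (rule annular_mult[OF \<phi> smooth1_inverse])
  let ?f0 = "average_along n j 0 g"
  \<comment> \<open>Accounts for the second endpoint: shifting by 2 \<alpha> \<xi>_i and then
    halving the j-th coordinate gives \<alpha> \<xi>_i + \<xi>_j/2. Hence the slopes between 1 and 2
    for this function.\<close>
  let ?f1 = "%\<xi>. ?f0 (dil (%k. if k = j then 1 / 2 else 1) \<xi>)"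
  let ?N = "average_along n i (1 / 2) (average_along n j (1 / 2) g)"
  have f1: "mb c ?f1" by (rule mb_dil[OF f0]) simp
  define V where "V e m u v \<xi> = (LINT \<alpha>:{u..v}|lborel. of_real (\<alpha> ^ e) * m (\<xi> + (\<alpha> * \<xi> $ i) *\<^sub>R unit_vec j))" for e :: nat and m :: "real^'a => complex" and u v \<xi>
  define R where "R \<xi> = complex_of_real (diag_sum r \<psi> \<phi> (\<xi> $ i) (\<xi> $ j))" for \<xi> :: "real^'a"
  define R' where "R' \<xi> = complex_of_real (diag_sum r \<psi>' \<phi>' (\<xi> $ i) (\<xi> $ j))" for \<xi> :: "real^'a"
  obtain c1 where c1: "mb c1 (%\<xi>. R' \<xi> * V 1 ?f0 (1/2) 1 \<xi>)"
    unfolding R'_def V_def using paraproduct_average[OF ij(1) \<psi>' \<phi>' f0, of "1/2" 1 1] by auto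
  obtain c2 where c2: "mb c2 (%\<xi>. R \<xi> * V 0 ?f0 (1/2) 1 \<xi>)"
    unfolding R_def V_def using paraproduct_average[OF ij(1) \<psi> \<phi> f0, of "1/2" 1 0] by auto
  obtain c3 where c3: "mb c3 (%\<xi>. R' \<xi> * V 1 ?f1 1 2 \<xi>)"
    unfolding R'_def V_def using paraproduct_average[OF ij(1) \<psi>' \<phi>' f1, of 1 2 1] by auto
  obtain c4 where c4: "mb c4 (%\<xi>. R \<xi> * V 0 ?f1 1 2 \<xi>)"
    unfolding R_def V_def using paraproduct_average[OF ij(1) \<psi> \<phi> f1, of 1 2 0] by auto
  note all = mult_bound_diff[OF mult_bound_add[OF c1 c2] mult_bound_cmult[OF mult_bound_add[OF c3 c4], of "1 / 4"]]
  have gj: "average_along n j (1/2) g \<in> borel_measurable borel" using averages_measurable[OF g, of n "[(j, 1/2)]"] by simp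
  have gjB: "norm (average_along n j (1/2) g \<xi>) \<le> B" for \<xi> by (rule average_along_norm_le[OF g B]) auto
  have NB: "norm (?N \<xi>) \<le> B" for \<xi> by (rule average_along_norm_le[OF gj gjB]) auto
  have Nm [measurable]: "?N \<in> borel_measurable borel" using averages_measurable[OF g, of n "[(i, 1/2), (j, 1/2)]"] by simp
  have f0B: "norm (?f0 \<xi>) \<le> B" for \<xi> by (rule average_along_norm_le[OF g B]) auto
  have f0m [measurable]: "?f0 \<in> borel_measurable borel" by (rule mult_boundD(2)[OF f0])
  have f1m [measurable]: "?f1 \<in> borel_measurable borel" by (rule mult_boundD(2)[OF f1])
  note [measurable] = diag_sum_measurable[OF \<psi> \<phi>]
  obtain D where D: "0 \<le> D" "\<And>I u v. finite I ==> \<bar>\<Sum>k\<in>I. \<psi> (dyadic k * u) * \<phi> (dyadic k * v)\<bar> \<le> D"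
    using diag_sum_bounded[OF \<psi> \<phi>] by blast
  have RB: "norm (R \<xi>) \<le> D" for \<xi> unfolding R_def diag_sum_def norm_of_real by (rule D(2)) simp
  have "mb (c1 + c2 + norm (1 / 4 :: complex) * (c3 + c4)) (%\<xi>. R \<xi> * ?N \<xi>)"
  proof (rule mult_bound_cong[OF all])
    show "(%\<xi>. R \<xi> * ?N \<xi>) \<in> borel_measurable borel" unfolding R_def by measurable
    have "norm (R \<xi> * ?N \<xi>) \<le> D * B" for \<xi> unfolding norm_mult by (rule mult_mono[OF RB NB D(1)]) simp
    then show "bounded_fn (%\<xi>. R \<xi> * ?N \<xi>)" unfolding bounded_fn_def by (intro exI allI)
    fix \<xi> :: "real^'a" assume "\<forall>l. \<xi> $ l \<noteq> 0"
    then have x0: "\<xi> $ j \<noteq> 0" by blast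
    define x where "x = \<xi> $ j"
    define u where "u = \<xi> $ i / \<xi> $ j"
    have R': "R' \<xi> = of_real u * R \<xi>" unfolding R'_def R_def \<psi>'_def \<phi>'_def u_def diag_sum_weight[OF x0] by simp
    define h where "h s = g (\<xi> + s *\<^sub>R unit_vec n)" for s
    have hm: "h \<in> borel_measurable borel" unfolding h_def by measurable
    have hB: "norm (h s) \<le> B" for s unfolding h_def by (rule B)
    define k0 where "k0 \<alpha> = ?f0 (\<xi> + (\<alpha> * \<xi> $ i) *\<^sub>R unit_vec j)" for \<alpha>
    define k1 where "k1 \<alpha> = ?f1 (\<xi> + (\<alpha> * \<xi> $ i) *\<^sub>R unit_vec j)" for \<alpha>
    have k0: "k0 \<alpha> = (LINT a:{0..1}|lborel. h (a * (\<alpha> * \<xi> $ i + x)))" for \<alpha>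
    proof -
      have "g (\<xi> + (\<alpha> * \<xi> $ i) *\<^sub>R unit_vec j + (a * (\<xi> + (\<alpha> * \<xi> $ i) *\<^sub>R unit_vec j) $ j) *\<^sub>R unit_vec n) = h (a * (\<alpha> * \<xi> $ i + x))" for a
        using ignoresD[OF ig, of "\<xi> + (a * (\<alpha> * \<xi> $ i + x)) *\<^sub>R unit_vec n" "\<alpha> * \<xi> $ i"] unfolding h_def x_def
        by (simp add: unit_vec_nth add_ac)
      then show ?thesis unfolding k0_def average_along_def by (simp only:)
    qed
    have k1: "k1 (2 * \<alpha>) = (LINT a:{0..1}|lborel. h (a * (\<alpha> * \<xi> $ i + x / 2)))" for \<alpha>
    proof -
      let ?\<eta> = "dil (%k. if k = j then 1 / 2 else 1) (\<xi> + (2 * \<alpha> * \<xi> $ i) *\<^sub>R unit_vec j)"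
      have "?\<eta> + (a * ?\<eta> $ j) *\<^sub>R unit_vec n = (\<xi> + (a * (\<alpha> * \<xi> $ i + x / 2)) *\<^sub>R unit_vec n) + (\<alpha> * \<xi> $ i - x / 2) *\<^sub>R unit_vec j" for a
        using ij by (simp add: vec_eq_iff dil_def unit_vec_nth x_def field_simps)
      then have "g (?\<eta> + (a * ?\<eta> $ j) *\<^sub>R unit_vec n) = h (a * (\<alpha> * \<xi> $ i + x / 2))" for a
        unfolding h_def by (simp only: ignoresD[OF ig])
      then show ?thesis unfolding k1_def average_along_def by (simp only:)
    qed
    have inner: "average_along n j (1/2) g (\<xi> + (\<alpha> * \<xi> $ i) *\<^sub>R unit_vec n) = (of_real \<alpha> * of_real u + 1) * k0 \<alpha> - (of_real \<alpha> * of_real u + 1 / 2) * k1 (2 * \<alpha>)" for \<alpha>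
    proof -
      have "g (\<xi> + (\<alpha> * \<xi> $ i) *\<^sub>R unit_vec n + (a * (\<xi> + (\<alpha> * \<xi> $ i) *\<^sub>R unit_vec n) $ j) *\<^sub>R unit_vec n) = h (\<alpha> * \<xi> $ i + a * x)" for a
        unfolding h_def x_def using ij by (simp add: unit_vec_nth add.assoc scaleR_left_distrib)
      then have a: "average_along n j (1/2) g (\<xi> + (\<alpha> * \<xi> $ i) *\<^sub>R unit_vec n) = (LINT a:{1/2..1}|lborel. h (\<alpha> * \<xi> $ i + a * x))"
        unfolding average_along_def by (simp only:)
      have "of_real x * (LINT a:{1/2..1}|lborel. h (\<alpha> * \<xi> $ i + a * x)) = of_real (\<alpha> * \<xi> $ i + x) * k0 \<alpha> - of_real (\<alpha> * \<xi> $ i + x / 2) * k1 (2 * \<alpha>)"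
        unfolding k0 k1 by (rule average_interval_difference[OF hm hB])
      moreover have "of_real (\<alpha> * \<xi> $ i + x) = of_real x * (of_real \<alpha> * of_real u + 1 :: complex)"
        "of_real (\<alpha> * \<xi> $ i + x / 2) = of_real x * (of_real \<alpha> * of_real u + 1 / 2 :: complex)"
        using x0 unfolding u_def x_def by (simp_all add: field_simps)
      ultimately have "of_real x * average_along n j (1/2) g (\<xi> + (\<alpha> * \<xi> $ i) *\<^sub>R unit_vec n) = of_real x * ((of_real \<alpha> * of_real u + 1) * k0 \<alpha> - (of_real \<alpha> * of_real u + 1 / 2) * k1 (2 * \<alpha>))"
        unfolding a by (simp only: right_diff_distrib mult.assoc)
      then show ?thesis using x0 unfolding x_def by simp
    qed
    have km: "k0 \<in> borel_measurable borel" "k1 \<in> borel_measurable borel" unfolding k0_def k1_def by measurable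
    have kB: "norm (k0 \<alpha>) \<le> B" "norm (k1 \<alpha>) \<le> B" for \<alpha> unfolding k0_def k1_def by (rule f0B)+
    have B0: "0 \<le> B" using order_trans[OF norm_ge_zero B] by blast
    have int: "set_integrable lborel {s..t} (%\<alpha>. of_real (\<alpha> ^ e) * k \<alpha>)"
      if "k \<in> borel_measurable borel" "\<And>\<alpha>. norm (k \<alpha>) \<le> B" "0 \<le> s" "t \<le> 2" "e \<le> 1" for s t e and k :: "real => complex"
    proof (rule bounded_set_integrable[where B = "2 * B"])
      show "(%\<alpha>. complex_of_real (\<alpha> ^ e) * k \<alpha>) \<in> borel_measurable borel" using that(1) by measurable
      fix \<alpha> assume a: "\<alpha> \<in> {s..t}"
      have "\<bar>\<alpha> ^ e\<bar> \<le> 2" using a that(3-5) by (cases e) auto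
      then show "norm (complex_of_real (\<alpha> ^ e) * k \<alpha>) \<le> 2 * B" unfolding norm_mult norm_of_real by (intro mult_mono that(2)) auto
    qed
    define k2 where "k2 \<beta> = of_real (\<beta> ^ 1) * k1 \<beta> * (of_real u / 2) + of_real (\<beta> ^ 0) * k1 \<beta> * (1 / 2)" for \<beta>
    have k2m: "k2 \<in> borel_measurable borel" unfolding k2_def using km by measurable
    have i02: "set_integrable lborel {1/2..1} (%\<alpha>. k2 (2 * \<alpha>))"
    proof (rule bounded_set_integrable[where B = "(2 * \<bar>u\<bar> / 2 + 1 / 2) * B"])
      show "(%\<alpha>. k2 (2 * \<alpha>)) \<in> borel_measurable borel" using k2m by measurable
      fix \<alpha> :: real assume a: "\<alpha> \<in> {1/2..1}"
      have "norm (k2 (2 * \<alpha>)) \<le> norm (of_real ((2 * \<alpha>) ^ 1) * k1 (2 * \<alpha>) * (of_real u / 2)) + norm (of_real ((2 * \<alpha>) ^ 0) * k1 (2 * \<alpha>) * (1 / 2))"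
        unfolding k2_def by (rule norm_triangle_ineq)
      also have "\<dots> = (\<bar>2 * \<alpha>\<bar> * (\<bar>u\<bar> / 2) + 1 / 2) * norm (k1 (2 * \<alpha>))" by (simp add: norm_mult norm_divide abs_mult algebra_simps)
      also have "\<dots> \<le> (2 * \<bar>u\<bar> / 2 + 1 / 2) * B"
      proof (rule mult_mono[OF _ kB(2)])
        have "\<bar>2 * \<alpha>\<bar> * (\<bar>u\<bar> / 2) \<le> 2 * (\<bar>u\<bar> / 2)" using a by (intro mult_right_mono) auto
        then show "\<bar>2 * \<alpha>\<bar> * (\<bar>u\<bar> / 2) + 1 / 2 \<le> 2 * \<bar>u\<bar> / 2 + 1 / 2" by simp
      qed auto
      finally show "norm (k2 (2 * \<alpha>)) \<le> (2 * \<bar>u\<bar> / 2 + 1 / 2) * B" .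
    qed
    have V: "V e ?f0 s t \<xi> = (LINT \<alpha>:{s..t}|lborel. of_real (\<alpha> ^ e) * k0 \<alpha>)" "V e ?f1 s t \<xi> = (LINT \<alpha>:{s..t}|lborel. of_real (\<alpha> ^ e) * k1 \<alpha>)" for e s t
      unfolding V_def k0_def k1_def by (rule refl)+
    have i0: "set_integrable lborel {1/2..1} (%\<alpha>. of_real (\<alpha> ^ e) * k0 \<alpha>)" if "e \<le> 1" for e
      by (rule int[OF km(1) kB(1)]) (use that in auto)
    have i1: "set_integrable lborel {1..2} (%\<alpha>. of_real (\<alpha> ^ e) * k1 \<alpha>)" if "e \<le> 1" for e
      by (rule int[OF km(2) kB(2)]) (use that in auto)
    have "?N \<xi> = (LINT \<alpha>:{1/2..1}|lborel. of_real u * (of_real (\<alpha> ^ 1) * k0 \<alpha>) + of_real (\<alpha> ^ 0) * k0 \<alpha> - k2 (2 * \<alpha>))"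
      unfolding average_along_def[of n i] inner k2_def by (simp add: algebra_simps)
    also have "\<dots> = of_real u * V 1 ?f0 (1/2) 1 \<xi> + V 0 ?f0 (1/2) 1 \<xi> - (LINT \<alpha>:{1/2..1}|lborel. k2 (2 * \<alpha>))"
    proof -
      have a: "set_integrable lborel {1/2..1} (%\<alpha>. of_real u * (of_real (\<alpha> ^ 1) * k0 \<alpha>))" by (rule set_integrable_mult_right, rule i0) simp
      have b: "set_integrable lborel {1/2..1} (%\<alpha>. of_real (\<alpha> ^ 0) * k0 \<alpha>)" by (rule i0) simp
      show ?thesis
        unfolding set_integral_diff(2)[OF set_integral_add(1)[OF a b] i02] set_integral_add(2)[OF a b] V by (simp only: set_integral_mult_right)
    qed
    also have "(LINT \<alpha>:{1/2..1}|lborel. k2 (2 * \<alpha>)) = (1 / 2) * (LINT \<beta>:{1..2}|lborel. k2 \<beta>)" by (rule average_doubling[OF k2m])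
    also have "(LINT \<beta>:{1..2}|lborel. k2 \<beta>) = V 1 ?f1 1 2 \<xi> * (of_real u / 2) + V 0 ?f1 1 2 \<xi> * (1 / 2)"
    proof -
      have a: "set_integrable lborel {1..2} (%\<beta>. of_real (\<beta> ^ 1) * k1 \<beta> * (of_real u / 2))" by (rule set_integrable_mult_left, rule i1) simp
      have b: "set_integrable lborel {1..2} (%\<beta>. of_real (\<beta> ^ 0) * k1 \<beta> * (1 / 2))" by (rule set_integrable_mult_left, rule i1) simp
      show ?thesis unfolding k2_def set_integral_add(2)[OF a b] V by (simp only: set_integral_mult_left)
    qed
    \<comment> \<open>In the factor 1/4 one half comes from rescaling the slopes and one half from
      the coefficients in \<open>k2\<close>.\<close>
    finally have Neq: "?N \<xi> = of_real u * V 1 ?f0 (1/2) 1 \<xi> + V 0 ?f0 (1/2) 1 \<xi> - (1 / 4) * (of_real u * V 1 ?f1 1 2 \<xi> + V 0 ?f1 1 2 \<xi>)" by (simp add: algebra_simps)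
    show "R' \<xi> * V 1 ?f0 (1/2) 1 \<xi> + R \<xi> * V 0 ?f0 (1/2) 1 \<xi> - 1 / 4 * (R' \<xi> * V 1 ?f1 1 2 \<xi> + R \<xi> * V 0 ?f1 1 2 \<xi>) = R \<xi> * ?N \<xi>"
      unfolding R' Neq by (simp add: algebra_simps)
  qed
  then show ?thesis unfolding R_def by (rule that)
qed

end

subsection \<open>Signs of averaged linear forms\<close>

lemma sum_telescope_int:
  fixes g :: "int => real"
  shows "(\<Sum>k\<in>{- int L..int L}. g k - g (k - 1)) = g (int L) - g (- int L - 1)"
proof (induction L)
  case (Suc L)
  have "{- int (Suc L)..int (Suc L)} = insert (- int (Suc L)) (insert (int (Suc L)) {- int L..int L})" by auto
  moreover have "g (- 1 - int L) = g (- int L - 1)" by (rule arg_cong[of _ _ g]) simp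
  ultimately show ?case using Suc by (simp add: algebra_simps)
qed simp

text \<open>Chosen so that its dyadic dilates telescope to a partition of unity over the
  bands.\<close>

definition cutoff :: "real => real" where
  "cutoff u = bump (1 * u) - bump (2 * u)"

lemma annular_cutoff: "annular 4 cutoff"
  unfolding cutoff_def by (rule bump_annular) auto

lemma cutoff_support: "cutoff t \<noteq> 0 ==> 1 / 4 < \<bar>t\<bar> \<and> \<bar>t\<bar> < 1"
proof (rule ccontr)
  assume nz: "cutoff t \<noteq> 0" and "\<not> (1 / 4 < \<bar>t\<bar> \<and> \<bar>t\<bar> < 1)"
  then consider "\<bar>t\<bar> \<le> 1 / 4" | "1 \<le> \<bar>t\<bar>" by linarith
  then show False
  proof cases
    case 1
    then have "\<bar>t\<bar>\<^sup>2 \<le> (1 / 4)\<^sup>2" by (intro power_mono) auto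
    then have "t\<^sup>2 \<le> 1 / 16" by (simp add: power2_eq_square)
    then have "bump t = 1" "bump (2 * t) = 1" by (auto intro!: bump_inner simp: power_mult_distrib)
    then show False using nz by (simp add: cutoff_def)
  next
    case 2
    then have "bump t = 0" "bump (2 * t) = 0" by (auto intro!: bump_outer)
    then show False using nz by (simp add: cutoff_def)
  qed
qed

text \<open>In the telescoped sum over [-L, L] with large L, the upper end term is
  \<open>bump\<close> at a small argument and the lower one \<open>bump\<close> at a large argument,
  hence 1 and 0.\<close>

lemma cutoff_partition:
  assumes u: "u \<noteq> 0"
  shows "diag_sum 4 cutoff (%_. 1) u v = 1"
proof (rule LIMSEQ_unique[OF diag_sum_tendsto[OF annular_cutoff]])
  obtain L0 :: nat where L0: "\<bar>log 2 \<bar>u\<bar>\<bar> + 1 \<le> real L0" using real_arch_simple by blast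
  have s: "dyadic k * \<bar>u\<bar> = 2 powr (log 2 \<bar>u\<bar> - real_of_int k)" for k
    using u by (simp add: dyadic_def powr_diff powr_minus field_simps)
  have "(\<Sum>k\<in>{- int L..int L}. cutoff (dyadic k * u) * 1) = 1" if L: "L0 \<le> L" for L
  proof -
    have "(\<Sum>k\<in>{- int L..int L}. cutoff (dyadic k * u) * 1) = (\<Sum>k\<in>{- int L..int L}. bump (dyadic k * u) - bump (dyadic (k - 1) * u))"
      using dyadic_diff[of _ 1] by (intro sum.cong refl) (simp add: cutoff_def mult_ac)
    also have "\<dots> = bump (dyadic (int L) * u) - bump (dyadic (- int L - 1) * u)" by (rule sum_telescope_int)
    also have "bump (dyadic (int L) * u) = 1"
    proof (rule bump_inner)
      have "\<bar>dyadic (int L) * u\<bar> \<le> 2 powr (- 1)"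
        unfolding abs_mult abs_of_pos[OF dyadic_pos] s by (rule powr_mono) (use L0 L in auto)
      then have "\<bar>dyadic (int L) * u\<bar>\<^sup>2 \<le> (1 / 2)\<^sup>2" by (intro power_mono) (auto simp: powr_minus)
      then show "(dyadic (int L) * u)\<^sup>2 \<le> 1 / 2" by (simp add: power2_eq_square)
    qed
    also have "bump (dyadic (- int L - 1) * u) = 0"
    proof (rule bump_outer)
      have "2 powr 0 \<le> \<bar>dyadic (- int L - 1) * u\<bar>"
        unfolding abs_mult abs_of_pos[OF dyadic_pos] s by (rule powr_mono) (use L0 L in auto)
      then show "1 \<le> \<bar>dyadic (- int L - 1) * u\<bar>" by simp
    qed
    finally show ?thesis by simp
  qed
  then show "(%L. \<Sum>k\<in>{- int L..int L}. cutoff (dyadic k * u) * 1) \<longlonglongrightarrow> 1"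
    by (intro tendsto_eventually) (auto simp: eventually_sequentially)
qed

text \<open>Equal to 1 for arguments of modulus between 1/(4K) and K. This is the range left to the
  second frequency when the first one lies in the support of \<open>cutoff\<close> and the two are
  comparable up to K.\<close>

definition wide_cutoff :: "real => real => real" where
  "wide_cutoff K u = bump (1 / (2 * K) * u) - bump (8 * K * u)"

lemma annular_wide_cutoff:
  assumes "1 \<le> K"
  shows "annular (16 * K) (wide_cutoff K)"
  unfolding wide_cutoff_def
proof (rule bump_annular)
  have "1 * 1 \<le> K * K" using assms by (intro mult_mono) auto
  then show "1 / (2 * K) \<le> 8 * K" using assms by (simp add: divide_le_eq)
qed (use assms in auto)

lemma wide_cutoff_one:
  assumes K: "1 \<le> K" and u: "1 / (4 * K) \<le> \<bar>u\<bar>" "\<bar>u\<bar> \<le> K"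
  shows "wide_cutoff K u = 1"
proof -
  have "bump (8 * K * u) = 0"
  proof (rule bump_outer)
    have "1 \<le> 4 * (K * \<bar>u\<bar>)" using u(1) K by (simp add: divide_le_eq mult_ac)
    moreover have "0 \<le> K * \<bar>u\<bar>" using K by simp
    ultimately have "1 \<le> 8 * (K * \<bar>u\<bar>)" by linarith
    then show "1 \<le> \<bar>8 * K * u\<bar>" using K by (simp add: abs_mult mult.assoc)
  qed
  moreover have "bump (1 / (2 * K) * u) = 1"
  proof (rule bump_inner)
    have "\<bar>1 / (2 * K) * u\<bar> \<le> 1 / 2" using u(2) K by (simp add: abs_mult divide_le_eq)
    then have "\<bar>1 / (2 * K) * u\<bar>\<^sup>2 \<le> (1 / 2)\<^sup>2" by (intro power_mono) auto
    then show "(1 / (2 * K) * u)\<^sup>2 \<le> 1 / 2" unfolding power2_abs by (rule order_trans) (simp add: power2_eq_square)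
  qed
  ultimately show ?thesis by (simp add: wide_cutoff_def)
qed

lemma diag_sum_comparable:
  assumes K: "1 \<le> K" and u: "u \<noteq> 0" and uv: "\<bar>u\<bar> \<le> K * \<bar>v\<bar>" "\<bar>v\<bar> \<le> K * \<bar>u\<bar>"
  shows "diag_sum 4 cutoff (wide_cutoff K) u v = 1"
proof -
  have "cutoff (dyadic k * u) * wide_cutoff K (dyadic k * v) = cutoff (dyadic k * u) * 1" for k
  proof (cases "cutoff (dyadic k * u) = 0")
    case False
    note t = cutoff_support[OF False]
    have d: "\<bar>dyadic k * x\<bar> = dyadic k * \<bar>x\<bar>" for x using dyadic_pos[of k] by (simp add: abs_mult)
    have "dyadic k * \<bar>u\<bar> \<le> dyadic k * (K * \<bar>v\<bar>)" "dyadic k * \<bar>v\<bar> \<le> dyadic k * (K * \<bar>u\<bar>)"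
      using uv dyadic_pos[of k] by (auto intro!: mult_left_mono)
    then have le: "\<bar>dyadic k * u\<bar> \<le> K * \<bar>dyadic k * v\<bar>" "\<bar>dyadic k * v\<bar> \<le> K * \<bar>dyadic k * u\<bar>" unfolding d by (simp_all add: mult_ac)
    have "K * \<bar>dyadic k * u\<bar> \<le> K * 1" using t K by (intro mult_left_mono) auto
    then have "\<bar>dyadic k * v\<bar> \<le> K" using le(2) by simp
    moreover have "1 / (4 * K) \<le> \<bar>dyadic k * v\<bar>"
    proof -
      have "1 / 4 \<le> K * \<bar>dyadic k * v\<bar>" using le(1) t by linarith
      then show ?thesis using K by (simp add: field_simps)
    qed
    ultimately have "wide_cutoff K (dyadic k * v) = 1" by (intro wide_cutoff_one K)
    then show ?thesis by simp
  qed simp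
  then have "diag_sum 4 cutoff (wide_cutoff K) u v = diag_sum 4 cutoff (%_. 1) u v" unfolding diag_sum_def by (simp only:)
  then show ?thesis using cutoff_partition[OF u] by simp
qed

lemma remove1_map_Pair: "remove1 (i, c) (map (%j. (j, c)) js) = map (%j. (j, c)) (remove1 i js)"
  by (induction js) auto

lemma averages_cmult: "averages n r (%\<xi>. k * f \<xi>) = (%\<xi>. k * averages n r f \<xi>)"
proof (induction r)
  case (Cons x r)
  obtain j l where "x = (j, l)" by force
  then show ?case using Cons by (simp add: average_along_def[abs_def])
qed simp

lemma ignores_sgn: "j \<noteq> n ==> ignores j (%\<xi>. complex_of_real (sgn (\<xi> $ n)))"
  by (simp add: ignores_def unit_vec_nth)

text \<open>All other coordinates are below |\<xi>_i|/K in modulus and there are at most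
  \<open>CARD('n)\<close> of them. With K = 2 (\<open>CARD('n)\<close> + 1) their total stays below
  |\<xi>_i|/2, the least contribution of coordinate \<open>i\<close> when slopes are at least 1/2.
  In the sum of cone multipliers only the cone of the dominating coordinate survives.\<close>

lemma dominated_sign:
  fixes \<xi> :: "real^'n::finite"
  assumes K: "K = 2 * (real CARD('n) + 1)" and A: "A = insert n (set js)" and js: "distinct js" "n \<notin> set js"
    and i: "i \<in> A" "\<xi> $ i \<noteq> 0" and dom: "\<And>j. j \<in> A ==> j \<noteq> i ==> K * \<bar>\<xi> $ j\<bar> < \<bar>\<xi> $ i\<bar>"
  shows "0 < sgn (\<xi> $ i) * \<xi> $ n + (\<Sum>j\<in>set js. min (sgn (\<xi> $ i) * \<xi> $ j / 2) (sgn (\<xi> $ i) * \<xi> $ j))"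
    and "(\<Sum>k\<in>A. sgn (\<xi> $ k) * (\<Prod>l\<in>A - {k}. bump (\<xi> $ l / \<xi> $ k))) = sgn (\<xi> $ i)"
proof -
  let ?\<sigma> = "sgn (\<xi> $ i)"
  have K1: "1 \<le> K" "2 \<le> K" "0 < K" unfolding K by auto
  have fA: "finite A" unfolding A by simp
  define b where "b j = (if j = i then \<bar>\<xi> $ i\<bar> / 2 else - (\<bar>\<xi> $ i\<bar> / K))" for j
  have small: "\<bar>\<xi> $ j\<bar> \<le> \<bar>\<xi> $ i\<bar> / K" if "j \<in> A" "j \<noteq> i" for j
    using dom[OF that] K1 by (simp add: le_divide_eq mult.commute)
  have s1: "\<bar>?\<sigma>\<bar> = 1" using i(2) by (simp add: abs_sgn_eq)
  have si: "?\<sigma> * \<xi> $ i = \<bar>\<xi> $ i\<bar>" by (simp add: sgn_mult_self_eq abs_sgn mult.commute)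
  have lower: "b j \<le> min (?\<sigma> * \<xi> $ j / 2) (?\<sigma> * \<xi> $ j)" if "j \<in> A" for j
  proof (cases "j = i")
    case True then show ?thesis using si by (simp add: b_def)
  next
    case False
    have "\<bar>?\<sigma> * \<xi> $ j\<bar> \<le> \<bar>\<xi> $ i\<bar> / K" using small[OF that False] s1 by (simp add: abs_mult)
    then show ?thesis using False by (auto simp: b_def)
  qed
  have "(\<Sum>j\<in>A. b j) = b i + (\<Sum>j\<in>A - {i}. b j)" by (rule sum.remove[OF fA i(1)])
  also have "(\<Sum>j\<in>A - {i}. b j) = (\<Sum>j\<in>A - {i}. - (\<bar>\<xi> $ i\<bar> / K))" by (intro sum.cong) (auto simp: b_def)
  also have "\<dots> = - (real (card (A - {i})) * (\<bar>\<xi> $ i\<bar> / K))" by simp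
  also have "b i + \<dots> > 0"
  proof -
    have "real (card (A - {i})) \<le> real CARD('n)" by (intro of_nat_mono card_mono) auto
    then have "real (card (A - {i})) < K / 2" unfolding K by simp
    then have "real (card (A - {i})) * (\<bar>\<xi> $ i\<bar> / K) < K / 2 * (\<bar>\<xi> $ i\<bar> / K)" using i(2) K1 by (intro mult_strict_right_mono) auto
    then show ?thesis using K1 by (simp add: b_def)
  qed
  finally have pos: "0 < (\<Sum>j\<in>A. b j)" .
  have "(\<Sum>j\<in>A. b j) = b n + (\<Sum>j\<in>set js. b j)" unfolding A using js by simp
  also have "\<dots> \<le> ?\<sigma> * \<xi> $ n + (\<Sum>j\<in>set js. min (?\<sigma> * \<xi> $ j / 2) (?\<sigma> * \<xi> $ j))"
  proof (rule add_mono)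
    show "b n \<le> ?\<sigma> * \<xi> $ n" using lower[of n] unfolding A by simp
    show "(\<Sum>j\<in>set js. b j) \<le> (\<Sum>j\<in>set js. min (?\<sigma> * \<xi> $ j / 2) (?\<sigma> * \<xi> $ j))"
      by (intro sum_mono lower) (simp add: A)
  qed
  finally show "0 < ?\<sigma> * \<xi> $ n + (\<Sum>j\<in>set js. min (?\<sigma> * \<xi> $ j / 2) (?\<sigma> * \<xi> $ j))" using pos by linarith
  have one: "(\<Prod>l\<in>A - {i}. bump (\<xi> $ l / \<xi> $ i)) = 1"
  proof (rule prod.neutral, intro ballI bump_inner)
    fix l assume l: "l \<in> A - {i}"
    have "2 * \<bar>\<xi> $ l\<bar> \<le> K * \<bar>\<xi> $ l\<bar>" using K1 by (intro mult_right_mono) auto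
    then have "2 * \<bar>\<xi> $ l\<bar> \<le> \<bar>\<xi> $ i\<bar>" using dom[of l] l by simp
    then have "\<bar>\<xi> $ l / \<xi> $ i\<bar> \<le> 1 / 2" using i(2) by (simp add: divide_le_eq)
    then have "\<bar>\<xi> $ l / \<xi> $ i\<bar>\<^sup>2 \<le> (1 / 2)\<^sup>2" by (intro power_mono) auto
    then show "(\<xi> $ l / \<xi> $ i)\<^sup>2 \<le> 1 / 2" unfolding power2_abs by (rule order_trans) (simp add: power2_eq_square)
  qed
  have zero: "(\<Prod>l\<in>A - {k}. bump (\<xi> $ l / \<xi> $ k)) = 0 \<or> sgn (\<xi> $ k) = 0" if k: "k \<in> A" "k \<noteq> i" for k
  proof (cases "\<xi> $ k = 0")
    case False
    have "1 * \<bar>\<xi> $ k\<bar> \<le> K * \<bar>\<xi> $ k\<bar>" using K1 by (intro mult_right_mono) auto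
    then have "\<bar>\<xi> $ k\<bar> \<le> \<bar>\<xi> $ i\<bar>" using dom[OF k] by simp
    then have "bump (\<xi> $ i / \<xi> $ k) = 0" using False by (intro bump_outer) (simp add: le_divide_eq)
    then have "\<exists>l\<in>A - {k}. bump (\<xi> $ l / \<xi> $ k) = 0" using i(1) k by (intro bexI[of _ i]) auto
    then show ?thesis using fA by (simp add: prod_zero_iff)
  qed simp
  have "(\<Sum>k\<in>A - {i}. sgn (\<xi> $ k) * (\<Prod>l\<in>A - {k}. bump (\<xi> $ l / \<xi> $ k))) = 0"
    using zero by (intro sum.neutral ballI) auto
  then show "(\<Sum>k\<in>A. sgn (\<xi> $ k) * (\<Prod>l\<in>A - {k}. bump (\<xi> $ l / \<xi> $ k))) = ?\<sigma>"
    unfolding sum.remove[OF fA i(1), of "%k. sgn (\<xi> $ k) * (\<Prod>l\<in>A - {k}. bump (\<xi> $ l / \<xi> $ k))"] one by simp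
qed

context symbol_bounds
begin

text \<open>Pairs are added one at a time through 1 - P (1 - R) = (1 - P) + R - R (1 - P), where
  \<open>paraproduct_mult\<close> bounds the last term. The resulting multiplier equals
  \<open>X\<close> wherever one of the cutoffs is 1.\<close>

lemma mb_diag_cover:
  fixes X :: "real^'a => complex"
  assumes \<psi>: "annular r \<psi>" and \<phi>: "annular r' \<phi>" and "finite Q"
    and Q: "\<And>q. q \<in> Q ==> fst q \<noteq> snd q \<and> (\<exists>c. mb c (%\<xi>. of_real (diag_sum r \<psi> \<phi> (\<xi> $ fst q) (\<xi> $ snd q)) * X \<xi>))"
  shows "\<exists>c. mb c (%\<xi>. (1 - (\<Prod>q\<in>Q. 1 - of_real (diag_sum r \<psi> \<phi> (\<xi> $ fst q) (\<xi> $ snd q)))) * X \<xi>)"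
  using assms(3) Q
proof (induction Q rule: finite_induct)
  case empty
  then show ?case using mult_bound_zero by (intro exI[of _ 0]) simp
next
  case (insert q Q)
  let ?R = "%\<xi>. complex_of_real (diag_sum r \<psi> \<phi> (\<xi> $ fst q) (\<xi> $ snd q))"
  let ?P = "%\<xi>::real^'a. \<Prod>q\<in>Q. 1 - complex_of_real (diag_sum r \<psi> \<phi> (\<xi> $ fst q) (\<xi> $ snd q))"
  obtain c1 where c1: "mb c1 (%\<xi>. (1 - ?P \<xi>) * X \<xi>)" using insert by blast
  obtain c2 where c2: "mb c2 (%\<xi>. ?R \<xi> * X \<xi>)" using insert.prems[of q] by blast
  have q: "fst q \<noteq> snd q" using insert.prems[of q] by blast
  obtain c3 where c3: "mb c3 (%\<xi>. ?R \<xi> * ((1 - ?P \<xi>) * X \<xi>))" using paraproduct_mult[OF q \<psi> \<phi> c1] by blast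
  have "(%\<xi>. (1 - ?P \<xi>) * X \<xi> + ?R \<xi> * X \<xi> - ?R \<xi> * ((1 - ?P \<xi>) * X \<xi>)) = (%\<xi>. (1 - (\<Prod>q\<in>insert q Q. 1 - of_real (diag_sum r \<psi> \<phi> (\<xi> $ fst q) (\<xi> $ snd q)))) * X \<xi>)"
    unfolding prod.insert[OF insert(1,2)] by (simp add: algebra_simps)
  then show ?case using mult_bound_diff[OF mult_bound_add[OF c1 c2] c3] by (intro exI) simp
qed

text \<open>Where one frequency dominates, the average equals the cone multiplier \<open>E\<close>;
  elsewhere some pair is comparable and its cutoff equals 1. So the difference \<open>X\<close> is
  recovered from its products with the cutoffs, and those reduce to shorter lists. The induction
  hypothesis admits both lower limits because \<open>mb_diagonal_pair\<close> needs an average from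
  0.\<close>

lemma mb_averages_half:
  fixes n :: 'a
  assumes js: "distinct js" "n \<notin> set js"
    and IH: "\<And>r. length r < length js ==> distinct (map fst r) ==> n \<notin> fst ` set r ==> snd ` set r \<subseteq> {0, 1 / 2} ==>
      \<exists>c. mb c (averages n r (%\<xi>. of_real (sgn (\<xi> $ n))))"
  shows "\<exists>c. mb c (averages n (map (%j. (j, 1 / 2)) js) (%\<xi>. of_real (sgn (\<xi> $ n))))"
proof -
  let ?w = "%\<xi>::real^'a. complex_of_real (sgn (\<xi> $ n))"
  let ?h = "%js::'a list. map (%j. (j, 1 / 2 :: real)) js"
  let ?N = "averages n (?h js) ?w"
  have wm: "?w \<in> borel_measurable borel" by measurable
  have wB: "norm (?w \<xi>) \<le> 1" for \<xi> by (simp add: abs_sgn_eq)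
  have Nm: "averages n r ?w \<in> borel_measurable borel" for r by (rule averages_measurable[OF wm])
  have NB: "norm (averages n (?h ks) ?w \<xi>) \<le> 1" for ks \<xi> by (rule averages_norm_le[OF wm wB]) auto
  define A where "A = insert n (set js)"
  define K where "K = 2 * (real CARD('a) + 1)"
  have K1: "1 \<le> K" unfolding K_def by simp
  note \<psi> = annular_cutoff
  note \<phi> = annular_wide_cutoff[OF K1]
  define R where "R i j \<xi> = complex_of_real (diag_sum 4 cutoff (wide_cutoff K) (\<xi> $ i) (\<xi> $ j))" for i j and \<xi> :: "real^'a"
  define T where "T i \<xi> = complex_of_real (sgn (\<xi> $ i) * (\<Prod>l\<in>A - {i}. bump (\<xi> $ l / \<xi> $ i)))" for i and \<xi> :: "real^'a"
  define E where "E \<xi> = of_real ((1 / 2) ^ length js) * (\<Sum>i\<in>A. T i \<xi>)" for \<xi> :: "real^'a"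
  have fA: "finite A" unfolding A_def by simp
  have "\<exists>c. i \<in> A \<longrightarrow> mb c (T i)" for i
  proof -
    obtain c where c: "\<And>A. i \<in> A ==> mb c (%\<xi>. complex_of_real (sgn (\<xi> $ i) * (\<Prod>l\<in>A - {i}. bump (\<xi> $ l / \<xi> $ i))))"
      using mb_cone[OF symbol1_sgn] by blast
    show ?thesis unfolding T_def by (rule exI[of _ c], rule impI, rule c)
  qed
  then obtain cE where cE: "\<And>i. i \<in> A ==> mb (cE i) (T i)" by metis
  have Emb: "mb (norm (complex_of_real ((1 / 2) ^ length js)) * (\<Sum>i\<in>A. cE i)) E"
    unfolding E_def[abs_def] by (rule mult_bound_cmult, rule mult_bound_sum[OF fA]) (rule cE)
  have front: "averages n (?h ks) ?w = average_along n i (1 / 2) (averages n (?h (remove1 i ks)) ?w)" if "i \<in> set ks" "n \<notin> set ks" for i ks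
  proof -
    have "averages n (?h ks) ?w = averages n ((i, 1 / 2) # remove1 (i, 1 / 2) (?h ks)) ?w"
      by (rule averages_move_front[OF wm wB]) (use that in auto)
    then show ?thesis unfolding remove1_map_Pair by simp
  qed
  have RN: "\<exists>c. mb c (%\<xi>. R i j \<xi> * ?N \<xi>)" if i: "i \<in> set js" and j: "j \<in> A" and ij: "i \<noteq> j" for i j
  proof -
    have iN: "i \<noteq> n" using i js by blast
    define ks where "ks = remove1 i js"
    have ks: "distinct ks" "n \<notin> set ks" "length ks < length js" "set ks = set js - {i}"
      unfolding ks_def using js i length_pos_if_in_set[OF i] by (auto simp: length_remove1 dest: notin_set_remove1)
    have N: "?N = average_along n i (1 / 2) (averages n (?h ks) ?w)" unfolding ks_def by (rule front[OF i js(2)])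
    show ?thesis
    \<comment> \<open>A pair containing \<open>n\<close> is treated directly: its slope is the
      translation in \<open>paraproduct_average\<close>. For two averaged frequencies the double
      average is collapsed first.\<close>
    proof (cases "j = n")
      case True
      obtain c where c: "mb c (averages n (?h ks) ?w)" using IH[of "?h ks"] ks by (auto simp: o_def image_image)
      obtain c' where "mb c' (%\<xi>. R i n \<xi> * (LINT \<alpha>:{1/2..1}|lborel. of_real (\<alpha> ^ 0) * averages n (?h ks) ?w (\<xi> + (\<alpha> * \<xi> $ i) *\<^sub>R unit_vec n)))"
        unfolding R_def using paraproduct_average[OF iN \<psi> \<phi> c, of "1 / 2" 1 0] by auto
      then show ?thesis unfolding N True average_along_def by (intro exI[of _ c']) simp
    next
      case False
      then have jk: "j \<in> set ks" using j ij ks(4) unfolding A_def by auto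
      define ls where "ls = remove1 j ks"
      have ls: "distinct ls" "n \<notin> set ls" "length ls < length ks" "set ls = set ks - {j}"
        unfolding ls_def using ks(1,2) jk length_pos_if_in_set[OF jk] by (auto simp: length_remove1 dest: notin_set_remove1)
      have N2: "averages n (?h ks) ?w = average_along n j (1 / 2) (averages n (?h ls) ?w)" unfolding ls_def by (rule front[OF jk ks(2)])
      have "\<exists>c. mb c (averages n ((j, 0) # ?h ls) ?w)"
        by (rule IH) (use ls ks False in \<open>auto simp: o_def image_image\<close>)
      then obtain c where c: "mb c (average_along n j 0 (averages n (?h ls) ?w))" by auto
      have ig: "ignores j (averages n (?h ls) ?w)"
        by (rule ignores_averages[OF ignores_sgn[OF False]]) (use ls in \<open>auto simp: image_image\<close>)
      obtain c' where c': "mb c' (%\<xi>. R i j \<xi> * average_along n i (1 / 2) (average_along n j (1 / 2) (averages n (?h ls) ?w)) \<xi>)"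
        unfolding R_def using mb_diagonal_pair[OF ij iN False Nm NB ig c \<psi> \<phi>] by blast
      show ?thesis unfolding N N2 by (rule exI[of _ c'], rule c')
    qed
  qed
  define X where "X \<xi> = ?N \<xi> - E \<xi>" for \<xi>
  define Q where "Q = {q. fst q \<in> set js \<and> snd q \<in> A \<and> fst q \<noteq> snd q}"
  have fQ: "finite Q" by (rule finite_subset[of _ "set js \<times> A"]) (use fA in \<open>auto simp: Q_def\<close>)
  have "\<exists>c. mb c (%\<xi>. (1 - (\<Prod>q\<in>Q. 1 - of_real (diag_sum 4 cutoff (wide_cutoff K) (\<xi> $ fst q) (\<xi> $ snd q)))) * X \<xi>)"
  proof (rule mb_diag_cover[OF \<psi> \<phi> fQ], rule conjI)
    fix q assume q: "q \<in> Q"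
    then show qq: "fst q \<noteq> snd q" unfolding Q_def by simp
    obtain c1 where c1: "mb c1 (%\<xi>. R (fst q) (snd q) \<xi> * ?N \<xi>)" using RN q unfolding Q_def by blast
    obtain c2 where c2: "mb c2 (%\<xi>. R (fst q) (snd q) \<xi> * E \<xi>)" unfolding R_def using paraproduct_mult[OF qq \<psi> \<phi> Emb] by blast
    have e: "(%\<xi>. R (fst q) (snd q) \<xi> * X \<xi>) = (%\<xi>. R (fst q) (snd q) \<xi> * ?N \<xi> - R (fst q) (snd q) \<xi> * E \<xi>)"
      unfolding X_def right_diff_distrib ..
    have "mb (c1 + c2) (%\<xi>. R (fst q) (snd q) \<xi> * X \<xi>)" unfolding e by (rule mult_bound_diff[OF c1 c2])
    then show "\<exists>c. mb c (%\<xi>. of_real (diag_sum 4 cutoff (wide_cutoff K) (\<xi> $ fst q) (\<xi> $ snd q)) * X \<xi>)" unfolding R_def by (rule exI)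
  qed
  then obtain c where c: "mb c (%\<xi>. (1 - (\<Prod>q\<in>Q. 1 - R (fst q) (snd q) \<xi>)) * X \<xi>)" unfolding R_def by blast
  show ?thesis
  proof (rule exI, rule mult_bound_cong[OF mult_bound_add[OF Emb c]])
    show "?N \<in> borel_measurable borel" by (rule Nm)
    show "bounded_fn ?N" unfolding bounded_fn_def by (rule exI[of _ 1], rule allI, rule NB)
    fix \<xi> :: "real^'a" assume nz: "\<forall>j. \<xi> $ j \<noteq> 0"
    show "E \<xi> + (1 - (\<Prod>q\<in>Q. 1 - R (fst q) (snd q) \<xi>)) * X \<xi> = ?N \<xi>"
    proof (cases "\<exists>q\<in>Q. R (fst q) (snd q) \<xi> = 1")
      case True
      then have P0: "(\<Prod>q\<in>Q. 1 - R (fst q) (snd q) \<xi>) = 0" using fQ by (auto simp: prod_zero_iff)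
      show ?thesis unfolding P0 X_def by simp
    next
      case False
      let ?a = "%j. \<bar>\<xi> $ j\<bar>"
      have "Max (?a ` A) \<in> ?a ` A" using fA by (intro Max_in) (auto simp: A_def)
      then obtain i where i: "i \<in> A" "?a i = Max (?a ` A)" by auto
      have mx: "?a j \<le> ?a i" if "j \<in> A" for j unfolding i(2) using fA that by simp
      have dom: "K * ?a j < ?a i" if j: "j \<in> A" "j \<noteq> i" for j
      proof (rule ccontr)
        assume "\<not> K * ?a j < ?a i"
        then have 1: "?a i \<le> K * ?a j" by simp
        have "1 * ?a i \<le> K * ?a i" using K1 by (intro mult_right_mono) auto
        then have 2: "?a j \<le> K * ?a i" using mx[OF j(1)] by simp
        show False
        proof (cases "i = n")
          case True
          \<comment> \<open>\<open>Q\<close> has an averaged coordinate in first place, so the pair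
            is taken in reversed order; comparability up to K is symmetric.\<close>
          then have "(j, n) \<in> Q" using j unfolding Q_def A_def by auto
          moreover have "R j n \<xi> = 1" unfolding R_def using diag_sum_comparable[OF K1, of "\<xi> $ j" "\<xi> $ n"] 1 2 nz True by simp
          ultimately show False using False by force
        next
          case n: False
          then have "(i, j) \<in> Q" using i(1) j unfolding Q_def A_def by auto
          moreover have "R i j \<xi> = 1" unfolding R_def using diag_sum_comparable[OF K1, of "\<xi> $ i" "\<xi> $ j"] 1 2 nz by simp
          ultimately show False using False by force
        qed
      qed
      have nzi: "\<xi> $ i \<noteq> 0" using nz by blast
      have ds1: "0 < sgn (\<xi> $ i) * \<xi> $ n + (\<Sum>j\<in>set js. min (sgn (\<xi> $ i) * \<xi> $ j / 2) (sgn (\<xi> $ i) * \<xi> $ j))"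
        by (rule dominated_sign(1)[OF K_def A_def js i(1) nzi]) (rule dom)
      have ds2: "(\<Sum>k\<in>A. sgn (\<xi> $ k) * (\<Prod>l\<in>A - {k}. bump (\<xi> $ l / \<xi> $ k))) = sgn (\<xi> $ i)"
        by (rule dominated_sign(2)[OF K_def A_def js i(1) nzi]) (rule dom)
      have "?N \<xi> = of_real ((1 / 2) ^ length js * sgn (\<xi> $ i))"
        by (rule averages_dominated[OF js _ ds1]) (use nz in \<open>auto simp: sgn_if\<close>)
      moreover have "E \<xi> = of_real ((1 / 2) ^ length js * sgn (\<xi> $ i))"
        unfolding E_def T_def of_real_sum[symmetric] of_real_mult[symmetric] ds2 ..
      ultimately have "X \<xi> = 0" "E \<xi> = ?N \<xi>" by (simp_all add: X_def)
      then show ?thesis by simp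
    qed
  qed
qed

text \<open>Nested induction on the length of the list and, at equal length, on the number of lower
  limits 0. Each 0 is traded for 1/2 at the cost of a factor 2 in the constant, and a list without
  zeros is reduced to shorter ones.\<close>

lemma mb_averages:
  fixes n :: 'a
  assumes "distinct (map fst r)" "n \<notin> fst ` set r" "snd ` set r \<subseteq> {0, 1 / 2}"
  shows "\<exists>c. mb c (averages n r (%\<xi>. of_real (sgn (\<xi> $ n))))"
  using assms
proof (induction "length r" arbitrary: r rule: less_induct)
  case less
  note IH = less.hyps
  have "\<exists>c. mb c (averages n r' (%\<xi>. of_real (sgn (\<xi> $ n))))"
    if "length r' = length r" "distinct (map fst r')" "n \<notin> fst ` set r'" "snd ` set r' \<subseteq> {0, 1 / 2}" for r'
    using that
  proof (induction "length (filter (%x. snd x = 0) r')" arbitrary: r')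
    case 0
    then have "filter (%x. snd x = 0) r' = []" by simp
    then have nz: "\<forall>x\<in>set r'. snd x \<noteq> 0" unfolding filter_empty_conv .
    have "snd x = 1 / 2" if "x \<in> set r'" for x
    proof -
      have "snd x \<in> {0, 1 / 2}" using 0(5) that by blast
      then show ?thesis using nz that by auto
    qed
    then have "map (%j. (j, 1 / 2)) (map fst r') = r'" by (simp add: map_idI o_def prod_eq_iff)
    moreover have "\<exists>c. mb c (averages n (map (%j. (j, 1 / 2)) (map fst r')) (%\<xi>. of_real (sgn (\<xi> $ n))))"
    proof (rule mb_averages_half)
      show "distinct (map fst r')" by (rule 0(3))
      show "n \<notin> set (map fst r')" using 0(4) by simp
      fix s :: "('a \<times> real) list"
      assume s: "length s < length (map fst r')" "distinct (map fst s)" "n \<notin> fst ` set s" "snd ` set s \<subseteq> {0, 1 / 2}"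
      have "length s < length r" using s(1) 0(2) by simp
      then show "\<exists>c. mb c (averages n s (%\<xi>. of_real (sgn (\<xi> $ n))))" by (rule IH[OF _ s(2-4)])
    qed
    ultimately show ?case by simp
  next
    case (Suc z)
    let ?w = "%\<xi>::real^'a. complex_of_real (sgn (\<xi> $ n))"
    have wm: "?w \<in> borel_measurable borel" by measurable
    have wB: "norm (?w \<xi>) \<le> 1" for \<xi> by (simp add: abs_sgn_eq)
    have "filter (%x. snd x = 0) r' \<noteq> []" using Suc.hyps(2) by auto
    then obtain j where j: "(j, 0) \<in> set r'" by (auto simp: filter_empty_conv)
    define s where "s = remove1 (j, 0) r'"
    have len: "length r' = Suc (length s)" unfolding s_def using j length_pos_if_in_set[OF j] by (simp add: length_remove1)
    have sub: "set s \<subseteq> set r'" unfolding s_def by (rule set_remove1_subset)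
    have dr: "distinct r'" using Suc.prems(2) by (simp add: distinct_map)
    have sset: "set s = set r' - {(j, 0)}" unfolding s_def using dr by simp
    have inj: "inj_on fst (set r')" using Suc.prems(2) by (simp add: distinct_map)
    have js: "j \<notin> fst ` set s"
    proof
      assume "j \<in> fst ` set s"
      then obtain x where x: "x \<in> set s" "fst x = j" by auto
      then have "x = (j, 0)" using inj_onD[OF inj, of x "(j, 0)"] j sub by auto
      then show False using x(1) sset by simp
    qed
    have ds: "distinct (map fst s)" unfolding distinct_map s_def using dr inj_on_subset[OF inj sub] s_def by simp
    have jn: "j \<noteq> n" using Suc.prems(3) j by force
    have z: "length (filter (%x. snd x = 0) s) = z"
    proof -
      have "mset r' = add_mset (j, 0) (mset s)" unfolding s_def using j by simp
      then have "size (filter_mset (%x. snd x = 0) (mset r')) = Suc (size (filter_mset (%x. snd x = 0) (mset s)))" by simp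
      then show ?thesis using Suc.hyps(2) by (simp flip: mset_filter)
    qed
    have l: "fst x \<noteq> n \<and> 0 \<le> snd x \<and> snd x \<le> 1" if "x \<in> set r'" for x
    proof -
      have "snd x \<in> {0, 1 / 2}" using Suc.prems(4) that by blast
      moreover have "fst x \<noteq> n" using Suc.prems(3) that by force
      ultimately show ?thesis by auto
    qed
    have "\<exists>c. mb c (averages n ((j, 1 / 2) # s) ?w)"
    proof (rule Suc.hyps(1))
      show "z = length (filter (%x. snd x = 0) ((j, 1 / 2) # s))" using z by simp
      show "length ((j, 1 / 2) # s) = length r" using len Suc.prems(1) by simp
      show "distinct (map fst ((j, 1 / 2) # s))" using js ds by simp
      show "n \<notin> fst ` set ((j, 1 / 2) # s)" using Suc.prems(3) sub jn by auto
      show "snd ` set ((j, 1 / 2) # s) \<subseteq> {0, 1 / 2}" using Suc.prems(4) sub by auto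
    qed
    then obtain c where c: "mb c (average_along n j (1 / 2) (averages n s ?w))" by auto
    have "mb (2 * c) (average_along n j 0 (averages n s ?w))"
    proof (rule mb_average_zero[OF averages_measurable[OF wm] _ ignores_averages[OF ignores_sgn[OF jn] js] jn c])
      show "norm (averages n s ?w \<xi>) \<le> 1" for \<xi> by (rule averages_norm_le[OF wm wB]) (use l sub in auto)
    qed
    moreover have "averages n r' ?w = averages n ((j, 0) # s) ?w" unfolding s_def by (rule averages_move_front[OF wm wB l j])
    ultimately show ?case by (intro exI[of _ "2 * c"]) simp
  qed
  then show ?case using less.prems by blast
qed

end

theorem theorem2:
  fixes p0 :: real and p :: "'n::{finite,linorder} \<Rightarrow> real"
  assumes "CARD('n::{finite,linorder}) \<ge> 2"
    and "p0 > 1" and "\<And>j. p j > 1"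
    and "\<And>m :: real^('n::{finite,linorder}) \<Rightarrow> complex. standard_symbol m \<Longrightarrow>
           \<exists>c. \<forall>F0 F. schwartz F0 \<and> (\<forall>j. schwartz (F j)) \<longrightarrow>
             norm (Lambda_m m F0 F) \<le> c * Lp_norm p0 F0 * (\<Prod>j\<in>UNIV. Lp_norm (p j) (F j))"
  shows "\<exists>c. \<forall>F0 F. schwartz F0 \<and> (\<forall>j. schwartz (F j)) \<longrightarrow>
           norm (Lambda_n F0 F) \<le> c * Lp_norm p0 F0 * (\<Prod>j\<in>UNIV. Lp_norm (p j) (F j))"
proof -
  have std: "\<exists>c. mult_bound p0 p c m"
    if s: "standard_symbol m" and m: "m \<in> borel_measurable borel" "bounded_fn m" for m :: "real^('n::{finite,linorder}) \<Rightarrow> complex"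
  proof -
    obtain c where c: "\<forall>F0 F. schwartz F0 \<and> (\<forall>j. schwartz (F j)) \<longrightarrow>
        norm (Lambda_m m F0 F) \<le> c * Lp_norm p0 F0 * (\<Prod>j\<in>UNIV. Lp_norm (p j) (F j))"
      using assms(4)[OF s] by blast
    \<comment> \<open>\<open>mult_bound\<close> asks for a nonnegative constant, which the
      hypothesis does not provide.\<close>
    have "mult_bound p0 p (max c 0) m"
    proof (rule mult_boundI[OF _ m])
      fix F0 :: "real^('n::{finite,linorder}) \<Rightarrow> complex" and F :: "'n \<Rightarrow> real^('n::{finite,linorder}) \<Rightarrow> complex"
      assume F: "schwartz F0" "\<And>j. schwartz (F j)"
      have "norm (Lambda_m m F0 F) \<le> c * (Lp_norm p0 F0 * (\<Prod>j\<in>UNIV. Lp_norm (p j) (F j)))"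
        using c F by (simp add: mult.assoc)
      also have "\<dots> \<le> max c 0 * (Lp_norm p0 F0 * (\<Prod>j\<in>UNIV. Lp_norm (p j) (F j)))"
        by (rule mult_right_mono[OF max.cobounded1 Lp_prod_nonneg])
      finally show "norm (Lambda_m m F0 F) \<le> max c 0 * (Lp_norm p0 F0 * (\<Prod>j\<in>UNIV. Lp_norm (p j) (F j)))" .
    qed simp
    then show ?thesis by blast
  qed
  obtain c1 where "mult_bound p0 p c1 (\<lambda>_. 1)" using std[OF standard_symbol_one] by auto
  then have "1 / p0 + (\<Sum>j\<in>UNIV. 1 / p j) = 1" by (rule exponents_scaling)
  then interpret symbol_bounds p0 p
    using assms(2,3) std by unfold_locales auto
  obtain js :: "'n list" where js: "set js = UNIV - {last_idx}" "distinct js" using finite_distinct_list[of "UNIV - {last_idx :: 'n}"] by auto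
  let ?r = "map (\<lambda>j. (j, 0 :: real)) js"
  have "\<exists>c. mb c (averages last_idx ?r (\<lambda>\<xi>. of_real (sgn (\<xi> $ last_idx))))"
  proof (rule mb_averages)
    show "distinct (map fst ?r)" using js(2) by (simp add: o_def)
    show "last_idx \<notin> fst ` set ?r" using js(1) by (simp add: image_image)
    show "snd ` set ?r \<subseteq> {0, 1 / 2}" by auto
  qed
  then obtain c where c: "mb c (averages last_idx ?r (\<lambda>\<xi>. of_real (sgn (\<xi> $ last_idx))))" by blast
  let ?C = "norm (\<i> * complex_of_real pi) * c"
  have C: "mb ?C (averages last_idx ?r (\<lambda>\<xi>. \<i> * pi * of_real (sgn (\<xi> $ last_idx))))"
    unfolding averages_cmult by (rule mult_bound_cmult[OF c])
  show ?thesis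
  proof (rule exI[of _ ?C], intro allI impI)
    fix F0 :: "real^('n::{finite,linorder}) \<Rightarrow> complex" and F :: "'n \<Rightarrow> real^('n::{finite,linorder}) \<Rightarrow> complex"
    assume F: "schwartz F0 \<and> (\<forall>j. schwartz (F j))"
    then have F0: "schwartz F0" and Fj: "\<And>j. schwartz (F j)" by auto
    show "norm (Lambda_n F0 F) \<le> ?C * Lp_norm p0 F0 * (\<Prod>j\<in>UNIV. Lp_norm (p j) (F j))"
      unfolding Lambda_n_eq_Lambda_m[OF F0 Fj js(2,1)] mult.assoc[of ?C] by (rule mult_boundD(4)[OF C F0 Fj])
  qed
qed

end
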